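(* Let $d\in\mathbb{N}$, $1<p<\infty$, and let $A=(-\Delta)^{1/2}$ on $X=L^p(\mathbb{R}^d)$; i.e. the generated semigroup $\exp(-e^{i\theta}tA)$ is analytic on the right half-plane and has as integral (convolution) kernel the Poisson kernel $$p_{t,\theta}(x)=c_d\,\frac{e^{i\theta}t}{\big((e^{i\theta}t)^2+|x|^2\big)^{\frac{d+1}2}},\qquad t>0,\ |\theta|<\tfrac\pi2,$$ with a normalising constant $c_d>0$ depending only on $d$. Then for any $\alpha>\frac{d-1}2$ there is a constant $C>0$ such that for all $t>0$ and all $|\theta|<\frac\pi2$ the set $\{\exp(-e^{i\theta}t2^kA):k\in\mathbb{Z}\}$ is $\gamma$-bounded with $$\gamma\big(\{\exp(-e^{i\theta}t2^kA):k\in\mathbb{Z}\}\big)\le C\big(\tfrac\pi2-|\theta|\big)^{-\alpha}.$$ Consequently, for any $\alpha>\frac{d-1}2$ there is a constant $C>0$ such that for all $t\in\mathbb{R}$ $$\gamma\big(\{(1+2^kA)^{-\alpha}e^{it2^kA}:k\in\mathbb{Z}\}\big)\le C(1+|t|)^\alpha .$$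
   Context: $\gamma$-boundedness: with $(\gamma_k)$ independent standard Gaussian variables and $\|\sum_k\gamma_k\otimes x_k\|_{\mathrm{Gauss}(X)}=(\mathbb{E}\|\sum_k\gamma_kx_k\|_X^2)^{1/2}$, a set $\tau\subset B(X)$ is $\gamma$-bounded if there is $C\ge0$ with $\|\sum_k\gamma_k\otimes T_kx_k\|_{\mathrm{Gauss}(X)}\le C\|\sum_k\gamma_k\otimes x_k\|_{\mathrm{Gauss}(X)}$ for all finite families $T_k\in\tau$, $x_k\in X$; the smallest such $C$ is $\gamma(\tau)$. The operator $(1+2^kA)^{-\alpha}e^{it2^kA}$ is the Fourier multiplier operator on $L^p(\mathbb{R}^d)$ with symbol $\xi\mapsto(1+2^k|\xi|)^{-\alpha}e^{it2^k|\xi|}$. *)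

theory Defs
  imports "HOL-Probability.Probability"
begin

section \<open>The space \<open>L\<^sup>p(\<real>\<^sup>d)\<close> and its bounded operators\<close>

text \<open>
  The space \<open>\<real>\<^sup>d\<close> is an arbitrary Euclidean space \<open>'a\<close>, with \<open>d = DIM('a) \<ge> 1\<close>. Functions are
  complex-valued. Elements of \<open>L\<^sup>p\<close> are represented by functions, so equality in \<open>L\<^sup>p\<close> is equality
  almost everywhere.
\<close>

definition Lp :: "real \<Rightarrow> ('a::euclidean_space \<Rightarrow> complex) set" where
  "Lp p = {f \<in> borel_measurable lborel. integrable lborel (\<lambda>x. norm (f x) powr p)}"

definition Lp_norm :: "real \<Rightarrow> ('a::euclidean_space \<Rightarrow> complex) \<Rightarrow> real" where
  "Lp_norm p f = (LINT x|lborel. norm (f x) powr p) powr (1 / p)"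

type_synonym 'a fun_op = "('a \<Rightarrow> complex) \<Rightarrow> ('a \<Rightarrow> complex)"

text \<open>
  \<open>B(L\<^sup>p)\<close>. Boundedness and linearity make such an operator respect equality almost everywhere, so
  it is an operator on the equivalence classes.
\<close>

definition bounded_ops :: "real \<Rightarrow> ('a::euclidean_space) fun_op set" where
  "bounded_ops p = {T.
     (\<forall>f\<in>Lp p. T f \<in> Lp p) \<and>
     (\<forall>f\<in>Lp p. \<forall>g\<in>Lp p. AE x in lborel. T (\<lambda>y. f y + g y) x = T f x + T g x) \<and>
     (\<forall>c. \<forall>f\<in>Lp p. AE x in lborel. T (\<lambda>y. c * f y) x = c * T f x) \<and>
     (\<exists>K. \<forall>f\<in>Lp p. Lp_norm p (T f) \<le> K * Lp_norm p f)}"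

text \<open>Strong holomorphy, which for bounded operators is the same as holomorphy in operator norm.\<close>

definition holomorphic_family_on ::
  "real \<Rightarrow> (complex \<Rightarrow> ('a::euclidean_space) fun_op) \<Rightarrow> complex set \<Rightarrow> bool" where
  "holomorphic_family_on p S U \<longleftrightarrow>
     (\<forall>z\<in>U. S z \<in> bounded_ops p) \<and>
     (\<forall>f\<in>Lp p. \<forall>z\<in>U. \<exists>g\<in>Lp p.
        ((\<lambda>h. Lp_norm p (\<lambda>x. (S (z + h) f x - S z f x) / h - g x)) \<longlongrightarrow> 0) (at 0))"


section \<open>\<open>\<gamma>\<close>-boundedness in \<open>L\<^sup>p\<close>\<close>

definition std_gaussian :: "real measure" where
  "std_gaussian = density lborel (\<lambda>x. ennreal (std_normal_density x))"

text \<open>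
  The norm of \<open>\<Sum>\<^sub>k \<gamma>\<^sub>k \<otimes> f\<^sub>k\<close>, \<open>k < n\<close>, in \<open>Gauss(L\<^sup>p)\<close>; the coordinates of the product space are
  the independent standard Gaussian variables \<open>\<gamma>\<^sub>k\<close>.
\<close>

definition gauss_norm :: "real \<Rightarrow> nat \<Rightarrow> (nat \<Rightarrow> 'a::euclidean_space \<Rightarrow> complex) \<Rightarrow> real" where
  "gauss_norm p n f =
     sqrt (LINT \<gamma>|(\<Pi>\<^sub>M k\<in>{..<n}. std_gaussian).
       (Lp_norm p (\<lambda>x. \<Sum>k<n. complex_of_real (\<gamma> k) * f k x))\<^sup>2)"

definition gamma_constants :: "real \<Rightarrow> ('a::euclidean_space) fun_op set \<Rightarrow> real set" where
  "gamma_constants p \<tau> = {C. 0 \<le> C \<and>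
     (\<forall>n T f. (\<forall>k<n. T k \<in> \<tau> \<and> f k \<in> Lp p) \<longrightarrow>
        gauss_norm p n (\<lambda>k. T k (f k)) \<le> C * gauss_norm p n f)}"

definition gamma_bounded :: "real \<Rightarrow> ('a::euclidean_space) fun_op set \<Rightarrow> bool" where
  "gamma_bounded p \<tau> \<longleftrightarrow> \<tau> \<subseteq> bounded_ops p \<and> gamma_constants p \<tau> \<noteq> {}"

text \<open>
  The smallest admissible constant; \<open>gamma_constants p \<tau>\<close> is closed and bounded below, so the
  infimum is attained as soon as \<open>\<tau>\<close> is \<open>\<gamma>\<close>-bounded.
\<close>

definition gamma_bound :: "real \<Rightarrow> ('a::euclidean_space) fun_op set \<Rightarrow> real" where
  "gamma_bound p \<tau> = Inf (gamma_constants p \<tau>)"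


section \<open>Fourier multipliers and functions of \<open>A = (-\<Delta>)\<^bsup>1/2\<^esup>\<close>\<close>

definition fourier :: "('a::euclidean_space \<Rightarrow> complex) \<Rightarrow> 'a \<Rightarrow> complex" where
  "fourier f \<xi> = (LINT x|lborel. cis (- (\<xi> \<bullet> x)) * f x)"

definition inv_fourier :: "('a::euclidean_space \<Rightarrow> complex) \<Rightarrow> 'a \<Rightarrow> complex" where
  "inv_fourier g x =
     complex_of_real (1 / (2 * pi) ^ DIM('a)) * (LINT \<xi>|lborel. cis (x \<bullet> \<xi>) * g \<xi>)"

text \<open>
  \<open>T\<close> is a bounded operator on \<open>L\<^sup>p\<close> that acts as \<open>f \<mapsto> F\<^sup>-\<^sup>1(m F f)\<close> on the dense subspace of those
  \<open>f \<in> L\<^sup>1 \<inter> L\<^sup>p\<close> with \<open>F f \<in> L\<^sup>1\<close>, where all the integrals converge absolutely. The subspace contains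
  the Schwartz functions. Hence \<open>T\<close> is determined by \<open>m\<close> up to equality almost everywhere.
\<close>

definition has_symbol :: "real \<Rightarrow> ('a::euclidean_space) fun_op \<Rightarrow> ('a \<Rightarrow> complex) \<Rightarrow> bool" where
  "has_symbol p T m \<longleftrightarrow>
     m \<in> borel_measurable lborel \<and> bounded (range m) \<and> T \<in> bounded_ops p \<and>
     (\<forall>f\<in>Lp p. integrable lborel f \<longrightarrow> integrable lborel (fourier f) \<longrightarrow>
        (AE x in lborel. T f x = inv_fourier (\<lambda>\<xi>. m \<xi> * fourier f \<xi>) x))"

definition fourier_multiplier :: "real \<Rightarrow> ('a::euclidean_space \<Rightarrow> complex) \<Rightarrow> 'a fun_op" where
  "fourier_multiplier p m = (SOME T. has_symbol p T m)"

text \<open>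
  With the above Fourier transform, \<open>-\<Delta>\<close> has the symbol \<open>|\<xi>|\<^sup>2\<close> and \<open>A = (-\<Delta>)\<^bsup>1/2\<^esup>\<close> the symbol
  \<open>|\<xi>|\<close>, so the operator \<open>F(A)\<close> is the Fourier multiplier operator with symbol \<open>F(|\<xi>|)\<close>.
\<close>

definition symbol_of_A :: "(real \<Rightarrow> complex) \<Rightarrow> 'a::euclidean_space \<Rightarrow> complex" where
  "symbol_of_A F = (\<lambda>\<xi>. F (norm \<xi>))"

definition function_of_A :: "real \<Rightarrow> (real \<Rightarrow> complex) \<Rightarrow> ('a::euclidean_space) fun_op" where
  "function_of_A p F = fourier_multiplier p (symbol_of_A F)"

text \<open>
  \<open>F(A)\<close> is a well-defined bounded operator on \<open>L\<^sup>p\<close>. Without this, the choice operator in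
  \<open>fourier_multiplier\<close> would give no information.
\<close>

definition defined_on_Lp :: "'a::euclidean_space itself \<Rightarrow> real \<Rightarrow> (real \<Rightarrow> complex) \<Rightarrow> bool" where
  "defined_on_Lp _ p F \<longleftrightarrow> (\<exists>T :: 'a fun_op. has_symbol p T (symbol_of_A F))"

text \<open>The functions \<open>r \<mapsto> e\<^bsup>-zr\<^esup>\<close> and \<open>r \<mapsto> (1 + s r)\<^bsup>-\<alpha>\<^esup> e\<^bsup>itsr\<^esup>\<close>, giving \<open>exp(-zA)\<close> and
  \<open>(1 + sA)\<^bsup>-\<alpha>\<^esup> e\<^bsup>itsA\<^esup>\<close>.\<close>

definition exp_fun :: "complex \<Rightarrow> real \<Rightarrow> complex" where
  "exp_fun z r = exp (- (z * complex_of_real r))"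

definition wave_fun :: "real \<Rightarrow> real \<Rightarrow> real \<Rightarrow> real \<Rightarrow> complex" where
  "wave_fun \<alpha> t s r = complex_of_real ((1 + s * r) powr (- \<alpha>)) * exp (\<i> * complex_of_real (t * s * r))"


section \<open>The Poisson kernel\<close>

text \<open>The constant that makes \<open>p\<^sub>t\<^sub>,\<^sub>0\<close> a probability density on \<open>\<real>\<^sup>d\<close>.\<close>

definition poisson_const :: "nat \<Rightarrow> real" where
  "poisson_const d = Gamma ((real d + 1) / 2) / pi powr ((real d + 1) / 2)"

text \<open>
  The power is the principal one. For \<open>|\<theta>| < \<pi>/2\<close> its base lies off the branch cut, since
  \<open>(e\<^bsup>i\<theta>\<^esup>t)\<^sup>2\<close> is not in \<open>(-\<infinity>, 0]\<close>.
\<close>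

definition poisson_kernel :: "real \<Rightarrow> real \<Rightarrow> 'a::euclidean_space \<Rightarrow> complex" where
  "poisson_kernel t \<theta> x =
     complex_of_real (poisson_const DIM('a)) * (cis \<theta> * complex_of_real t) /
     ((cis \<theta> * complex_of_real t)\<^sup>2 + complex_of_real ((norm x)\<^sup>2))
        powr complex_of_real ((real DIM('a) + 1) / 2)"

end

(* All operators are mixtures of convolutions with Poisson kernels P_z, Re z > 0: exp(-zA) is P_z itself, and the
   wave operator is the average of exp(-2^k(u - it)A) in u against the density u^(alpha-1) e^(-u) / Gamma(alpha).
   Up to a constant, |P_z| is bounded by the |z|-dilate of a majorant m depending only on delta = Re z / |z|;
   m is nearly constant on balls of radius delta, so the lacunary maximal function over its dilates 2^k is an
   m-average of shifted dyadic maximal functions. A Vitali argument bounds the one with shift v in L^q with a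
   constant logarithmic in |v|/delta, which gives C delta^(-beta) for every beta > (d-1)/2. By duality the maximal
   inequality yields a square function inequality for the operators, and square functions in L^p are equivalent
   to Gaussian norms. *)
theory Submission
  imports Defs "HOL-Complex_Analysis.Complex_Analysis"
begin

text \<open>The obstacle is the loss as \<delta> tends to 0. At |z| = 1 the kernel sits on a shell
  of thickness \<delta> about the unit sphere, with height of order \<delta>^(-(d + 1) / 2); its
  mass is of order \<delta>^(-(d - 1) / 2), up to a logarithm for d = 1. Domination by the centred
  Hardy-Littlewood maximal function would need a radially decreasing majorant, and such a majorant
  fills the whole unit ball: a full power of \<delta> would be lost. Cutting the shell into balls of
  radius \<delta> keeps the mass, but a ball at distance |v| is then off centre by |v| / \<delta> of
  its radii. For averages at all scales this would cost a power of |v| / \<delta>; for dyadic scales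
  only about log (|v| / \<delta>) of them interact with a given ball, so the cost is logarithmic.
  The logarithm and the borderline case d = 1 are paid from the gap between (d - 1) / 2 and \<beta>.

  The wave operators need a second gap: along the path u - it the loss \<delta>^(-\<beta>) grows
  like u^(-\<beta>) at u = 0 when t is not 0, and it is integrable against u^(\<alpha> - 1) only for
  \<beta> < \<alpha>. Absolute values are taken inside the mixture, so no cancellation in u is
  used.\<close>

section \<open>Powers and integral inequalities in the extended nonnegative reals\<close>

text \<open>The conventions \<open>epow 0 a = 0\<close> and \<open>epow \<top> a = \<top>\<close>
  hold for every real a, negative ones included. They make \<open>epow_add\<close> and
  \<open>epow_epow\<close> unconditional, so that an expression like
  \<open>epow (U x) (p / 2 - 1)\<close> with p < 2 needs no case distinction at the zeros of
  U.\<close>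

definition epow :: "ennreal \<Rightarrow> real \<Rightarrow> ennreal" where
  "epow x a = (if x = \<top> then \<top> else ennreal (enn2real x powr a))"

lemma epow_ennreal: "0 \<le> x \<Longrightarrow> epow (ennreal x) a = ennreal (x powr a)"
  by (simp add: epow_def)

lemma epow_0 [simp]: "epow 0 a = 0"
  by (simp add: epow_def)

lemma epow_top [simp]: "epow \<top> a = \<top>"
  by (simp add: epow_def)

lemma epow_1 [simp]: "epow 1 a = 1"
  by (simp add: epow_def)

lemma epow_one [simp]: "epow x 1 = x"
  by (cases x) (auto simp: epow_def)

lemma epow_eq_0 [simp]: "epow x a = 0 \<longleftrightarrow> x = 0"
  by (cases x) (auto simp: epow_def powr_def)

lemma epow_eq_top [simp]: "epow x a = \<top> \<longleftrightarrow> x = \<top>"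
  by (auto simp: epow_def)

lemma epow_mult: "0 < a \<Longrightarrow> epow (x * y) a = epow x a * epow y a"
proof -
  assume a: "0 < a"
  consider "x = 0" | "y = 0" | "x \<noteq> 0" "y \<noteq> 0" "x = \<top> \<or> y = \<top>" | "x \<noteq> \<top>" "y \<noteq> \<top>" by blast
  then show ?thesis
  proof cases
    case 3 then show ?thesis by (auto simp: ennreal_mult_top ennreal_top_mult)
  next
    case 4 then show ?thesis
      by (cases x; cases y) (auto simp: epow_ennreal powr_mult simp flip: ennreal_mult)
  qed auto
qed

lemma epow_mono: "x \<le> y \<Longrightarrow> 0 \<le> a \<Longrightarrow> epow x a \<le> epow y a"
  by (cases x; cases y) (auto simp: epow_ennreal top_unique intro!: ennreal_leI powr_mono2)

lemma epow_epow: "epow (epow x a) b = epow x (a * b)"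
  by (cases x) (auto simp: epow_ennreal powr_powr)

lemma epow_add: "epow x (a + b) = epow x a * epow x b"
  by (cases x) (auto simp: epow_ennreal powr_add ennreal_mult)

lemma epow_inverse: "0 < a \<Longrightarrow> epow (epow x a) (1 / a) = x"
  by (simp add: epow_epow)

lemma epow_inverse': "0 < a \<Longrightarrow> epow (epow x (1 / a)) a = x"
  by (simp add: epow_epow)

lemma epow_le_iff: "0 < a \<Longrightarrow> epow x a \<le> epow y a \<longleftrightarrow> x \<le> y"
  by (metis epow_inverse epow_mono less_eq_real_def zero_less_divide_1_iff)

lemma epow_2: "epow x 2 = x * x"
  using epow_add[of x 1 1] by simp

lemma epow_measurable [measurable]: "(\<lambda>x. epow x a) \<in> borel_measurable borel"
  unfolding epow_def by measurable

lemma epow_less_top [simp]: "epow x a < \<top> \<longleftrightarrow> x < \<top>"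
  by (simp add: less_top[symmetric])

lemma Young_ennreal:
  assumes "0 < a" "0 < b" "a + b = 1"
  shows "epow x a * epow y b \<le> ennreal a * x + ennreal b * y"
proof (cases "x = \<top> \<or> y = \<top>")
  case True
  then show ?thesis using assms by (auto simp: ennreal_mult_top)
next
  case False
  then obtain u v where "x = ennreal u" "y = ennreal v" "0 \<le> u" "0 \<le> v"
    by (metis ennreal_cases)
  moreover have "u powr a * v powr b \<le> a * u + b * v"
    using Youngs_inequality_0[of a b u v] assms calculation by (cases "u = 0"; cases "v = 0") auto
  ultimately show ?thesis
    using assms by (simp add: epow_ennreal flip: ennreal_mult ennreal_plus)
qed

text \<open>Dividing F and G by their integrals A and B reduces the claim to Young's inequality at
  each point. The normalisation needs A and B invertible, so the values 0 and infinity are split off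
  first.\<close>

lemma Hoelder_ennreal:
  assumes [measurable]: "F \<in> borel_measurable M" "G \<in> borel_measurable M"
    and ab: "0 < a" "0 < b" "a + b = 1"
  shows "(\<integral>\<^sup>+x. epow (F x) a * epow (G x) b \<partial>M) \<le> epow (\<integral>\<^sup>+x. F x \<partial>M) a * epow (\<integral>\<^sup>+x. G x \<partial>M) b"
proof -
  define A where "A = (\<integral>\<^sup>+x. F x \<partial>M)"
  define B where "B = (\<integral>\<^sup>+x. G x \<partial>M)"
  consider "A = 0" | "B = 0" | "A \<noteq> 0" "B \<noteq> 0" "A = \<top> \<or> B = \<top>"
    | "A \<noteq> 0" "B \<noteq> 0" "A \<noteq> \<top>" "B \<noteq> \<top>" by blast
  then show ?thesis
  proof cases
    case 1
    then have "AE x in M. F x = 0" unfolding A_def by (subst (asm) nn_integral_0_iff_AE) auto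
    then have "(\<integral>\<^sup>+x. epow (F x) a * epow (G x) b \<partial>M) = (\<integral>\<^sup>+x. 0 \<partial>M)"
      by (intro nn_integral_cong_AE) auto
    then show ?thesis by simp
  next
    case 2
    then have "AE x in M. G x = 0" unfolding B_def by (subst (asm) nn_integral_0_iff_AE) auto
    then have "(\<integral>\<^sup>+x. epow (F x) a * epow (G x) b \<partial>M) = (\<integral>\<^sup>+x. 0 \<partial>M)"
      by (intro nn_integral_cong_AE) auto
    then show ?thesis by simp
  next
    case 3
    then show ?thesis unfolding A_def[symmetric] B_def[symmetric]
      by (auto simp: ennreal_mult_top ennreal_top_mult)
  next
    case 4
    have inv: "A * inverse A = 1" "B * inverse B = 1"
      using 4 by (auto simp: top.not_eq_extremum simp flip: divide_ennreal_def)
    have "epow (F x) a * epow (G x) b \<le> epow A a * epow B b *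
        (ennreal a * (F x * inverse A) + ennreal b * (G x * inverse B))" for x
    proof -
      have "epow (F x) a = epow A a * epow (F x * inverse A) a"
        using ab inv by (metis epow_mult mult.left_commute mult.right_neutral)
      moreover have "epow (G x) b = epow B b * epow (G x * inverse B) b"
        using ab inv by (metis epow_mult mult.left_commute mult.right_neutral)
      moreover have "epow (F x * inverse A) a * epow (G x * inverse B) b
          \<le> ennreal a * (F x * inverse A) + ennreal b * (G x * inverse B)"
        using ab by (rule Young_ennreal)
      ultimately show ?thesis
        using mult_left_mono[of "epow (F x * inverse A) a * epow (G x * inverse B) b"
            "ennreal a * (F x * inverse A) + ennreal b * (G x * inverse B)" "epow A a * epow B b"]
        by (simp add: ac_simps)
    qed
    then have "(\<integral>\<^sup>+x. epow (F x) a * epow (G x) b \<partial>M) \<le> (\<integral>\<^sup>+x. epow A a * epow B b *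
        (ennreal a * (F x * inverse A) + ennreal b * (G x * inverse B)) \<partial>M)"
      by (intro nn_integral_mono) auto
    also have "\<dots> = epow A a * epow B b *
        (ennreal a * (A * inverse A) + ennreal b * (B * inverse B))"
      unfolding A_def B_def by (simp add: nn_integral_cmult nn_integral_add nn_integral_multc)
    also have "\<dots> = epow A a * epow B b"
      using ab by (simp add: inv flip: ennreal_plus)
    finally show ?thesis unfolding A_def B_def .
  qed
qed

text \<open>The q-th power of the inequality with exponents 1 / q and 1 - 1 / q; the second exponent
  becomes q (1 - 1 / q) = q - 1.\<close>

lemma Hoelder_power:
  assumes [measurable]: "H \<in> borel_measurable M" "a \<in> borel_measurable M"
    and q: "1 < q" and le: "\<And>x. x \<in> space M \<Longrightarrow> F x \<le> epow (H x) (1 / q) * epow (a x) (1 - 1 / q)"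
  shows "epow (\<integral>\<^sup>+x. F x \<partial>M) q \<le> (\<integral>\<^sup>+x. H x \<partial>M) * epow (\<integral>\<^sup>+x. a x \<partial>M) (q - 1)"
proof -
  have "(\<integral>\<^sup>+x. F x \<partial>M) \<le> (\<integral>\<^sup>+x. epow (H x) (1 / q) * epow (a x) (1 - 1 / q) \<partial>M)"
    using le by (intro nn_integral_mono)
  also have "\<dots> \<le> epow (\<integral>\<^sup>+x. H x \<partial>M) (1 / q) * epow (\<integral>\<^sup>+x. a x \<partial>M) (1 - 1 / q)"
    using q by (intro Hoelder_ennreal) auto
  finally have "epow (\<integral>\<^sup>+x. F x \<partial>M) q \<le>
      epow (epow (\<integral>\<^sup>+x. H x \<partial>M) (1 / q) * epow (\<integral>\<^sup>+x. a x \<partial>M) (1 - 1 / q)) q"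
    using q by (intro epow_mono) auto
  also have "\<dots> = (\<integral>\<^sup>+x. H x \<partial>M) * epow (\<integral>\<^sup>+x. a x \<partial>M) (q - 1)"
    using q by (simp add: epow_mult epow_epow algebra_simps)
  finally show ?thesis .
qed

text \<open>Jensen's inequality for the measure with density K, without normalisation: the total
  mass of K enters with the power q - 1. It is applied to convolution kernels, to the majorant as a
  weight on shifts, and to the weight of a mixture.\<close>

lemma nn_integral_product_power:
  assumes [measurable]: "K \<in> borel_measurable M" "f \<in> borel_measurable M" and q: "1 < q"
  shows "epow (\<integral>\<^sup>+x. K x * f x \<partial>M) q
    \<le> (\<integral>\<^sup>+x. K x * epow (f x) q \<partial>M) * epow (\<integral>\<^sup>+x. K x \<partial>M) (q - 1)"
proof (rule Hoelder_power)
  fix x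
  have "K x = epow (K x) (1 / q) * epow (K x) (1 - 1 / q)"
    by (simp flip: epow_add)
  then show "K x * f x \<le> epow (K x * epow (f x) q) (1 / q) * epow (K x) (1 - 1 / q)"
    using q by (simp add: epow_mult epow_inverse mult.assoc) (simp add: ac_simps)
qed (use q in auto)

text \<open>The absorption step of the duality arguments below, where an integral is bounded by a
  smaller power of itself. Division is legitimate only for finite I, which is why the results built
  on it carry an a priori finiteness hypothesis.\<close>

lemma ennreal_cancel_power:
  assumes "I \<le> X * epow I (1 - a)" "0 < a" "a < 1" "I < \<top>"
  shows "epow I a \<le> X"
proof (cases "I = 0")
  case False
  define J where "J = epow I (1 - a)"
  have "I = epow I a * J" unfolding J_def by (simp flip: epow_add)
  moreover have "J \<noteq> 0" "J \<noteq> \<top>" using False assms by (auto simp: J_def)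
  ultimately have "epow I a * J / J \<le> X * J / J"
    using assms(1) by (metis J_def divide_right_mono_ennreal)
  then show ?thesis using \<open>J \<noteq> 0\<close> \<open>J \<noteq> \<top>\<close>
    by (simp add: ennreal_mult_divide_eq)
qed auto

text \<open>With J the inner integral, J^s = J J^(s - 1). Expanding one factor J, exchanging the
  integrals and applying Hoelder for each fixed w bounds the left side I by a multiple of
  \<open>epow I (1 - 1 / s)\<close>, which is then cancelled.\<close>

lemma Minkowski_integral:
  assumes "sigma_finite_measure M" "sigma_finite_measure N"
    and G[measurable]: "case_prod G \<in> borel_measurable (M \<Otimes>\<^sub>M N)" and s: "1 < s"
    and fin: "(\<integral>\<^sup>+x. epow (\<integral>\<^sup>+w. G x w \<partial>N) s \<partial>M) < \<top>"
  shows "(\<integral>\<^sup>+x. epow (\<integral>\<^sup>+w. G x w \<partial>N) s \<partial>M)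
    \<le> epow (\<integral>\<^sup>+w. epow (\<integral>\<^sup>+x. epow (G x w) s \<partial>M) (1 / s) \<partial>N) s"
proof -
  interpret M: sigma_finite_measure M by fact
  interpret N: sigma_finite_measure N by fact
  interpret pair_sigma_finite M N ..
  define J where "J x = (\<integral>\<^sup>+w. G x w \<partial>N)" for x
  have [measurable]: "J \<in> borel_measurable M" unfolding J_def by measurable
  define I where "I = (\<integral>\<^sup>+x. epow (J x) s \<partial>M)"
  define a where "a w = epow (\<integral>\<^sup>+x. epow (G x w) s \<partial>M) (1 / s)" for w
  have swap: "(\<lambda>(w, x). G x w) \<in> borel_measurable (N \<Otimes>\<^sub>M M)"
    using measurable_compose[OF measurable_pair_swap' G] by (simp add: case_prod_beta')
  have [measurable]: "a \<in> borel_measurable N" unfolding a_def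
    using swap by measurable
  have "I = (\<integral>\<^sup>+x. J x * epow (J x) (s - 1) \<partial>M)"
    unfolding I_def using epow_add[of _ 1 "s - 1"] by simp
  also have "\<dots> = (\<integral>\<^sup>+x. \<integral>\<^sup>+w. G x w * epow (J x) (s - 1) \<partial>N \<partial>M)"
    unfolding J_def[of "_"] by (intro nn_integral_cong nn_integral_multc[symmetric]) measurable
  also have "\<dots> = (\<integral>\<^sup>+w. \<integral>\<^sup>+x. G x w * epow (J x) (s - 1) \<partial>M \<partial>N)"
    by (rule Fubini'[symmetric]) measurable
  also have "\<dots> \<le> (\<integral>\<^sup>+w. a w * epow I (1 - 1 / s) \<partial>N)"
  proof (rule nn_integral_mono)
    fix w assume [measurable]: "w \<in> space N"
    have [measurable]: "(\<lambda>x. G x w) \<in> borel_measurable M" by measurable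
    have "(\<integral>\<^sup>+x. epow (epow (G x w) s) (1 / s) * epow (epow (J x) s) (1 - 1 / s) \<partial>M)
      \<le> a w * epow I (1 - 1 / s)"
      unfolding a_def I_def using s by (intro Hoelder_ennreal) auto
    then show "(\<integral>\<^sup>+x. G x w * epow (J x) (s - 1) \<partial>M) \<le> a w * epow I (1 - 1 / s)"
      using s by (simp add: epow_epow algebra_simps)
  qed
  also have "\<dots> = (\<integral>\<^sup>+w. a w \<partial>N) * epow I (1 - 1 / s)"
    by (rule nn_integral_multc) measurable
  finally have "epow I (1 / s) \<le> (\<integral>\<^sup>+w. a w \<partial>N)"
    using s fin by (intro ennreal_cancel_power) (auto simp: I_def J_def)
  then have "epow (epow I (1 / s)) s \<le> epow (\<integral>\<^sup>+w. a w \<partial>N) s"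
    using s by (intro epow_mono) auto
  then show ?thesis using s by (simp add: epow_inverse' I_def J_def a_def)
qed

lemma Jensen_power:
  assumes "prob_space N" and [measurable]: "f \<in> borel_measurable N" and q: "1 \<le> q"
  shows "epow (\<integral>\<^sup>+x. f x \<partial>N) q \<le> (\<integral>\<^sup>+x. epow (f x) q \<partial>N)"
proof (cases "q = 1")
  case False
  interpret prob_space N by fact
  show ?thesis using nn_integral_product_power[of "\<lambda>_. 1" N f q] q False
    by (simp add: emeasure_space_1)
qed simp

lemma nn_integral_powr_Icc:
  assumes "0 < a" "0 \<le> c"
  shows "(\<integral>\<^sup>+t. ennreal (a * t powr (a - 1)) * indicator {0<..<c} t \<partial>lborel) = ennreal (c powr a)"
proof (cases "c = 0")
  case False
  with assms have c: "0 < c" by simp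
  have "(\<integral>\<^sup>+t. ennreal (a * t powr (a - 1)) * indicator {0<..<c} t \<partial>lborel)
     = (\<integral>\<^sup>+t. ennreal (a * t powr (a - 1)) * indicator {0..c} t \<partial>lborel)"
    by (rule nn_integral_cong_AE) (use AE_lborel_singleton[of 0] AE_lborel_singleton[of c] in
      \<open>eventually_elim, auto simp: indicator_def\<close>)
  also have "\<dots> = ennreal (c powr a)"
  proof -
    have "((\<lambda>t. a * t powr (a - 1)) has_integral (a * (c powr a / a))) {0..c}"
      using has_integral_powr_from_0[of "a - 1" c] assms by (intro has_integral_mult_right) auto
    then have "(\<integral>\<^sup>+t. ennreal (indicator {0..c} t * (a * t powr (a - 1))) \<partial>lborel) = ennreal (a * (c powr a / a))"
      using assms by (intro nn_integral_has_integral_lebesgue) auto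
    then show ?thesis using assms
      by (simp add: ennreal_mult' ennreal_indicator mult.commute)
  qed
  finally show ?thesis .
qed (auto simp: greaterThanLessThan_empty)

lemma epow_eq_nn_integral:
  assumes a: "0 < a"
  shows "epow u a = (\<integral>\<^sup>+t. ennreal (a * t powr (a - 1)) * indicator {0<..} t *
      indicator {t. ennreal t < u} t \<partial>lborel)"
proof (cases u)
  case (real c)
  have "(\<integral>\<^sup>+t. ennreal (a * t powr (a - 1)) * indicator {0<..} t *
    indicator {t. ennreal t < u} t \<partial>lborel) =
    (\<integral>\<^sup>+t. ennreal (a * t powr (a - 1)) * indicator {0<..<c} t \<partial>lborel)"
    by (intro nn_integral_cong) (auto simp: indicator_def real ennreal_less_iff)
  then show ?thesis using real a by (simp add: nn_integral_powr_Icc epow_ennreal)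
next
  case top
  have "\<top> \<le> (\<integral>\<^sup>+t. ennreal (a * t powr (a - 1)) * indicator {0<..} t *
    indicator {t. ennreal t < u} t \<partial>lborel)" (is "_ \<le> ?I")
  proof (rule ccontr)
    assume "\<not> \<top> \<le> ?I"
    then obtain r where r: "?I = ennreal r" "0 \<le> r" by (cases ?I) (auto simp: top)
    \<comment> \<open>With this c the integral up to c is already r + 1, more than the supposed
      finite value r.\<close>
    define c where "c = (r + 1) powr (1 / a)"
    have "ennreal (c powr a) = (\<integral>\<^sup>+t. ennreal (a * t powr (a - 1)) * indicator {0<..<c} t \<partial>lborel)"
      using a by (subst nn_integral_powr_Icc) (auto simp: c_def)
    also have "\<dots> \<le> ?I" by (intro nn_integral_mono) (auto simp: indicator_def top)
    finally show False using r a by (simp add: c_def powr_powr)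
  qed
  then show ?thesis by (simp add: top top_unique)
qed

lemma layer_cake:
  assumes "sigma_finite_measure M" and [measurable]: "f \<in> borel_measurable M" and a: "0 < a"
  shows "(\<integral>\<^sup>+x. epow (f x) a \<partial>M) = (\<integral>\<^sup>+t\<in>{0<..}. ennreal (a * t powr (a - 1)) *
    emeasure M {x\<in>space M. ennreal t < f x} \<partial>lborel)"
proof -
  interpret sigma_finite_measure M by fact
  interpret pair_sigma_finite M lborel ..
  have "(\<integral>\<^sup>+x. epow (f x) a \<partial>M) = (\<integral>\<^sup>+x. \<integral>\<^sup>+t. ennreal (a * t powr (a - 1)) * indicator {0<..} t *
      indicator {t. ennreal t < f x} t \<partial>lborel \<partial>M)"
    by (simp flip: epow_eq_nn_integral[OF a])
  also have "\<dots> = (\<integral>\<^sup>+t. \<integral>\<^sup>+x. ennreal (a * t powr (a - 1)) * indicator {0<..} t *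
      indicator {t. ennreal t < f x} t \<partial>M \<partial>lborel)"
    by (rule Fubini'[symmetric]) (simp add: indicator_def, measurable)
  also have "\<dots> = (\<integral>\<^sup>+t. ennreal (a * t powr (a - 1)) * indicator {0<..} t *
      emeasure M {x\<in>space M. ennreal t < f x} \<partial>lborel)"
  proof (rule nn_integral_cong)
    fix t :: real
    have "(\<integral>\<^sup>+x. ennreal (a * t powr (a - 1)) * indicator {0<..} t *
      indicator {t. ennreal t < f x} t \<partial>M) = (\<integral>\<^sup>+x. ennreal (a * t powr (a - 1)) * indicator {0<..} t *
      indicator {x\<in>space M. ennreal t < f x} x \<partial>M)"
      by (intro nn_integral_cong) (auto simp: indicator_def)
    also have "\<dots> = ennreal (a * t powr (a - 1)) * indicator {0<..} t *
      emeasure M {x\<in>space M. ennreal t < f x}"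
      by (subst nn_integral_cmult_indicator) auto
    finally show "(\<integral>\<^sup>+x. ennreal (a * t powr (a - 1)) * indicator {0<..} t *
      indicator {t. ennreal t < f x} t \<partial>M) = \<dots>" .
  qed
  also have "\<dots> = (\<integral>\<^sup>+t\<in>{0<..}. ennreal (a * t powr (a - 1)) *
    emeasure M {x\<in>space M. ennreal t < f x} \<partial>lborel)"
    by (intro nn_integral_cong) (auto simp: ac_simps)
  finally show ?thesis .
qed

section \<open>The shifted lacunary maximal function\<close>

definition bavg :: "'a::euclidean_space \<Rightarrow> real \<Rightarrow> ('a \<Rightarrow> ennreal) \<Rightarrow> 'a \<Rightarrow> ennreal" where
  "bavg c r g x = (\<integral>\<^sup>+y. g y * indicator (cball (x - c) r) y \<partial>lborel) / emeasure lborel (cball (0::'a) r)"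

text \<open>Shift and radius are both multiplied by the scale \<rho>: all the balls are dilates of
  one off-centre ball, so only the ratio \<open>norm v / \<delta>\<close> matters for the
  bounds.\<close>

definition smax :: "real set \<Rightarrow> 'a::euclidean_space \<Rightarrow> real \<Rightarrow> ('a \<Rightarrow> ennreal) \<Rightarrow> 'a \<Rightarrow> ennreal" where
  "smax R v \<delta> g x = (SUP \<rho>\<in>R. bavg (\<rho> *\<^sub>R v) (\<rho> * \<delta>) g x)"

lemma emeasure_cball_pos_finite:
  assumes "0 < r"
  shows "emeasure lborel (cball (a::'a::euclidean_space) r) \<noteq> 0"
    "emeasure lborel (cball (a::'a::euclidean_space) r) \<noteq> \<top>"
proof -
  have "0 < unit_ball_vol (real DIM('a)) * r ^ DIM('a)" using assms by simp
  then show "emeasure lborel (cball (a::'a) r) \<noteq> 0"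
    using assms by (metis emeasure_cball ennreal_eq_0_iff less_imp_le not_le)
qed (use assms in \<open>simp add: emeasure_cball\<close>)

lemma bavg_measurable2:
  assumes [measurable]: "g \<in> borel_measurable borel"
  shows "(\<lambda>(v, x). bavg (\<rho> *\<^sub>R v) r g x) \<in> borel_measurable (borel \<Otimes>\<^sub>M borel)"
proof -
  have "(\<lambda>z. g (snd z) * indicator {w. norm w \<le> r} (snd (fst z) - \<rho> *\<^sub>R fst (fst z) - snd z))
      \<in> borel_measurable (((borel :: 'a measure) \<Otimes>\<^sub>M borel) \<Otimes>\<^sub>M lborel)"
    by measurable
  moreover have "indicator {w. norm w \<le> r} (x - \<rho> *\<^sub>R v - y)
      = (indicator (cball (x - \<rho> *\<^sub>R v) r) y :: ennreal)" for x v y :: 'a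
    by (auto simp: indicator_def dist_norm)
  ultimately have [measurable]: "(\<lambda>z. g (snd z) * indicator (cball (snd (fst z) - \<rho> *\<^sub>R fst (fst z)) r) (snd z))
      \<in> borel_measurable (((borel :: 'a measure) \<Otimes>\<^sub>M borel) \<Otimes>\<^sub>M lborel)"
    by simp
  have "(\<lambda>w. \<integral>\<^sup>+y. g y * indicator (cball (snd w - \<rho> *\<^sub>R fst w) r) y \<partial>lborel)
      \<in> borel_measurable ((borel :: 'a measure) \<Otimes>\<^sub>M borel)"
    by (rule lborel.borel_measurable_nn_integral) (simp add: case_prod_beta')
  then show ?thesis
    unfolding bavg_def case_prod_beta' by measurable
qed

lemma smax_measurable2:
  assumes [measurable]: "g \<in> borel_measurable borel" and "finite R"
  shows "(\<lambda>(v, x). smax R v \<delta> g x) \<in> borel_measurable (borel \<Otimes>\<^sub>M borel)"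
proof -
  have "(\<lambda>z. SUP \<rho>\<in>R. bavg (\<rho> *\<^sub>R fst z) (\<rho> * \<delta>) g (snd z)) \<in> borel_measurable (borel \<Otimes>\<^sub>M borel)"
    using bavg_measurable2[OF assms(1)] assms(2)
    by (intro borel_measurable_SUP countable_finite) (simp_all add: case_prod_beta')
  then show ?thesis by (simp add: smax_def case_prod_beta')
qed

lemma smax_measurable:
  assumes [measurable]: "g \<in> borel_measurable borel" and "finite R"
  shows "smax R v \<delta> g \<in> borel_measurable borel"
proof -
  have "(\<lambda>x. (v, x)) \<in> borel \<rightarrow>\<^sub>M borel \<Otimes>\<^sub>M borel" by measurable
  from measurable_compose[OF this smax_measurable2[OF assms]] show ?thesis by simp
qed

text \<open>A constant is its own average: this is the trivial endpoint at infinity of the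
  interpolation in \<open>smax_strong_type\<close>.\<close>

lemma bavg_add_const_le:
  assumes [measurable]: "g \<in> borel_measurable borel" "h \<in> borel_measurable borel" and "0 < r"
    and le: "\<And>x. g x \<le> h x + c"
  shows "bavg v r g x \<le> bavg v r h x + c"
proof -
  have "(\<integral>\<^sup>+y. g y * indicator (cball (x - v) r) y \<partial>lborel)
      \<le> (\<integral>\<^sup>+y. h y * indicator (cball (x - v) r) y + c * indicator (cball (x - v) r) y \<partial>lborel)"
    using le by (intro nn_integral_mono) (auto simp: indicator_def)
  also have "\<dots> = (\<integral>\<^sup>+y. h y * indicator (cball (x - v) r) y \<partial>lborel) + c * emeasure lborel (cball (x - v) r)"
  proof -
    have [measurable]: "indicator (cball (x - v) r) \<in> borel_measurable lborel"
      by (intro borel_measurable_indicator) simp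
    have "(\<lambda>y. h y * indicator (cball (x - v) r) y) \<in> borel_measurable lborel" by measurable
    moreover have "(\<lambda>y. c * indicator (cball (x - v) r) y) \<in> borel_measurable lborel" by measurable
    ultimately show ?thesis by (simp add: nn_integral_add nn_integral_cmult_indicator)
  qed
  also have "emeasure lborel (cball (x - v) r) = emeasure lborel (cball (0::'a) r)"
    using \<open>0 < r\<close> by (simp add: emeasure_cball)
  finally have "bavg v r g x \<le> ((\<integral>\<^sup>+y. h y * indicator (cball (x - v) r) y \<partial>lborel)
      + c * emeasure lborel (cball (0::'a) r)) / emeasure lborel (cball (0::'a) r)"
    unfolding bavg_def by (rule divide_right_mono_ennreal)
  also have "\<dots> = bavg v r h x + c"
    using emeasure_cball_pos_finite[OF \<open>0 < r\<close>, of "0::'a"]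
    by (simp add: bavg_def add_divide_distrib_ennreal ennreal_mult_divide_eq)
  finally show ?thesis .
qed

lemma smax_add_const_le:
  assumes "g \<in> borel_measurable borel" "h \<in> borel_measurable borel" "0 < \<delta>" "\<And>\<rho>. \<rho> \<in> R \<Longrightarrow> 0 < \<rho>"
    and "\<And>x. g x \<le> h x + c"
  shows "smax R v \<delta> g x \<le> smax R v \<delta> h x + c"
  unfolding smax_def
  by (rule SUP_least, rule order_trans[OF bavg_add_const_le[of g h _ c]])
     (use assms in \<open>auto intro!: add_right_mono SUP_upper\<close>)

text \<open>Vitali selects disjoint averaging balls, but these are displaced from the points x they
  serve, so the enlarged balls must be moved back by the shift. The scale of x is 2^(-m) times that
  of the selected ball, and each m gives one translate; for m > n the shift is shorter than the
  radius and the ball about the centre suffices. Dyadic scales thus leave the n + 3 values m = -2,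
  ..., n and one centred ball, whence the factor n + 4.\<close>

lemma smax_weak_type:
  fixes g :: "'a::euclidean_space \<Rightarrow> ennreal"
  assumes g[measurable]: "g \<in> borel_measurable borel" and R: "finite R"
    "\<And>\<rho>. \<rho> \<in> R \<Longrightarrow> \<exists>k::int. \<rho> = s * 2 powi k"
    and s: "0 < s" "0 < \<delta>" "norm v \<le> 2 ^ n * \<delta>" and L: "0 < L"
  shows "ennreal L * emeasure lborel {x. ennreal L < smax R v \<delta> g x}
    \<le> ennreal ((real n + 4) * 6 ^ DIM('a)) * (\<integral>\<^sup>+x. g x \<partial>lborel)"
proof -
  define E where "E = {x. ennreal L < smax R v \<delta> g x}"
  have [measurable]: "E \<in> sets borel"
    unfolding E_def using smax_measurable[OF g R(1)] by measurable
  define V where "V r = emeasure lborel (cball (0::'a) r)" for r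
  have V: "emeasure lborel (cball a r) = V r" if "0 \<le> r" for a :: 'a and r
    using that by (simp add: V_def emeasure_cball)
  have V6: "V (6 * r) = ennreal (6 ^ DIM('a)) * V r" if "0 \<le> r" for r
    using that by (simp add: V_def emeasure_cball power_mult_distrib mult.left_commute flip: ennreal_mult)
  have Rpos: "0 < \<rho>" if "\<rho> \<in> R" for \<rho> using R(2)[OF that] s by auto
  have "\<exists>\<rho>. \<rho> \<in> R \<and> ennreal L < bavg (\<rho> *\<^sub>R v) (\<rho> * \<delta>) g x" if "x \<in> E" for x
    using that unfolding E_def smax_def by (auto simp: less_SUP_iff)
  then obtain \<rho> where \<rho>: "\<And>x. x \<in> E \<Longrightarrow> \<rho> x \<in> R"
      "\<And>x. x \<in> E \<Longrightarrow> ennreal L < bavg (\<rho> x *\<^sub>R v) (\<rho> x * \<delta>) g x"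
    by metis
  define a where "a x = x - \<rho> x *\<^sub>R v" for x
  define r where "r x = \<rho> x * \<delta>" for x
  \<comment> \<open>The finite set R bounds the radii, as the Vitali covering lemma
    requires.\<close>
  have r: "0 < r x \<and> r x \<le> Max R * \<delta>" if "x \<in> E" for x
    using \<rho>(1)[OF that] Rpos R(1) s by (auto simp: r_def intro!: mult_right_mono)
  have avg: "ennreal L * V (r x) \<le> (\<integral>\<^sup>+y. g y * indicator (cball (a x) (r x)) y \<partial>lborel)" (is "_ \<le> ?I")
    if "x \<in> E" for x
  proof -
    have "ennreal L * V (r x) \<le> ?I / V (r x) * V (r x)"
      using \<rho>(2)[OF that] by (intro mult_right_mono) (auto simp: bavg_def a_def r_def V_def)
    also have "\<dots> = ?I" using emeasure_cball_pos_finite[of "r x" "0::'a"] r[OF that]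
      by (auto simp: V_def ennreal_divide_times top.not_eq_extremum)
    finally show ?thesis .
  qed
  obtain C where C: "countable C" "C \<subseteq> E"
      "pairwise (\<lambda>i j. disjnt (cball (a i) (r i)) (cball (a j) (r j))) C"
      "\<And>i. i \<in> E \<Longrightarrow> \<exists>j. j \<in> C \<and> cball (a i) (r i) \<subseteq> ball (a j) (5 * r j)"
  proof (rule Vitali_covering_lemma_cballs_balls[of E r "Max R * \<delta>" a])
    fix C assume C: "countable C" "C \<subseteq> E"
      "pairwise (\<lambda>i j. disjnt (cball (a i) (r i)) (cball (a j) (r j))) C"
      and j: "\<And>i. i \<in> E \<Longrightarrow> \<exists>j. j \<in> C \<and> \<not> disjnt (cball (a i) (r i)) (cball (a j) (r j)) \<and>
        cball (a i) (r i) \<subseteq> ball (a j) (5 * r j)"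
    show thesis
    proof (rule that[OF C])
      fix i assume "i \<in> E"
      from j[OF this] show "\<exists>j. j \<in> C \<and> cball (a i) (r i) \<subseteq> ball (a j) (5 * r j)" by (elim exE conjE) (rule exI, rule conjI)
    qed
  qed (rule r)
  \<comment> \<open>Radius 6 r: the Vitali lemma gives 5 r, and one further r absorbs the shift when
    m > n.\<close>
  define U where "U j = cball (a j) (6 * r j) \<union>
      (\<Union>m\<in>{-2..int n}. cball (a j + (2 powi (- m) * \<rho> j) *\<^sub>R v) (6 * r j))" for j
  have [measurable]: "U j \<in> sets borel" for j unfolding U_def by measurable
  have [measurable]: "cball (a j) (r j) \<in> sets borel" for j by simp
  have cover: "\<exists>j\<in>C. x \<in> U j" if x: "x \<in> E" for x
  proof -
    obtain j where j: "j \<in> C" "cball (a x) (r x) \<subseteq> ball (a j) (5 * r j)" using C(4)[OF x] by auto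
    have jE: "j \<in> E" using j C by auto
    have rr: "0 < r x" "0 < r j" using r x jE by auto
    have "cball (a x) (r x) \<subseteq> cball (a j) (5 * r j)" using j(2) ball_subset_cball by blast
    then have "dist (a x) (a j) + r x \<le> 5 * r j" using rr by (auto simp: cball_subset_cball_iff)
    then have d: "dist (a x) (a j) \<le> 5 * r j" "r x \<le> 5 * r j" using rr by auto (smt (verit) zero_le_dist)
    obtain k l :: int where kl: "\<rho> x = s * 2 powi k" "\<rho> j = s * 2 powi l"
      using R(2) \<rho>(1) x jE by metis
    define m where "m = l - k"
    have m: "\<rho> x = 2 powi (- m) * \<rho> j" by (simp add: kl m_def power_int_diff)
    have "\<rho> j > 0" using rr s by (auto simp: r_def zero_less_mult_iff)
    have "2 powi (- m) \<le> (5::real)"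
      using d(2) m s \<open>\<rho> j > 0\<close> by (simp add: r_def)
    \<comment> \<open>The ratio of the scales is a power of 2 and at most 5, hence at most
      4.\<close>
    have m2: "- 2 \<le> m"
    proof (rule ccontr)
      assume "\<not> - 2 \<le> m"
      then have "(2::real) powi 3 \<le> 2 powi (- m)" by (intro power_int_increasing) auto
      then show False using \<open>2 powi (- m) \<le> (5::real)\<close> by simp
    qed
    have xa: "x = a x + \<rho> x *\<^sub>R v" by (simp add: a_def)
    show ?thesis
    proof (cases "m \<le> int n")
      case True
      have "dist (a j + (2 powi (- m) * \<rho> j) *\<^sub>R v) x = dist (a j) (a x)"
        using xa m by (metis add.commute dist_add_cancel)
      then have "x \<in> cball (a j + (2 powi (- m) * \<rho> j) *\<^sub>R v) (6 * r j)"
        using d rr by (auto simp: dist_commute)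
      then have "x \<in> U j" unfolding U_def using True m2 by (intro UnI2 UN_I[of m]) auto
      then show ?thesis using j(1) by blast
    next
      case False
      have "norm (\<rho> x *\<^sub>R v) \<le> \<rho> x * (2 ^ n * \<delta>)" using s rr
        by (auto simp: r_def zero_less_mult_iff intro!: mult_left_mono)
      also have "\<dots> = (2 powi (- m) * 2 ^ n) * r j" by (simp add: m r_def)
      also have "\<dots> = 2 powi (int n - m) * r j"
        by (simp add: power_int_diff power_int_minus field_simps)
      also have "\<dots> \<le> 1 * r j"
        using False rr power_int_increasing[of "int n - m" 0 "2::real"] by (intro mult_right_mono) auto
      finally have "norm (\<rho> x *\<^sub>R v) \<le> r j" by simp
      moreover have "dist (a j) x \<le> dist (a j) (a x) + norm (\<rho> x *\<^sub>R v)"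
        using xa by (metis dist_triangle dist_norm add_diff_cancel_left' dist_commute)
      ultimately have "x \<in> cball (a j) (6 * r j)" using d(1) rr by (auto simp: dist_commute)
      then show ?thesis using j(1) unfolding U_def by auto
    qed
  qed
  have UV: "emeasure lborel (U j) \<le> ennreal ((real n + 4) * 6 ^ DIM('a)) * V (r j)" if "j \<in> E" for j
  proof -
    have "emeasure lborel (U j) \<le> emeasure lborel (cball (a j) (6 * r j)) +
      emeasure lborel (\<Union>m\<in>{-2..int n}. cball (a j + (2 powi (- m) * \<rho> j) *\<^sub>R v) (6 * r j))"
      unfolding U_def by (rule emeasure_subadditive) auto
    also have "\<dots> \<le> V (6 * r j) + (\<Sum>m\<in>{-2..int n}. V (6 * r j))"
      using r[OF that] V
      by (intro add_mono order.trans[OF emeasure_subadditive_finite] sum_mono) auto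
    also have "\<dots> = ennreal (real n + 4) * V (6 * r j)"
    proof -
      have c: "card {-2..int n} = n + 3" by simp
      have "ennreal (real n + 4) = ennreal 1 + ennreal (real (n + 3))"
        by (subst ennreal_plus[symmetric]) auto
      then have e: "ennreal (real n + 4) = 1 + of_nat (n + 3)"
        by (simp only: ennreal_of_nat_eq_real_of_nat ennreal_1)
      show ?thesis by (simp only: sum_constant c e distrib_right mult_1_left)
    qed
    also have "\<dots> = ennreal ((real n + 4) * 6 ^ DIM('a)) * V (r j)"
      using r[OF that] by (simp add: V6 ennreal_mult mult.assoc)
    finally show ?thesis .
  qed
  have "ennreal L * emeasure lborel E = (\<integral>\<^sup>+x. ennreal L * indicator E x \<partial>lborel)"
    by (simp add: nn_integral_cmult_indicator)
  \<comment> \<open>Sums over the countable family C are written as integrals over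
    \<open>count_space C\<close>, so that sum and integral can be exchanged in both directions:
    first over the covering sets \<open>U j\<close>, later over the disjoint balls.\<close>
  also have "\<dots> \<le> (\<integral>\<^sup>+x. \<integral>\<^sup>+j. ennreal L * indicator (U j) x \<partial>count_space C \<partial>lborel)"
  proof (rule nn_integral_mono)
    fix x :: 'a
    show "ennreal L * indicator E x \<le> (\<integral>\<^sup>+j. ennreal L * indicator (U j) x \<partial>count_space C)"
    proof (cases "x \<in> E")
      case True
      then obtain j where "j \<in> C" "x \<in> U j" using cover by auto
      then show ?thesis
        using nn_integral_ge_point[of j C "\<lambda>j. ennreal L * indicator (U j) x"] True by auto
    qed auto
  qed
  also have "\<dots> = (\<integral>\<^sup>+j. \<integral>\<^sup>+x. ennreal L * indicator (U j) x \<partial>lborel \<partial>count_space C)"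
    using C(1) by (intro nn_integral_count_space_nn_integral) auto
  also have "\<dots> = (\<integral>\<^sup>+j. ennreal L * emeasure lborel (U j) \<partial>count_space C)"
    by (simp add: nn_integral_cmult_indicator)
  also have "\<dots> \<le> (\<integral>\<^sup>+j. ennreal ((real n + 4) * 6 ^ DIM('a)) *
      (\<integral>\<^sup>+y. g y * indicator (cball (a j) (r j)) y \<partial>lborel) \<partial>count_space C)"
  proof (rule nn_integral_mono)
    fix j assume "j \<in> space (count_space C)"
    then have j: "j \<in> E" using C by auto
    have "ennreal L * emeasure lborel (U j) \<le> ennreal L * (ennreal ((real n + 4) * 6 ^ DIM('a)) * V (r j))"
      using UV[OF j] by (intro mult_left_mono) auto
    also have "\<dots> = ennreal ((real n + 4) * 6 ^ DIM('a)) * (ennreal L * V (r j))"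
      by (simp add: ac_simps)
    also have "\<dots> \<le> ennreal ((real n + 4) * 6 ^ DIM('a)) *
        (\<integral>\<^sup>+y. g y * indicator (cball (a j) (r j)) y \<partial>lborel)"
      using avg[OF j] by (intro mult_left_mono) auto
    finally show "ennreal L * emeasure lborel (U j) \<le> \<dots>" .
  qed
  also have "\<dots> = ennreal ((real n + 4) * 6 ^ DIM('a)) *
      (\<integral>\<^sup>+j. (\<integral>\<^sup>+y. g y * indicator (cball (a j) (r j)) y \<partial>lborel) \<partial>count_space C)"
    by (rule nn_integral_cmult) auto
  also have "(\<integral>\<^sup>+j. (\<integral>\<^sup>+y. g y * indicator (cball (a j) (r j)) y \<partial>lborel) \<partial>count_space C)
      = (\<integral>\<^sup>+y. \<integral>\<^sup>+j. g y * indicator (cball (a j) (r j)) y \<partial>count_space C \<partial>lborel)"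
    using C(1) by (intro nn_integral_count_space_nn_integral[symmetric]) auto
  also have "\<dots> \<le> (\<integral>\<^sup>+y. g y \<partial>lborel)"
  proof (rule nn_integral_mono)
    fix y :: 'a
    show "(\<integral>\<^sup>+j. g y * indicator (cball (a j) (r j)) y \<partial>count_space C) \<le> g y"
    proof (cases "\<exists>j\<in>C. y \<in> cball (a j) (r j)")
      case True
      then obtain j where j: "j \<in> C" "y \<in> cball (a j) (r j)" by auto
      then have "y \<notin> cball (a i) (r i)" if "i \<in> C" "i \<noteq> j" for i
        using C(3) that by (auto simp: pairwise_def disjnt_iff)
      moreover define F where "F i = g y * indicator (cball (a i) (r i)) y" for i
      ultimately have "(\<integral>\<^sup>+i. F i \<partial>count_space C) = (\<Sum>i\<in>{j}. F i)"
        using j by (intro nn_integral_count_space') auto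
      also have "\<dots> \<le> g y" using j by (simp add: F_def)
      finally show ?thesis by (simp only: F_def)
    next
      case False
      then have "(\<integral>\<^sup>+j. g y * indicator (cball (a j) (r j)) y \<partial>count_space C)
          = (\<integral>\<^sup>+j. 0 \<partial>count_space C)" by (intro nn_integral_cong) auto
      then show ?thesis by simp
    qed
  qed
  finally show ?thesis unfolding E_def by (rule meta_mp) (auto intro: mult_left_mono)
qed

text \<open>Marcinkiewicz interpolation. At level t only the part of g above t / 2 contributes,
  because the rest raises every average by at most t / 2; the weak type bound for that part is
  integrated over t by the layer cake formula.\<close>

theorem smax_strong_type:
  fixes g :: "'a::euclidean_space \<Rightarrow> ennreal"
  assumes g[measurable]: "g \<in> borel_measurable borel" and R: "finite R"
    "\<And>\<rho>. \<rho> \<in> R \<Longrightarrow> \<exists>k::int. \<rho> = s * 2 powi k"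
    and s: "0 < s" "0 < \<delta>" "norm v \<le> 2 ^ n * \<delta>" and q: "1 < q"
  shows "(\<integral>\<^sup>+x. epow (smax R v \<delta> g x) q \<partial>lborel)
    \<le> ennreal (2 powr q * q / (q - 1) * 6 ^ DIM('a)) * ennreal (real n + 4) * (\<integral>\<^sup>+x. epow (g x) q \<partial>lborel)"
proof -
  define A where "A = (real n + 4) * 6 ^ DIM('a)"
  have A: "0 < A" by (simp add: A_def)
  have Rpos: "0 < \<rho>" if "\<rho> \<in> R" for \<rho> using R(2)[OF that] s by auto
  note [measurable] = smax_measurable[OF g R(1)]
  have weak: "emeasure lborel {x. ennreal t < smax R v \<delta> g x} \<le>
      ennreal (2 * A / t) * (\<integral>\<^sup>+x. g x * indicator {x. ennreal t < 2 * g x} x \<partial>lborel)"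
    if t: "0 < t" for t
  proof -
    define h where "h x = g x * indicator {x. ennreal t < 2 * g x} x" for x
    have [measurable]: "h \<in> borel_measurable borel" unfolding h_def by measurable
    have "g x \<le> h x + ennreal (t / 2)" for x
    proof (cases "ennreal t < 2 * g x")
      case False
      then have "2 * g x \<le> 2 * ennreal (t / 2)" using t
        by (simp flip: ennreal_mult ennreal_numeral)
      then have "g x \<le> ennreal (t / 2)"
        by (subst (asm) ennreal_mult_le_mult_iff) auto
      then show ?thesis by (simp add: add_increasing)
    qed (auto simp: h_def)
    then have le: "smax R v \<delta> g x \<le> smax R v \<delta> h x + ennreal (t / 2)" for x
      using s Rpos by (intro smax_add_const_le) auto
    have sub: "{x. ennreal t < smax R v \<delta> g x} \<subseteq> {x. ennreal (t / 2) < smax R v \<delta> h x}"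
    proof safe
      fix x assume "ennreal t < smax R v \<delta> g x"
      then have "ennreal t < smax R v \<delta> h x + ennreal (t / 2)" using le by (rule less_le_trans)
      moreover have "ennreal t = ennreal (t / 2) + ennreal (t / 2)" using t by (simp flip: ennreal_plus)
      ultimately show "ennreal (t / 2) < smax R v \<delta> h x"
        by (metis add_right_mono linorder_not_le)
    qed
    have [measurable]: "smax R v \<delta> h \<in> borel_measurable borel"
      by (rule smax_measurable) (use R in auto)
    have "ennreal (t / 2) * emeasure lborel {x. ennreal t < smax R v \<delta> g x} \<le> ennreal (t / 2) *
        emeasure lborel {x. ennreal (t / 2) < smax R v \<delta> h x}"
      by (intro mult_left_mono emeasure_mono sub) auto
    also have "\<dots> \<le> ennreal A * (\<integral>\<^sup>+x. h x \<partial>lborel)"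
      unfolding A_def using t s R by (intro smax_weak_type[where s = s]) auto
    finally have "ennreal (2 / t) * (ennreal (t / 2) * emeasure lborel {x. ennreal t < smax R v \<delta> g x})
        \<le> ennreal (2 / t) * (ennreal A * (\<integral>\<^sup>+x. h x \<partial>lborel))"
      by (rule mult_left_mono) auto
    then show ?thesis using t A
      by (simp add: h_def mult.assoc[symmetric] flip: ennreal_mult)
  qed
  have "(\<integral>\<^sup>+x. epow (smax R v \<delta> g x) q \<partial>lborel) = (\<integral>\<^sup>+t\<in>{0<..}. ennreal (q * t powr (q - 1)) *
    emeasure lborel {x\<in>space lborel. ennreal t < smax R v \<delta> g x} \<partial>lborel)"
    using q by (intro layer_cake sigma_finite_lborel) auto
  \<comment> \<open>The factor q - 1 is inserted so that the integral over t becomes the layer cake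
    representation of the power q - 1 of \<open>2 * g x\<close>.\<close>
  also have "\<dots> \<le> (\<integral>\<^sup>+t. \<integral>\<^sup>+x. (ennreal (2 * A * q / (q - 1)) * g x) * (ennreal ((q - 1) * t powr (q - 1 - 1)) *
      indicator {0<..} t * indicator {t. ennreal t < 2 * g x} t) \<partial>lborel \<partial>lborel)"
  proof (rule nn_integral_mono)
    fix t :: real
    show "ennreal (q * t powr (q - 1)) * emeasure lborel {x\<in>space lborel. ennreal t < smax R v \<delta> g x} *
        indicator {0<..} t \<le> (\<integral>\<^sup>+x. (ennreal (2 * A * q / (q - 1)) * g x) * (ennreal ((q - 1) * t powr (q - 1 - 1)) *
      indicator {0<..} t * indicator {t. ennreal t < 2 * g x} t) \<partial>lborel)"
    proof (cases "0 < t")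
      case True
      have "ennreal (q * t powr (q - 1)) * emeasure lborel {x\<in>space lborel. ennreal t < smax R v \<delta> g x}
          \<le> ennreal (q * t powr (q - 1)) * (ennreal (2 * A / t) * (\<integral>\<^sup>+x. g x * indicator {x. ennreal t < 2 * g x} x \<partial>lborel))"
        using weak[OF True] by (intro mult_left_mono) auto
      also have "\<dots> = ennreal (2 * A * q / (q - 1)) * ennreal ((q - 1) * t powr (q - 1 - 1)) *
          (\<integral>\<^sup>+x. g x * indicator {x. ennreal t < 2 * g x} x \<partial>lborel)"
        using True q A by (simp add: mult.assoc[symmetric] powr_diff flip: ennreal_mult)
          (simp add: field_simps power2_eq_square)
      also have "\<dots> = (\<integral>\<^sup>+x. ennreal (2 * A * q / (q - 1)) * ennreal ((q - 1) * t powr (q - 1 - 1)) *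
          (g x * indicator {x. ennreal t < 2 * g x} x) \<partial>lborel)"
        by (rule nn_integral_cmult[symmetric]) auto
      also have "\<dots> = (\<integral>\<^sup>+x. (ennreal (2 * A * q / (q - 1)) * g x) * (ennreal ((q - 1) * t powr (q - 1 - 1)) *
        indicator {0<..} t * indicator {t. ennreal t < 2 * g x} t) \<partial>lborel)"
        using True by (intro nn_integral_cong) (auto simp: indicator_def ac_simps)
      finally show ?thesis using True by simp
    qed auto
  qed
  also have "\<dots> = (\<integral>\<^sup>+x. \<integral>\<^sup>+t. (ennreal (2 * A * q / (q - 1)) * g x) * (ennreal ((q - 1) * t powr (q - 1 - 1)) *
      indicator {0<..} t * indicator {t. ennreal t < 2 * g x} t) \<partial>lborel \<partial>lborel)"
    by (rule lborel_pair.Fubini') (simp add: indicator_def, measurable)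
  also have "\<dots> = (\<integral>\<^sup>+x. (ennreal (2 * A * q / (q - 1)) * g x) * epow (2 * g x) (q - 1) \<partial>lborel)"
    using q by (intro nn_integral_cong) (subst nn_integral_cmult, simp, simp add: epow_eq_nn_integral)
  also have "\<dots> = (\<integral>\<^sup>+x. ennreal (2 * A * q / (q - 1) * 2 powr (q - 1)) * epow (g x) q \<partial>lborel)"
  proof (rule nn_integral_cong)
    fix x
    have "epow (2 * g x) (q - 1) = ennreal (2 powr (q - 1)) * epow (g x) (q - 1)"
      using q epow_ennreal[of 2] by (simp add: epow_mult)
    moreover have "epow (g x) q = g x * epow (g x) (q - 1)" using epow_add[of "g x" 1 "q - 1"] by simp
    ultimately show "(ennreal (2 * A * q / (q - 1)) * g x) * epow (2 * g x) (q - 1) =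
        ennreal (2 * A * q / (q - 1) * 2 powr (q - 1)) * epow (g x) q"
      using ennreal_mult[of "2 * A * q / (q - 1)" "2 powr (q - 1)"] q A
      by (simp only: ac_simps) simp
  qed
  also have "\<dots> = ennreal (2 * A * q / (q - 1) * 2 powr (q - 1)) * (\<integral>\<^sup>+x. epow (g x) q \<partial>lborel)"
    by (rule nn_integral_cmult) auto
  also have "2 * A * q / (q - 1) * 2 powr (q - 1) = (2 powr q * q / (q - 1) * 6 ^ DIM('a)) * (real n + 4)"
    using q by (simp add: A_def powr_diff field_simps)
  also have "ennreal \<dots> = ennreal (2 powr q * q / (q - 1) * 6 ^ DIM('a)) * ennreal (real n + 4)"
    using q by (intro ennreal_mult) auto
  finally show ?thesis .
qed

section \<open>Square functions of convolutions with positive kernels\<close>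

lemma nn_integral_lborel_affine:
  fixes f :: "'a::euclidean_space \<Rightarrow> ennreal"
  assumes [measurable]: "f \<in> borel_measurable borel" and "c \<noteq> 0"
  shows "(\<integral>\<^sup>+x. f x \<partial>lborel) = ennreal (\<bar>c\<bar> ^ DIM('a)) * (\<integral>\<^sup>+x. f (t + c *\<^sub>R x) \<partial>lborel)"
proof -
  have "(\<integral>\<^sup>+x. f x \<partial>lborel)
      = (\<integral>\<^sup>+x. f x \<partial>(density (distr lborel borel (\<lambda>x. t + c *\<^sub>R x)) (\<lambda>_. \<bar>c\<bar> ^ DIM('a))))"
    by (simp flip: lborel_affine[OF \<open>c \<noteq> 0\<close>])
  also have "\<dots> = (\<integral>\<^sup>+x. ennreal (\<bar>c\<bar> ^ DIM('a)) * f (t + c *\<^sub>R x) \<partial>lborel)"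
    by (simp add: nn_integral_density nn_integral_distr)
  also have "\<dots> = ennreal (\<bar>c\<bar> ^ DIM('a)) * (\<integral>\<^sup>+x. f (t + c *\<^sub>R x) \<partial>lborel)"
    by (rule nn_integral_cmult) simp
  finally show ?thesis .
qed

lemma nn_integral_lborel_reflect:
  fixes f :: "'a::euclidean_space \<Rightarrow> ennreal"
  assumes "f \<in> borel_measurable borel"
  shows "(\<integral>\<^sup>+y. f (x - y) \<partial>lborel) = (\<integral>\<^sup>+y. f y \<partial>lborel)"
  using nn_integral_lborel_affine[OF assms, of "-1" x] by simp

definition conv :: "('a::euclidean_space \<Rightarrow> ennreal) \<Rightarrow> ('a \<Rightarrow> ennreal) \<Rightarrow> 'a \<Rightarrow> ennreal" where
  "conv K f x = (\<integral>\<^sup>+y. K (x - y) * f y \<partial>lborel)"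

lemma conv_measurable [measurable]:
  assumes [measurable]: "K \<in> borel_measurable borel" "f \<in> borel_measurable borel"
  shows "conv K f \<in> borel_measurable borel"
proof -
  have "(\<lambda>x. \<integral>\<^sup>+y. K (x - y) * f y \<partial>lborel) \<in> borel_measurable borel"
    by (rule lborel.borel_measurable_nn_integral) measurable
  then show ?thesis by (simp add: conv_def[abs_def])
qed

lemma conv_commute:
  assumes [measurable]: "K \<in> borel_measurable borel" "f \<in> borel_measurable borel"
  shows "conv K f x = conv f K x"
  using nn_integral_lborel_reflect[of "\<lambda>y. K (x - y) * f y" x] by (simp add: conv_def mult.commute)

text \<open>Evenness makes the convolution its own transpose. This moves the kernels from the given
  functions onto a dual function, where the maximal inequality can act.\<close>

lemma conv_duality:
  assumes [measurable]: "K \<in> borel_measurable borel" "f \<in> borel_measurable borel" "g \<in> borel_measurable borel"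
    and even: "\<And>x. K (- x) = K x"
  shows "(\<integral>\<^sup>+x. conv K f x * g x \<partial>lborel) = (\<integral>\<^sup>+x. f x * conv K g x \<partial>lborel)"
proof -
  have "(\<integral>\<^sup>+x. conv K f x * g x \<partial>lborel) = (\<integral>\<^sup>+x. \<integral>\<^sup>+y. K (x - y) * f y * g x \<partial>lborel \<partial>lborel)"
    unfolding conv_def by (intro nn_integral_cong nn_integral_multc[symmetric]) measurable
  also have "\<dots> = (\<integral>\<^sup>+y. \<integral>\<^sup>+x. K (x - y) * f y * g x \<partial>lborel \<partial>lborel)"
    by (rule lborel_pair.Fubini') measurable
  also have "\<dots> = (\<integral>\<^sup>+y. \<integral>\<^sup>+x. f y * (K (y - x) * g x) \<partial>lborel \<partial>lborel)"
  proof -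
    have "K (x - y) = K (y - x)" for x y using even[of "x - y"] by simp
    then show ?thesis by (simp add: ac_simps)
  qed
  also have "\<dots> = (\<integral>\<^sup>+x. f x * conv K g x \<partial>lborel)"
    unfolding conv_def by (intro nn_integral_cong nn_integral_cmult) measurable
  finally show ?thesis .
qed

lemma conv_integral:
  assumes [measurable]: "K \<in> borel_measurable borel" "f \<in> borel_measurable borel"
  shows "(\<integral>\<^sup>+x. conv K f x \<partial>lborel) = (\<integral>\<^sup>+x. K x \<partial>lborel) * (\<integral>\<^sup>+x. f x \<partial>lborel)"
proof -
  have "(\<integral>\<^sup>+x. conv K f x \<partial>lborel) = (\<integral>\<^sup>+x. \<integral>\<^sup>+y. K y * f (x - y) \<partial>lborel \<partial>lborel)"
    by (simp add: conv_commute[of K f], simp add: conv_def mult.commute)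
  also have "\<dots> = (\<integral>\<^sup>+y. \<integral>\<^sup>+x. K y * f (x - y) \<partial>lborel \<partial>lborel)"
    by (rule lborel_pair.Fubini') measurable
  also have "\<dots> = (\<integral>\<^sup>+y. K y * (\<integral>\<^sup>+x. f x \<partial>lborel) \<partial>lborel)"
  proof (rule nn_integral_cong)
    fix y :: 'a
    have "(\<integral>\<^sup>+x. f (x - y) \<partial>lborel) = (\<integral>\<^sup>+x. f x \<partial>(distr lborel borel (\<lambda>x. - y + x)))"
      by (subst nn_integral_distr) auto
    also have "\<dots> = (\<integral>\<^sup>+x. f x \<partial>lborel)" by (simp only: lborel_distr_plus)
    finally show "(\<integral>\<^sup>+x. K y * f (x - y) \<partial>lborel) = K y * (\<integral>\<^sup>+x. f x \<partial>lborel)"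
      by (subst nn_integral_cmult) auto
  qed
  also have "\<dots> = (\<integral>\<^sup>+x. K x \<partial>lborel) * (\<integral>\<^sup>+x. f x \<partial>lborel)"
    by (rule nn_integral_multc) measurable
  finally show ?thesis .
qed

lemma conv_power:
  assumes [measurable]: "K \<in> borel_measurable borel" "f \<in> borel_measurable borel" and q: "1 < q"
    and B: "(\<integral>\<^sup>+x. K x \<partial>lborel) \<le> B"
  shows "epow (conv K f x) q \<le> conv K (\<lambda>y. epow (f y) q) x * epow B (q - 1)"
proof -
  have "epow (\<integral>\<^sup>+y. K (x - y) * f y \<partial>lborel) q
    \<le> (\<integral>\<^sup>+y. K (x - y) * epow (f y) q \<partial>lborel) * epow (\<integral>\<^sup>+y. K (x - y) \<partial>lborel) (q - 1)"
    using q by (intro nn_integral_product_power) auto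
  also have "\<dots> \<le> (\<integral>\<^sup>+y. K (x - y) * epow (f y) q \<partial>lborel) * epow B (q - 1)"
    using B q by (intro mult_left_mono epow_mono) (auto simp: nn_integral_lborel_reflect)
  finally show ?thesis by (simp add: conv_def)
qed

lemma conv_Lp:
  assumes [measurable]: "K \<in> borel_measurable borel" "f \<in> borel_measurable borel" and q: "1 < q"
    and B: "(\<integral>\<^sup>+x. K x \<partial>lborel) \<le> B"
  shows "(\<integral>\<^sup>+x. epow (conv K f x) q \<partial>lborel) \<le> epow B q * (\<integral>\<^sup>+x. epow (f x) q \<partial>lborel)"
proof -
  have "(\<integral>\<^sup>+x. epow (conv K f x) q \<partial>lborel) \<le> (\<integral>\<^sup>+x. conv K (\<lambda>y. epow (f y) q) x * epow B (q - 1) \<partial>lborel)"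
    using q B by (intro nn_integral_mono conv_power) auto
  also have "\<dots> = (\<integral>\<^sup>+x. K x \<partial>lborel) * (\<integral>\<^sup>+x. epow (f x) q \<partial>lborel) * epow B (q - 1)"
    by (simp add: nn_integral_multc conv_integral)
  also have "\<dots> \<le> B * (\<integral>\<^sup>+x. epow (f x) q \<partial>lborel) * epow B (q - 1)"
    using B by (intro mult_right_mono) auto
  also have "\<dots> = epow B q * (\<integral>\<^sup>+x. epow (f x) q \<partial>lborel)"
    using epow_add[of B 1 "q - 1"] by (simp add: ac_simps)
  finally show ?thesis .
qed

text \<open>The sum is at most the number of terms times the largest one. The constant is crude, but
  the argument covers r < 1 and r > 1 alike.\<close>

lemma epow_sum_le:
  assumes "0 < r" "finite I"
  shows "epow (\<Sum>i\<in>I. a i) r \<le> ennreal (real (card I) powr r) * (\<Sum>i\<in>I. epow (a i) r)"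
proof (cases "I = {}")
  case False
  define m where "m = Max (a ` I)"
  have "m \<in> a ` I" unfolding m_def using False assms by (intro Max_in) auto
  then obtain j where j: "j \<in> I" "m = a j" by auto
  have "(\<Sum>i\<in>I. a i) \<le> (\<Sum>i\<in>I. m)" using assms by (intro sum_mono) (auto simp: m_def)
  also have "\<dots> = ennreal (real (card I)) * m" by (simp add: ennreal_of_nat_eq_real_of_nat)
  finally have "epow (\<Sum>i\<in>I. a i) r \<le> epow (ennreal (real (card I)) * m) r"
    using assms by (intro epow_mono) auto
  also have "\<dots> = ennreal (real (card I) powr r) * epow (a j) r"
    using assms j by (simp add: epow_mult epow_ennreal)
  also have "\<dots> \<le> ennreal (real (card I) powr r) * (\<Sum>i\<in>I. epow (a i) r)"
    using assms j by (intro mult_left_mono member_le_sum) auto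
  finally show ?thesis .
qed auto

lemma Cauchy_Schwarz_sum_ennreal:
  assumes "finite I"
  shows "(\<Sum>i\<in>I. a i * b i) \<le> epow (\<Sum>i\<in>I. a i * a i) (1/2) * epow (\<Sum>i\<in>I. b i * b i) (1/2)"
proof -
  have "epow (x * x) (1/2) = x" for x by (simp add: epow_2[symmetric] epow_epow)
  then show ?thesis
    using Hoelder_ennreal[of "\<lambda>i. a i * a i" "count_space I" "\<lambda>i. b i * b i" "1/2" "1/2"] assms
    by (simp add: nn_integral_count_space_finite)
qed

text \<open>A qualitative statement, obtained from a bound that grows with n: it licenses the
  cancellation of a power in the square function estimates that follow.\<close>

lemma square_sum_power_finite:
  fixes n :: nat
  assumes [measurable]: "\<And>k. k < n \<Longrightarrow> K k \<in> borel_measurable borel" "\<And>k. k < n \<Longrightarrow> f k \<in> borel_measurable borel"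
    and B: "\<And>k. k < n \<Longrightarrow> (\<integral>\<^sup>+x. K k x \<partial>lborel) \<le> B" "B < \<top>"
    and r: "1 / 2 < r" and fin: "(\<integral>\<^sup>+x. epow (\<Sum>k<n. f k x * f k x) r \<partial>lborel) < \<top>"
  shows "(\<integral>\<^sup>+x. epow (\<Sum>k<n. conv (K k) (f k) x * conv (K k) (f k) x) r \<partial>lborel) < \<top>"
proof -
  have sq: "epow (y * y) r = epow y (2 * r)" for y by (simp add: epow_2[symmetric] epow_epow)
  have fk: "(\<integral>\<^sup>+x. epow (f k x) (2 * r) \<partial>lborel) < \<top>" if "k < n" for k
  proof -
    have "(\<integral>\<^sup>+x. epow (f k x) (2 * r) \<partial>lborel) \<le> (\<integral>\<^sup>+x. epow (\<Sum>k<n. f k x * f k x) r \<partial>lborel)"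
      unfolding sq[symmetric] using that r
      by (intro nn_integral_mono epow_mono member_le_sum[of k "{..<n}" "\<lambda>k. f k _ * f k _"]) auto
    then show ?thesis using fin by auto
  qed
  have "(\<integral>\<^sup>+x. epow (\<Sum>k<n. conv (K k) (f k) x * conv (K k) (f k) x) r \<partial>lborel)
    \<le> (\<integral>\<^sup>+x. ennreal (real n powr r) * (\<Sum>k<n. epow (conv (K k) (f k) x) (2 * r)) \<partial>lborel)"
    using epow_sum_le[of r "{..<n}"] r by (intro nn_integral_mono) (simp add: sq[symmetric])
  also have "\<dots> = ennreal (real n powr r) * (\<Sum>k<n. \<integral>\<^sup>+x. epow (conv (K k) (f k) x) (2 * r) \<partial>lborel)"
  proof -
    have "(\<integral>\<^sup>+x. (\<Sum>k<n. epow (conv (K k) (f k) x) (2 * r)) \<partial>lborel)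
        = (\<Sum>k<n. \<integral>\<^sup>+x. epow (conv (K k) (f k) x) (2 * r) \<partial>lborel)"
      by (rule nn_integral_sum; simp)
    then show ?thesis by (simp add: nn_integral_cmult)
  qed
  also have "\<dots> \<le> ennreal (real n powr r) * (\<Sum>k<n. epow B (2 * r) * (\<integral>\<^sup>+x. epow (f k x) (2 * r) \<partial>lborel))"
    using r B by (intro mult_left_mono sum_mono conv_Lp) auto
  also have "\<dots> < \<top>" using fk B by (auto simp: ennreal_mult_less_top)
  finally show ?thesis .
qed

text \<open>Here r stands for p / 2, and h = U^(r - 1) is the function that norms U in L^r. Jensen
  moves the square under the convolution, evenness moves the kernel onto h, and what remains is the
  supremum over k of \<open>conv (K k) h\<close>, measured in the conjugate exponent q. One factor B
  comes from Jensen and one from the maximal inequality.\<close>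

lemma square_function_above_2:
  fixes n :: nat
  assumes [measurable]: "\<And>k. k < n \<Longrightarrow> K k \<in> borel_measurable borel" "\<And>k. k < n \<Longrightarrow> f k \<in> borel_measurable borel"
    and even: "\<And>k x. k < n \<Longrightarrow> K k (- x) = K k x"
    and B: "\<And>k. k < n \<Longrightarrow> (\<integral>\<^sup>+x. K k x \<partial>lborel) \<le> B" "B < \<top>"
    and r: "1 < r" and q: "q = r / (r - 1)"
    and mx: "\<And>g. g \<in> borel_measurable borel \<Longrightarrow>
      (\<integral>\<^sup>+x. epow (SUP k\<in>{..<n}. conv (K k) g x) q \<partial>lborel) \<le> epow B q * (\<integral>\<^sup>+x. epow (g x) q \<partial>lborel)"
    and fin: "(\<integral>\<^sup>+x. epow (\<Sum>k<n. f k x * f k x) r \<partial>lborel) < \<top>"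
  shows "(\<integral>\<^sup>+x. epow (\<Sum>k<n. conv (K k) (f k) x * conv (K k) (f k) x) r \<partial>lborel)
    \<le> epow B (2 * r) * (\<integral>\<^sup>+x. epow (\<Sum>k<n. f k x * f k x) r \<partial>lborel)"
proof -
  define S where "S x = (\<Sum>k<n. f k x * f k x)" for x
  define U where "U x = (\<Sum>k<n. conv (K k) (f k) x * conv (K k) (f k) x)" for x
  define h where "h x = epow (U x) (r - 1)" for x
  define G where "G x = (SUP k\<in>{..<n}. conv (K k) h x)" for x
  define N where "N = (\<integral>\<^sup>+x. epow (U x) r \<partial>lborel)"
  have [measurable]: "S \<in> borel_measurable borel" "U \<in> borel_measurable borel" unfolding S_def U_def by measurable
  have [measurable]: "h \<in> borel_measurable borel" unfolding h_def by measurable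
  have [measurable]: "G \<in> borel_measurable borel" unfolding G_def
    by (intro borel_measurable_SUP) auto
  have qr: "1 < q" "1 / q = 1 - 1 / r" "q * (1 / q) = 1" "(r - 1) * q = r" using r by (auto simp: q field_simps)
  have "N < \<top>" unfolding N_def U_def using r B fin by (intro square_sum_power_finite) auto
  have "N = (\<integral>\<^sup>+x. (\<Sum>k<n. conv (K k) (f k) x * conv (K k) (f k) x * h x) \<partial>lborel)"
    unfolding N_def h_def using epow_add[of _ 1 "r - 1"] by (simp add: U_def sum_distrib_right)
  also have "\<dots> \<le> (\<integral>\<^sup>+x. (\<Sum>k<n. B * (conv (K k) (\<lambda>y. f k y * f k y) x * h x)) \<partial>lborel)"
  proof (intro nn_integral_mono sum_mono)
    fix k x assume "k \<in> {..<n}"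
    then have "epow (conv (K k) (f k) x) 2 \<le> conv (K k) (\<lambda>y. epow (f k y) 2) x * epow B (2 - 1)"
      using B by (intro conv_power) auto
    then have "conv (K k) (f k) x * conv (K k) (f k) x \<le> conv (K k) (\<lambda>y. f k y * f k y) x * B"
      by (simp add: epow_2)
    then show "conv (K k) (f k) x * conv (K k) (f k) x * h x \<le> B * (conv (K k) (\<lambda>y. f k y * f k y) x * h x)"
      using mult_right_mono[of "conv (K k) (f k) x * conv (K k) (f k) x"
          "conv (K k) (\<lambda>y. f k y * f k y) x * B" "h x"] by (simp add: ac_simps)
  qed
  also have "\<dots> = B * (\<Sum>k<n. \<integral>\<^sup>+x. conv (K k) (\<lambda>y. f k y * f k y) x * h x \<partial>lborel)"
  proof -
    have "(\<integral>\<^sup>+x. (\<Sum>k<n. B * (conv (K k) (\<lambda>y. f k y * f k y) x * h x)) \<partial>lborel)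
        = (\<Sum>k<n. \<integral>\<^sup>+x. B * (conv (K k) (\<lambda>y. f k y * f k y) x * h x) \<partial>lborel)"
      by (rule nn_integral_sum; simp)
    then show ?thesis by (simp add: nn_integral_cmult sum_distrib_left)
  qed
  also have "\<dots> = B * (\<Sum>k<n. \<integral>\<^sup>+x. (f k x * f k x) * conv (K k) h x \<partial>lborel)"
    using even by (intro arg_cong[where f = "\<lambda>x. B * x"] sum.cong conv_duality) auto
  also have "\<dots> = B * (\<integral>\<^sup>+x. (\<Sum>k<n. (f k x * f k x) * conv (K k) h x) \<partial>lborel)"
    by (subst nn_integral_sum) auto
  also have "\<dots> \<le> B * (\<integral>\<^sup>+x. epow (epow (S x) r) (1 / r) * epow (epow (G x) q) (1 / q) \<partial>lborel)"
  proof (intro mult_left_mono nn_integral_mono)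
    fix x
    have "(\<Sum>k<n. (f k x * f k x) * conv (K k) h x) \<le> (\<Sum>k<n. (f k x * f k x) * G x)"
      unfolding G_def by (intro sum_mono mult_left_mono SUP_upper) auto
    moreover have "epow (epow (G x) q) (1 / q) = G x" "epow (epow (S x) r) (1 / r) = S x"
      using r qr(1) by (simp_all only: epow_inverse)
    ultimately show "(\<Sum>k<n. (f k x * f k x) * conv (K k) h x) \<le> epow (epow (S x) r) (1 / r) * epow (epow (G x) q) (1 / q)"
      by (simp only: S_def sum_distrib_right)
  qed auto
  also have "\<dots> \<le> B * (epow (\<integral>\<^sup>+x. epow (S x) r \<partial>lborel) (1 / r) * epow (\<integral>\<^sup>+x. epow (G x) q \<partial>lborel) (1 / q))"
    using r qr by (intro mult_left_mono Hoelder_ennreal) auto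
  also have "\<dots> \<le> B * (epow (\<integral>\<^sup>+x. epow (S x) r \<partial>lborel) (1 / r) * epow (epow B q * (\<integral>\<^sup>+x. epow (h x) q \<partial>lborel)) (1 / q))"
    unfolding G_def using qr(1) by (intro mult_left_mono epow_mono mx) auto
  also have "\<dots> = B * B * epow (\<integral>\<^sup>+x. epow (S x) r \<partial>lborel) (1 / r) * epow N (1 - 1 / r)"
  proof -
    have "(\<integral>\<^sup>+x. epow (h x) q \<partial>lborel) = N" unfolding N_def h_def by (simp add: epow_epow qr)
    moreover have "epow (epow B q * N) (1 / q) = B * epow N (1 / q)"
      using qr(1) by (simp add: epow_mult epow_inverse)
    ultimately show ?thesis by (simp add: qr(2) ac_simps)
  qed
  finally have "epow N (1 / r) \<le> B * B * epow (\<integral>\<^sup>+x. epow (S x) r \<partial>lborel) (1 / r)"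
    using r \<open>N < \<top>\<close> by (intro ennreal_cancel_power) auto
  then have "epow (epow N (1 / r)) r \<le> epow (B * B * epow (\<integral>\<^sup>+x. epow (S x) r \<partial>lborel) (1 / r)) r"
    using r by (intro epow_mono) auto
  moreover have "epow (epow N (1 / r)) r = N" using r by (intro epow_inverse') auto
  moreover have "epow (B * B * epow (\<integral>\<^sup>+x. epow (S x) r \<partial>lborel) (1 / r)) r
      = epow B (2 * r) * (\<integral>\<^sup>+x. epow (S x) r \<partial>lborel)"
    using r epow_add[of B r r] by (simp only: epow_mult epow_inverse' mult_2)
  ultimately show ?thesis unfolding N_def S_def U_def by simp
qed

lemma square_function_at_2:
  fixes n :: nat
  assumes [measurable]: "\<And>k. k < n \<Longrightarrow> K k \<in> borel_measurable borel" "\<And>k. k < n \<Longrightarrow> f k \<in> borel_measurable borel"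
    and B: "\<And>k. k < n \<Longrightarrow> (\<integral>\<^sup>+x. K k x \<partial>lborel) \<le> B"
  shows "(\<integral>\<^sup>+x. (\<Sum>k<n. conv (K k) (f k) x * conv (K k) (f k) x) \<partial>lborel)
    \<le> epow B 2 * (\<integral>\<^sup>+x. (\<Sum>k<n. f k x * f k x) \<partial>lborel)"
proof -
  have "(\<Sum>k<n. \<integral>\<^sup>+x. epow (conv (K k) (f k) x) 2 \<partial>lborel) \<le> (\<Sum>k<n. epow B 2 * (\<integral>\<^sup>+x. epow (f k x) 2 \<partial>lborel))"
    using B by (intro sum_mono conv_Lp) auto
  moreover have "(\<integral>\<^sup>+x. (\<Sum>k<n. f k x * f k x) \<partial>lborel) = (\<Sum>k<n. \<integral>\<^sup>+x. f k x * f k x \<partial>lborel)"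
    "(\<integral>\<^sup>+x. (\<Sum>k<n. conv (K k) (f k) x * conv (K k) (f k) x) \<partial>lborel)
      = (\<Sum>k<n. \<integral>\<^sup>+x. conv (K k) (f k) x * conv (K k) (f k) x \<partial>lborel)"
    by (rule nn_integral_sum; simp)+
  ultimately show ?thesis by (simp add: epow_2 sum_distrib_left)
qed

text \<open>Let p' be conjugate to p. The exponent \<open>p / \<bar>p - 2\<bar>\<close> is the
  conjugate of p / 2 when p > 2 and of p' / 2 when p < 2, so one maximal inequality serves both
  ranges: the second one follows by duality from the first at p' > 2. At p = 2 sum and integral
  commute and the L^2 bound of each convolution is enough.\<close>

theorem square_function_bound:
  fixes n :: nat
  assumes [measurable]: "\<And>k. k < n \<Longrightarrow> K k \<in> borel_measurable borel" "\<And>k. k < n \<Longrightarrow> f k \<in> borel_measurable borel"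
    and even: "\<And>k x. k < n \<Longrightarrow> K k (- x) = K k x"
    and B: "\<And>k. k < n \<Longrightarrow> (\<integral>\<^sup>+x. K k x \<partial>lborel) \<le> B" "B < \<top>"
    and p: "1 < p"
    and mx: "\<And>g. p \<noteq> 2 \<Longrightarrow> g \<in> borel_measurable borel \<Longrightarrow>
      (\<integral>\<^sup>+x. epow (SUP k\<in>{..<n}. conv (K k) g x) (p / \<bar>p - 2\<bar>) \<partial>lborel)
        \<le> epow B (p / \<bar>p - 2\<bar>) * (\<integral>\<^sup>+x. epow (g x) (p / \<bar>p - 2\<bar>) \<partial>lborel)"
    and fin: "(\<integral>\<^sup>+x. epow (\<Sum>k<n. f k x * f k x) (p / 2) \<partial>lborel) < \<top>"
  shows "(\<integral>\<^sup>+x. epow (\<Sum>k<n. conv (K k) (f k) x * conv (K k) (f k) x) (p / 2) \<partial>lborel)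
    \<le> epow B p * (\<integral>\<^sup>+x. epow (\<Sum>k<n. f k x * f k x) (p / 2) \<partial>lborel)"
proof -
  consider "p = 2" | "2 < p" | "p < 2" by linarith
  then show ?thesis
  proof cases
    case 1
    then show ?thesis using square_function_at_2[of n K f B] B by simp
  next
    case 2
    have "p / 2 / (p / 2 - 1) = p / \<bar>p - 2\<bar>" using 2 by (simp add: field_simps)
    then show ?thesis
      using square_function_above_2[of n K f B "p / 2" "p / \<bar>p - 2\<bar>"] 2 assms by simp
  next
    case 3
    define p' where "p' = p / (p - 1)"
    have p': "2 < p'" "1 / p' = 1 - 1 / p" "(p - 1) * p' / 2 = p / 2" using p 3 by (auto simp: p'_def field_simps)
    have q: "p' / 2 / (p' / 2 - 1) = p / \<bar>p - 2\<bar>" using p 3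
      by (simp add: p'_def divide_simps)
    define S where "S x = (\<Sum>k<n. f k x * f k x)" for x
    define u where "u k = conv (K k) (f k)" for k
    define U where "U x = (\<Sum>k<n. u k x * u k x)" for x
    \<comment> \<open>The sequence that norms u: its pairing with u integrates to N, and so does the
      power p' / 2 of its square sum. The exponent p / 2 - 1 is negative; at a zero of U the
      convention for \<open>epow 0\<close> gives h = 0.\<close>
    define h where "h k x = u k x * epow (U x) (p / 2 - 1)" for k x
    define W where "W x = (\<Sum>k<n. conv (K k) (h k) x * conv (K k) (h k) x)" for x
    define N where "N = (\<integral>\<^sup>+x. epow (U x) (p / 2) \<partial>lborel)"
    have [measurable]: "u k \<in> borel_measurable borel" if "k < n" for k unfolding u_def using that by measurable
    have [measurable]: "S \<in> borel_measurable borel" "U \<in> borel_measurable borel" unfolding S_def U_def by measurable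
    have [measurable]: "h k \<in> borel_measurable borel" if "k < n" for k unfolding h_def using that by measurable
    have [measurable]: "W \<in> borel_measurable borel" unfolding W_def by measurable
    have "N < \<top>" unfolding N_def U_def u_def using p B fin by (intro square_sum_power_finite) auto
    have hh: "(\<Sum>k<n. h k x * h k x) = epow (U x) (p - 1)" for x
    proof -
      have "(\<Sum>k<n. h k x * h k x) = (\<Sum>k<n. (u k x * u k x) * (epow (U x) (p / 2 - 1) * epow (U x) (p / 2 - 1)))"
        unfolding h_def by (intro sum.cong) (auto simp: ac_simps)
      also have "\<dots> = epow (U x) 1 * (epow (U x) (p / 2 - 1) * epow (U x) (p / 2 - 1))"
        unfolding sum_distrib_right[symmetric] by (simp add: U_def)
      also have "\<dots> = epow (U x) (1 + ((p / 2 - 1) + (p / 2 - 1)))" by (simp only: epow_add)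
      finally show ?thesis by simp
    qed
    have hN: "(\<integral>\<^sup>+x. epow (\<Sum>k<n. h k x * h k x) (p' / 2) \<partial>lborel) = N"
      by (simp add: hh epow_epow p' N_def)
    have W: "(\<integral>\<^sup>+x. epow (W x) (p' / 2) \<partial>lborel) \<le> epow B (2 * (p' / 2)) * N"
      unfolding hN[symmetric] W_def
      by (rule square_function_above_2[of n K h B "p' / 2" "p / \<bar>p - 2\<bar>"])
        (use 3 p' q \<open>N < \<top>\<close> hN assms in auto)
    have "epow (U x) (p / 2) = (\<Sum>k<n. u k x * h k x)" for x
    proof -
      have "(\<Sum>k<n. u k x * h k x) = (\<Sum>k<n. u k x * u k x) * epow (U x) (p / 2 - 1)"
        unfolding h_def sum_distrib_right by (simp add: mult.assoc)
      also have "\<dots> = epow (U x) (1 + (p / 2 - 1))" by (simp only: epow_add epow_one U_def)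
      finally show ?thesis by simp
    qed
    then have "N = (\<Sum>k<n. \<integral>\<^sup>+x. u k x * h k x \<partial>lborel)"
      unfolding N_def by (simp only:) (rule nn_integral_sum; simp)
    also have "\<dots> = (\<Sum>k<n. \<integral>\<^sup>+x. f k x * conv (K k) (h k) x \<partial>lborel)"
      unfolding u_def using even by (intro sum.cong conv_duality) auto
    also have "\<dots> = (\<integral>\<^sup>+x. (\<Sum>k<n. f k x * conv (K k) (h k) x) \<partial>lborel)"
      by (subst nn_integral_sum) auto
    also have "\<dots> \<le> (\<integral>\<^sup>+x. epow (epow (S x) (p / 2)) (1 / p) * epow (epow (W x) (p' / 2)) (1 / p') \<partial>lborel)"
    proof (rule nn_integral_mono)
      fix x
      show "(\<Sum>k<n. f k x * conv (K k) (h k) x) \<le> epow (epow (S x) (p / 2)) (1 / p) * epow (epow (W x) (p' / 2)) (1 / p')"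
        using Cauchy_Schwarz_sum_ennreal[of "{..<n}" "\<lambda>k. f k x" "\<lambda>k. conv (K k) (h k) x"] p p'(1)
        by (simp add: epow_epow S_def W_def)
    qed
    also have "\<dots> \<le> epow (\<integral>\<^sup>+x. epow (S x) (p / 2) \<partial>lborel) (1 / p) * epow (\<integral>\<^sup>+x. epow (W x) (p' / 2) \<partial>lborel) (1 / p')"
      using p p' by (intro Hoelder_ennreal) auto
    also have "\<dots> \<le> epow (\<integral>\<^sup>+x. epow (S x) (p / 2) \<partial>lborel) (1 / p) * epow (epow B (2 * (p' / 2)) * N) (1 / p')"
      using W p'(1) by (intro mult_left_mono epow_mono) auto
    also have "\<dots> = B * epow (\<integral>\<^sup>+x. epow (S x) (p / 2) \<partial>lborel) (1 / p) * epow N (1 - 1 / p)"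
    proof -
      have "epow (epow B (2 * (p' / 2)) * N) (1 / p') = B * epow N (1 / p')"
        using p'(1) by (simp add: epow_mult epow_epow)
      then show ?thesis by (simp add: p'(2) ac_simps)
    qed
    finally have "epow N (1 / p) \<le> B * epow (\<integral>\<^sup>+x. epow (S x) (p / 2) \<partial>lborel) (1 / p)"
      using p \<open>N < \<top>\<close> by (intro ennreal_cancel_power) auto
    then have "epow (epow N (1 / p)) p \<le> epow (B * epow (\<integral>\<^sup>+x. epow (S x) (p / 2) \<partial>lborel) (1 / p)) p"
      using p by (intro epow_mono) auto
    moreover have "epow (epow N (1 / p)) p = N" using p by (intro epow_inverse') auto
    moreover have "epow (B * epow (\<integral>\<^sup>+x. epow (S x) (p / 2) \<partial>lborel) (1 / p)) p
        = epow B p * (\<integral>\<^sup>+x. epow (S x) (p / 2) \<partial>lborel)"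
      using p by (subst epow_mult) (simp_all only: epow_inverse')
    ultimately show ?thesis unfolding N_def S_def U_def u_def by simp
  qed
qed

section \<open>The majorant of the Poisson kernel\<close>

text \<open>For dyadic decompositions. The sets may overlap, so balls and full neighbourhoods of the
  sphere can stand in for dyadic shells.\<close>

lemma nn_integral_le_suminf_cover:
  assumes [measurable]: "\<And>j. A j \<in> sets M"
    and cover: "\<And>x. x \<in> space M \<Longrightarrow> F x \<noteq> 0 \<Longrightarrow> \<exists>j::nat. x \<in> A j \<and> F x \<le> c j"
  shows "(\<integral>\<^sup>+x. F x \<partial>M) \<le> (\<Sum>j. c j * emeasure M (A j))"
proof -
  have "(\<integral>\<^sup>+x. F x \<partial>M) \<le> (\<integral>\<^sup>+x. (\<Sum>j. c j * indicator (A j) x) \<partial>M)"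
  proof (rule nn_integral_mono)
    fix x assume "x \<in> space M"
    show "F x \<le> (\<Sum>j. c j * indicator (A j) x)"
    proof (cases "F x = 0")
      case False
      then obtain j where "x \<in> A j" "F x \<le> c j" using cover \<open>x \<in> space M\<close> by blast
      then have "F x \<le> (\<Sum>i\<in>{j}. c i * indicator (A i) x)" by simp
      also have "\<dots> \<le> (\<Sum>i. c i * indicator (A i) x)"
        by (rule sum_le_suminf) auto
      finally show ?thesis .
    qed auto
  qed
  also have "\<dots> = (\<Sum>j. \<integral>\<^sup>+x. c j * indicator (A j) x \<partial>M)"
    by (rule nn_integral_suminf) measurable
  also have "\<dots> = (\<Sum>j. c j * emeasure M (A j))"
    by (simp add: nn_integral_cmult_indicator)
  finally show ?thesis .
qed

lemma suminf_geometric_less_top: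
  assumes "\<And>j. f j \<le> ennreal (C * a ^ j)" "0 \<le> C" "0 \<le> a" "a < 1"
  shows "(\<Sum>j. f j) < \<top>"
proof -
  have "summable (\<lambda>j. C * a ^ j)" using assms by (intro summable_mult summable_geometric) auto
  have "(\<Sum>j. f j) \<le> (\<Sum>j. ennreal (C * a ^ j))" using assms by (intro suminf_le) auto
  also have "\<dots> = ennreal (\<Sum>j. C * a ^ j)"
    using assms \<open>summable _\<close> by (intro suminf_ennreal2) auto
  finally show ?thesis by (simp add: le_less_trans)
qed

lemma obtain_dyadic:
  assumes "1 \<le> (u::real)"
  obtains j :: nat where "2 ^ j \<le> u" "u < 2 ^ Suc j"
proof -
  define j where "j = (LEAST j. u < 2 ^ Suc j)"
  have "\<exists>j. u < 2 ^ Suc j"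
    using real_arch_pow[of 2 u] by (metis less_trans one_less_numeral_iff semiring_norm(76) lessI power_strict_increasing)
  then have 1: "u < 2 ^ Suc j" unfolding j_def by (rule LeastI_ex)
  have "2 ^ j \<le> u"
  proof (cases j)
    case (Suc i)
    then have "\<not> u < 2 ^ Suc i" unfolding j_def by (intro not_less_Least) (simp add: j_def[symmetric])
    then show ?thesis using Suc by simp
  qed (use assms in auto)
  with 1 show ?thesis using that by blast
qed

text \<open>The region where 1 + |x| is between 2^j and 2^(j + 1) has volume of order 2^(j d), so it
  contributes at most of order 2^(-j \<epsilon>).\<close>

lemma nn_integral_decay:
  assumes "0 < \<epsilon>"
  shows "(\<integral>\<^sup>+(x::'a::euclidean_space). ennreal ((1 + norm x) powr (- (real DIM('a) + \<epsilon>))) \<partial>lborel) < \<top>"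
proof -
  let ?d = "real DIM('a)"
  define c where "c j = ennreal ((2 ^ j) powr (- (?d + \<epsilon>)))" for j :: nat
  define A where "A j = cball (0::'a) (2 ^ Suc j)" for j :: nat
  have "(\<integral>\<^sup>+(x::'a). ennreal ((1 + norm x) powr (- (?d + \<epsilon>))) \<partial>lborel) \<le> (\<Sum>j. c j * emeasure lborel (A j))"
  proof (rule nn_integral_le_suminf_cover)
    fix x :: 'a
    obtain j where j: "2 ^ j \<le> 1 + norm x" "1 + norm x < 2 ^ Suc j"
      using obtain_dyadic[of "1 + norm x"] by auto
    then have "x \<in> A j" by (auto simp: A_def)
    moreover have "ennreal ((1 + norm x) powr (- (?d + \<epsilon>))) \<le> c j"
      unfolding c_def using j assms by (intro ennreal_leI powr_mono2') auto
    ultimately show "\<exists>j. x \<in> A j \<and> ennreal ((1 + norm x) powr (- (?d + \<epsilon>))) \<le> c j" by blast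
  qed (auto simp: A_def)
  also have "\<dots> < \<top>"
  proof (rule suminf_geometric_less_top)
    fix j :: nat
    have "(2 ^ j) powr (- (?d + \<epsilon>)) * (2 ^ Suc j) ^ DIM('a) = 2 ^ DIM('a) * (2 powr (- \<epsilon>)) ^ j"
    proof -
      have "(2 ^ j) powr (- (?d + \<epsilon>)) = 2 powr (- ?d * j) * 2 powr (- \<epsilon> * j)"
        by (simp add: powr_realpow[symmetric] powr_powr powr_add[symmetric] algebra_simps)
      moreover have "(2 ^ Suc j) ^ DIM('a) = 2 ^ DIM('a) * (2 powr (?d * j))"
        by (simp add: powr_realpow[symmetric] powr_powr power_mult_distrib mult.commute
            power_mult[symmetric] flip: of_nat_mult) (simp add: powr_realpow mult.commute)?
      moreover have "2 powr (- ?d * j) * 2 powr (?d * j) = 1" by (simp flip: powr_add)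
      moreover have "2 powr (- \<epsilon> * j) = (2 powr (- \<epsilon>)) ^ j"
        by (simp add: powr_realpow[symmetric] powr_powr)
      ultimately show ?thesis by (simp add: algebra_simps)
    qed
    then show "c j * emeasure lborel (A j) \<le> ennreal ((unit_ball_vol ?d * 2 ^ DIM('a)) * (2 powr (- \<epsilon>)) ^ j)"
      unfolding c_def A_def by (simp add: emeasure_cball mult.left_commute flip: ennreal_mult) (simp add: mult.assoc)?
  qed (use assms in \<open>auto simp: powr_minus_divide\<close>)
  finally show ?thesis .
qed

lemma power_diff_le:
  assumes "0 \<le> (b::real)" "b \<le> a" "a \<le> 2"
  shows "a ^ n - b ^ n \<le> real n * 2 ^ n * (a - b)"
proof (induction n)
  case (Suc n)
  have "a ^ Suc n - b ^ Suc n = a * (a ^ n - b ^ n) + (a - b) * b ^ n" by (simp add: algebra_simps)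
  also have "\<dots> \<le> 2 * (real n * 2 ^ n * (a - b)) + (a - b) * 2 ^ n"
  proof (rule add_mono)
    have "0 \<le> a ^ n - b ^ n" using assms by (simp add: power_mono)
    then have "a * (a ^ n - b ^ n) \<le> 2 * (a ^ n - b ^ n)" using assms by (intro mult_right_mono) auto
    also have "\<dots> \<le> 2 * (real n * 2 ^ n * (a - b))" using Suc by simp
    finally show "a * (a ^ n - b ^ n) \<le> 2 * (real n * 2 ^ n * (a - b))" .
    show "(a - b) * b ^ n \<le> (a - b) * 2 ^ n" using assms by (intro mult_left_mono power_mono) auto
  qed
  also have "\<dots> \<le> real (Suc n) * 2 ^ Suc n * (a - b)" using assms by (simp add: algebra_simps)
  finally show ?case .
qed simp

text \<open>For \<rho> \<le> 1 the set is a difference of two balls, and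
  \<open>power_diff_le\<close> makes its volume linear in \<rho>. For larger \<rho> the ball of
  radius 3 contains it, and its volume is admissible because \<rho> > 1.\<close>

lemma emeasure_annulus:
  assumes "0 < \<rho>" "\<rho> \<le> 2"
  shows "emeasure lborel {x::'a::euclidean_space. \<bar>norm x - 1\<bar> \<le> \<rho>}
    \<le> ennreal (2 * unit_ball_vol DIM('a) * real DIM('a) * 3 ^ DIM('a) * \<rho>)"
proof -
  let ?d = "DIM('a)" and ?w = "unit_ball_vol DIM('a)"
  have w: "0 < ?w" by simp
  show ?thesis
  proof (cases "\<rho> \<le> 1")
    case True
    have eq: "{x::'a. \<bar>norm x - 1\<bar> \<le> \<rho>} = cball 0 (1 + \<rho>) - ball 0 (1 - \<rho>)" by auto
    have "emeasure lborel (cball (0::'a) (1 + \<rho>) - ball 0 (1 - \<rho>))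
        = emeasure lborel (cball (0::'a) (1 + \<rho>)) - emeasure lborel (ball (0::'a) (1 - \<rho>))"
      using True assms by (intro emeasure_Diff) (auto simp: emeasure_ball)
    also have "\<dots> = ennreal (?w * ((1 + \<rho>) ^ ?d - (1 - \<rho>) ^ ?d))"
      using True assms by (simp add: emeasure_ball emeasure_cball ennreal_minus right_diff_distrib)
    also have "\<dots> \<le> ennreal (?w * (real ?d * 2 ^ ?d * (2 * \<rho>)))"
      using power_diff_le[of "1 - \<rho>" "1 + \<rho>" ?d] True assms w
      by (intro ennreal_leI mult_left_mono) auto
    also have "\<dots> \<le> ennreal (2 * ?w * real ?d * 3 ^ ?d * \<rho>)"
      using w assms power_mono[of 2 "3::real" ?d] by (intro ennreal_leI) (simp add: algebra_simps)
    finally show ?thesis unfolding eq .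
  next
    case False
    have "emeasure lborel {x::'a. \<bar>norm x - 1\<bar> \<le> \<rho>} \<le> emeasure lborel (cball (0::'a) 3)"
      using assms by (intro emeasure_mono) auto
    also have "\<dots> = ennreal (?w * 3 ^ ?d)" by (simp add: emeasure_cball)
    also have "\<dots> \<le> ennreal (2 * ?w * real ?d * 3 ^ ?d * \<rho>)"
    proof (rule ennreal_leI)
      have "1 * 1 \<le> real ?d * \<rho>" using False by (intro mult_mono) (auto simp: Suc_leI)
      then have "?w * 3 ^ ?d * 1 \<le> ?w * 3 ^ ?d * (2 * (real ?d * \<rho>))"
        using w by (intro mult_left_mono) auto
      then show "?w * 3 ^ ?d \<le> 2 * ?w * real ?d * 3 ^ ?d * \<rho>" by (simp add: ac_simps)
    qed
    finally show ?thesis .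
  qed
qed

text \<open>The size of the Poisson kernel at a complex time w with |w| = 1 and Re w = \<delta>, up
  to constants: w^2 + |x|^2 is the product of |x| + iw and |x| - iw, one of modulus about | |x| - 1
  | + \<delta> and the other of modulus about 1 + |x|.\<close>

definition majorant :: "real \<Rightarrow> 'a::euclidean_space \<Rightarrow> real" where
  "majorant \<delta> x = ((\<bar>norm x - 1\<bar> + \<delta>) * (1 + norm x)) powr (- ((real DIM('a) + 1) / 2))"

text \<open>A measurable choice of an exponent n with \<open>norm v \<le> 2 ^ n * \<delta>\<close>,
  as the maximal inequality asks for; the summand 1 keeps the logarithm nonnegative.\<close>

definition shift_log :: "real \<Rightarrow> 'a::euclidean_space \<Rightarrow> nat" where
  "shift_log \<delta> v = nat \<lceil>log 2 (1 + norm v / \<delta>)\<rceil>"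

lemma majorant_pos: "0 < \<delta> \<Longrightarrow> 0 < majorant \<delta> x"
proof -
  assume "0 < \<delta>"
  then have "\<bar>norm x - 1\<bar> + \<delta> \<noteq> 0" "1 + norm x \<noteq> 0"
    using abs_ge_zero[of "norm x - 1"] norm_ge_zero[of x] by linarith+
  then show ?thesis by (simp add: majorant_def)
qed

lemma majorant_measurable [measurable]: "majorant \<delta> \<in> borel_measurable borel"
  unfolding majorant_def[abs_def] by measurable

lemma majorant_minus: "majorant \<delta> (- x) = majorant \<delta> x"
  by (simp add: majorant_def)

lemma shift_log_measurable [measurable]: "(\<lambda>v. real (shift_log \<delta> v)) \<in> borel_measurable borel"
  unfolding shift_log_def[abs_def] by measurable

lemma shift_log_bound:
  assumes "0 < \<delta>"
  shows "norm v \<le> 2 ^ shift_log \<delta> v * \<delta>"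
proof -
  have "1 + norm v / \<delta> = 2 powr (log 2 (1 + norm v / \<delta>))"
    using assms by (subst powr_log_cancel) (auto simp: add_pos_nonneg)
  also have "\<dots> \<le> 2 powr (real (shift_log \<delta> v))"
    unfolding shift_log_def by (intro powr_mono) linarith+
  also have "\<dots> = 2 ^ shift_log \<delta> v" by (simp add: powr_realpow)
  finally show ?thesis using assms by (simp add: field_simps)
qed

text \<open>A logarithm stays below every power, at the price of 1 / \<epsilon>. The \<epsilon> is
  taken from the gap between (d - 1) / 2 and \<beta>.\<close>

lemma shift_log_le:
  assumes "0 < \<delta>" "\<delta> \<le> 1" "0 < \<epsilon>"
  shows "real (shift_log \<delta> v) + 4 \<le> (5 + 1 / (\<epsilon> * ln 2)) * (\<delta> powr (- \<epsilon>) * (1 + norm v) powr \<epsilon>)"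
proof -
  define u where "u = (1 + norm v) / \<delta>"
  have u: "1 \<le> u" "1 + norm v / \<delta> \<le> u" "1 \<le> 1 + norm v / \<delta>" using assms
    by (auto simp: u_def field_simps add_increasing2)
  have "real (shift_log \<delta> v) \<le> log 2 (1 + norm v / \<delta>) + 1"
  proof -
    have "0 \<le> log 2 (1 + norm v / \<delta>)" using u by simp
    then show ?thesis unfolding shift_log_def by linarith
  qed
  also have "\<dots> \<le> log 2 u + 1" using u by simp
  also have "log 2 u \<le> u powr \<epsilon> / (\<epsilon> * ln 2)"
    using ln_powr_bound[of u \<epsilon>] u assms by (simp add: log_def divide_simps) (simp add: mult.commute)?
  finally have "real (shift_log \<delta> v) + 4 \<le> u powr \<epsilon> / (\<epsilon> * ln 2) + 5" by simp
  also have "\<dots> \<le> u powr \<epsilon> / (\<epsilon> * ln 2) + 5 * u powr \<epsilon>"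
    using ge_one_powr_ge_zero[of u \<epsilon>] u(1) assms(3) by simp
  also have "\<dots> = (5 + 1 / (\<epsilon> * ln 2)) * u powr \<epsilon>" by (simp add: algebra_simps)
  also have "u powr \<epsilon> = \<delta> powr (- \<epsilon>) * (1 + norm v) powr \<epsilon>"
    using assms by (simp add: u_def powr_divide powr_minus_divide)
  finally show ?thesis .
qed

text \<open>With w = | |v| - 1 | + \<delta>, the power -(d + 1) / 2 of w splits as w^(-\<gamma>)
  w^(-\<sigma>), \<sigma> = 1 - \<epsilon>. The first factor is at most \<delta>^(-\<gamma>). The
  second is of order 2^(j \<sigma>) on a shell of width 2^(-j), whose volume is of order 2^(-j), so
  the sum is geometric with ratio 2^(-\<epsilon>) in every dimension, d = 1 included.\<close>

lemma majorant_near: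
  assumes "0 < \<gamma>" "0 < \<epsilon>" "\<epsilon> < 1" "\<gamma> = (real DIM('a) - 1) / 2 + \<epsilon>"
  shows "\<exists>C. \<forall>\<delta>. 0 < \<delta> \<longrightarrow> \<delta> \<le> 1 \<longrightarrow>
    (\<integral>\<^sup>+(v::'a::euclidean_space). ennreal ((\<bar>norm v - 1\<bar> + \<delta>) powr (- ((real DIM('a) + 1) / 2))) * indicator (cball 0 2) v \<partial>lborel)
      \<le> ennreal (C * \<delta> powr (- \<gamma>))"
proof -
  let ?a = "(real DIM('a) + 1) / 2"
  define \<sigma> where "\<sigma> = 1 - \<epsilon>"
  have a: "?a = \<gamma> + \<sigma>" using assms by (simp add: \<sigma>_def field_simps)
  define W where "W = 2 * unit_ball_vol DIM('a) * real DIM('a) * 3 ^ DIM('a)"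
  have "0 < W" by (simp add: W_def)
  define A where "A j = {v::'a. \<bar>norm v - 1\<bar> \<le> 2 * (1/2) ^ j}" for j :: nat
  define S where "S = (\<Sum>j. ennreal ((2 ^ j) powr \<sigma>) * emeasure lborel (A j))"
  have "S < \<top>" unfolding S_def
  proof (rule suminf_geometric_less_top)
    fix j :: nat
    have p: "(2 ^ j) powr \<sigma> * (1/2) ^ j = (2 powr (- \<epsilon>)) ^ j"
      by (simp add: \<sigma>_def powr_diff powr_realpow[symmetric] powr_powr powr_minus_divide power_one_over
          power_divide divide_simps) (simp add: mult.commute powr_powr)?
    have "ennreal ((2 ^ j) powr \<sigma>) * emeasure lborel (A j) \<le> ennreal ((2 ^ j) powr \<sigma>) * ennreal (W * (2 * (1/2) ^ j))"
      unfolding A_def W_def by (intro mult_left_mono emeasure_annulus) (auto simp: power_le_one)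
    also have "\<dots> = ennreal ((2 * W) * ((2 ^ j) powr \<sigma> * (1/2) ^ j))"
      using \<open>0 < W\<close> by (subst ennreal_mult[symmetric]) (auto simp: ac_simps)
    finally show "ennreal ((2 ^ j) powr \<sigma>) * emeasure lborel (A j) \<le> ennreal ((2 * W) * (2 powr (- \<epsilon>)) ^ j)"
      unfolding p .
  qed (use \<open>0 < W\<close> assms in \<open>auto simp: powr_minus_divide\<close>)
  then obtain C where C: "S = ennreal C" "0 \<le> C" by (auto simp: less_top_ennreal)
  have "(\<integral>\<^sup>+(v::'a). ennreal ((\<bar>norm v - 1\<bar> + \<delta>) powr (- ?a)) * indicator (cball 0 2) v \<partial>lborel)
      \<le> ennreal (C * \<delta> powr (- \<gamma>))" if \<delta>: "0 < \<delta>" "\<delta> \<le> 1" for \<delta>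
  proof -
    have "(\<integral>\<^sup>+(v::'a). ennreal ((\<bar>norm v - 1\<bar> + \<delta>) powr (- ?a)) * indicator (cball 0 2) v \<partial>lborel)
      \<le> (\<Sum>j. (ennreal (\<delta> powr (- \<gamma>)) * ennreal ((2 ^ j) powr \<sigma>)) * emeasure lborel (A j))"
    proof (rule nn_integral_le_suminf_cover)
      fix v :: 'a
      assume "ennreal ((\<bar>norm v - 1\<bar> + \<delta>) powr (- ?a)) * indicator (cball 0 2) v \<noteq> 0"
      then have v: "norm v \<le> 2" by (auto simp: indicator_def split: if_splits)
      define w where "w = \<bar>norm v - 1\<bar> + \<delta>"
      have w: "0 < w" "w \<le> 2" "\<delta> \<le> w"
        using v \<delta> norm_ge_zero[of v] unfolding w_def by linarith+
      \<comment> \<open>The shell is indexed by 2 / w rather than 1 / w because w may be as large as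
        2; it gives 2^(-j) < w \<le> 2^(1 - j).\<close>
      obtain j where j: "2 ^ j \<le> 2 / w" "2 / w < 2 ^ Suc j"
        using obtain_dyadic[of "2 / w"] w by (auto simp: field_simps)
      have "w \<le> 2 * (1/2) ^ j" using j(1) w by (simp add: field_simps power_one_over)
      then have "v \<in> A j" using \<delta> by (auto simp: A_def w_def)
      moreover have "w powr (- ?a) \<le> \<delta> powr (- \<gamma>) * (2 ^ j) powr \<sigma>"
      proof -
        have "w powr (- ?a) = w powr (- \<gamma>) * (1 / w) powr \<sigma>"
          unfolding a using w by (simp add: powr_diff powr_divide powr_minus_divide powr_add)
        also have "\<dots> \<le> \<delta> powr (- \<gamma>) * (2 ^ j) powr \<sigma>"
        proof (rule mult_mono)
          show "w powr (- \<gamma>) \<le> \<delta> powr (- \<gamma>)" using w \<delta> assms by (intro powr_mono2') auto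
          have "1 / w \<le> 2 ^ j" using j(2) w by (simp add: field_simps)
          then show "(1 / w) powr \<sigma> \<le> (2 ^ j) powr \<sigma>" using w assms by (intro powr_mono2) (auto simp: \<sigma>_def)
        qed auto
        finally show ?thesis .
      qed
      ultimately show "\<exists>j. v \<in> A j \<and> ennreal ((\<bar>norm v - 1\<bar> + \<delta>) powr (- ?a)) * indicator (cball 0 2) v
          \<le> ennreal (\<delta> powr (- \<gamma>)) * ennreal ((2 ^ j) powr \<sigma>)"
        by (intro exI[of _ j]) (auto simp: w_def indicator_def ennreal_leI simp flip: ennreal_mult)
    qed (auto simp: A_def)
    also have "\<dots> = ennreal (\<delta> powr (- \<gamma>)) * S"
      unfolding S_def by (simp add: mult.assoc)
    also have "\<dots> = ennreal (C * \<delta> powr (- \<gamma>))" using C by (simp add: mult.commute flip: ennreal_mult)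
    finally show ?thesis .
  qed
  then show ?thesis by blast
qed

text \<open>The excess \<eta> of \<beta> over (d - 1) / 2 pays for two losses of \<epsilon>: one
  near the sphere (\<open>majorant_near\<close>), one for the logarithm
  (\<open>shift_log_le\<close>). In the ball of radius 2 the factor 1 + |v| is bounded. Outside, |
  |v| - 1 | \<ge> (1 + |v|) / 3 gives decay of order d + 1, which leaves room for the factor (1 +
  |v|)^\<epsilon>.\<close>

lemma majorant_mass:
  assumes \<beta>: "(real DIM('a) - 1) / 2 < \<beta>"
  shows "\<exists>C>0. \<forall>\<delta>. 0 < \<delta> \<longrightarrow> \<delta> \<le> 1 \<longrightarrow>
    (\<integral>\<^sup>+(v::'a::euclidean_space). ennreal (majorant \<delta> v) * ennreal (real (shift_log \<delta> v) + 4) \<partial>lborel)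
      \<le> ennreal (C * \<delta> powr (- \<beta>))"
proof -
  let ?d = "real DIM('a)" and ?a = "(real DIM('a) + 1) / 2"
  define \<eta> where "\<eta> = \<beta> - (?d - 1) / 2"
  define \<epsilon> where "\<epsilon> = min (\<eta> / 2) (1 / 2)"
  have "0 < \<eta>" using \<beta> by (simp add: \<eta>_def)
  then have \<epsilon>: "0 < \<epsilon>" "\<epsilon> < 1" "2 * \<epsilon> \<le> \<eta>" by (auto simp: \<epsilon>_def min_def)
  define \<gamma> where "\<gamma> = (?d - 1) / 2 + \<epsilon>"
  have "1 \<le> ?d" using DIM_positive[where 'a='a] by linarith
  then have "0 \<le> (?d - 1) / 2" by simp
  then have \<gamma>: "0 < \<gamma>" "\<gamma> + \<epsilon> \<le> \<beta>"
    using \<epsilon> by (simp_all only: \<gamma>_def \<eta>_def)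
  obtain C1 where C1: "\<And>\<delta>. 0 < \<delta> \<Longrightarrow> \<delta> \<le> 1 \<Longrightarrow>
    (\<integral>\<^sup>+(v::'a). ennreal ((\<bar>norm v - 1\<bar> + \<delta>) powr (- ?a)) * indicator (cball 0 2) v \<partial>lborel)
      \<le> ennreal (C1 * \<delta> powr (- \<gamma>))"
    using majorant_near[where 'a='a, of \<gamma> \<epsilon>] \<gamma> \<epsilon> \<gamma>_def by blast
  obtain C2 where C2: "0 \<le> C2"
    "(\<integral>\<^sup>+(v::'a). ennreal ((1 + norm v) powr (- (?d + (1 - \<epsilon>)))) \<partial>lborel) = ennreal C2"
    using nn_integral_decay[where 'a='a, of "1 - \<epsilon>"] \<epsilon> by (auto simp: less_top_ennreal)
  define L where "L = 5 + 1 / (\<epsilon> * ln 2)"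
  have "0 < L" using \<epsilon> by (simp add: L_def add_pos_pos)
  \<comment> \<open>The estimate below is obtained with C - 1; the summand 1 secures C > 0.\<close>
  define C where "C = L * (3 * \<bar>C1\<bar> + 3 powr ?a * C2) + 1"
  have "0 < C" using \<open>0 < L\<close> C2 by (simp add: C_def add_nonneg_pos)
  have "(\<integral>\<^sup>+(v::'a). ennreal (majorant \<delta> v) * ennreal (real (shift_log \<delta> v) + 4) \<partial>lborel)
      \<le> ennreal (C * \<delta> powr (- \<beta>))" if \<delta>: "0 < \<delta>" "\<delta> \<le> 1" for \<delta>
  proof -
    have pt: "majorant \<delta> v * (real (shift_log \<delta> v) + 4) \<le> L * \<delta> powr (- \<epsilon>) *
        (3 * ((\<bar>norm v - 1\<bar> + \<delta>) powr (- ?a) * indicator (cball 0 2) v) +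
         3 powr ?a * (1 + norm v) powr (- (?d + (1 - \<epsilon>))))" for v :: 'a
    proof -
      have m: "majorant \<delta> v * (1 + norm v) powr \<epsilon> \<le>
        3 * ((\<bar>norm v - 1\<bar> + \<delta>) powr (- ?a) * indicator (cball 0 2) v) +
         3 powr ?a * (1 + norm v) powr (- (?d + (1 - \<epsilon>)))"
      proof (cases "norm v \<le> 2")
        case True
        have "majorant \<delta> v = (\<bar>norm v - 1\<bar> + \<delta>) powr (- ?a) * (1 + norm v) powr (- ?a)"
          using \<delta> by (simp add: majorant_def powr_mult)
        also have "\<dots> \<le> (\<bar>norm v - 1\<bar> + \<delta>) powr (- ?a) * 1"
          by (intro mult_left_mono) (auto simp: powr_minus_divide divide_le_eq_1 ge_one_powr_ge_zero)
        finally have "majorant \<delta> v \<le> (\<bar>norm v - 1\<bar> + \<delta>) powr (- ?a)" by simp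
        moreover have "(1 + norm v) powr \<epsilon> \<le> 3"
        proof -
          have "(1 + norm v) powr \<epsilon> \<le> (1 + norm v) powr 1" using \<epsilon> by (intro powr_mono) auto
          then show ?thesis using True by simp
        qed
        ultimately have "majorant \<delta> v * (1 + norm v) powr \<epsilon> \<le> (\<bar>norm v - 1\<bar> + \<delta>) powr (- ?a) * 3"
          by (intro mult_mono) auto
        then show ?thesis using True by (simp add: add_increasing2)
      next
        case False
        have "majorant \<delta> v \<le> ((1 + norm v) / 3 * (1 + norm v)) powr (- ?a)"
          unfolding majorant_def using False \<delta>
          by (intro powr_mono2' mult_right_mono) (auto simp: abs_if)
        also have "\<dots> = 3 powr ?a * ((1 + norm v) powr (- ?a) * (1 + norm v) powr (- ?a))"
          by (simp add: powr_mult powr_divide powr_minus_divide)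
        also have "(1 + norm v) powr (- ?a) * (1 + norm v) powr (- ?a) = (1 + norm v) powr (- (?d + 1))"
          by (simp add: powr_add[symmetric] add_divide_distrib)
        finally have "majorant \<delta> v * (1 + norm v) powr \<epsilon> \<le> 3 powr ?a * (1 + norm v) powr (- (?d + 1)) * (1 + norm v) powr \<epsilon>"
          by (intro mult_right_mono) auto
        also have "\<dots> = 3 powr ?a * (1 + norm v) powr (- (?d + (1 - \<epsilon>)))"
        proof -
          have "- (?d + 1) + \<epsilon> = - (?d + (1 - \<epsilon>))" by simp
          then show ?thesis by (simp only: mult.assoc powr_add[symmetric])
        qed
        finally show ?thesis using False by simp
      qed
      have "majorant \<delta> v * (real (shift_log \<delta> v) + 4) \<le> majorant \<delta> v * (L * (\<delta> powr (- \<epsilon>) * (1 + norm v) powr \<epsilon>))"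
        unfolding L_def using shift_log_le[OF \<delta> \<epsilon>(1)] majorant_pos[OF \<delta>(1), of v]
        by (intro mult_left_mono) auto
      also have "\<dots> = L * \<delta> powr (- \<epsilon>) * (majorant \<delta> v * (1 + norm v) powr \<epsilon>)" by (simp add: ac_simps)
      also have "\<dots> \<le> L * \<delta> powr (- \<epsilon>) * (3 * ((\<bar>norm v - 1\<bar> + \<delta>) powr (- ?a) * indicator (cball 0 2) v) +
         3 powr ?a * (1 + norm v) powr (- (?d + (1 - \<epsilon>))))"
        using m \<open>0 < L\<close> by (intro mult_left_mono) auto
      finally show ?thesis .
    qed
    have "(\<integral>\<^sup>+(v::'a). ennreal (majorant \<delta> v) * ennreal (real (shift_log \<delta> v) + 4) \<partial>lborel)
      \<le> (\<integral>\<^sup>+(v::'a). ennreal (L * \<delta> powr (- \<epsilon>)) *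
        (3 * (ennreal ((\<bar>norm v - 1\<bar> + \<delta>) powr (- ?a)) * indicator (cball 0 2) v) +
         ennreal (3 powr ?a) * ennreal ((1 + norm v) powr (- (?d + (1 - \<epsilon>))))) \<partial>lborel)"
    proof (rule nn_integral_mono)
      fix v :: 'a
      have "ennreal (majorant \<delta> v) * ennreal (real (shift_log \<delta> v) + 4) = ennreal (majorant \<delta> v * (real (shift_log \<delta> v) + 4))"
        using majorant_pos[OF \<delta>(1), of v] by (simp add: ennreal_mult)
      also have "\<dots> \<le> ennreal (L * \<delta> powr (- \<epsilon>) *
        (3 * ((\<bar>norm v - 1\<bar> + \<delta>) powr (- ?a) * indicator (cball 0 2) v) +
         3 powr ?a * (1 + norm v) powr (- (?d + (1 - \<epsilon>)))))"
        using pt by (rule ennreal_leI)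
      also have "\<dots> = ennreal (L * \<delta> powr (- \<epsilon>)) *
        (3 * (ennreal ((\<bar>norm v - 1\<bar> + \<delta>) powr (- ?a)) * indicator (cball 0 2) v) +
         ennreal (3 powr ?a) * ennreal ((1 + norm v) powr (- (?d + (1 - \<epsilon>)))))"
        using \<open>0 < L\<close> by (simp add: ennreal_mult ennreal_plus ennreal_indicator)
      finally show "ennreal (majorant \<delta> v) * ennreal (real (shift_log \<delta> v) + 4) \<le> \<dots>" .
    qed
    also have "\<dots> = ennreal (L * \<delta> powr (- \<epsilon>)) *
        (3 * (\<integral>\<^sup>+(v::'a). ennreal ((\<bar>norm v - 1\<bar> + \<delta>) powr (- ?a)) * indicator (cball 0 2) v \<partial>lborel) + ennreal (3 powr ?a) * ennreal C2)"
    proof -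
      have [measurable]: "cball (0::'a) 2 \<in> sets borel" by simp
      show ?thesis unfolding C2(2)[symmetric] by (simp add: nn_integral_cmult nn_integral_add)
    qed
    also have "\<dots> \<le> ennreal (L * \<delta> powr (- \<epsilon>)) * (3 * ennreal (\<bar>C1\<bar> * \<delta> powr (- \<gamma>)) + ennreal (3 powr ?a) * ennreal C2)"
      using C1[OF \<delta>] by (intro mult_left_mono add_mono order.trans[OF C1[OF \<delta>]] ennreal_leI mult_right_mono) auto
    also have "\<dots> = ennreal (L * \<delta> powr (- \<epsilon>) * (3 * (\<bar>C1\<bar> * \<delta> powr (- \<gamma>)) + 3 powr ?a * C2))"
      using \<open>0 < L\<close> C2(1) by (simp add: ennreal_mult ennreal_plus)
    also have "\<dots> \<le> ennreal (C * \<delta> powr (- \<beta>))"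
    proof (rule ennreal_leI)
      have "1 \<le> \<delta> powr (- \<gamma>)" using \<delta> \<gamma> by (simp add: powr_minus_divide powr_le1)
      then have "3 powr ?a * C2 * 1 \<le> 3 powr ?a * C2 * \<delta> powr (- \<gamma>)" using C2 by (intro mult_left_mono) auto
      then have "L * \<delta> powr (- \<epsilon>) * (3 * (\<bar>C1\<bar> * \<delta> powr (- \<gamma>)) + 3 powr ?a * C2)
          \<le> L * \<delta> powr (- \<epsilon>) * (3 * (\<bar>C1\<bar> * \<delta> powr (- \<gamma>)) + 3 powr ?a * C2 * \<delta> powr (- \<gamma>))"
        using \<open>0 < L\<close> by (intro mult_left_mono) auto
      also have "\<dots> = (C - 1) * (\<delta> powr (- \<epsilon>) * \<delta> powr (- \<gamma>))" by (simp add: C_def algebra_simps)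
      also have "\<delta> powr (- \<epsilon>) * \<delta> powr (- \<gamma>) = \<delta> powr (- (\<gamma> + \<epsilon>))"
        by (simp add: powr_add[symmetric] add.commute)
      also have "(C - 1) * \<delta> powr (- (\<gamma> + \<epsilon>)) \<le> C * \<delta> powr (- \<beta>)"
        using \<delta> \<gamma> \<open>0 < L\<close> \<open>0 < C\<close> C2 by (intro mult_mono powr_mono') (auto simp: C_def)
      finally show "L * \<delta> powr (- \<epsilon>) * (3 * (\<bar>C1\<bar> * \<delta> powr (- \<gamma>)) + 3 powr ?a * C2) \<le> C * \<delta> powr (- \<beta>)" .
    qed
    finally show ?thesis .
  qed
  then show ?thesis using \<open>0 < C\<close> by blast
qed

section \<open>Dilates of the majorant and their lacunary maximal function\<close>

definition dilated_majorant :: "real \<Rightarrow> real \<Rightarrow> 'a::euclidean_space \<Rightarrow> ennreal" where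
  "dilated_majorant \<delta> \<rho> x = ennreal (majorant \<delta> (x /\<^sub>R \<rho>) / \<rho> ^ DIM('a))"

lemma dilated_majorant_measurable [measurable]: "dilated_majorant \<delta> \<rho> \<in> borel_measurable borel"
  unfolding dilated_majorant_def[abs_def] by measurable

lemma dilated_majorant_minus: "dilated_majorant \<delta> \<rho> (- x) = dilated_majorant \<delta> \<rho> x"
  by (simp add: dilated_majorant_def majorant_minus)

lemma nn_integral_dilated_majorant:
  assumes "0 < \<rho>"
  shows "(\<integral>\<^sup>+(x::'a::euclidean_space). dilated_majorant \<delta> \<rho> x \<partial>lborel) = (\<integral>\<^sup>+(x::'a). ennreal (majorant \<delta> x) \<partial>lborel)"
proof -
  have "(\<integral>\<^sup>+(x::'a). dilated_majorant \<delta> \<rho> x \<partial>lborel)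
      = ennreal (\<bar>\<rho>\<bar> ^ DIM('a)) * (\<integral>\<^sup>+(x::'a). dilated_majorant \<delta> \<rho> (0 + \<rho> *\<^sub>R x) \<partial>lborel)"
    using assms by (intro nn_integral_lborel_affine) auto
  also have "\<dots> = (\<integral>\<^sup>+(x::'a). ennreal (\<rho> ^ DIM('a)) * dilated_majorant \<delta> \<rho> (\<rho> *\<^sub>R x) \<partial>lborel)"
    using assms by (simp add: nn_integral_cmult)
  also have "\<dots> = (\<integral>\<^sup>+(x::'a). ennreal (majorant \<delta> x) \<partial>lborel)"
    using assms by (intro nn_integral_cong)
      (simp add: dilated_majorant_def majorant_def flip: ennreal_mult)
  finally show ?thesis .
qed

text \<open>A move of length \<delta> changes both factors of the base by at most \<delta>, and both
  are at least \<delta>; so each is changed by a factor of at most 2, and 4^((d + 1) / 2) = 2^(d +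
  1).\<close>

lemma majorant_le_near:
  assumes "0 < \<delta>" "\<delta> \<le> 1" "norm (w - v) \<le> \<delta>"
  shows "majorant \<delta> (w::'a::euclidean_space) \<le> 2 ^ (DIM('a) + 1) * majorant \<delta> v"
proof -
  let ?a = "(real DIM('a) + 1) / 2"
  have n: "\<bar>norm v - norm w\<bar> \<le> \<delta>" using assms(3) norm_triangle_ineq3[of w v] by linarith
  define A B where "A = \<bar>norm w - 1\<bar> + \<delta>" and "B = 1 + norm w"
  define A' B' where "A' = \<bar>norm v - 1\<bar> + \<delta>" and "B' = 1 + norm v"
  have "A' \<le> A + \<delta>" "B' \<le> B + \<delta>" unfolding A_def B_def A'_def B'_def using n by auto
  moreover have "\<delta> \<le> A" "\<delta> \<le> B" "0 \<le> B'" unfolding A_def B_def B'_def using assms by (auto simp: add_increasing2)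
  ultimately have "A' \<le> 2 * A" "B' \<le> 2 * B" "0 \<le> B'" "0 \<le> A" using assms(1) by auto
  then have "A' * B' \<le> (2 * A) * (2 * B)" by (intro mult_mono) auto
  then have "A' * B' / 4 \<le> A * B" by simp
  then have "((\<bar>norm w - 1\<bar> + \<delta>) * (1 + norm w)) \<ge> ((\<bar>norm v - 1\<bar> + \<delta>) * (1 + norm v)) / 4"
    by (simp only: A_def B_def A'_def B'_def)
  moreover have "0 < ((\<bar>norm v - 1\<bar> + \<delta>) * (1 + norm v)) / 4"
    using assms(1) by (intro divide_pos_pos mult_pos_pos add_nonneg_pos add_pos_nonneg) auto
  ultimately have "majorant \<delta> w \<le> (((\<bar>norm v - 1\<bar> + \<delta>) * (1 + norm v)) / 4) powr (- ?a)"
    unfolding majorant_def by (intro powr_mono2'; (assumption | simp))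
  also have "\<dots> = 4 powr ?a * majorant \<delta> v"
    unfolding majorant_def by (subst powr_divide) (auto simp: powr_minus_divide)
  also have "4 powr ?a = 2 ^ (DIM('a) + 1)"
  proof -
    have "4 powr ?a = (2 powr 2) powr ?a" by simp
    also have "\<dots> = 2 powr real (DIM('a) + 1)"
    proof -
      have "2 * ?a = real (DIM('a) + 1)" by simp
      then show ?thesis by (simp only: powr_powr)
    qed
    finally show ?thesis by (simp only: powr_realpow)
  qed
  finally show ?thesis .
qed

text \<open>By \<open>majorant_le_near\<close> the majorant is at most 2^(d + 1) times its own
  average over balls of radius \<delta>. After dilation by \<rho> and an exchange of integrals this
  averaging falls on g, with displacement \<open>\<rho> *\<^sub>R v\<close>.\<close>

lemma conv_dilated_majorant_le:
  fixes g :: "'a::euclidean_space \<Rightarrow> ennreal"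
  assumes [measurable]: "g \<in> borel_measurable borel" and \<delta>: "0 < \<delta>" "\<delta> \<le> 1" and \<rho>: "0 < \<rho>"
  shows "conv (dilated_majorant \<delta> \<rho>) g x \<le>
    ennreal (2 ^ (DIM('a) + 1)) * (\<integral>\<^sup>+v. ennreal (majorant \<delta> v) * bavg (\<rho> *\<^sub>R v) (\<rho> * \<delta>) g x \<partial>lborel)"
proof -
  define V where "V = emeasure lborel (cball (0::'a) (\<rho> * \<delta>))"
  define V0 where "V0 = emeasure lborel (cball (0::'a) \<delta>)"
  have V: "V \<noteq> 0" "V \<noteq> \<top>" "V0 \<noteq> 0" "V0 \<noteq> \<top>"
    unfolding V_def V0_def using \<delta> \<rho> by (intro emeasure_cball_pos_finite; simp)+
  have VV0: "V = ennreal (\<rho> ^ DIM('a)) * V0"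
    using \<delta> \<rho> by (simp add: V_def V0_def emeasure_cball power_mult_distrib mult.left_commute flip: ennreal_mult)
  have [measurable]: "{z::'a. norm z \<le> c} \<in> sets borel" for c by measurable
  have ind: "indicator (cball (x - \<rho> *\<^sub>R v) (\<rho> * \<delta>)) y = (indicator {z. norm z \<le> \<delta>} ((x - y) /\<^sub>R \<rho> - v) :: ennreal)" for v y
  proof -
    have "norm ((x - y) /\<^sub>R \<rho> - v) * \<rho> = norm (x - \<rho> *\<^sub>R v - y)"
    proof -
      have "norm ((x - y) /\<^sub>R \<rho> - v) * \<rho> = norm (\<rho> *\<^sub>R ((x - y) /\<^sub>R \<rho> - v))" using \<rho> by simp
      also have "\<rho> *\<^sub>R ((x - y) /\<^sub>R \<rho> - v) = x - \<rho> *\<^sub>R v - y" using \<rho> by (simp add: scaleR_diff_right)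
      finally show ?thesis .
    qed
    then have "norm (x - \<rho> *\<^sub>R v - y) \<le> \<rho> * \<delta> \<longleftrightarrow> norm ((x - y) /\<^sub>R \<rho> - v) \<le> \<delta>"
      using \<rho> by (metis mult.commute mult_le_cancel_left_pos)
    then show ?thesis by (auto simp: indicator_def dist_norm)
  qed
  define I where "I y = (\<integral>\<^sup>+v. ennreal (majorant \<delta> v) * indicator {z. norm z \<le> \<delta>} ((x - y) /\<^sub>R \<rho> - v) \<partial>lborel)" for y
  have [measurable]: "I \<in> borel_measurable borel" unfolding I_def[abs_def]
    by (rule lborel.borel_measurable_nn_integral) measurable
  \<comment> \<open>The inequality is multiplied by the volume V instead of being divided by it; V
    is finite and positive and is cancelled at the very end.\<close>
  have I: "V * dilated_majorant \<delta> \<rho> (x - y) \<le> ennreal (2 ^ (DIM('a) + 1)) * I y" for y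
  proof -
    define w where "w = (x - y) /\<^sub>R \<rho>"
    have "V * dilated_majorant \<delta> \<rho> (x - y) = ennreal (majorant \<delta> w) * V0"
    proof -
      have "ennreal (\<rho> ^ DIM('a)) * ennreal (majorant \<delta> w / \<rho> ^ DIM('a)) = ennreal (majorant \<delta> w)"
        using \<rho> majorant_pos[OF \<delta>(1), of w] by (simp flip: ennreal_mult)
      then show ?thesis unfolding VV0 dilated_majorant_def w_def by (simp add: ac_simps)
    qed
    also have "V0 = emeasure lborel (cball w \<delta>)" using \<delta> by (simp add: V0_def emeasure_cball)
    also have "ennreal (majorant \<delta> w) * \<dots> = (\<integral>\<^sup>+v. ennreal (majorant \<delta> w) * indicator (cball w \<delta>) v \<partial>lborel)"
      by (subst nn_integral_cmult_indicator) auto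
    also have "\<dots> \<le> (\<integral>\<^sup>+v. ennreal (2 ^ (DIM('a) + 1)) * (ennreal (majorant \<delta> v) * indicator {z. norm z \<le> \<delta>} (w - v)) \<partial>lborel)"
    proof (rule nn_integral_mono)
      fix v :: 'a
      show "ennreal (majorant \<delta> w) * indicator (cball w \<delta>) v \<le>
        ennreal (2 ^ (DIM('a) + 1)) * (ennreal (majorant \<delta> v) * indicator {z. norm z \<le> \<delta>} (w - v))"
      proof (cases "norm (w - v) \<le> \<delta>")
        case True
        have "ennreal (majorant \<delta> w) \<le> ennreal (2 ^ (DIM('a) + 1) * majorant \<delta> v)"
          using majorant_le_near[OF \<delta> True] by (rule ennreal_leI)
        also have "\<dots> = ennreal (2 ^ (DIM('a) + 1)) * ennreal (majorant \<delta> v)"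
          using majorant_pos[OF \<delta>(1), of v] by (intro ennreal_mult) auto
        finally show ?thesis using True by (simp add: dist_norm)
      qed (simp add: dist_norm)
    qed
    also have "\<dots> = ennreal (2 ^ (DIM('a) + 1)) * I y"
      unfolding I_def w_def by (rule nn_integral_cmult) measurable
    finally show ?thesis .
  qed
  have "V * conv (dilated_majorant \<delta> \<rho>) g x = (\<integral>\<^sup>+y. V * dilated_majorant \<delta> \<rho> (x - y) * g y \<partial>lborel)"
    unfolding conv_def mult.assoc by (rule nn_integral_cmult[symmetric]) measurable
  also have "\<dots> \<le> (\<integral>\<^sup>+y. ennreal (2 ^ (DIM('a) + 1)) * (I y * g y) \<partial>lborel)"
    using I by (intro nn_integral_mono) (metis mult.assoc mult_right_mono zero_le)
  also have "\<dots> = ennreal (2 ^ (DIM('a) + 1)) * (\<integral>\<^sup>+y. I y * g y \<partial>lborel)"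
    by (rule nn_integral_cmult) measurable
  also have "(\<integral>\<^sup>+y. I y * g y \<partial>lborel) = (\<integral>\<^sup>+y. \<integral>\<^sup>+v. ennreal (majorant \<delta> v) * indicator {z. norm z \<le> \<delta>} ((x - y) /\<^sub>R \<rho> - v) * g y \<partial>lborel \<partial>lborel)"
    unfolding I_def by (intro nn_integral_cong nn_integral_multc[symmetric]) measurable
  also have "\<dots> = (\<integral>\<^sup>+v. \<integral>\<^sup>+y. ennreal (majorant \<delta> v) * indicator {z. norm z \<le> \<delta>} ((x - y) /\<^sub>R \<rho> - v) * g y \<partial>lborel \<partial>lborel)"
    by (rule lborel_pair.Fubini') measurable
  also have "\<dots> = (\<integral>\<^sup>+v. V * (ennreal (majorant \<delta> v) * bavg (\<rho> *\<^sub>R v) (\<rho> * \<delta>) g x) \<partial>lborel)"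
  proof (rule nn_integral_cong)
    fix v :: 'a
    define J where "J = (\<integral>\<^sup>+y. g y * indicator (cball (x - \<rho> *\<^sub>R v) (\<rho> * \<delta>)) y \<partial>lborel)"
    have [measurable]: "cball (x - \<rho> *\<^sub>R v) (\<rho> * \<delta>) \<in> sets borel" by simp
    have "(\<integral>\<^sup>+y. ennreal (majorant \<delta> v) * indicator {z. norm z \<le> \<delta>} ((x - y) /\<^sub>R \<rho> - v) * g y \<partial>lborel)
        = (\<integral>\<^sup>+y. ennreal (majorant \<delta> v) * (g y * indicator (cball (x - \<rho> *\<^sub>R v) (\<rho> * \<delta>)) y) \<partial>lborel)"
      unfolding ind by (simp add: ac_simps)
    also have "\<dots> = ennreal (majorant \<delta> v) * J" unfolding J_def by (rule nn_integral_cmult) simp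
    also have "J = V * (J / V)" using V(1,2) by (simp add: ennreal_times_divide ennreal_mult_divide_eq mult.commute)
    also have "J / V = bavg (\<rho> *\<^sub>R v) (\<rho> * \<delta>) g x" by (simp add: J_def V_def bavg_def)
    finally show "(\<integral>\<^sup>+y. ennreal (majorant \<delta> v) * indicator {z. norm z \<le> \<delta>} ((x - y) /\<^sub>R \<rho> - v) * g y \<partial>lborel)
      = V * (ennreal (majorant \<delta> v) * bavg (\<rho> *\<^sub>R v) (\<rho> * \<delta>) g x)" by (simp add: ac_simps)
  qed
  also have "\<dots> = V * (\<integral>\<^sup>+v. ennreal (majorant \<delta> v) * bavg (\<rho> *\<^sub>R v) (\<rho> * \<delta>) g x \<partial>lborel)"
  proof (rule nn_integral_cmult)
    have "(\<lambda>v. (v, x)) \<in> borel \<rightarrow>\<^sub>M borel \<Otimes>\<^sub>M borel" by measurable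
    from measurable_compose[OF this bavg_measurable2[OF assms(1)]]
    have [measurable]: "(\<lambda>v. bavg (\<rho> *\<^sub>R v) (\<rho> * \<delta>) g x) \<in> borel_measurable borel" by simp
    show "(\<lambda>v. ennreal (majorant \<delta> v) * bavg (\<rho> *\<^sub>R v) (\<rho> * \<delta>) g x) \<in> borel_measurable lborel" by measurable
  qed
  finally have "V * conv (dilated_majorant \<delta> \<rho>) g x \<le> V * (ennreal (2 ^ (DIM('a) + 1)) *
      (\<integral>\<^sup>+v. ennreal (majorant \<delta> v) * bavg (\<rho> *\<^sub>R v) (\<rho> * \<delta>) g x \<partial>lborel))"
    by (simp add: ac_simps)
  then show ?thesis using V by (subst (asm) ennreal_mult_le_mult_iff) auto
qed

text \<open>Jensen with the weight m bounds the q-th power of the m-average over the shifts and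
  costs M^(q - 1). The strong type bound for each shift v contributes
  \<open>shift_log \<delta> v + 4\<close>, whose integral against m is again at most M: this is why
  \<open>majorant_mass\<close> includes the logarithm. Together they give M^q, and hence the first
  power of M for the norm.\<close>

theorem maximal_bound:
  assumes \<beta>: "(real DIM('a) - 1) / 2 < \<beta>" and q: "1 < q"
  shows "\<exists>C>0. \<forall>\<delta> s R. 0 < \<delta> \<longrightarrow> \<delta> \<le> 1 \<longrightarrow> 0 < s \<longrightarrow> finite R \<longrightarrow> (\<forall>\<rho>\<in>R. \<exists>k::int. \<rho> = s * 2 powi k) \<longrightarrow>
    (\<forall>g::'a::euclidean_space \<Rightarrow> ennreal. g \<in> borel_measurable borel \<longrightarrow>
      (\<integral>\<^sup>+x. epow (SUP \<rho>\<in>R. conv (dilated_majorant \<delta> \<rho>) g x) q \<partial>lborel)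
        \<le> epow (ennreal (C * \<delta> powr (- \<beta>))) q * (\<integral>\<^sup>+x. epow (g x) q \<partial>lborel))"
proof -
  obtain C0 where C0: "0 < C0" "\<And>\<delta>. 0 < \<delta> \<Longrightarrow> \<delta> \<le> 1 \<Longrightarrow>
    (\<integral>\<^sup>+(v::'a). ennreal (majorant \<delta> v) * ennreal (real (shift_log \<delta> v) + 4) \<partial>lborel) \<le> ennreal (C0 * \<delta> powr (- \<beta>))"
    using majorant_mass[OF \<beta>] by blast
  define Q where "Q = 2 powr q * q / (q - 1) * 6 ^ DIM('a)"
  define D where "D = (2::real) ^ (DIM('a) + 1)"
  define C where "C = D * C0 * Q powr (1 / q)"
  have pos: "0 < Q" "0 < D" using q by (auto simp: Q_def D_def)
  then have "0 < C" using C0 by (simp add: C_def)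
  moreover have "(\<integral>\<^sup>+x. epow (SUP \<rho>\<in>R. conv (dilated_majorant \<delta> \<rho>) g x) q \<partial>lborel)
        \<le> epow (ennreal (C * \<delta> powr (- \<beta>))) q * (\<integral>\<^sup>+x. epow (g x) q \<partial>lborel)"
    if \<delta>: "0 < \<delta>" "\<delta> \<le> 1" and s: "0 < s" and R: "finite R" "\<forall>\<rho>\<in>R. \<exists>k::int. \<rho> = s * 2 powi k"
      and g[measurable]: "g \<in> borel_measurable borel" for \<delta> s R and g :: "'a \<Rightarrow> ennreal"
  proof -
    define m where "m v = ennreal (majorant \<delta> v)" for v :: 'a
    define M where "M = ennreal (C0 * \<delta> powr (- \<beta>))"
    have [measurable]: "m \<in> borel_measurable borel" unfolding m_def[abs_def] by measurable
    have m1: "(\<integral>\<^sup>+v. m v \<partial>lborel) \<le> M"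
    proof -
      have "m v \<le> m v * ennreal (real (shift_log \<delta> v) + 4)" for v
      proof -
        have "m v * ennreal 1 \<le> m v * ennreal (real (shift_log \<delta> v) + 4)"
          by (intro mult_left_mono ennreal_leI) auto
        then show ?thesis by (simp only: ennreal_1 mult_1_right)
      qed
      then have "(\<integral>\<^sup>+v. m v \<partial>lborel) \<le> (\<integral>\<^sup>+v. m v * ennreal (real (shift_log \<delta> v) + 4) \<partial>lborel)"
        by (intro nn_integral_mono)
      also have "\<dots> \<le> M" unfolding m_def M_def by (rule C0(2)[OF \<delta>])
      finally show ?thesis .
    qed
    have Rpos: "0 < \<rho>" if "\<rho> \<in> R" for \<rho> using R(2) that s by auto
    note sm2[measurable] = smax_measurable2[OF g R(1), where \<delta> = \<delta>]
    have [measurable]: "(\<lambda>v. smax R v \<delta> g x) \<in> borel_measurable borel" for x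
    proof -
      have "(\<lambda>v. (v, x)) \<in> borel \<rightarrow>\<^sub>M borel \<Otimes>\<^sub>M borel" by measurable
      from measurable_compose[OF this sm2] show ?thesis by simp
    qed
    have [measurable]: "(\<lambda>x. smax R v \<delta> g x) \<in> borel_measurable borel" for v
      using smax_measurable[OF g R(1)] by simp
    have I: "(\<integral>\<^sup>+x. \<integral>\<^sup>+v. m v * epow (smax R v \<delta> g x) q \<partial>lborel \<partial>lborel)
        \<le> ennreal Q * (\<integral>\<^sup>+x. epow (g x) q \<partial>lborel) * M"
    proof -
      have "(\<integral>\<^sup>+x. \<integral>\<^sup>+v. m v * epow (smax R v \<delta> g x) q \<partial>lborel \<partial>lborel)
          = (\<integral>\<^sup>+v. \<integral>\<^sup>+x. m v * epow (smax R v \<delta> g x) q \<partial>lborel \<partial>lborel)"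
      proof (rule lborel_pair.Fubini')
        have "(\<lambda>z. (fst z, snd z)) \<in> (lborel \<Otimes>\<^sub>M lborel) \<rightarrow>\<^sub>M ((borel :: 'a measure) \<Otimes>\<^sub>M (borel :: 'a measure))" by measurable
        from measurable_compose[OF this sm2]
        have [measurable]: "(\<lambda>z. smax R (fst z) \<delta> g (snd z)) \<in> borel_measurable (lborel \<Otimes>\<^sub>M lborel)" by simp
        have "(\<lambda>z. m (fst z) * epow (smax R (fst z) \<delta> g (snd z)) q) \<in> borel_measurable (lborel \<Otimes>\<^sub>M lborel)" by measurable
        then show "(\<lambda>(v, x). m v * epow (smax R v \<delta> g x) q) \<in> borel_measurable (lborel \<Otimes>\<^sub>M lborel)"
          by (simp add: case_prod_beta')
      qed
      also have "\<dots> \<le> (\<integral>\<^sup>+v. (ennreal Q * (\<integral>\<^sup>+x. epow (g x) q \<partial>lborel)) * (m v * ennreal (real (shift_log \<delta> v) + 4)) \<partial>lborel)"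
      proof (rule nn_integral_mono)
        fix v :: 'a
        have "(\<integral>\<^sup>+x. m v * epow (smax R v \<delta> g x) q \<partial>lborel) = m v * (\<integral>\<^sup>+x. epow (smax R v \<delta> g x) q \<partial>lborel)"
          by (rule nn_integral_cmult) measurable
        also have "\<dots> \<le> m v * (ennreal Q * ennreal (real (shift_log \<delta> v) + 4) * (\<integral>\<^sup>+x. epow (g x) q \<partial>lborel))"
          unfolding Q_def using R s \<delta> q shift_log_bound[OF \<delta>(1)]
          by (intro mult_left_mono smax_strong_type[where s = s]) auto
        finally show "(\<integral>\<^sup>+x. m v * epow (smax R v \<delta> g x) q \<partial>lborel)
          \<le> (ennreal Q * (\<integral>\<^sup>+x. epow (g x) q \<partial>lborel)) * (m v * ennreal (real (shift_log \<delta> v) + 4))"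
          by (simp add: ac_simps)
      qed
      also have "\<dots> = (ennreal Q * (\<integral>\<^sup>+x. epow (g x) q \<partial>lborel)) * (\<integral>\<^sup>+v. m v * ennreal (real (shift_log \<delta> v) + 4) \<partial>lborel)"
        by (rule nn_integral_cmult) measurable
      also have "\<dots> \<le> (ennreal Q * (\<integral>\<^sup>+x. epow (g x) q \<partial>lborel)) * M"
        unfolding m_def M_def using C0(2)[OF \<delta>] by (rule mult_left_mono) simp
  finally show ?thesis .
    qed
    have "(SUP \<rho>\<in>R. conv (dilated_majorant \<delta> \<rho>) g x) \<le> ennreal D * (\<integral>\<^sup>+v. m v * smax R v \<delta> g x \<partial>lborel)" for x
    proof (rule SUP_least)
      fix \<rho> assume "\<rho> \<in> R"
      then have "conv (dilated_majorant \<delta> \<rho>) g x \<le>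
          ennreal D * (\<integral>\<^sup>+v. m v * bavg (\<rho> *\<^sub>R v) (\<rho> * \<delta>) g x \<partial>lborel)"
        unfolding D_def m_def using \<delta> Rpos by (intro conv_dilated_majorant_le) auto
      also have "\<dots> \<le> ennreal D * (\<integral>\<^sup>+v. m v * smax R v \<delta> g x \<partial>lborel)"
        unfolding smax_def using \<open>\<rho> \<in> R\<close> by (intro mult_left_mono nn_integral_mono SUP_upper) auto
      finally show "conv (dilated_majorant \<delta> \<rho>) g x \<le> \<dots>" .
    qed
    then have "(\<integral>\<^sup>+x. epow (SUP \<rho>\<in>R. conv (dilated_majorant \<delta> \<rho>) g x) q \<partial>lborel)
        \<le> (\<integral>\<^sup>+x. epow (ennreal D * (\<integral>\<^sup>+v. m v * smax R v \<delta> g x \<partial>lborel)) q \<partial>lborel)"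
      using q by (intro nn_integral_mono epow_mono) auto
    also have "\<dots> \<le> (\<integral>\<^sup>+x. epow (ennreal D) q * ((\<integral>\<^sup>+v. m v * epow (smax R v \<delta> g x) q \<partial>lborel) * epow M (q - 1)) \<partial>lborel)"
    proof (rule nn_integral_mono)
      fix x
      have "epow (\<integral>\<^sup>+v. m v * smax R v \<delta> g x \<partial>lborel) q
          \<le> (\<integral>\<^sup>+v. m v * epow (smax R v \<delta> g x) q \<partial>lborel) * epow (\<integral>\<^sup>+v. m v \<partial>lborel) (q - 1)"
        using q by (intro nn_integral_product_power) auto
      also have "\<dots> \<le> (\<integral>\<^sup>+v. m v * epow (smax R v \<delta> g x) q \<partial>lborel) * epow M (q - 1)"
        using m1 q by (intro mult_left_mono epow_mono) auto
      finally show "epow (ennreal D * (\<integral>\<^sup>+v. m v * smax R v \<delta> g x \<partial>lborel)) q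
          \<le> epow (ennreal D) q * ((\<integral>\<^sup>+v. m v * epow (smax R v \<delta> g x) q \<partial>lborel) * epow M (q - 1))"
        using q by (subst epow_mult) (auto intro!: mult_left_mono)
    qed
    also have "\<dots> = epow (ennreal D) q * (epow M (q - 1) * (\<integral>\<^sup>+x. \<integral>\<^sup>+v. m v * epow (smax R v \<delta> g x) q \<partial>lborel \<partial>lborel))"
    proof -
      have pm: "(\<lambda>z. m (snd z) * epow (smax R (snd z) \<delta> g (fst z)) q) \<in> borel_measurable (lborel \<Otimes>\<^sub>M lborel)"
      proof -
        have "(\<lambda>z. (snd z, fst z)) \<in> (lborel \<Otimes>\<^sub>M lborel) \<rightarrow>\<^sub>M ((borel :: 'a measure) \<Otimes>\<^sub>M (borel :: 'a measure))" by measurable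
        from measurable_compose[OF this sm2]
        have [measurable]: "(\<lambda>z. smax R (snd z) \<delta> g (fst z)) \<in> borel_measurable (lborel \<Otimes>\<^sub>M lborel)" by simp
        show ?thesis by measurable
      qed
      then have "(\<lambda>x. \<integral>\<^sup>+v. m v * epow (smax R v \<delta> g x) q \<partial>lborel) \<in> borel_measurable lborel"
        by (intro lborel.borel_measurable_nn_integral) (simp add: case_prod_beta')
      then show ?thesis by (simp add: nn_integral_cmult nn_integral_multc mult.commute)
    qed
    also have "\<dots> \<le> epow (ennreal D) q * (epow M (q - 1) * (ennreal Q * (\<integral>\<^sup>+x. epow (g x) q \<partial>lborel) * M))"
      by (intro mult_left_mono I) auto
    also have "\<dots> = (epow (ennreal D) q * (M * epow M (q - 1)) * ennreal Q) * (\<integral>\<^sup>+x. epow (g x) q \<partial>lborel)"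
      by (simp only: ac_simps)
    also have "M * epow M (q - 1) = epow M q" using epow_add[of M 1 "q - 1"] by simp
    also have "ennreal Q = epow (ennreal (Q powr (1 / q))) q" using pos q by (simp add: epow_ennreal powr_powr)
    also have "epow (ennreal D) q * epow M q * epow (ennreal (Q powr (1 / q))) q
        = epow (ennreal D * M * ennreal (Q powr (1 / q))) q" using q by (simp add: epow_mult)
    also have "ennreal D * M * ennreal (Q powr (1 / q)) = ennreal (C * \<delta> powr (- \<beta>))"
      unfolding M_def C_def using pos C0(1) by (simp add: ac_simps flip: ennreal_mult)
    finally show ?thesis .
  qed
  ultimately show ?thesis by blast
qed

lemma dilated_majorant_mass:
  assumes \<beta>: "(real DIM('a) - 1) / 2 < \<beta>"
  shows "\<exists>C>0. \<forall>\<delta> \<rho>. 0 < \<delta> \<longrightarrow> \<delta> \<le> 1 \<longrightarrow> 0 < \<rho> \<longrightarrow>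
    (\<integral>\<^sup>+(x::'a::euclidean_space). dilated_majorant \<delta> \<rho> x \<partial>lborel) \<le> ennreal (C * \<delta> powr (- \<beta>))"
proof -
  obtain C0 where C0: "0 < C0" "\<And>\<delta>. 0 < \<delta> \<Longrightarrow> \<delta> \<le> 1 \<Longrightarrow>
    (\<integral>\<^sup>+(v::'a). ennreal (majorant \<delta> v) * ennreal (real (shift_log \<delta> v) + 4) \<partial>lborel) \<le> ennreal (C0 * \<delta> powr (- \<beta>))"
    using majorant_mass[OF \<beta>] by blast
  have "(\<integral>\<^sup>+(x::'a). dilated_majorant \<delta> \<rho> x \<partial>lborel) \<le> ennreal (C0 * \<delta> powr (- \<beta>))"
    if "0 < \<delta>" "\<delta> \<le> 1" "0 < \<rho>" for \<delta> \<rho>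
  proof -
    have "ennreal (majorant \<delta> v) \<le> ennreal (majorant \<delta> v) * ennreal (real (shift_log \<delta> v) + 4)" for v :: 'a
    proof -
      have "ennreal (majorant \<delta> v) * ennreal 1 \<le> ennreal (majorant \<delta> v) * ennreal (real (shift_log \<delta> v) + 4)"
        by (intro mult_left_mono ennreal_leI) auto
      then show ?thesis by (simp only: ennreal_1 mult_1_right)
    qed
    then have "(\<integral>\<^sup>+(v::'a). ennreal (majorant \<delta> v) \<partial>lborel)
        \<le> (\<integral>\<^sup>+(v::'a). ennreal (majorant \<delta> v) * ennreal (real (shift_log \<delta> v) + 4) \<partial>lborel)"
      by (intro nn_integral_mono)
    also have "\<dots> \<le> ennreal (C0 * \<delta> powr (- \<beta>))" by (rule C0(2)[OF that(1,2)])
    finally show ?thesis unfolding nn_integral_dilated_majorant[OF that(3)] .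
  qed
  with C0(1) show ?thesis by blast
qed

section \<open>Gaussian norms and square functions\<close>

abbreviation gauss_space :: "nat \<Rightarrow> (nat \<Rightarrow> real) measure" where
  "gauss_space n \<equiv> (\<Pi>\<^sub>M k\<in>{..<n}. std_gaussian)"

lemma sets_std_gaussian [measurable_cong, simp]: "sets std_gaussian = sets borel"
  by (simp add: std_gaussian_def)

lemma space_std_gaussian [simp]: "space std_gaussian = UNIV"
  by (simp add: std_gaussian_def)

lemma prob_space_std_gaussian: "prob_space std_gaussian"
  unfolding std_gaussian_def by (rule prob_space_normal_density) simp

lemma prob_space_gauss_space: "prob_space (gauss_space n)"
  by (intro prob_space_PiM prob_space_std_gaussian)

definition gauss_moment :: "real \<Rightarrow> ennreal" where
  "gauss_moment r = (\<integral>\<^sup>+t. epow (ennreal \<bar>t\<bar>) r \<partial>std_gaussian)"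

lemma gauss_moment_finite: "0 < r \<Longrightarrow> gauss_moment r < \<top>"
proof -
  assume r: "0 < r"
  define m where "m = nat \<lceil>r\<rceil>"
  interpret prob_space std_gaussian by (rule prob_space_std_gaussian)
  have "gauss_moment r \<le> (\<integral>\<^sup>+t. 1 + ennreal (\<bar>t\<bar> ^ m) \<partial>std_gaussian)"
    unfolding gauss_moment_def
  proof (rule nn_integral_mono)
    fix t :: real
    have "\<bar>t\<bar> powr r \<le> 1 + \<bar>t\<bar> ^ m"
    proof (cases "\<bar>t\<bar> \<le> 1")
      case True
      then have "\<bar>t\<bar> powr r \<le> 1" using r by (intro powr_le1) auto
      moreover have "0 \<le> \<bar>t\<bar> ^ m" by simp
      ultimately show ?thesis by linarith
    next
      case False
      have "\<bar>t\<bar> powr r \<le> \<bar>t\<bar> powr real m" using False unfolding m_def by (intro powr_mono) linarith+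
      then show ?thesis using False by (simp add: powr_realpow)
    qed
    then show "epow (ennreal \<bar>t\<bar>) r \<le> 1 + ennreal (\<bar>t\<bar> ^ m)"
      by (simp add: epow_ennreal ennreal_leI flip: ennreal_1 ennreal_plus)
  qed
  also have "\<dots> = 1 + (\<integral>\<^sup>+t. ennreal (\<bar>t\<bar> ^ m) \<partial>std_gaussian)"
    using emeasure_space_1 by (subst nn_integral_add) auto
  also have "(\<integral>\<^sup>+t. ennreal (\<bar>t\<bar> ^ m) \<partial>std_gaussian) = (\<integral>\<^sup>+t. ennreal (std_normal_density t * \<bar>t\<bar> ^ m) \<partial>lborel)"
    unfolding std_gaussian_def by (subst nn_integral_density) (auto simp: ennreal_mult)
  also have "1 + \<dots> < \<top>"
    using integrable_std_normal_moment_abs[of m] by (auto simp: real_integrable_def less_top)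
  finally show ?thesis .
qed

lemma gauss_moment_pos: "gauss_moment r \<noteq> 0"
proof
  assume "gauss_moment r = 0"
  then have "AE t in std_gaussian. epow (ennreal \<bar>t\<bar>) r = 0"
    unfolding gauss_moment_def by (subst (asm) nn_integral_0_iff_AE) auto
  then have "AE t in lborel. t = (0::real)"
    unfolding std_gaussian_def by (subst (asm) AE_density) (auto simp: normal_density_pos)
  moreover have "AE t in lborel. t \<noteq> (0::real)" by (rule AE_lborel_singleton)
  ultimately have "AE t in lborel. False \<and> t = (0::real)" by eventually_elim auto
  then have "AE t in (lborel :: real measure). False" by eventually_elim auto
  then show False by (subst (asm) AE_iff_measurable[of UNIV]) auto
qed

text \<open>Independent normal variables add up to a normal variable with added variances. Indices
  with \<open>a k = 0\<close> are removed beforehand, because a normal variable of variance 0 has no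
  density.\<close>

lemma distributed_gauss_sum:
  fixes a :: "nat \<Rightarrow> real"
  assumes "0 < (\<Sum>k<n. (a k)\<^sup>2)"
  shows "distributed (gauss_space n) lborel (\<lambda>\<gamma>. (\<Sum>k<n. \<gamma> k * a k) / sqrt (\<Sum>k<n. (a k)\<^sup>2)) std_normal_density"
proof -
  define I where "I = {k. k < n \<and> a k \<noteq> 0}"
  have "finite I" "I \<subseteq> {..<n}" by (auto simp: I_def)
  have "I \<noteq> {}"
  proof
    assume "I = {}"
    then have "(\<Sum>k<n. (a k)\<^sup>2) = 0" by (intro sum.neutral) (auto simp: I_def)
    then show False using assms by simp
  qed
  then have "{..<n} \<noteq> {}" using \<open>I \<subseteq> _\<close> by blast
  interpret prob_space "gauss_space n" by (rule prob_space_gauss_space)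
  have comp: "distr (gauss_space n) borel (\<lambda>\<gamma>. \<gamma> k) = std_gaussian" if "k < n" for k
  proof -
    have "distr (gauss_space n) std_gaussian (\<lambda>\<gamma>. \<gamma> k) = std_gaussian"
      using that by (intro distr_PiM_component prob_space_std_gaussian) auto
    moreover have "distr (gauss_space n) std_gaussian (\<lambda>\<gamma>. \<gamma> k) = distr (gauss_space n) borel (\<lambda>\<gamma>. \<gamma> k)"
      by (intro distr_cong) auto
    ultimately show ?thesis by simp
  qed
  have meas[measurable]: "(\<lambda>\<gamma>. \<gamma> k) \<in> borel_measurable (gauss_space n)" if "k < n" for k
    using measurable_component_singleton[of k "{..<n}" "\<lambda>_. std_gaussian"] that
    by (simp cong: measurable_cong_sets)
  \<comment> \<open>Independence of the coordinates says that their joint law is the product of the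
    marginals; the joint law is the product measure itself.\<close>
  have "indep_vars (\<lambda>_. borel) (\<lambda>k \<gamma>. \<gamma> k) {..<n}"
  proof (subst indep_vars_iff_distr_eq_PiM'[OF \<open>{..<n} \<noteq> {}\<close>])
    show "distr (gauss_space n) (Pi\<^sub>M {..<n} (\<lambda>_. borel)) (\<lambda>x. \<lambda>k\<in>{..<n}. x k)
      = (\<Pi>\<^sub>M k\<in>{..<n}. distr (gauss_space n) borel (\<lambda>\<gamma>. \<gamma> k))"
    proof -
      have "distr (gauss_space n) (Pi\<^sub>M {..<n} (\<lambda>_. borel)) (\<lambda>x. \<lambda>k\<in>{..<n}. x k)
          = distr (gauss_space n) (gauss_space n) (\<lambda>x. x)"
        by (intro distr_cong sets_PiM_cong) (auto simp: space_PiM PiE_def extensional_restrict)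
      also have "\<dots> = (\<Pi>\<^sub>M k\<in>{..<n}. distr (gauss_space n) borel (\<lambda>\<gamma>. \<gamma> k))"
        unfolding distr_id by (intro PiM_cong) (auto simp: comp)
      finally show ?thesis .
    qed
  qed (use meas in auto)
  then have "indep_vars (\<lambda>_. borel) (\<lambda>k \<gamma>. \<gamma> k) I" using \<open>I \<subseteq> _\<close> by (rule indep_vars_subset)
  then have ind: "indep_vars (\<lambda>_. borel) (\<lambda>k \<gamma>. a k * \<gamma> k) I"
    by (rule indep_vars_compose2[where Y = "\<lambda>k x. a k * x"]) auto
  have "distributed (gauss_space n) lborel (\<lambda>\<gamma>. a k * \<gamma> k) (normal_density 0 \<bar>a k\<bar>)" if "k \<in> I" for k
  proof -
    have k: "k < n" "a k \<noteq> 0" using that by (auto simp: I_def)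
    have "distributed (gauss_space n) lborel (\<lambda>\<gamma>. \<gamma> k) std_normal_density"
      using comp[OF k(1)] meas[OF k(1)] unfolding distributed_def std_gaussian_def by (simp cong: distr_cong)
    then have "distributed (gauss_space n) lborel (\<lambda>\<gamma>. 0 + a k * \<gamma> k) (normal_density (0 + a k * 0) (\<bar>a k\<bar> * 1))"
      using k by (intro normal_density_affine) auto
    then show ?thesis by simp
  qed
  then have "distributed (gauss_space n) lborel (\<lambda>\<gamma>. \<Sum>k\<in>I. a k * \<gamma> k)
      (normal_density (\<Sum>k\<in>I. 0) (sqrt (\<Sum>k\<in>I. \<bar>a k\<bar>\<^sup>2)))"
    using \<open>finite I\<close> \<open>I \<noteq> {}\<close> ind by (intro sum_indep_normal) (auto simp: I_def)
  moreover have "(\<Sum>k\<in>I. \<bar>a k\<bar>\<^sup>2) = (\<Sum>k<n. (a k)\<^sup>2)"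
    using \<open>I \<subseteq> _\<close> by (intro sum.mono_neutral_cong_left) (auto simp: I_def)
  moreover have "(\<Sum>k\<in>I. a k * \<gamma> k) = (\<Sum>k<n. \<gamma> k * a k)" for \<gamma>
    using \<open>I \<subseteq> _\<close> by (intro sum.mono_neutral_cong_left) (auto simp: I_def)
  ultimately show ?thesis
    using normal_standard_normal_convert[of "sqrt (\<Sum>k<n. (a k)\<^sup>2)" "\<lambda>\<gamma>. \<Sum>k<n. \<gamma> k * a k" 0] assms by simp
qed

text \<open>Khinchine's inequality is an identity for real coefficients: after division by the
  square root of the sum of squares the variable is standard normal, and the factor s scales
  out.\<close>

lemma gauss_moment_sum:
  fixes a :: "nat \<Rightarrow> real"
  assumes r: "0 < r"
  shows "(\<integral>\<^sup>+\<gamma>. epow (ennreal \<bar>\<Sum>k<n. \<gamma> k * a k\<bar>) r \<partial>gauss_space n)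
    = gauss_moment r * epow (ennreal (\<Sum>k<n. (a k)\<^sup>2)) (r / 2)"
proof (cases "(\<Sum>k<n. (a k)\<^sup>2) = 0")
  case True
  then have "a k = 0" if "k < n" for k using that by (subst (asm) sum_nonneg_eq_0_iff) auto
  then have "(\<integral>\<^sup>+\<gamma>. epow (ennreal \<bar>\<Sum>k<n. \<gamma> k * a k\<bar>) r \<partial>gauss_space n) = (\<integral>\<^sup>+\<gamma>. 0 \<partial>gauss_space n)"
    by (intro nn_integral_cong) simp
  then show ?thesis using True by simp
next
  case False
  define s where "s = sqrt (\<Sum>k<n. (a k)\<^sup>2)"
  have pos: "0 < (\<Sum>k<n. (a k)\<^sup>2)" using False by (simp add: sum_nonneg order_less_le)
  then have s: "0 < s" by (simp add: s_def)
  have X: "distributed (gauss_space n) lborel (\<lambda>\<gamma>. (\<Sum>k<n. \<gamma> k * a k) / s) std_normal_density"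
    unfolding s_def using pos by (rule distributed_gauss_sum)
  have [measurable]: "(\<lambda>\<gamma>. (\<Sum>k<n. \<gamma> k * a k) / s) \<in> borel_measurable (gauss_space n)"
    using distributed_measurable[OF X] by simp
  have "(\<integral>\<^sup>+\<gamma>. epow (ennreal \<bar>\<Sum>k<n. \<gamma> k * a k\<bar>) r \<partial>gauss_space n)
      = (\<integral>\<^sup>+\<gamma>. epow (ennreal s) r * epow (ennreal \<bar>(\<Sum>k<n. \<gamma> k * a k) / s\<bar>) r \<partial>gauss_space n)"
  proof (rule nn_integral_cong)
    fix \<gamma>
    have "ennreal \<bar>\<Sum>k<n. \<gamma> k * a k\<bar> = ennreal s * ennreal \<bar>(\<Sum>k<n. \<gamma> k * a k) / s\<bar>"
      using s by (subst ennreal_mult[symmetric]) (auto simp: abs_div_pos[symmetric])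
    then show "epow (ennreal \<bar>\<Sum>k<n. \<gamma> k * a k\<bar>) r = epow (ennreal s) r * epow (ennreal \<bar>(\<Sum>k<n. \<gamma> k * a k) / s\<bar>) r"
      using r by (simp only: epow_mult)
  qed
  also have "\<dots> = epow (ennreal s) r * (\<integral>\<^sup>+\<gamma>. epow (ennreal \<bar>(\<Sum>k<n. \<gamma> k * a k) / s\<bar>) r \<partial>gauss_space n)"
    by (rule nn_integral_cmult) measurable
  also have "(\<integral>\<^sup>+\<gamma>. epow (ennreal \<bar>(\<Sum>k<n. \<gamma> k * a k) / s\<bar>) r \<partial>gauss_space n)
      = (\<integral>\<^sup>+t. ennreal (std_normal_density t) * epow (ennreal \<bar>t\<bar>) r \<partial>lborel)"
    by (rule distributed_nn_integral[OF X, symmetric]) measurable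
  also have "\<dots> = gauss_moment r"
    unfolding gauss_moment_def std_gaussian_def by (rule nn_integral_density[symmetric]) auto
  also have "epow (ennreal s) r = epow (ennreal (\<Sum>k<n. (a k)\<^sup>2)) (r / 2)"
    using pos unfolding s_def by (simp add: epow_ennreal powr_half_sqrt[symmetric] powr_powr)
  finally show ?thesis by (simp add: mult.commute)
qed

definition sq_sum :: "nat \<Rightarrow> (nat \<Rightarrow> complex) \<Rightarrow> ennreal" where
  "sq_sum n c = (\<Sum>k<n. ennreal (cmod (c k)) * ennreal (cmod (c k)))"

definition gauss_avg :: "nat \<Rightarrow> (nat \<Rightarrow> complex) \<Rightarrow> (nat \<Rightarrow> real) \<Rightarrow> ennreal" where
  "gauss_avg n c \<gamma> = ennreal (cmod (\<Sum>k<n. complex_of_real (\<gamma> k) * c k))"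

lemma gauss_component_measurable [measurable]:
  "k < n \<Longrightarrow> (\<lambda>\<gamma>. \<gamma> k) \<in> borel_measurable (gauss_space n)"
  using measurable_component_singleton[of k "{..<n}" "\<lambda>_. std_gaussian"]
  by (simp cong: measurable_cong_sets)

lemma sq_sum_eq: "sq_sum n c = ennreal (\<Sum>k<n. (Re (c k))\<^sup>2) + ennreal (\<Sum>k<n. (Im (c k))\<^sup>2)"
proof -
  have "sq_sum n c = (\<Sum>k<n. ennreal ((Re (c k))\<^sup>2 + (Im (c k))\<^sup>2))"
    unfolding sq_sum_def
  proof (intro sum.cong refl)
    fix k
    have "ennreal (cmod (c k)) * ennreal (cmod (c k)) = ennreal ((cmod (c k))\<^sup>2)"
      by (simp add: ennreal_mult power2_eq_square)
    then show "ennreal (cmod (c k)) * ennreal (cmod (c k)) = ennreal ((Re (c k))\<^sup>2 + (Im (c k))\<^sup>2)"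
      by (simp only: cmod_power2)
  qed
  also have "\<dots> = ennreal (\<Sum>k<n. (Re (c k))\<^sup>2) + ennreal (\<Sum>k<n. (Im (c k))\<^sup>2)"
    by (simp add: sum.distrib sum_nonneg)
  finally show ?thesis .
qed

text \<open>With complex coefficients the sum is no longer a multiple of a single real Gaussian
  variable. Real and imaginary parts are treated separately, which costs the factor
  \<open>2 powr r\<close> and a doubling of the moment.\<close>

lemma gauss_avg_moment_le:
  assumes r: "0 < r"
  shows "(\<integral>\<^sup>+\<gamma>. epow (gauss_avg n c \<gamma>) r \<partial>gauss_space n)
    \<le> ennreal (2 powr r) * (2 * gauss_moment r) * epow (sq_sum n c) (r / 2)"
proof -
  define X where "X \<gamma> = ennreal \<bar>\<Sum>k<n. \<gamma> k * Re (c k)\<bar>" for \<gamma> :: "nat \<Rightarrow> real"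
  define Y where "Y \<gamma> = ennreal \<bar>\<Sum>k<n. \<gamma> k * Im (c k)\<bar>" for \<gamma> :: "nat \<Rightarrow> real"
  have [measurable]: "X \<in> borel_measurable (gauss_space n)" "Y \<in> borel_measurable (gauss_space n)"
    unfolding X_def[abs_def] Y_def[abs_def] by measurable
  have "(\<integral>\<^sup>+\<gamma>. epow (gauss_avg n c \<gamma>) r \<partial>gauss_space n)
    \<le> (\<integral>\<^sup>+\<gamma>. ennreal (2 powr r) * (epow (X \<gamma>) r + epow (Y \<gamma>) r) \<partial>gauss_space n)"
  proof (rule nn_integral_mono)
    fix \<gamma>
    have "gauss_avg n c \<gamma> \<le> (\<Sum>i\<in>(UNIV::bool set). if i then X \<gamma> else Y \<gamma>)"
    proof -
      have "cmod (\<Sum>k<n. complex_of_real (\<gamma> k) * c k) \<le> \<bar>\<Sum>k<n. \<gamma> k * Re (c k)\<bar> + \<bar>\<Sum>k<n. \<gamma> k * Im (c k)\<bar>"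
        using cmod_le[of "\<Sum>k<n. complex_of_real (\<gamma> k) * c k"] by simp
      then show ?thesis unfolding gauss_avg_def X_def Y_def UNIV_bool
        by (simp add: ennreal_leI add.commute flip: ennreal_plus)
    qed
    then have "epow (gauss_avg n c \<gamma>) r \<le> epow (\<Sum>i\<in>(UNIV::bool set). if i then X \<gamma> else Y \<gamma>) r"
      using r by (intro epow_mono) auto
    also have "\<dots> \<le> ennreal (real (card (UNIV::bool set)) powr r) * (\<Sum>i\<in>UNIV. epow (if i then X \<gamma> else Y \<gamma>) r)"
      using r by (intro epow_sum_le) auto
    finally show "epow (gauss_avg n c \<gamma>) r \<le> ennreal (2 powr r) * (epow (X \<gamma>) r + epow (Y \<gamma>) r)"
      by (simp add: UNIV_bool add.commute)
  qed
  also have "\<dots> = ennreal (2 powr r) * (gauss_moment r * epow (ennreal (\<Sum>k<n. (Re (c k))\<^sup>2)) (r / 2) +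
      gauss_moment r * epow (ennreal (\<Sum>k<n. (Im (c k))\<^sup>2)) (r / 2))"
    using gauss_moment_sum[OF r, of n "\<lambda>k. Re (c k)"] gauss_moment_sum[OF r, of n "\<lambda>k. Im (c k)"]
    by (simp add: nn_integral_cmult nn_integral_add flip: X_def Y_def)
  also have "\<dots> \<le> ennreal (2 powr r) * (gauss_moment r * epow (sq_sum n c) (r / 2) +
      gauss_moment r * epow (sq_sum n c) (r / 2))"
    using r by (intro mult_left_mono add_mono epow_mono) (auto simp: sq_sum_eq)
  also have "\<dots> = ennreal (2 powr r) * (2 * gauss_moment r) * epow (sq_sum n c) (r / 2)"
    by (simp only: mult_2 distrib_left distrib_right mult.assoc)
  finally show ?thesis .
qed

text \<open>The modulus dominates the real and the imaginary part, and the larger of the two square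
  sums is at least half of the total.\<close>

lemma gauss_avg_moment_ge:
  assumes r: "0 < r"
  shows "gauss_moment r * epow (sq_sum n c) (r / 2)
    \<le> ennreal (2 powr (r / 2)) * (\<integral>\<^sup>+\<gamma>. epow (gauss_avg n c \<gamma>) r \<partial>gauss_space n)"
proof -
  define a where "a = (\<Sum>k<n. (Re (c k))\<^sup>2)"
  define b where "b = (\<Sum>k<n. (Im (c k))\<^sup>2)"
  have ab: "0 \<le> a" "0 \<le> b" by (auto simp: a_def b_def sum_nonneg)
  define M where "M = (\<integral>\<^sup>+\<gamma>. epow (gauss_avg n c \<gamma>) r \<partial>gauss_space n)"
  have "gauss_moment r * epow (ennreal a) (r / 2) \<le> M"
    unfolding a_def M_def gauss_moment_sum[OF r, symmetric] gauss_avg_def using r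
  proof (intro nn_integral_mono epow_mono ennreal_leI)
    fix \<gamma>
    show "\<bar>\<Sum>k<n. \<gamma> k * Re (c k)\<bar> \<le> cmod (\<Sum>k<n. complex_of_real (\<gamma> k) * c k)"
      using abs_Re_le_cmod[of "\<Sum>k<n. complex_of_real (\<gamma> k) * c k"] by simp
  qed auto
  moreover have "gauss_moment r * epow (ennreal b) (r / 2) \<le> M"
    unfolding b_def M_def gauss_moment_sum[OF r, symmetric] gauss_avg_def using r
  proof (intro nn_integral_mono epow_mono ennreal_leI)
    fix \<gamma>
    show "\<bar>\<Sum>k<n. \<gamma> k * Im (c k)\<bar> \<le> cmod (\<Sum>k<n. complex_of_real (\<gamma> k) * c k)"
      using abs_Im_le_cmod[of "\<Sum>k<n. complex_of_real (\<gamma> k) * c k"] by simp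
  qed auto
  ultimately have m: "gauss_moment r * epow (ennreal (max a b)) (r / 2) \<le> M" by (auto simp: max_def)
  have "sq_sum n c \<le> ennreal 2 * ennreal (max a b)"
    unfolding sq_sum_eq a_def[symmetric] b_def[symmetric] using ab
    by (subst ennreal_mult[symmetric]) (auto simp flip: ennreal_plus intro!: ennreal_leI)
  then have "epow (sq_sum n c) (r / 2) \<le> epow (ennreal 2 * ennreal (max a b)) (r / 2)"
    using r by (intro epow_mono) auto
  also have "\<dots> = ennreal (2 powr (r / 2)) * epow (ennreal (max a b)) (r / 2)"
    using r epow_ennreal[of 2] by (subst epow_mult) auto
  finally have "gauss_moment r * epow (sq_sum n c) (r / 2)
      \<le> gauss_moment r * (ennreal (2 powr (r / 2)) * epow (ennreal (max a b)) (r / 2))"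
    by (rule mult_left_mono) simp
  also have "\<dots> = ennreal (2 powr (r / 2)) * (gauss_moment r * epow (ennreal (max a b)) (r / 2))"
    by (simp only: ac_simps)
  also have "\<dots> \<le> ennreal (2 powr (r / 2)) * M" using m by (rule mult_left_mono) simp
  finally show ?thesis unfolding M_def .
qed

lemma gauss_avg_equivalence:
  assumes "0 < r"
  obtains C :: real where "0 < C"
    "\<And>n c. (\<integral>\<^sup>+\<gamma>. epow (gauss_avg n c \<gamma>) r \<partial>gauss_space n) \<le> ennreal C * epow (sq_sum n c) (r / 2)"
    "\<And>n c. epow (sq_sum n c) (r / 2) \<le> ennreal C * (\<integral>\<^sup>+\<gamma>. epow (gauss_avg n c \<gamma>) r \<partial>gauss_space n)"
proof -
  obtain m where m: "gauss_moment r = ennreal m" "0 \<le> m"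
    using gauss_moment_finite[OF assms] by (auto simp: less_top_ennreal)
  then have "0 < m" using gauss_moment_pos[of r] by (auto simp: order_less_le)
  define C where "C = 2 powr r * (2 * m) + 2 powr (r / 2) / m"
  have "0 < C" using \<open>0 < m\<close> by (simp add: C_def add_pos_pos)
  moreover have "(\<integral>\<^sup>+\<gamma>. epow (gauss_avg n c \<gamma>) r \<partial>gauss_space n) \<le> ennreal C * epow (sq_sum n c) (r / 2)" for n c
  proof -
    have "ennreal (2 powr r) * (2 * gauss_moment r) = ennreal (2 powr r * (2 * m))"
      using m by (simp add: ennreal_mult)
    also have "\<dots> \<le> ennreal C" using \<open>0 < m\<close> by (intro ennreal_leI) (simp add: C_def)
    finally show ?thesis using gauss_avg_moment_le[OF assms, of n c]
      by (meson mult_right_mono order_trans zero_le)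
  qed
  moreover have "epow (sq_sum n c) (r / 2) \<le> ennreal C * (\<integral>\<^sup>+\<gamma>. epow (gauss_avg n c \<gamma>) r \<partial>gauss_space n)" for n c
  proof -
    let ?M = "\<integral>\<^sup>+\<gamma>. epow (gauss_avg n c \<gamma>) r \<partial>gauss_space n"
    have "ennreal (1 / m) * (ennreal m * epow (sq_sum n c) (r / 2)) \<le> ennreal (1 / m) * (ennreal (2 powr (r / 2)) * ?M)"
      using gauss_avg_moment_ge[OF assms, of n c] m by (intro mult_left_mono) auto
    then have "epow (sq_sum n c) (r / 2) \<le> ennreal (2 powr (r / 2) / m) * ?M"
      using \<open>0 < m\<close> by (simp add: mult.assoc[symmetric] flip: ennreal_mult)
    also have "\<dots> \<le> ennreal C * ?M"
      using \<open>0 < m\<close> by (intro mult_right_mono ennreal_leI) (auto simp: C_def)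
    finally show ?thesis .
  qed
  ultimately show ?thesis using that by blast
qed

text \<open>A bound for each single \<gamma>. It supplies the finiteness of the L^p mass at fixed
  \<gamma> and the a priori hypothesis of Minkowski's inequality for p < 2.\<close>

lemma sq_sum_gauss_Cauchy_Schwarz:
  "gauss_avg n c \<gamma> \<le> epow (\<Sum>k<n. ennreal \<bar>\<gamma> k\<bar> * ennreal \<bar>\<gamma> k\<bar>) (1 / 2) * epow (sq_sum n c) (1 / 2)"
proof -
  have "gauss_avg n c \<gamma> \<le> ennreal (\<Sum>k<n. \<bar>\<gamma> k\<bar> * cmod (c k))"
    unfolding gauss_avg_def
    by (intro ennreal_leI order.trans[OF norm_sum] sum_mono) (simp add: norm_mult)
  also have "\<dots> = (\<Sum>k<n. ennreal \<bar>\<gamma> k\<bar> * ennreal (cmod (c k)))"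
    by (simp add: ennreal_mult flip: sum_ennreal)
  also have "\<dots> \<le> epow (\<Sum>k<n. ennreal \<bar>\<gamma> k\<bar> * ennreal \<bar>\<gamma> k\<bar>) (1 / 2) * epow (sq_sum n c) (1 / 2)"
    unfolding sq_sum_def by (rule Cauchy_Schwarz_sum_ennreal) simp
  finally show ?thesis .
qed

lemma nn_integral_gauss_squares: "(\<integral>\<^sup>+\<gamma>. (\<Sum>k<n. ennreal \<bar>\<gamma> k\<bar> * ennreal \<bar>\<gamma> k\<bar>) \<partial>gauss_space n) < \<top>"
proof -
  have *: "(\<integral>\<^sup>+\<gamma>. ennreal \<bar>\<gamma> k\<bar> * ennreal \<bar>\<gamma> k\<bar> \<partial>gauss_space n) < \<top>" if k: "k < n" for k
  proof -
    have "(\<Sum>j<n. \<gamma> j * (if j = k then 1 else 0)) = \<gamma> k" for \<gamma> :: "nat \<Rightarrow> real"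
      using k by (simp add: if_distrib[of "\<lambda>x. _ * x"] cong: if_cong)
    moreover have "(\<Sum>j<n. (if j = k then 1 else 0 :: real)\<^sup>2) = 1"
      using k by (simp add: if_distrib[of "\<lambda>x. x\<^sup>2"] cong: if_cong)
    ultimately have "(\<integral>\<^sup>+\<gamma>. epow (ennreal \<bar>\<gamma> k\<bar>) 2 \<partial>gauss_space n) = gauss_moment 2 * epow (ennreal 1) (2 / 2)"
      using gauss_moment_sum[of 2 n "\<lambda>j. if j = k then 1 else 0"] by simp
    then show ?thesis using gauss_moment_finite[of 2] by (simp add: epow_2)
  qed
  have "(\<integral>\<^sup>+\<gamma>. (\<Sum>k<n. ennreal \<bar>\<gamma> k\<bar> * ennreal \<bar>\<gamma> k\<bar>) \<partial>gauss_space n)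
      = (\<Sum>k<n. \<integral>\<^sup>+\<gamma>. ennreal \<bar>\<gamma> k\<bar> * ennreal \<bar>\<gamma> k\<bar> \<partial>gauss_space n)"
    by (rule nn_integral_sum) auto
  also have "\<dots> < \<top>" using * by simp
  finally show ?thesis .
qed

definition sq_mass :: "real \<Rightarrow> nat \<Rightarrow> (nat \<Rightarrow> 'a::euclidean_space \<Rightarrow> complex) \<Rightarrow> ennreal" where
  "sq_mass p n f = (\<integral>\<^sup>+x. epow (sq_sum n (\<lambda>k. f k x)) (p / 2) \<partial>lborel)"

text \<open>The square of \<open>gauss_norm\<close>, when finite, as an extended number: the inner
  power 2 / p turns the integral of a p-th power into a squared norm.\<close>

definition gauss_mass :: "real \<Rightarrow> nat \<Rightarrow> (nat \<Rightarrow> 'a::euclidean_space \<Rightarrow> complex) \<Rightarrow> ennreal" where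
  "gauss_mass p n f = (\<integral>\<^sup>+\<gamma>. epow (\<integral>\<^sup>+x. epow (gauss_avg n (\<lambda>k. f k x) \<gamma>) p \<partial>lborel) (2 / p) \<partial>gauss_space n)"

lemma gauss_avg_measurable2 [measurable]:
  fixes f :: "nat \<Rightarrow> 'a::euclidean_space \<Rightarrow> complex"
  assumes [measurable]: "\<And>k. k < n \<Longrightarrow> f k \<in> borel_measurable borel"
  shows "(\<lambda>z. gauss_avg n (\<lambda>k. f k (snd z)) (fst z)) \<in> borel_measurable (gauss_space n \<Otimes>\<^sub>M lborel)"
    "(\<lambda>z. gauss_avg n (\<lambda>k. f k (fst z)) (snd z)) \<in> borel_measurable (lborel \<Otimes>\<^sub>M gauss_space n)"
    "(\<lambda>x. gauss_avg n (\<lambda>k. f k x) \<gamma>) \<in> borel_measurable borel"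
    "(\<lambda>\<gamma>. gauss_avg n (\<lambda>k. f k x) \<gamma>) \<in> borel_measurable (gauss_space n)"
    "(\<lambda>x. sq_sum n (\<lambda>k. f k x)) \<in> borel_measurable borel"
  unfolding gauss_avg_def sq_sum_def by measurable

lemma gauss_avg_Lp_mass_le:
  fixes f :: "nat \<Rightarrow> 'a::euclidean_space \<Rightarrow> complex"
  assumes [measurable]: "\<And>k. k < n \<Longrightarrow> f k \<in> borel_measurable borel" and p: "0 < p"
  shows "(\<integral>\<^sup>+x. epow (gauss_avg n (\<lambda>k. f k x) \<gamma>) p \<partial>lborel)
    \<le> epow (\<Sum>k<n. ennreal \<bar>\<gamma> k\<bar> * ennreal \<bar>\<gamma> k\<bar>) (p / 2) * sq_mass p n f"
proof -
  let ?G = "\<Sum>k<n. ennreal \<bar>\<gamma> k\<bar> * ennreal \<bar>\<gamma> k\<bar>"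
  have "(\<integral>\<^sup>+x. epow (gauss_avg n (\<lambda>k. f k x) \<gamma>) p \<partial>lborel)
      \<le> (\<integral>\<^sup>+x. epow (epow ?G (1 / 2) * epow (sq_sum n (\<lambda>k. f k x)) (1 / 2)) p \<partial>lborel)"
    using p by (intro nn_integral_mono epow_mono sq_sum_gauss_Cauchy_Schwarz) auto
  also have "\<dots> = (\<integral>\<^sup>+x. epow ?G (p / 2) * epow (sq_sum n (\<lambda>k. f k x)) (p / 2) \<partial>lborel)"
    using p by (simp add: epow_mult epow_epow)
  also have "\<dots> = epow ?G (p / 2) * sq_mass p n f"
    unfolding sq_mass_def by (rule nn_integral_cmult) measurable
  finally show ?thesis .
qed

lemma sigma_finite_gauss_space: "sigma_finite_measure (gauss_space n)"
  by (intro prob_space_imp_sigma_finite prob_space_gauss_space)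

lemma gauss_Fubini:
  fixes f :: "nat \<Rightarrow> 'a::euclidean_space \<Rightarrow> complex"
  assumes [measurable]: "\<And>k. k < n \<Longrightarrow> f k \<in> borel_measurable borel"
  shows "(\<integral>\<^sup>+\<gamma>. \<integral>\<^sup>+x. epow (gauss_avg n (\<lambda>k. f k x) \<gamma>) r \<partial>lborel \<partial>gauss_space n)
    = (\<integral>\<^sup>+x. \<integral>\<^sup>+\<gamma>. epow (gauss_avg n (\<lambda>k. f k x) \<gamma>) r \<partial>gauss_space n \<partial>lborel)"
proof -
  interpret G: sigma_finite_measure "gauss_space n" by (rule sigma_finite_gauss_space)
  interpret pair_sigma_finite lborel "gauss_space n" ..
  note [measurable] = gauss_avg_measurable2[OF assms]
  show ?thesis by (rule Fubini') (simp add: case_prod_beta')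
qed

text \<open>Khinchine's inequality at the two exponents p and 2, joined by Jensen and Minkowski,
  takes the place of the Kahane-Khinchine inequality for L^p-valued sums. Jensen relates the mean of
  Y to that of its power 2 / p; Minkowski relates the two orders of integration in x and \<gamma>.
  For p \<ge> 2 Jensen yields the upper bound and Minkowski the lower one; for p < 2 they exchange
  their roles.\<close>

lemma gauss_mass_equivalence:
  assumes p: "1 < p"
  obtains C :: real where "0 < C"
    "\<And>n (f :: nat \<Rightarrow> 'a::euclidean_space \<Rightarrow> complex). (\<And>k. k < n \<Longrightarrow> f k \<in> borel_measurable borel) \<Longrightarrow>
      sq_mass p n f < \<top> \<Longrightarrow> epow (gauss_mass p n f) (p / 2) \<le> ennreal C * sq_mass p n f"
    "\<And>n (f :: nat \<Rightarrow> 'a \<Rightarrow> complex). (\<And>k. k < n \<Longrightarrow> f k \<in> borel_measurable borel) \<Longrightarrow>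
      sq_mass p n f < \<top> \<Longrightarrow> sq_mass p n f \<le> ennreal C * epow (gauss_mass p n f) (p / 2)"
proof -
  obtain Cp where Cp: "0 < Cp"
    "\<And>n c. (\<integral>\<^sup>+\<gamma>. epow (gauss_avg n c \<gamma>) p \<partial>gauss_space n) \<le> ennreal Cp * epow (sq_sum n c) (p / 2)"
    "\<And>n c. epow (sq_sum n c) (p / 2) \<le> ennreal Cp * (\<integral>\<^sup>+\<gamma>. epow (gauss_avg n c \<gamma>) p \<partial>gauss_space n)"
    by (rule gauss_avg_equivalence[of p]) (use p in auto)
  obtain C2 where C2: "0 < C2"
    "\<And>n c. (\<integral>\<^sup>+\<gamma>. epow (gauss_avg n c \<gamma>) 2 \<partial>gauss_space n) \<le> ennreal C2 * sq_sum n c"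
    "\<And>n c. sq_sum n c \<le> ennreal C2 * (\<integral>\<^sup>+\<gamma>. epow (gauss_avg n c \<gamma>) 2 \<partial>gauss_space n)"
    by (rule gauss_avg_equivalence[of 2]) auto
  define C where "C = Cp + C2 powr (p / 2)"
  have C: "0 < C" "ennreal Cp \<le> ennreal C" "ennreal (C2 powr (p / 2)) \<le> ennreal C"
    using Cp(1) by (auto simp: C_def add_pos_nonneg intro!: ennreal_leI)
  have C2p: "epow (ennreal C2 * x) (p / 2) = ennreal (C2 powr (p / 2)) * epow x (p / 2)" for x
    using C2(1) p by (simp add: epow_mult epow_ennreal)
  have "epow (gauss_mass p n f) (p / 2) \<le> ennreal C * sq_mass p n f \<and>
      sq_mass p n f \<le> ennreal C * epow (gauss_mass p n f) (p / 2)"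
    if f[measurable]: "\<And>k. k < n \<Longrightarrow> f k \<in> borel_measurable borel" and fin: "sq_mass p n f < \<top>"
    for n and f :: "nat \<Rightarrow> 'a \<Rightarrow> complex"
  proof -
    interpret prob_space "gauss_space n" by (rule prob_space_gauss_space)
    note [measurable] = gauss_avg_measurable2[OF f]
    define \<Phi> where "\<Phi> x \<gamma> = gauss_avg n (\<lambda>k. f k x) \<gamma>" for x \<gamma>
    define S where "S x = sq_sum n (\<lambda>k. f k x)" for x
    \<comment> \<open>\<open>J x\<close> is the second moment at the point x,
      \<open>Y \<gamma>\<close> the p-th power of the norm at fixed \<gamma>. The integral of J^(p /
      2) is comparable to \<open>sq_mass\<close> by Khinchine at exponent 2, the mean of Y by
      Khinchine at exponent p.\<close>
    define J where "J x = (\<integral>\<^sup>+\<gamma>. epow (\<Phi> x \<gamma>) 2 \<partial>gauss_space n)" for x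
    define Y where "Y \<gamma> = (\<integral>\<^sup>+x. epow (\<Phi> x \<gamma>) p \<partial>lborel)" for \<gamma>
    have [measurable]: "S \<in> borel_measurable borel" unfolding S_def by measurable
    have m1[measurable]: "(\<lambda>z. \<Phi> (snd z) (fst z)) \<in> borel_measurable (gauss_space n \<Otimes>\<^sub>M lborel)"
      and m2[measurable]: "(\<lambda>z. \<Phi> (fst z) (snd z)) \<in> borel_measurable (lborel \<Otimes>\<^sub>M gauss_space n)"
      unfolding \<Phi>_def by measurable
    have [measurable]: "Y \<in> borel_measurable (gauss_space n)" unfolding Y_def
      by (intro lborel.borel_measurable_nn_integral) (simp add: case_prod_beta')
    have [measurable]: "J \<in> borel_measurable borel"
    proof -
      have "J \<in> borel_measurable lborel" unfolding J_def
        by (intro borel_measurable_nn_integral) (simp add: case_prod_beta')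
      then show ?thesis by simp
    qed
    have N: "sq_mass p n f = (\<integral>\<^sup>+x. epow (S x) (p / 2) \<partial>lborel)" by (simp add: sq_mass_def S_def)
    have A: "gauss_mass p n f = (\<integral>\<^sup>+\<gamma>. epow (Y \<gamma>) (2 / p) \<partial>gauss_space n)"
      by (simp add: gauss_mass_def Y_def \<Phi>_def)
    have EY: "(\<integral>\<^sup>+\<gamma>. Y \<gamma> \<partial>gauss_space n) = (\<integral>\<^sup>+x. \<integral>\<^sup>+\<gamma>. epow (\<Phi> x \<gamma>) p \<partial>gauss_space n \<partial>lborel)"
      unfolding Y_def \<Phi>_def by (rule gauss_Fubini) simp
    have inner_measurable: "(\<lambda>x. \<integral>\<^sup>+\<gamma>. epow (\<Phi> x \<gamma>) p \<partial>gauss_space n) \<in> borel_measurable lborel"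
      by (intro borel_measurable_nn_integral) (simp add: case_prod_beta')
    have EYle: "(\<integral>\<^sup>+\<gamma>. Y \<gamma> \<partial>gauss_space n) \<le> ennreal Cp * sq_mass p n f"
    proof -
      have "(\<integral>\<^sup>+\<gamma>. Y \<gamma> \<partial>gauss_space n) \<le> (\<integral>\<^sup>+x. ennreal Cp * epow (S x) (p / 2) \<partial>lborel)"
        unfolding EY unfolding \<Phi>_def S_def using Cp(2) by (intro nn_integral_mono)
      then show ?thesis unfolding N by (simp add: nn_integral_cmult)
    qed
    have EYge: "sq_mass p n f \<le> ennreal Cp * (\<integral>\<^sup>+\<gamma>. Y \<gamma> \<partial>gauss_space n)"
    proof -
      have "sq_mass p n f \<le> (\<integral>\<^sup>+x. ennreal Cp * (\<integral>\<^sup>+\<gamma>. epow (\<Phi> x \<gamma>) p \<partial>gauss_space n) \<partial>lborel)"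
        unfolding N unfolding \<Phi>_def S_def using Cp(3) by (intro nn_integral_mono)
      also have "\<dots> = ennreal Cp * (\<integral>\<^sup>+\<gamma>. Y \<gamma> \<partial>gauss_space n)"
        unfolding EY by (rule nn_integral_cmult[OF inner_measurable])
      finally show ?thesis .
    qed
    have Jle: "(\<integral>\<^sup>+x. epow (J x) (p / 2) \<partial>lborel) \<le> ennreal (C2 powr (p / 2)) * sq_mass p n f"
    proof -
      have "(\<integral>\<^sup>+x. epow (J x) (p / 2) \<partial>lborel) \<le> (\<integral>\<^sup>+x. epow (ennreal C2 * S x) (p / 2) \<partial>lborel)"
        unfolding J_def \<Phi>_def S_def using p by (intro nn_integral_mono epow_mono C2(2)) auto
      then show ?thesis unfolding N C2p by (simp add: nn_integral_cmult)
    qed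
    have Jge: "sq_mass p n f \<le> ennreal (C2 powr (p / 2)) * (\<integral>\<^sup>+x. epow (J x) (p / 2) \<partial>lborel)"
    proof -
      have "sq_mass p n f \<le> (\<integral>\<^sup>+x. epow (ennreal C2 * J x) (p / 2) \<partial>lborel)"
        unfolding N unfolding J_def \<Phi>_def S_def using p by (intro nn_integral_mono epow_mono C2(3)) auto
      then show ?thesis unfolding C2p by (simp add: nn_integral_cmult)
    qed
    show ?thesis
    proof (cases "2 \<le> p")
      case True
      have "epow (gauss_mass p n f) (p / 2) \<le> (\<integral>\<^sup>+\<gamma>. epow (epow (Y \<gamma>) (2 / p)) (p / 2) \<partial>gauss_space n)"
        unfolding A using True by (intro Jensen_power prob_space_gauss_space) auto
      also have "\<dots> = (\<integral>\<^sup>+\<gamma>. Y \<gamma> \<partial>gauss_space n)" using p by (simp add: epow_epow)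
      also note EYle
      finally have up: "epow (gauss_mass p n f) (p / 2) \<le> ennreal Cp * sq_mass p n f" .
      have "(\<integral>\<^sup>+x. epow (J x) (p / 2) \<partial>lborel) \<le> epow (gauss_mass p n f) (p / 2)"
      proof (cases "p = 2")
        case False
        have "(\<integral>\<^sup>+x. epow (J x) (p / 2) \<partial>lborel) \<le>
          epow (\<integral>\<^sup>+\<gamma>. epow (\<integral>\<^sup>+x. epow (epow (\<Phi> x \<gamma>) 2) (p / 2) \<partial>lborel) (1 / (p / 2)) \<partial>gauss_space n) (p / 2)"
          unfolding J_def
        proof (rule Minkowski_integral)
          have "ennreal (C2 powr (p / 2)) * sq_mass p n f < \<top>" using fin by (simp add: ennreal_mult_less_top)
          then show "(\<integral>\<^sup>+x. epow (\<integral>\<^sup>+\<gamma>. epow (\<Phi> x \<gamma>) 2 \<partial>gauss_space n) (p / 2) \<partial>lborel) < \<top>"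
            using Jle unfolding J_def by (rule le_less_trans[rotated])
        qed (use True False in \<open>auto simp: case_prod_beta' sigma_finite_lborel sigma_finite_gauss_space\<close>)
        also have "\<dots> = epow (gauss_mass p n f) (p / 2)"
          unfolding A Y_def using p by (simp add: epow_epow)
        finally show ?thesis .
      next
        case True
        have "(\<integral>\<^sup>+x. J x \<partial>lborel) = (\<integral>\<^sup>+\<gamma>. Y \<gamma> \<partial>gauss_space n)"
          unfolding EY unfolding J_def using True by simp
        then show ?thesis unfolding A using True by simp
      qed
      then have lo: "sq_mass p n f \<le> ennreal (C2 powr (p / 2)) * epow (gauss_mass p n f) (p / 2)"
        using Jge by (meson mult_left_mono order_trans zero_le)
      show ?thesis using up lo C by (meson mult_right_mono order_trans zero_le)
    next
      case False
      have "epow (\<integral>\<^sup>+\<gamma>. Y \<gamma> \<partial>gauss_space n) (2 / p) \<le> gauss_mass p n f"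
        unfolding A using False p by (intro Jensen_power prob_space_gauss_space) auto
      then have "epow (epow (\<integral>\<^sup>+\<gamma>. Y \<gamma> \<partial>gauss_space n) (2 / p)) (p / 2) \<le> epow (gauss_mass p n f) (p / 2)"
        using p by (intro epow_mono) auto
      then have "(\<integral>\<^sup>+\<gamma>. Y \<gamma> \<partial>gauss_space n) \<le> epow (gauss_mass p n f) (p / 2)"
        using p by (simp add: epow_epow)
      then have lo: "sq_mass p n f \<le> ennreal Cp * epow (gauss_mass p n f) (p / 2)"
        using EYge by (meson mult_left_mono order_trans zero_le)
      have "gauss_mass p n f \<le> epow (\<integral>\<^sup>+x. epow (\<integral>\<^sup>+\<gamma>. epow (epow (\<Phi> x \<gamma>) p) (2 / p) \<partial>gauss_space n) (1 / (2 / p)) \<partial>lborel) (2 / p)"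
        unfolding A Y_def
      proof (rule Minkowski_integral)
        have "(\<integral>\<^sup>+\<gamma>. epow (Y \<gamma>) (2 / p) \<partial>gauss_space n)
            \<le> (\<integral>\<^sup>+\<gamma>. (\<Sum>k<n. ennreal \<bar>\<gamma> k\<bar> * ennreal \<bar>\<gamma> k\<bar>) * epow (sq_mass p n f) (2 / p) \<partial>gauss_space n)"
        proof (rule nn_integral_mono)
          fix \<gamma>
          have "Y \<gamma> \<le> epow (\<Sum>k<n. ennreal \<bar>\<gamma> k\<bar> * ennreal \<bar>\<gamma> k\<bar>) (p / 2) * sq_mass p n f"
            unfolding Y_def \<Phi>_def using p by (intro gauss_avg_Lp_mass_le) auto
          then have "epow (Y \<gamma>) (2 / p) \<le> epow (epow (\<Sum>k<n. ennreal \<bar>\<gamma> k\<bar> * ennreal \<bar>\<gamma> k\<bar>) (p / 2) * sq_mass p n f) (2 / p)"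
            using p by (intro epow_mono) auto
          then show "epow (Y \<gamma>) (2 / p) \<le> (\<Sum>k<n. ennreal \<bar>\<gamma> k\<bar> * ennreal \<bar>\<gamma> k\<bar>) * epow (sq_mass p n f) (2 / p)"
            using p by (simp add: epow_mult epow_epow)
        qed
        also have "\<dots> = (\<integral>\<^sup>+\<gamma>. (\<Sum>k<n. ennreal \<bar>\<gamma> k\<bar> * ennreal \<bar>\<gamma> k\<bar>) \<partial>gauss_space n) * epow (sq_mass p n f) (2 / p)"
          by (rule nn_integral_multc) measurable
        also have "\<dots> < \<top>" using nn_integral_gauss_squares[of n] fin by (simp add: ennreal_mult_less_top)
        finally show "(\<integral>\<^sup>+\<gamma>. epow (\<integral>\<^sup>+x. epow (\<Phi> x \<gamma>) p \<partial>lborel) (2 / p) \<partial>gauss_space n) < \<top>"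
          by (simp add: Y_def)
      qed (use False p in \<open>auto simp: case_prod_beta' sigma_finite_lborel sigma_finite_gauss_space\<close>)
      also have "\<dots> = epow (\<integral>\<^sup>+x. epow (J x) (p / 2) \<partial>lborel) (2 / p)"
        unfolding J_def using p by (simp add: epow_epow)
      finally have "epow (gauss_mass p n f) (p / 2) \<le> epow (epow (\<integral>\<^sup>+x. epow (J x) (p / 2) \<partial>lborel) (2 / p)) (p / 2)"
        using p by (intro epow_mono) auto
      also have "\<dots> = (\<integral>\<^sup>+x. epow (J x) (p / 2) \<partial>lborel)" using p by (simp add: epow_epow)
      also note Jle
      finally have up: "epow (gauss_mass p n f) (p / 2) \<le> ennreal (C2 powr (p / 2)) * sq_mass p n f" .
      show ?thesis using up lo C by (meson mult_right_mono order_trans zero_le)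
    qed
  qed
  with C(1) show ?thesis using that by blast
qed

section \<open>Passage from extended masses to the norms of Lp and Gauss(Lp)\<close>

lemma Lp_D:
  fixes f :: "'a::euclidean_space \<Rightarrow> complex"
  assumes "f \<in> Lp p"
  shows "f \<in> borel_measurable borel" "(\<integral>\<^sup>+x. epow (ennreal (cmod (f x))) p \<partial>lborel) < \<top>"
  using assms by (auto simp: Lp_def epow_ennreal real_integrable_def less_top)

lemma Lp_I:
  fixes f :: "'a::euclidean_space \<Rightarrow> complex"
  assumes [measurable]: "f \<in> borel_measurable borel" and "(\<integral>\<^sup>+x. epow (ennreal (cmod (f x))) p \<partial>lborel) < \<top>"
  shows "f \<in> Lp p"
  using assms by (auto simp: Lp_def epow_ennreal intro!: integrableI_bounded)

lemma Lp_norm_eq: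
  fixes f :: "'a::euclidean_space \<Rightarrow> complex"
  assumes [measurable]: "f \<in> borel_measurable borel"
  shows "Lp_norm p f = enn2real (\<integral>\<^sup>+x. epow (ennreal (cmod (f x))) p \<partial>lborel) powr (1 / p)"
  unfolding Lp_norm_def by (subst integral_eq_nn_integral) (auto simp: epow_ennreal)

lemma ennreal_Lp_norm:
  fixes f :: "'a::euclidean_space \<Rightarrow> complex"
  assumes "f \<in> Lp p"
  shows "ennreal (Lp_norm p f) = epow (\<integral>\<^sup>+x. epow (ennreal (cmod (f x))) p \<partial>lborel) (1 / p)"
  using Lp_D[OF assms] by (simp add: Lp_norm_eq epow_def less_top)

lemma sq_mass_finite:
  fixes f :: "nat \<Rightarrow> 'a::euclidean_space \<Rightarrow> complex"
  assumes f: "\<And>k. k < n \<Longrightarrow> f k \<in> Lp p" and p: "0 < p"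
  shows "sq_mass p n f < \<top>"
proof -
  have [measurable]: "\<And>k. k < n \<Longrightarrow> f k \<in> borel_measurable borel" using f Lp_D by blast
  have sq: "epow (y * y) (p / 2) = epow y p" for y by (simp add: epow_2[symmetric] epow_epow)
  have "sq_mass p n f \<le> (\<integral>\<^sup>+x. ennreal (real n powr (p / 2)) * (\<Sum>k<n. epow (ennreal (cmod (f k x))) p) \<partial>lborel)"
    unfolding sq_mass_def sq_sum_def sq[symmetric] using epow_sum_le[of "p / 2" "{..<n}"] p
    by (intro nn_integral_mono) simp
  also have "\<dots> = ennreal (real n powr (p / 2)) * (\<integral>\<^sup>+x. (\<Sum>k<n. epow (ennreal (cmod (f k x))) p) \<partial>lborel)"
    by (rule nn_integral_cmult) measurable
  also have "(\<integral>\<^sup>+x. (\<Sum>k<n. epow (ennreal (cmod (f k x))) p) \<partial>lborel) = (\<Sum>k<n. \<integral>\<^sup>+x. epow (ennreal (cmod (f k x))) p \<partial>lborel)"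
    by (rule nn_integral_sum) simp
  also have "ennreal (real n powr (p / 2)) * \<dots> < \<top>"
    using Lp_D(2)[OF f] by (auto simp: ennreal_mult_less_top)
  finally show ?thesis .
qed

text \<open>The Bochner integral in \<open>gauss_norm\<close> takes the value 0 on functions that
  are not integrable, so finiteness of the mass has to be known before the two can be
  identified.\<close>

lemma ennreal_gauss_norm:
  fixes f :: "nat \<Rightarrow> 'a::euclidean_space \<Rightarrow> complex"
  assumes f: "\<And>k. k < n \<Longrightarrow> f k \<in> Lp p" and p: "1 < p" and fin: "gauss_mass p n f < \<top>"
  shows "ennreal (gauss_norm p n f) = epow (gauss_mass p n f) (1 / 2)"
proof -
  have m[measurable]: "\<And>k. k < n \<Longrightarrow> f k \<in> borel_measurable borel" using f Lp_D by blast
  note [measurable] = gauss_avg_measurable2[OF m]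
  define Y where "Y \<gamma> = (\<integral>\<^sup>+x. epow (gauss_avg n (\<lambda>k. f k x) \<gamma>) p \<partial>lborel)" for \<gamma>
  have [measurable]: "Y \<in> borel_measurable (gauss_space n)" unfolding Y_def
    by (intro lborel.borel_measurable_nn_integral) (simp add: case_prod_beta')
  have Yfin: "Y \<gamma> < \<top>" for \<gamma>
  proof -
    have "Y \<gamma> \<le> epow (\<Sum>k<n. ennreal \<bar>\<gamma> k\<bar> * ennreal \<bar>\<gamma> k\<bar>) (p / 2) * sq_mass p n f"
      unfolding Y_def using p by (intro gauss_avg_Lp_mass_le m) auto
    also have "\<dots> < \<top>" using sq_mass_finite[OF f] p by (auto simp: ennreal_mult_less_top)
    finally show ?thesis .
  qed
  have norm: "(Lp_norm p (\<lambda>x. \<Sum>k<n. complex_of_real (\<gamma> k) * f k x))\<^sup>2 = enn2real (epow (Y \<gamma>) (2 / p))" for \<gamma>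
  proof -
    have "Lp_norm p (\<lambda>x. \<Sum>k<n. complex_of_real (\<gamma> k) * f k x) = enn2real (Y \<gamma>) powr (1 / p)"
      unfolding Y_def gauss_avg_def by (subst Lp_norm_eq) auto
    moreover have "(enn2real (Y \<gamma>) powr (1 / p))\<^sup>2 = enn2real (Y \<gamma>) powr (2 / p)"
      by (simp add: power2_eq_square flip: powr_add)
    ultimately show ?thesis using Yfin[of \<gamma>] by (simp add: epow_def less_top)
  qed
  have "(LINT \<gamma>|gauss_space n. enn2real (epow (Y \<gamma>) (2 / p)))
      = enn2real (\<integral>\<^sup>+\<gamma>. ennreal (enn2real (epow (Y \<gamma>) (2 / p))) \<partial>gauss_space n)"
    by (rule integral_eq_nn_integral) auto
  also have "(\<integral>\<^sup>+\<gamma>. ennreal (enn2real (epow (Y \<gamma>) (2 / p))) \<partial>gauss_space n) = gauss_mass p n f"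
    unfolding gauss_mass_def Y_def[symmetric] using Yfin by (intro nn_integral_cong) simp
  finally have "gauss_norm p n f = sqrt (enn2real (gauss_mass p n f))"
    unfolding gauss_norm_def norm by simp
  then show ?thesis using fin
    by (cases "gauss_mass p n f") (auto simp: epow_ennreal powr_half_sqrt)
qed

text \<open>Square function inequalities become Gaussian ones. Each of the two passages between the
  masses costs C on the level of p-th powers, which gives D = (C C)^(1 / p).\<close>

theorem gauss_norm_le_of_sq_mass_le:
  assumes p: "1 < p"
  shows "\<exists>D>0. \<forall>n (f :: nat \<Rightarrow> 'a::euclidean_space \<Rightarrow> complex) (g :: nat \<Rightarrow> 'a \<Rightarrow> complex) B. (\<forall>k<n. f k \<in> Lp p \<and> g k \<in> Lp p) \<longrightarrow>
    0 \<le> B \<longrightarrow> sq_mass p n g \<le> epow (ennreal B) p * sq_mass p n f \<longrightarrow>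
    gauss_norm p n g \<le> D * B * gauss_norm p n f"
proof -
  obtain C where C: "0 < C"
    "\<And>n (f :: nat \<Rightarrow> 'a \<Rightarrow> complex). (\<And>k. k < n \<Longrightarrow> f k \<in> borel_measurable borel) \<Longrightarrow>
      sq_mass p n f < \<top> \<Longrightarrow> epow (gauss_mass p n f) (p / 2) \<le> ennreal C * sq_mass p n f"
    "\<And>n (f :: nat \<Rightarrow> 'a \<Rightarrow> complex). (\<And>k. k < n \<Longrightarrow> f k \<in> borel_measurable borel) \<Longrightarrow>
      sq_mass p n f < \<top> \<Longrightarrow> sq_mass p n f \<le> ennreal C * epow (gauss_mass p n f) (p / 2)"
    using gauss_mass_equivalence[OF p] by metis
  define D where "D = (C * C) powr (1 / p)"
  have "0 < D" using C(1) by (simp add: D_def)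
  have main: "gauss_norm p n g \<le> D * B * gauss_norm p n f"
    if f: "\<And>k. k < n \<Longrightarrow> f k \<in> Lp p" and g: "\<And>k. k < n \<Longrightarrow> g k \<in> Lp p" and B: "0 \<le> B"
      and le: "sq_mass p n g \<le> epow (ennreal B) p * sq_mass p n f"
    for n B and f g :: "nat \<Rightarrow> 'a \<Rightarrow> complex"
  proof -
    have mass: "epow (gauss_mass p n h) (p / 2) = epow (ennreal (gauss_norm p n h)) p"
      if h: "\<And>k. k < n \<Longrightarrow> h k \<in> Lp p" for h :: "nat \<Rightarrow> 'a \<Rightarrow> complex"
    proof -
      have hm: "\<And>k. k < n \<Longrightarrow> h k \<in> borel_measurable borel" using h Lp_D by blast
      have hf: "sq_mass p n h < \<top>" using sq_mass_finite[OF h] p by simp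
      have "epow (gauss_mass p n h) (p / 2) \<le> ennreal C * sq_mass p n h" using hm hf by (rule C(2))
      also have "\<dots> < \<top>" using hf by (simp add: ennreal_mult_less_top)
      finally have "gauss_mass p n h < \<top>" by simp
      then show ?thesis using ennreal_gauss_norm[OF h p] by (simp add: epow_epow)
    qed
    have fm: "\<And>k. k < n \<Longrightarrow> f k \<in> borel_measurable borel" "\<And>k. k < n \<Longrightarrow> g k \<in> borel_measurable borel"
      using f g Lp_D by blast+
    have fin: "sq_mass p n f < \<top>" "sq_mass p n g < \<top>" using sq_mass_finite[OF f] sq_mass_finite[OF g] p by auto
    have nonneg: "0 \<le> gauss_norm p n f" by (simp add: gauss_norm_def)
    have mg: "epow (gauss_mass p n g) (p / 2) = epow (ennreal (gauss_norm p n g)) p" by (rule mass) (rule g)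
    have mf: "epow (gauss_mass p n f) (p / 2) = epow (ennreal (gauss_norm p n f)) p" by (rule mass) (rule f)
    have "epow (gauss_mass p n g) (p / 2) \<le> ennreal C * sq_mass p n g"
      by (rule C(2)) (use fm fin in auto)
    then have "epow (ennreal (gauss_norm p n g)) p \<le> ennreal C * sq_mass p n g" by (simp only: mg)
    also have "\<dots> \<le> ennreal C * (epow (ennreal B) p * sq_mass p n f)" using le by (rule mult_left_mono) simp
    also have "\<dots> \<le> ennreal C * (epow (ennreal B) p * (ennreal C * epow (ennreal (gauss_norm p n f)) p))"
    proof -
      have "sq_mass p n f \<le> ennreal C * epow (gauss_mass p n f) (p / 2)"
        by (rule C(3)) (use fm fin in auto)
      then show ?thesis unfolding mf by (intro mult_left_mono) auto
    qed
    also have "\<dots> = ennreal (C * C) * epow (ennreal B) p * epow (ennreal (gauss_norm p n f)) p"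
      using C(1) by (simp only: ennreal_mult less_imp_le ac_simps)
    also have "ennreal (C * C) = epow (ennreal D) p"
      using C(1) p by (simp add: D_def epow_ennreal powr_powr)
    also have "epow (ennreal D) p * epow (ennreal B) p * epow (ennreal (gauss_norm p n f)) p
        = epow (ennreal D * ennreal B * ennreal (gauss_norm p n f)) p"
      using p by (simp only: epow_mult)
    finally have "ennreal (gauss_norm p n g) \<le> ennreal D * ennreal B * ennreal (gauss_norm p n f)"
      using p by (subst (asm) epow_le_iff) auto
    also have "\<dots> = ennreal (D * B * gauss_norm p n f)"
      using \<open>0 < D\<close> B nonneg by (simp add: ennreal_mult)
    finally show ?thesis using \<open>0 < D\<close> B nonneg by (subst (asm) ennreal_le_iff) auto
  qed
  show ?thesis
  proof (intro exI[of _ D] conjI allI impI)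
    fix n B and f g :: "nat \<Rightarrow> 'a \<Rightarrow> complex"
    assume a: "\<forall>k<n. f k \<in> Lp p \<and> g k \<in> Lp p" "0 \<le> B" "sq_mass p n g \<le> epow (ennreal B) p * sq_mass p n f"
    show "gauss_norm p n g \<le> D * B * gauss_norm p n f" by (rule main) (use a in auto)
  qed fact
qed

section \<open>The Fourier transform of the Poisson kernel\<close>

declare gauss_component_measurable [measurable del]

lemma borel_measurable_cis [measurable]: "cis \<in> borel_measurable borel"
  by (intro borel_measurable_continuous_onI continuous_intros)

lemma has_bochner_integral_Gamma:
  fixes s b :: real
  assumes "0 < s" "0 < b"
  shows "has_bochner_integral lborel (\<lambda>u. indicator {0<..} u * (u powr (s - 1) * exp (- (b * u)))) (Gamma s * b powr (- s))"
proof (rule has_bochner_integral_nn_integral)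
  have "ennreal (Gamma s) = (\<integral>\<^sup>+t. ennreal (indicator {0<..} t * t powr (s - 1) / exp t) \<partial>lborel)"
    unfolding Gamma_conv_nn_integral_real[OF \<open>0 < s\<close>]
  proof (rule nn_integral_cong_AE)
    show "AE t in lborel. ennreal (indicator {0..} t * t powr (s - 1) / exp t) = ennreal (indicator {0<..} t * t powr (s - 1) / exp t)"
      using AE_lborel_singleton[of "0::real"] by eventually_elim (auto simp: indicator_def)
  qed
  also have "\<dots> = ennreal (\<bar>b\<bar> ^ DIM(real)) * (\<integral>\<^sup>+t. ennreal (indicator {0<..} (0 + b *\<^sub>R t) * (0 + b *\<^sub>R t) powr (s - 1) / exp (0 + b *\<^sub>R t)) \<partial>lborel)"
    using assms by (intro nn_integral_lborel_affine) auto
  also have "\<dots> = (\<integral>\<^sup>+t. ennreal b * ennreal (indicator {0<..} (b * t) * (b * t) powr (s - 1) / exp (b * t)) \<partial>lborel)"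
    using assms by (subst nn_integral_cmult) auto
  also have "\<dots> = (\<integral>\<^sup>+t. ennreal (b powr s) * ennreal (indicator {0<..} t * (t powr (s - 1) * exp (- (b * t)))) \<partial>lborel)"
  proof (rule nn_integral_cong)
    fix t :: real
    show "ennreal b * ennreal (indicator {0<..} (b * t) * (b * t) powr (s - 1) / exp (b * t))
        = ennreal (b powr s) * ennreal (indicator {0<..} t * (t powr (s - 1) * exp (- (b * t))))"
    proof (cases "0 < t")
      case True
      have "b * (b powr (s - 1)) = b powr s" using assms by (simp add: powr_diff)
      then show ?thesis using True assms
        by (simp add: powr_mult exp_minus inverse_eq_divide flip: ennreal_mult)
    qed (use assms in \<open>auto simp: indicator_def zero_less_mult_iff\<close>)
  qed
  also have "\<dots> = ennreal (b powr s) * (\<integral>\<^sup>+t. ennreal (indicator {0<..} t * (t powr (s - 1) * exp (- (b * t)))) \<partial>lborel)"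
    by (rule nn_integral_cmult) measurable
  finally have "ennreal (b powr (- s)) * ennreal (Gamma s) = ennreal (b powr (- s)) * (ennreal (b powr s) *
      (\<integral>\<^sup>+t. ennreal (indicator {0<..} t * (t powr (s - 1) * exp (- (b * t)))) \<partial>lborel))" by simp
  also have "\<dots> = (\<integral>\<^sup>+t. ennreal (indicator {0<..} t * (t powr (s - 1) * exp (- (b * t)))) \<partial>lborel)"
    using assms by (simp add: mult.assoc[symmetric] flip: ennreal_mult powr_add)
  finally show "(\<integral>\<^sup>+t. ennreal (indicator {0<..} t * (t powr (s - 1) * exp (- (b * t)))) \<partial>lborel) = ennreal (Gamma s * b powr (- s))"
    using assms by (simp add: ennreal_mult' mult.commute Gamma_real_nonneg)
qed (use assms in \<open>auto simp: Gamma_real_nonneg\<close>)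

text \<open>The characteristic function of the standard normal distribution, rescaled by c = sqrt (2
  a).\<close>

lemma gaussian_fourier_real:
  fixes a x :: real
  assumes a: "0 < a"
  shows "integrable lborel (\<lambda>s. cis (x * s) * complex_of_real (exp (- (a * s\<^sup>2))))"
    "(LINT s|lborel. cis (x * s) * complex_of_real (exp (- (a * s\<^sup>2)))) = complex_of_real (sqrt (pi / a) * exp (- (x\<^sup>2 / (4 * a))))"
proof -
  define c where "c = sqrt (2 * a)"
  have c: "0 < c" "c\<^sup>2 = 2 * a" using a by (auto simp: c_def)
  define F where "F t = complex_of_real (std_normal_density t) * cis (x / c * t)" for t
  have "complex_of_real (exp (- ((x / c)\<^sup>2) / 2)) = (CLINT t|std_normal_distribution. iexp (x / c * t))"
    using char_std_normal_distribution unfolding char_def by metis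
  also have "\<dots> = (LINT t|lborel. F t)"
    unfolding F_def by (subst integral_density) (auto simp: normal_density_nonneg scaleR_conv_of_real cis_conv_exp)
  finally have F: "(LINT t|lborel. F t) = complex_of_real (exp (- (x\<^sup>2 / (4 * a))))"
    using c by (simp add: power_divide)
  have [measurable]: "F \<in> borel_measurable borel" unfolding F_def[abs_def] by measurable
  have "integrable lborel F"
  proof (rule Bochner_Integration.integrable_bound)
    show "integrable lborel (\<lambda>x. std_normal_density x)" using integrable_std_normal_moment[of 0] by simp
  qed (auto simp: F_def norm_mult normal_density_nonneg)
  then have int: "integrable lborel (\<lambda>s. F (0 + c * s))"
    using c by (subst lborel_integrable_real_affine_iff) auto
  have Fc: "complex_of_real (sqrt (2 * pi)) * F (0 + c * s) = cis (x * s) * complex_of_real (exp (- (a * s\<^sup>2)))" for s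
  proof -
    have "sqrt (2 * pi) * std_normal_density (c * s) = exp (- (a * s\<^sup>2))"
      using c by (simp add: std_normal_density_def power_mult_distrib)
    moreover have "complex_of_real (sqrt (2 * pi)) * F (0 + c * s)
        = complex_of_real (sqrt (2 * pi) * std_normal_density (c * s)) * cis (x / c * (c * s))"
      unfolding F_def by simp
    ultimately show ?thesis using c by (simp add: mult.commute)
  qed
  show "integrable lborel (\<lambda>s. cis (x * s) * complex_of_real (exp (- (a * s\<^sup>2))))"
    unfolding Fc[symmetric] using int by simp
  have "(LINT s|lborel. cis (x * s) * complex_of_real (exp (- (a * s\<^sup>2))))
      = complex_of_real (sqrt (2 * pi)) * (LINT s|lborel. F (0 + c * s))"
    unfolding Fc[symmetric] by simp
  also have "(LINT s|lborel. F (0 + c * s)) = complex_of_real (1 / c * exp (- (x\<^sup>2 / (4 * a))))"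
    using lborel_integral_real_affine[of c F 0] c F by (simp add: scaleR_conv_of_real field_simps)
  also have "complex_of_real (sqrt (2 * pi)) * \<dots> = complex_of_real (sqrt (2 * pi) / c * exp (- (x\<^sup>2 / (4 * a))))" by simp
  also have "sqrt (2 * pi) / c = sqrt (pi / a)"
    unfolding c_def by (simp flip: real_sqrt_divide)
  finally show "(LINT s|lborel. cis (x * s) * complex_of_real (exp (- (a * s\<^sup>2)))) = complex_of_real (sqrt (pi / a) * exp (- (x\<^sup>2 / (4 * a))))" .
qed

lemma cis_sum: "finite A \<Longrightarrow> cis (\<Sum>i\<in>A. f i) = (\<Prod>i\<in>A. cis (f i))"
  by (induction A rule: finite_induct) (auto simp: cis_mult[symmetric])

text \<open>Lebesgue measure is the image of a product measure under the coordinate map, and both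
  the character and the Gaussian factor over \<open>Basis\<close>.\<close>

lemma gaussian_fourier:
  fixes x :: "'a::euclidean_space"
  assumes a: "0 < a"
  shows "integrable lborel (\<lambda>\<xi>. cis (x \<bullet> \<xi>) * complex_of_real (exp (- (a * (norm \<xi>)\<^sup>2))))"
    "(LINT \<xi>|lborel. cis (x \<bullet> \<xi>) * complex_of_real (exp (- (a * (norm \<xi>)\<^sup>2))))
      = complex_of_real ((pi / a) powr (real DIM('a) / 2) * exp (- ((norm x)\<^sup>2 / (4 * a))))"
proof -
  interpret product_sigma_finite "\<lambda>_::'a. lborel :: real measure" ..
  define g where "g b s = cis ((x \<bullet> b) * s) * complex_of_real (exp (- (a * s\<^sup>2)))" for b :: 'a and s :: real
  define T where "T f = (\<Sum>b\<in>Basis. f b *\<^sub>R b)" for f :: "'a \<Rightarrow> real"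
  define h where "h \<xi> = cis (x \<bullet> \<xi>) * complex_of_real (exp (- (a * (norm \<xi>)\<^sup>2)))" for \<xi> :: 'a
  have [measurable]: "T \<in> (\<Pi>\<^sub>M b\<in>Basis. lborel) \<rightarrow>\<^sub>M borel" unfolding T_def by measurable
  have [measurable]: "h \<in> borel_measurable borel" unfolding h_def
    by (intro borel_measurable_continuous_onI continuous_intros)
  have Tb: "T f \<bullet> b = f b" if "b \<in> Basis" for f b
    using that unfolding T_def by (rule inner_sum_left_Basis)
  have hT: "h (T f) = (\<Prod>b\<in>Basis. g b (f b))" for f
  proof -
    have "x \<bullet> T f = (\<Sum>b\<in>Basis. (x \<bullet> b) * f b)" by (subst euclidean_inner) (simp add: Tb)
    moreover have "(norm (T f))\<^sup>2 = (\<Sum>b\<in>Basis. (f b)\<^sup>2)"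
      unfolding power2_norm_eq_inner by (subst euclidean_inner) (simp add: Tb power2_eq_square)
    ultimately show ?thesis
      unfolding h_def g_def
      by (simp add: cis_sum prod.distrib sum_distrib_left sum_negf[symmetric] exp_sum)
  qed
  have ig: "integrable lborel (g b)" for b unfolding g_def by (rule gaussian_fourier_real(1)[OF a])
  have int: "integrable (\<Pi>\<^sub>M b\<in>Basis. lborel) (\<lambda>f. \<Prod>b\<in>Basis. g b (f b))"
    using ig by (intro product_integrable_prod) auto
  have "integrable (distr (\<Pi>\<^sub>M b\<in>Basis. lborel) borel T) h"
    by (subst integrable_distr_eq) (use int hT in auto)
  then show "integrable lborel (\<lambda>\<xi>. cis (x \<bullet> \<xi>) * complex_of_real (exp (- (a * (norm \<xi>)\<^sup>2))))"
    by (subst lborel_eq) (simp add: h_def[symmetric] T_def[symmetric])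
  have "(LINT \<xi>|lborel. h \<xi>) = (LINT \<xi>|distr (\<Pi>\<^sub>M b\<in>Basis. lborel) borel T. h \<xi>)"
    by (subst lborel_eq) (simp add: T_def[abs_def])
  also have "\<dots> = (LINT f|(\<Pi>\<^sub>M b\<in>Basis. lborel). h (T f))" by (rule integral_distr) measurable
  also have "\<dots> = (\<Prod>b\<in>Basis. LINT s|lborel. g b s)"
    unfolding hT using ig by (intro product_integral_prod) auto
  also have "\<dots> = (\<Prod>b\<in>Basis. complex_of_real (sqrt (pi / a) * exp (- ((x \<bullet> b)\<^sup>2 / (4 * a)))))"
    unfolding g_def by (intro prod.cong refl gaussian_fourier_real(2)[OF a])
  also have "\<dots> = complex_of_real (sqrt (pi / a) ^ DIM('a) * exp (- ((norm x)\<^sup>2 / (4 * a))))"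
  proof -
    have "(\<Prod>b\<in>Basis. exp (- ((x \<bullet> b)\<^sup>2 / (4 * a)))) = exp (- ((norm x)\<^sup>2 / (4 * a)))"
      unfolding power2_norm_eq_inner by (subst euclidean_inner)
        (simp add: exp_sum[symmetric] sum_negf sum_divide_distrib power2_eq_square)
    then show ?thesis by (simp add: prod.distrib flip: of_real_prod)
  qed
  also have "sqrt (pi / a) ^ DIM('a) = (pi / a) powr (real DIM('a) / 2)"
    using a by (simp add: powr_half_sqrt[symmetric] powr_realpow[symmetric] powr_powr)
  finally show "(LINT \<xi>|lborel. cis (x \<bullet> \<xi>) * complex_of_real (exp (- (a * (norm \<xi>)\<^sup>2))))
      = complex_of_real ((pi / a) powr (real DIM('a) / 2) * exp (- ((norm x)\<^sup>2 / (4 * a))))"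
    unfolding h_def .
qed

lemma gauss_integral_UNIV:
  "(\<lambda>x::real. exp (- x\<^sup>2)) absolutely_integrable_on UNIV" "integral UNIV (\<lambda>x::real. exp (- x\<^sup>2)) = sqrt pi"
proof -
  have "complex_of_real (LINT s|lborel. exp (- s\<^sup>2)) = complex_of_real (sqrt pi)"
    using gaussian_fourier_real(2)[of 1 0] by simp
  then have L: "(LINT s|lborel. exp (- s\<^sup>2)) = sqrt pi" using of_real_eq_iff by blast
  have I: "integrable lborel (\<lambda>s::real. exp (- s\<^sup>2))"
    using gaussian_fourier_real(1)[of 1 0] by (simp add: complex_of_real_integrable_eq)
  then have "integrable lebesgue (\<lambda>s::real. exp (- s\<^sup>2))" by (simp add: integrable_completion)
  then show *: "(\<lambda>x::real. exp (- x\<^sup>2)) absolutely_integrable_on UNIV"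
    by (simp add: set_integrable_def)
  show "integral UNIV (\<lambda>x::real. exp (- x\<^sup>2)) = sqrt pi"
    using has_integral_integral_lborel[OF I] L by (auto simp: integral_unique)
qed

text \<open>The substitutions \<open>x = \<surd>u - c/\<surd>u\<close> and \<open>u \<mapsto> c\<^sup>2/u\<close> reduce the integral to the Gaussian one.\<close>

lemma subordination:
  assumes c: "0 < c"
  shows "has_bochner_integral lborel (\<lambda>u. indicator {0<..} u * (exp (- u - c\<^sup>2 / u) / sqrt u)) (sqrt pi * exp (- (2 * c)))"
proof -
  define S where "S = {0::real<..}"
  have S: "S \<in> sets lebesgue" by (simp add: S_def)
  define g where "g u = sqrt u - c / sqrt u" for u
  define g' where "g' u = (1 / sqrt u + c / (u * sqrt u)) / 2" for u
  define w1 where "w1 u = exp (- u - c\<^sup>2 / u) / sqrt u" for u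
  define w2 where "w2 u = c * exp (- u - c\<^sup>2 / u) / (u * sqrt u)" for u
  have der: "(g has_field_derivative g' u) (at u within S)" if "u \<in> S" for u
  proof -
    have u: "0 < u" using that by (simp add: S_def)
    have "((\<lambda>u. sqrt u - c / sqrt u) has_real_derivative
        inverse (sqrt u) / 2 - (0 * sqrt u - c * (inverse (sqrt u) / 2)) / (sqrt u * sqrt u)) (at u)"
      using u by (intro DERIV_diff DERIV_divide DERIV_const DERIV_real_sqrt) auto
    moreover have "inverse (sqrt u) / 2 - (0 * sqrt u - c * (inverse (sqrt u) / 2)) / (sqrt u * sqrt u) = g' u"
      using u by (simp add: g'_def field_simps)
    ultimately show ?thesis unfolding g_def[abs_def] by (metis has_field_derivative_at_within)
  qed
  have "strict_mono_on S g"
  proof (rule strict_mono_onI)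
    fix u v assume "u \<in> S" "v \<in> S" "u < v"
    then have "sqrt u < sqrt v" "c / sqrt v < c / sqrt u"
      using c by (auto simp: S_def intro!: divide_strict_left_mono mult_pos_pos)
    then show "g u < g v" unfolding g_def by linarith
  qed
  then have inj: "inj_on g S" by (rule strict_mono_on_imp_inj_on)
  have img: "g ` S = UNIV"
  proof safe
    fix y :: real
    define r where "r = (y + sqrt (y\<^sup>2 + 4 * c)) / 2"
    have "\<bar>y\<bar> < sqrt (y\<^sup>2 + 4 * c)" using c by (intro real_less_rsqrt) simp
    then have r: "0 < r" by (simp add: r_def abs_if split: if_splits)
    have "(sqrt (y\<^sup>2 + 4 * c))\<^sup>2 = y\<^sup>2 + 4 * c" using c by simp
    moreover have "2 * r = y + sqrt (y\<^sup>2 + 4 * c)" by (simp add: r_def field_simps)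
    then have "sqrt (y\<^sup>2 + 4 * c) = 2 * r - y" by linarith
    ultimately have "(2 * r - y)\<^sup>2 = y\<^sup>2 + 4 * c" by simp
    then have "r * r - c = y * r" by (simp add: power2_eq_square algebra_simps)
    then have "g (r\<^sup>2) = y" using r by (simp add: g_def field_simps)
    then show "y \<in> g ` S" using r by (intro image_eqI[of _ _ "r\<^sup>2"]) (auto simp: S_def)
  qed auto
  \<comment> \<open>Since (g u)^2 = u - 2 c + c^2 / u, the Gaussian integral turns into that of w1 +
    w2 and not of w1 alone. The involution u -> c^2 / u exchanges w1 and w2, so each of them carries
    half of the value.\<close>
  have fg: "\<bar>g' u\<bar> * exp (- (g u)\<^sup>2) = exp (2 * c) / 2 * (w1 u + w2 u)" if "u \<in> S" for u
  proof -
    have u: "0 < u" using that by (simp add: S_def)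
    have "(g u)\<^sup>2 = u - 2 * c + c\<^sup>2 / u"
      using u by (simp add: g_def power2_diff power_divide)
    then have "exp (- (g u)\<^sup>2) = exp (2 * c) * exp (- u - c\<^sup>2 / u)" by (simp flip: exp_add)
    moreover have "\<bar>g' u\<bar> = g' u" using u c by (simp add: g'_def)
    ultimately show ?thesis by (simp add: g'_def w1_def w2_def algebra_simps add_divide_distrib)
  qed
  have "(\<lambda>u. \<bar>g' u\<bar> * exp (- (g u)\<^sup>2)) absolutely_integrable_on S \<and> integral S (\<lambda>u. \<bar>g' u\<bar> * exp (- (g u)\<^sup>2)) = sqrt pi"
    by (subst has_absolute_integral_change_of_variables_1'[OF S der inj]) (simp_all add: img gauss_integral_UNIV)
  moreover have "(\<lambda>u. \<bar>g' u\<bar> * exp (- (g u)\<^sup>2)) absolutely_integrable_on S \<longleftrightarrow> (\<lambda>u. exp (2 * c) / 2 * (w1 u + w2 u)) absolutely_integrable_on S"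
    by (rule set_integrable_cong) (use fg in auto)
  moreover have "integral S (\<lambda>u. \<bar>g' u\<bar> * exp (- (g u)\<^sup>2)) = integral S (\<lambda>u. exp (2 * c) / 2 * (w1 u + w2 u))"
    by (rule integral_cong) (use fg in auto)
  ultimately have A: "(\<lambda>u. exp (2 * c) / 2 * (w1 u + w2 u)) absolutely_integrable_on S"
    "integral S (\<lambda>u. exp (2 * c) / 2 * (w1 u + w2 u)) = sqrt pi" by auto
  then have "(\<lambda>u. 2 * exp (- (2 * c)) * (exp (2 * c) / 2 * (w1 u + w2 u))) absolutely_integrable_on S"
    by (intro set_integrable_mult_right) auto
  then have sum: "(\<lambda>u. w1 u + w2 u) absolutely_integrable_on S" by (simp add: mult.assoc[symmetric] flip: exp_add)
  have w1: "w1 absolutely_integrable_on S"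
  proof (rule measurable_bounded_by_integrable_imp_absolutely_integrable)
    show "w1 \<in> borel_measurable (lebesgue_on S)"
      by (rule continuous_imp_measurable_on_sets_lebesgue[OF _ S])
        (auto simp: w1_def[abs_def] S_def intro!: continuous_intros)
    show "(\<lambda>u. w1 u + w2 u) integrable_on S" using sum by (rule set_lebesgue_integral_eq_integral(1))
    show "norm (w1 u) \<le> w1 u + w2 u" if "u \<in> S" for u
      using that c by (simp add: w1_def w2_def S_def)
  qed (rule S)
  have w2: "w2 absolutely_integrable_on S \<and> integral S w2 = integral S w1"
  proof -
    define h where "h u = c\<^sup>2 / u" for u
    define h' where "h' u = - (c\<^sup>2 / u\<^sup>2)" for u
    have derh: "(h has_field_derivative h' u) (at u within S)" if "u \<in> S" for u
      using that unfolding h_def h'_def S_def by (auto intro!: derivative_eq_intros simp: power2_eq_square)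
    have injh: "inj_on h S" using c by (auto simp: inj_on_def h_def S_def)
    have imgh: "h ` S = S"
    proof safe
      fix u assume "u \<in> S" then show "h u \<in> S" using c by (auto simp: S_def h_def)
      from \<open>u \<in> S\<close> show "u \<in> h ` S" using c by (intro image_eqI[of _ _ "c\<^sup>2 / u"]) (auto simp: S_def h_def)
    qed
    have "(\<lambda>u. \<bar>h' u\<bar> * w1 (h u)) absolutely_integrable_on S \<and> integral S (\<lambda>u. \<bar>h' u\<bar> * w1 (h u)) = integral S w1"
      by (subst has_absolute_integral_change_of_variables_1'[OF S derh injh]) (simp_all add: imgh w1)
    moreover have hw: "\<bar>h' u\<bar> * w1 (h u) = w2 u" if "u \<in> S" for u
    proof -
      have u: "0 < u" using that by (simp add: S_def)
      define q where "q = sqrt u"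
      define E where "E = exp (- u - c\<^sup>2 / u)"
      have q: "0 < q" "u = q * q" using u by (auto simp: q_def)
      have "- (c\<^sup>2 / u) - c\<^sup>2 / (c\<^sup>2 / u) = - u - c\<^sup>2 / u" using u c by simp
      moreover have "sqrt (c\<^sup>2 / u) = c / q" using c by (simp add: real_sqrt_divide q_def)
      ultimately have "w1 (h u) = E / (c / q)" by (simp only: w1_def h_def E_def)
      moreover have "\<bar>h' u\<bar> = c\<^sup>2 / u\<^sup>2" by (simp add: h'_def)
      moreover have "w2 u = c * E / (u * q)" by (simp add: w2_def E_def q_def)
      moreover have "c\<^sup>2 / u\<^sup>2 * (E / (c / q)) = c * E / (u * q)"
        using q(1) c unfolding q(2) by (simp add: field_simps power2_eq_square)
      ultimately show ?thesis by simp
    qed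
    moreover have "(\<lambda>u. \<bar>h' u\<bar> * w1 (h u)) absolutely_integrable_on S \<longleftrightarrow> w2 absolutely_integrable_on S"
      by (rule set_integrable_cong) (use hw in auto)
    moreover have "integral S (\<lambda>u. \<bar>h' u\<bar> * w1 (h u)) = integral S w2"
      by (rule integral_cong) (use hw in auto)
    ultimately show ?thesis by auto
  qed
  have i1: "w1 integrable_on S" and i2: "w2 integrable_on S"
    using w1 w2 by (auto intro: set_lebesgue_integral_eq_integral(1))
  have "integral S (\<lambda>u. exp (2 * c) / 2 * (w1 u + w2 u)) = exp (2 * c) / 2 * (integral S w1 + integral S w2)"
    using i1 i2 by (simp add: integral_add)
  then have "exp (2 * c) * integral S w1 = sqrt pi" using A(2) w2 by simp
  then have "integral S w1 = sqrt pi * exp (- (2 * c))" by (simp add: exp_minus field_simps)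
  then have "(w1 has_integral (sqrt pi * exp (- (2 * c)))) S" using i1 by (metis integrable_integral)
  then have "(\<integral>\<^sup>+u. ennreal (indicator S u * w1 u) \<partial>lborel) = ennreal (sqrt pi * exp (- (2 * c)))"
    by (rule nn_integral_has_integral_lebesgue[rotated]) (auto simp: w1_def S_def)
  then show ?thesis unfolding w1_def S_def
    by (intro has_bochner_integral_nn_integral) (auto simp: indicator_def)
qed

lemma poly_le_exp:
  assumes "0 < \<delta>"
  obtains C :: real where "0 < C" "\<And>r. 0 \<le> r \<Longrightarrow> (1 + r) ^ k \<le> C * exp (\<delta> * r)"
proof -
  define \<eta> where "\<eta> = \<delta> / real (Suc k)"
  have \<eta>: "0 < \<eta>" using assms by (simp add: \<eta>_def)
  have "(1 + r) ^ k \<le> (exp \<delta> / \<eta> ^ k) * exp (\<delta> * r)" if r: "0 \<le> r" for r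
  proof -
    have "\<eta> * (1 + r) \<le> exp (\<eta> * (1 + r))" using exp_ge_add_one_self[of "\<eta> * (1 + r)"] by linarith
    then have "(\<eta> * (1 + r)) ^ k \<le> exp (\<eta> * (1 + r)) ^ k" using r \<eta> by (intro power_mono) auto
    also have "\<dots> = exp (real k * (\<eta> * (1 + r)))" by (simp add: exp_of_nat_mult)
    also have "\<dots> \<le> exp (\<delta> * (1 + r))"
    proof -
      have "real k * \<eta> \<le> \<delta>" using assms by (simp add: \<eta>_def field_simps)
      then have "real k * \<eta> * (1 + r) \<le> \<delta> * (1 + r)" using r by (intro mult_right_mono) auto
      then show ?thesis by (simp add: mult.assoc)
    qed
    also have "\<dots> = exp \<delta> * exp (\<delta> * r)" by (simp add: distrib_left exp_add)
    finally have "\<eta> ^ k * (1 + r) ^ k \<le> exp \<delta> * exp (\<delta> * r)" by (simp only: power_mult_distrib)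
    then show ?thesis using \<eta> by (simp add: pos_le_divide_eq mult.commute)
  qed
  then show ?thesis using that[of "exp \<delta> / \<eta> ^ k"] \<eta> by simp
qed

lemma integrable_decay:
  "integrable lborel (\<lambda>x::'a::euclidean_space. (1 + norm x) powr (- (real DIM('a) + 1)))"
  using nn_integral_decay[where 'a='a, of 1] by (intro integrableI_bounded) auto

lemma integrable_poly_exp:
  assumes "0 < \<delta>"
  shows "integrable lborel (\<lambda>\<xi>::'a::euclidean_space. (1 + norm \<xi>) ^ m * exp (- (\<delta> * norm \<xi>)))"
proof -
  obtain C where C: "0 < C" "\<And>r. 0 \<le> r \<Longrightarrow> (1 + r) ^ (m + DIM('a) + 1) \<le> C * exp (\<delta> * r)"
    using poly_le_exp[OF assms, of "m + DIM('a) + 1"] by blast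
  show ?thesis
  proof (rule Bochner_Integration.integrable_bound)
    show "integrable lborel (\<lambda>x::'a. C * (1 + norm x) powr (- (real DIM('a) + 1)))"
      using integrable_decay[where 'a='a] by simp
    show "AE x::'a in lborel. norm ((1 + norm x) ^ m * exp (- (\<delta> * norm x))) \<le> norm (C * (1 + norm x) powr (- (real DIM('a) + 1)))"
    proof (rule AE_I2)
      fix x :: 'a
      have p: "0 < 1 + norm x" by (simp add: add_pos_nonneg)
      define P where "P = (1 + norm x) ^ (DIM('a) + 1)"
      have "0 < P" using p by (simp add: P_def)
      have "(1 + norm x) ^ m * P \<le> C * exp (\<delta> * norm x)"
        using C(2)[of "norm x"] unfolding P_def by (simp only: power_add[symmetric] add.assoc norm_ge_zero)
      then have "((1 + norm x) ^ m * P) * exp (- (\<delta> * norm x)) \<le> (C * exp (\<delta> * norm x)) * exp (- (\<delta> * norm x))"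
        by (rule mult_right_mono) simp
      also have "\<dots> = C" by (simp add: mult.assoc flip: exp_add)
      finally have "(1 + norm x) ^ m * exp (- (\<delta> * norm x)) \<le> C / P"
        using \<open>0 < P\<close> by (simp add: pos_le_divide_eq ac_simps)
      also have "P = (1 + norm x) powr (real DIM('a) + 1)"
        using powr_realpow[OF p, of "DIM('a) + 1"] by (simp add: P_def add.commute)
      finally show "norm ((1 + norm x) ^ m * exp (- (\<delta> * norm x))) \<le> norm (C * (1 + norm x) powr (- (real DIM('a) + 1)))"
        using C(1) unfolding powr_minus_divide by simp
    qed
  qed measurable
qed

text \<open>\<open>poisson_kernel\<close> with the complex time z = \<open>cis \<theta> * t\<close>
  as its parameter: the variable in which the kernel is holomorphic.\<close>

definition poisson :: "complex \<Rightarrow> 'a::euclidean_space \<Rightarrow> complex" where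
  "poisson z x = complex_of_real (poisson_const DIM('a)) * z /
     (z\<^sup>2 + complex_of_real ((norm x)\<^sup>2)) powr complex_of_real ((real DIM('a) + 1) / 2)"

lemma poisson_kernel_eq: "poisson_kernel t \<theta> x = poisson (cis \<theta> * complex_of_real t) x"
  by (simp add: poisson_kernel_def poisson_def)

lemma poisson_const_pos: "0 < poisson_const d"
  by (simp add: poisson_const_def Gamma_real_pos)

text \<open>If the base were real, then Im z = 0 because Re z > 0, and the base would be positive.
  So the principal power stays off its branch cut and \<open>poisson\<close> is holomorphic in
  z.\<close>

lemma poisson_base_notin:
  assumes "0 < Re z" "0 \<le> s"
  shows "z\<^sup>2 + complex_of_real s \<notin> \<real>\<^sub>\<le>\<^sub>0"
proof
  assume "z\<^sup>2 + complex_of_real s \<in> \<real>\<^sub>\<le>\<^sub>0"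
  then have "Re (z\<^sup>2) + s \<le> 0" "Im (z\<^sup>2) = 0" by (auto simp: complex_nonpos_Reals_iff)
  moreover from this have "Im z = 0" using assms by (simp add: power2_eq_square)
  ultimately have "Re z * Re z \<le> 0" using assms by (simp add: power2_eq_square)
  then show False using assms(1) by (simp add: mult_le_0_iff)
qed

lemma norm_powr_of_real: "cmod (w powr complex_of_real a) = cmod w powr a"
  by (cases "w = 0") (auto simp: powr_def)

text \<open>The left factor in (s + iw)(s - iw) is the small one when Im w \<ge> 0: its modulus is
  at least |s - 1| and, through its imaginary part, at least Re w, hence at least half of their sum.
  The other factor is at least (1 + s) / 2. For Im w < 0 complex conjugation exchanges the
  two.\<close>

lemma square_plus_square_ge_unit:
  assumes "cmod w = 1" "0 \<le> Re w" "0 \<le> s"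
  shows "(\<bar>s - 1\<bar> + Re w) * (1 + s) / 4 \<le> cmod (w\<^sup>2 + complex_of_real (s\<^sup>2))"
proof -
  have unit: "(Re w)\<^sup>2 + (Im w)\<^sup>2 = 1" using assms(1) by (simp add: cmod_def)
  have key: "(\<bar>s - 1\<bar> + Re w) * (1 + s) / 4 \<le> cmod (complex_of_real s + \<i> * v) * cmod (complex_of_real s - \<i> * v)"
    if v: "Re v = Re w" "Im v \<ge> 0" "(Re v)\<^sup>2 + (Im v)\<^sup>2 = 1" for v
  proof -
    have Re: "\<bar>Re v\<bar> = Re w" using v assms by simp
    have a2: "(cmod (complex_of_real s + \<i> * v))\<^sup>2 = (s - 1)\<^sup>2 + 2 * s * (1 - Im v)"
      unfolding cmod_power2 using v(3) by (simp add: power2_eq_square algebra_simps)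
    have b2: "(cmod (complex_of_real s - \<i> * v))\<^sup>2 = s\<^sup>2 + 1 + 2 * s * Im v"
      unfolding cmod_power2 using v(3) by (simp add: power2_eq_square algebra_simps)
    have "(Im v)\<^sup>2 \<le> 1\<^sup>2" using v(3) by (metis add_increasing order_refl zero_le_power2 power_one)
    then have "Im v \<le> 1" by (rule power2_le_imp_le) simp
    then have "\<bar>s - 1\<bar>\<^sup>2 \<le> (cmod (complex_of_real s + \<i> * v))\<^sup>2" using a2 assms by simp
    then have a: "\<bar>s - 1\<bar> \<le> cmod (complex_of_real s + \<i> * v)" by (rule power2_le_imp_le) simp
    have a': "Re w \<le> cmod (complex_of_real s + \<i> * v)"
      using abs_Im_le_cmod[of "complex_of_real s + \<i> * v"] Re by simp
    have "((1 + s) / 2)\<^sup>2 \<le> (cmod (complex_of_real s - \<i> * v))\<^sup>2"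
    proof -
      have "0 \<le> (s - 1)\<^sup>2 + 2 * s\<^sup>2 + 2 + 8 * (s * Im v)" using assms v by (intro add_nonneg_nonneg mult_nonneg_nonneg) auto
      then show ?thesis unfolding b2 by (simp add: power2_eq_square field_simps)
    qed
    then have b: "(1 + s) / 2 \<le> cmod (complex_of_real s - \<i> * v)" by (rule power2_le_imp_le) simp
    have "(\<bar>s - 1\<bar> + Re w) / 2 \<le> cmod (complex_of_real s + \<i> * v)" using a a' by simp
    then have "(\<bar>s - 1\<bar> + Re w) / 2 * ((1 + s) / 2) \<le> cmod (complex_of_real s + \<i> * v) * cmod (complex_of_real s - \<i> * v)"
      using b assms by (intro mult_mono) auto
    then show ?thesis by simp
  qed
  have fact: "cmod (w\<^sup>2 + complex_of_real (s\<^sup>2)) = cmod (complex_of_real s + \<i> * w) * cmod (complex_of_real s - \<i> * w)"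
  proof -
    have "w\<^sup>2 + complex_of_real (s\<^sup>2) = (complex_of_real s + \<i> * w) * (complex_of_real s - \<i> * w)"
      by (simp add: algebra_simps power2_eq_square)
    then show ?thesis by (simp only: norm_mult)
  qed
  show ?thesis
  proof (cases "0 \<le> Im w")
    case True
    then show ?thesis unfolding fact using key[of w] unit by simp
  next
    case False
    define v where "v = cnj w"
    have 1: "cmod (complex_of_real s + \<i> * v) = cmod (complex_of_real s - \<i> * w)"
      unfolding v_def using complex_mod_cnj[of "complex_of_real s - \<i> * w"] by simp
    have 2: "cmod (complex_of_real s - \<i> * v) = cmod (complex_of_real s + \<i> * w)"
      unfolding v_def using complex_mod_cnj[of "complex_of_real s + \<i> * w"] by simp
    have "Re v = Re w" "0 \<le> Im v" "(Re v)\<^sup>2 + (Im v)\<^sup>2 = 1" using False unit by (auto simp: v_def)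
    from key[OF this] show ?thesis unfolding fact 1 2 by (simp only: mult.commute)
  qed
qed

lemma square_powr_half:
  assumes "0 < (x::real)"
  shows "(x\<^sup>2) powr (real n / 2) = x ^ n"
proof -
  have "(x\<^sup>2) powr (real n / 2) = (x powr 2) powr (real n / 2)" using assms by simp
  also have "\<dots> = x powr (2 * (real n / 2))" by (rule powr_powr)
  also have "\<dots> = x powr real n" by simp
  also have "\<dots> = x ^ n" using assms by (rule powr_realpow)
  finally show ?thesis .
qed

text \<open>Rescaling by \<rho> = |z| leads to the case |w| = 1. The numerator carries one power of
  \<rho> and the denominator d + 1 of them, which leaves the factor \<rho>^(-d) of a dilate that
  preserves mass.\<close>

lemma poisson_bound:
  assumes z: "0 < Re z"
  shows "ennreal (cmod (poisson z (x::'a::euclidean_space))) \<le>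
    ennreal (poisson_const DIM('a) * 4 powr ((real DIM('a) + 1) / 2)) * dilated_majorant (Re z / cmod z) (cmod z) x"
proof -
  let ?a = "(real DIM('a) + 1) / 2"
  define \<rho> where "\<rho> = cmod z"
  have \<rho>: "0 < \<rho>" using z by (auto simp: \<rho>_def)
  define w where "w = z / complex_of_real \<rho>"
  define s where "s = norm x / \<rho>"
  define Q where "Q = (\<bar>s - 1\<bar> + Re w) * (1 + s)"
  have s: "0 \<le> s" using \<rho> by (simp add: s_def)
  have w: "cmod w = 1" "0 < Re w" "Re w = Re z / \<rho>"
    using \<rho> z by (auto simp: w_def norm_divide \<rho>_def[symmetric] Re_divide_of_real)
  have Q: "0 < Q" unfolding Q_def using w s by (intro mult_pos_pos add_nonneg_pos add_pos_nonneg) auto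
  have eq: "cmod (z\<^sup>2 + complex_of_real ((norm x)\<^sup>2)) = \<rho>\<^sup>2 * cmod (w\<^sup>2 + complex_of_real (s\<^sup>2))"
  proof -
    have "z\<^sup>2 + complex_of_real ((norm x)\<^sup>2) = complex_of_real (\<rho>\<^sup>2) * (w\<^sup>2 + complex_of_real (s\<^sup>2))"
      using \<rho> by (simp add: w_def s_def power_divide distrib_left)
    then show ?thesis by (simp add: norm_mult norm_power)
  qed
  have "\<rho>\<^sup>2 * (Q / 4) \<le> cmod (z\<^sup>2 + complex_of_real ((norm x)\<^sup>2))"
    unfolding eq Q_def using w s by (intro mult_left_mono square_plus_square_ge_unit) auto
  then have "(\<rho>\<^sup>2 * (Q / 4)) powr ?a \<le> cmod (z\<^sup>2 + complex_of_real ((norm x)\<^sup>2)) powr ?a"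
    using \<rho> Q by (intro powr_mono2) auto
  moreover have "0 < (\<rho>\<^sup>2 * (Q / 4)) powr ?a" using \<rho> Q by simp
  ultimately have "cmod (poisson z x) \<le> poisson_const DIM('a) * \<rho> / (\<rho>\<^sup>2 * (Q / 4)) powr ?a"
    unfolding poisson_def norm_divide norm_mult norm_powr_of_real \<rho>_def[symmetric]
    using poisson_const_pos[of "DIM('a)"] \<rho> by (intro frac_le) simp_all
  also have "(\<rho>\<^sup>2 * (Q / 4)) powr ?a = \<rho> ^ DIM('a) * \<rho> * (Q powr ?a / 4 powr ?a)"
  proof -
    have "?a = real (DIM('a) + 1) / 2" by simp
    then have "(\<rho>\<^sup>2) powr ?a = \<rho> ^ DIM('a) * \<rho>"
      by (simp only: square_powr_half[OF \<rho>] power_add power_one_right)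
    then show ?thesis using \<rho> Q by (simp add: powr_mult powr_divide)
  qed
  also have "poisson_const DIM('a) * \<rho> / (\<rho> ^ DIM('a) * \<rho> * (Q powr ?a / 4 powr ?a))
      = (poisson_const DIM('a) * 4 powr ?a) * (Q powr (- ?a) / \<rho> ^ DIM('a))"
  proof -
    have "c * \<rho> / (D * \<rho> * (u / v)) = (c * v) * (1 / u / D)" for c D u v :: real
    proof -
      have "c * \<rho> / (D * \<rho> * (u / v)) = c / (D * (u / v))" using \<rho> by (simp only: mult.commute[of _ \<rho>] mult.assoc) simp
      then show ?thesis by (simp only: divide_inverse inverse_mult_distrib inverse_inverse_eq mult_1 ac_simps)
    qed
    from this[of "poisson_const DIM('a)" "\<rho> ^ DIM('a)" "Q powr ?a" "4 powr ?a"]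
    show ?thesis by (simp only: powr_minus_divide)
  qed
  also have "Q powr (- ?a) = majorant (Re z / \<rho>) (x /\<^sub>R \<rho>)"
  proof -
    have "norm (x /\<^sub>R \<rho>) = inverse \<rho> * norm x" using \<rho> by simp
    then have nx: "norm (x /\<^sub>R \<rho>) = s" unfolding s_def divide_inverse by (simp only: mult.commute)
    show ?thesis unfolding majorant_def nx Q_def w(3) ..
  qed
  finally have "ennreal (cmod (poisson z x)) \<le> ennreal ((poisson_const DIM('a) * 4 powr ?a) * (majorant (Re z / \<rho>) (x /\<^sub>R \<rho>) / \<rho> ^ DIM('a)))"
    by (rule ennreal_leI)
  then show ?thesis
    unfolding dilated_majorant_def \<rho>_def[symmetric]
    using poisson_const_pos[of "DIM('a)"] by (subst (asm) ennreal_mult') auto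
qed

text \<open>Subordination with c = t |\<xi>| / 2 writes exp (-t |\<xi>|) as a superposition of
  Gaussians in \<xi>. Their transforms are known, and the remaining integral over u is a Gamma
  integral, the source of the constant \<open>poisson_const\<close>. The subordination formula
  requires c > 0, so the origin is excluded as a null set.\<close>

lemma poisson_transform_real:
  fixes x :: "'a::euclidean_space"
  assumes t: "0 < t"
  shows "(LINT \<xi>|lborel. cis (x \<bullet> \<xi>) * complex_of_real (exp (- (t * norm \<xi>)))) = complex_of_real ((2 * pi) ^ DIM('a)) * poisson (complex_of_real t) x"
proof -
  let ?d = "real DIM('a)" and ?a = "(real DIM('a) + 1) / 2"
  define k where "k \<xi> u = indicator {0<..} u * (exp (- u - (t * norm \<xi> / 2)\<^sup>2 / u) / sqrt u)" for \<xi> :: 'a and u :: real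
  define \<Psi> where "\<Psi> \<xi> u = cis (x \<bullet> \<xi>) * complex_of_real (k \<xi> u)" for \<xi> u
  have km[measurable]: "(\<lambda>z. k (fst z) (snd z)) \<in> borel_measurable (lborel \<Otimes>\<^sub>M lborel)"
    unfolding k_def by measurable
  have [measurable]: "(\<lambda>z. \<Psi> (fst z) (snd z)) \<in> borel_measurable (lborel \<Otimes>\<^sub>M lborel)"
    unfolding \<Psi>_def by measurable
  have k0: "0 \<le> k \<xi> u" for \<xi> u by (simp add: k_def indicator_def)
  have kint: "has_bochner_integral lborel (k \<xi>) (sqrt pi * exp (- (t * norm \<xi>)))" if "\<xi> \<noteq> 0" for \<xi>
    using subordination[of "t * norm \<xi> / 2"] t that unfolding k_def by simp
  have ne0: "AE \<xi> in lborel. \<xi> \<noteq> (0::'a)" by (rule AE_lborel_singleton)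
  have pint: "integrable (lborel \<Otimes>\<^sub>M lborel) (case_prod \<Psi>)"
  proof (rule integrableI_bounded)
    show "case_prod \<Psi> \<in> borel_measurable (lborel \<Otimes>\<^sub>M lborel)" by (simp add: case_prod_beta')
    have "(\<integral>\<^sup>+z. ennreal (norm (case_prod \<Psi> z)) \<partial>(lborel \<Otimes>\<^sub>M lborel)) = (\<integral>\<^sup>+\<xi>. \<integral>\<^sup>+u. ennreal (k \<xi> u) \<partial>lborel \<partial>lborel)"
      by (subst lborel.nn_integral_fst[symmetric]) (auto simp: case_prod_beta' \<Psi>_def norm_mult k0)
    also have "\<dots> = (\<integral>\<^sup>+\<xi>. ennreal (sqrt pi * exp (- (t * norm \<xi>))) \<partial>(lborel :: 'a measure))"
    proof (rule nn_integral_cong_AE, use ne0 in eventually_elim)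
      case (elim \<xi>)
      then show ?case using kint[OF elim] k0
        by (auto simp: has_bochner_integral_iff nn_integral_eq_integral)
    qed
    also have "\<dots> < \<infinity>"
    proof -
      have "integrable lborel (\<lambda>\<xi>::'a. sqrt pi * exp (- (t * norm \<xi>)))"
        using integrable_poly_exp[where 'a='a, OF t, of 0] by simp
      from nn_integral_eq_integral[OF this] show ?thesis by simp
    qed
    finally show "(\<integral>\<^sup>+z. ennreal (norm (case_prod \<Psi> z)) \<partial>(lborel \<Otimes>\<^sub>M lborel)) < \<infinity>" .
  qed
  have "complex_of_real (sqrt pi) * (LINT \<xi>|lborel. cis (x \<bullet> \<xi>) * complex_of_real (exp (- (t * norm \<xi>))))
      = (LINT \<xi>|lborel. complex_of_real (sqrt pi) * (cis (x \<bullet> \<xi>) * complex_of_real (exp (- (t * norm \<xi>)))))"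
    by simp
  also have "\<dots> = (LINT \<xi>|lborel. LINT u|lborel. \<Psi> \<xi> u)"
  proof (rule integral_cong_AE)
    show "(\<lambda>\<xi>. LINT u|lborel. \<Psi> \<xi> u) \<in> borel_measurable lborel"
      by (rule lborel.borel_measurable_lebesgue_integral) (simp add: case_prod_beta')
    show "AE \<xi> in lborel. complex_of_real (sqrt pi) * (cis (x \<bullet> \<xi>) * complex_of_real (exp (- (t * norm \<xi>)))) = (LINT u|lborel. \<Psi> \<xi> u)"
      using ne0
    proof eventually_elim
      case (elim \<xi>)
      have "(LINT u|lborel. complex_of_real (k \<xi> u)) = complex_of_real (sqrt pi * exp (- (t * norm \<xi>)))"
        using kint[OF elim] by (simp add: has_bochner_integral_iff)
      then show ?case unfolding \<Psi>_def by simp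
    qed
  qed measurable
  also have "\<dots> = (LINT u|lborel. LINT \<xi>|lborel. \<Psi> \<xi> u)"
    using lborel_pair.Fubini_integral[OF pint] by simp
  also have "\<dots> = (LINT u|lborel. complex_of_real ((4 * pi / t\<^sup>2) powr (?d / 2) *
      (indicator {0<..} u * (u powr (?a - 1) * exp (- ((1 + (norm x)\<^sup>2 / t\<^sup>2) * u))))))"
  proof (rule Bochner_Integration.integral_cong[OF refl])
    fix u :: real
    show "(LINT \<xi>|lborel. \<Psi> \<xi> u) = complex_of_real ((4 * pi / t\<^sup>2) powr (?d / 2) *
      (indicator {0<..} u * (u powr (?a - 1) * exp (- ((1 + (norm x)\<^sup>2 / t\<^sup>2) * u)))))"
    proof (cases "0 < u")
      case True
      define A where "A = t\<^sup>2 / (4 * u)"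
      have A: "0 < A" using True t by (simp add: A_def)
      have "\<Psi> \<xi> u = complex_of_real (exp (- u) / sqrt u) * (cis (x \<bullet> \<xi>) * complex_of_real (exp (- (A * (norm \<xi>)\<^sup>2))))" for \<xi>
      proof -
        have "exp (- u - (t * norm \<xi> / 2)\<^sup>2 / u) = exp (- u) * exp (- (A * (norm \<xi>)\<^sup>2))"
          by (simp add: A_def power_divide power_mult_distrib flip: exp_add)
        then show ?thesis using True by (simp add: \<Psi>_def k_def)
      qed
      then have "(LINT \<xi>|lborel. \<Psi> \<xi> u) = complex_of_real (exp (- u) / sqrt u) *
          complex_of_real ((pi / A) powr (?d / 2) * exp (- ((norm x)\<^sup>2 / (4 * A))))"
        using gaussian_fourier(2)[OF A, of x] by simp
      then have F1: "(LINT \<xi>|lborel. \<Psi> \<xi> u) = complex_of_real ((exp (- u) / sqrt u) *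
          ((pi / A) powr (?d / 2) * exp (- ((norm x)\<^sup>2 / (4 * A)))))"
        by (simp only: of_real_mult)
      have F2: "(exp (- u) / sqrt u) * ((pi / A) powr (?d / 2) * exp (- ((norm x)\<^sup>2 / (4 * A))))
          = (4 * pi / t\<^sup>2) powr (?d / 2) * (u powr (?a - 1) * exp (- ((1 + (norm x)\<^sup>2 / t\<^sup>2) * u)))"
      proof -
        have e1: "(pi / A) powr (?d / 2) = (4 * pi / t\<^sup>2) powr (?d / 2) * u powr (?d / 2)"
        proof -
          have "pi / A = 4 * pi / t\<^sup>2 * u" using True t by (simp add: A_def field_simps)
          moreover have "0 \<le> 4 * pi / t\<^sup>2" "0 \<le> u" using True by auto
          ultimately show ?thesis by (simp only: powr_mult)
        qed
        have e2: "u powr (?d / 2) / sqrt u = u powr (?a - 1)"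
          using True by (simp add: powr_half_sqrt[symmetric] powr_diff[symmetric] add_divide_distrib)
        have e3: "exp (- u) * exp (- ((norm x)\<^sup>2 / (4 * A))) = exp (- ((1 + (norm x)\<^sup>2 / t\<^sup>2) * u))"
          using t True by (simp add: A_def algebra_simps flip: exp_add)
        have "(exp (- u) / sqrt u) * ((pi / A) powr (?d / 2) * exp (- ((norm x)\<^sup>2 / (4 * A))))
            = (4 * pi / t\<^sup>2) powr (?d / 2) * (u powr (?d / 2) / sqrt u * (exp (- u) * exp (- ((norm x)\<^sup>2 / (4 * A)))))"
          by (simp add: e1)
        then show ?thesis by (simp only: e2 e3)
      qed
      show ?thesis unfolding F1 F2 using True by (simp only: indicator_simps greaterThan_iff if_True mult_1)
    next
      case False
      then show ?thesis by (simp add: \<Psi>_def k_def)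
    qed
  qed
  also have "\<dots> = complex_of_real ((4 * pi / t\<^sup>2) powr (?d / 2) * (Gamma ?a * (1 + (norm x)\<^sup>2 / t\<^sup>2) powr (- ?a)))"
  proof -
    have "0 < 1 + (norm x)\<^sup>2 / t\<^sup>2" by (simp add: add_pos_nonneg)
    then have "has_bochner_integral lborel (\<lambda>u. indicator {0<..} u * (u powr (?a - 1) * exp (- ((1 + (norm x)\<^sup>2 / t\<^sup>2) * u))))
        (Gamma ?a * (1 + (norm x)\<^sup>2 / t\<^sup>2) powr (- ?a))"
      by (intro has_bochner_integral_Gamma) auto
    then show ?thesis
      by (simp only: has_bochner_integral_iff integral_complex_of_real integral_mult_right_zero)
  qed
  also have "(4 * pi / t\<^sup>2) powr (?d / 2) * (Gamma ?a * (1 + (norm x)\<^sup>2 / t\<^sup>2) powr (- ?a))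
      = sqrt pi * ((2 * pi) ^ DIM('a) * (poisson_const DIM('a) * t / (t\<^sup>2 + (norm x)\<^sup>2) powr ?a))"
  proof -
    have "?a = real (DIM('a) + 1) / 2" by simp
    then have t2: "(t\<^sup>2) powr ?a = t ^ DIM('a) * t"
      by (simp only: square_powr_half[OF t] power_add power_one_right)
    have "1 + (norm x)\<^sup>2 / t\<^sup>2 = (t\<^sup>2 + (norm x)\<^sup>2) / t\<^sup>2" using t by (simp add: field_simps)
    then have "(1 + (norm x)\<^sup>2 / t\<^sup>2) powr (- ?a) = 1 / ((t\<^sup>2 + (norm x)\<^sup>2) / t\<^sup>2) powr ?a"
      by (simp only: powr_minus_divide)
    also have "((t\<^sup>2 + (norm x)\<^sup>2) / t\<^sup>2) powr ?a = (t\<^sup>2 + (norm x)\<^sup>2) powr ?a / (t ^ DIM('a) * t)"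
      unfolding t2[symmetric] by (simp add: powr_divide)
    also have "1 / ((t\<^sup>2 + (norm x)\<^sup>2) powr ?a / (t ^ DIM('a) * t)) = t ^ DIM('a) * t / (t\<^sup>2 + (norm x)\<^sup>2) powr ?a"
      by simp
    finally have 1: "(1 + (norm x)\<^sup>2 / t\<^sup>2) powr (- ?a) = t ^ DIM('a) * t / (t\<^sup>2 + (norm x)\<^sup>2) powr ?a" .
    have "4 * pi / t\<^sup>2 = (2 * pi)\<^sup>2 / (pi * t\<^sup>2)" by (simp add: power2_eq_square)
    then have "(4 * pi / t\<^sup>2) powr (?d / 2) = ((2 * pi)\<^sup>2 / (pi * t\<^sup>2)) powr (?d / 2)" by (simp only:)
    also have "\<dots> = ((2 * pi)\<^sup>2) powr (?d / 2) / (pi * t\<^sup>2) powr (?d / 2)" by (simp add: powr_divide)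
    also have "(pi * t\<^sup>2) powr (?d / 2) = pi powr (?d / 2) * (t\<^sup>2) powr (?d / 2)" by (simp add: powr_mult)
    also have "((2 * pi)\<^sup>2) powr (?d / 2) = (2 * pi) ^ DIM('a)" by (rule square_powr_half) simp
    also have "(t\<^sup>2) powr (?d / 2) = t ^ DIM('a)" by (rule square_powr_half[OF t])
    finally have 2: "(4 * pi / t\<^sup>2) powr (?d / 2) = (2 * pi) ^ DIM('a) / (pi powr (?d / 2) * t ^ DIM('a))" .
    have 3: "pi powr ?a = pi powr (?d / 2) * sqrt pi"
      by (simp add: powr_half_sqrt[symmetric] powr_add[symmetric] add_divide_distrib)
    have 4: "sqrt pi / (pi powr ?a) = 1 / pi powr (?d / 2)" unfolding 3 by simp
    have "(4 * pi / t\<^sup>2) powr (?d / 2) * (Gamma ?a * (1 + (norm x)\<^sup>2 / t\<^sup>2) powr (- ?a))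
       = (2 * pi) ^ DIM('a) * Gamma ?a * (1 / pi powr (?d / 2)) * t / (t\<^sup>2 + (norm x)\<^sup>2) powr ?a"
      unfolding 1 2 using t by simp
    then show ?thesis unfolding 4[symmetric] poisson_const_def by simp
  qed
  finally have "complex_of_real (sqrt pi) * (LINT \<xi>|lborel. cis (x \<bullet> \<xi>) * complex_of_real (exp (- (t * norm \<xi>))))
    = complex_of_real (sqrt pi) * complex_of_real ((2 * pi) ^ DIM('a) * (poisson_const DIM('a) * t / (t\<^sup>2 + (norm x)\<^sup>2) powr ?a))"
    by (simp only: of_real_mult)
  then have "(LINT \<xi>|lborel. cis (x \<bullet> \<xi>) * complex_of_real (exp (- (t * norm \<xi>))))
    = complex_of_real ((2 * pi) ^ DIM('a) * (poisson_const DIM('a) * t / (t\<^sup>2 + (norm x)\<^sup>2) powr ?a))"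
    by (subst (asm) mult_left_cancel) auto
  also have "\<dots> = complex_of_real ((2 * pi) ^ DIM('a)) * poisson (complex_of_real t) x"
  proof -
    have "complex_of_real ((t\<^sup>2 + (norm x)\<^sup>2) powr ?a) = (complex_of_real t ^ 2 + complex_of_real ((norm x)\<^sup>2)) powr complex_of_real ?a"
      by (subst powr_of_real[symmetric]) auto
    then show ?thesis unfolding poisson_def by simp
  qed
  finally show ?thesis .
qed

text \<open>The Taylor remainder of exp costs a factor exp (Re z / 2 * r), which is paid with half
  of the decay of exp (- (Re z * r)).\<close>

lemma exp_diff_quotient:
  fixes h z :: complex and r :: real
  assumes "h \<noteq> 0" "0 \<le> r" "cmod h \<le> Re z / 2"
  shows "cmod ((exp (- ((z + h) * r)) - exp (- (z * r))) / h - (- (r * exp (- (z * r))))) \<le> cmod h * (r\<^sup>2 * exp (- (Re z / 2 * r)))"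
proof -
  define w where "w = - (h * complex_of_real r)"
  have "(exp (- ((z + h) * r)) - exp (- (z * r))) / h - (- (r * exp (- (z * r)))) = exp (- (z * r)) * ((exp w - (1 + w)) / h)"
    using assms(1) by (simp add: w_def distrib_right exp_diff exp_minus exp_add field_simps)
  moreover have "cmod (exp w - (1 + w)) \<le> exp (Re z / 2 * r) * (cmod h * r)\<^sup>2"
  proof -
    have "cmod (exp w - (\<Sum>k\<le>1. w ^ k / fact k)) \<le> exp \<bar>Re w\<bar> * cmod w ^ Suc 1 / fact 1" by (rule Taylor_exp)
    then have "cmod (exp w - (1 + w)) \<le> exp \<bar>Re w\<bar> * (cmod w)\<^sup>2" by (simp add: numeral_2_eq_2)
    also have "\<dots> \<le> exp (Re z / 2 * r) * (cmod w)\<^sup>2"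
    proof -
      have "\<bar>Re w\<bar> \<le> cmod h * r" using abs_Re_le_cmod[of w] assms(2) by (simp add: w_def norm_mult)
      also have "\<dots> \<le> Re z / 2 * r" using assms by (intro mult_right_mono) auto
      finally show ?thesis by (intro mult_right_mono) auto
    qed
    finally show ?thesis using assms(2) by (simp add: w_def norm_mult)
  qed
  ultimately have "cmod ((exp (- ((z + h) * r)) - exp (- (z * r))) / h - (- (r * exp (- (z * r))))) \<le>
      exp (- (Re z * r)) * (exp (Re z / 2 * r) * (cmod h * r)\<^sup>2 / cmod h)"
    using assms by (simp only: norm_mult norm_divide norm_exp_eq_Re) (intro mult_mono divide_right_mono; simp)
  also have "\<dots> = (exp (- (Re z * r)) * exp (Re z / 2 * r)) * (cmod h * r\<^sup>2)"
    using assms(1) by (simp add: power2_eq_square)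
  also have "exp (- (Re z * r)) * exp (Re z / 2 * r) = exp (- (Re z / 2 * r))"
    by (simp flip: exp_add)
  finally show ?thesis by (simp add: ac_simps)
qed

lemma integrable_cis_exp:
  fixes x :: "'a::euclidean_space"
  assumes "0 < Re z"
  shows "integrable lborel (\<lambda>\<xi>. cis (x \<bullet> \<xi>) * exp (- (z * complex_of_real (norm \<xi>))))"
    "integrable lborel (\<lambda>\<xi>. cis (x \<bullet> \<xi>) * (complex_of_real (norm \<xi>) * exp (- (z * complex_of_real (norm \<xi>)))))"
proof -
  show "integrable lborel (\<lambda>\<xi>. cis (x \<bullet> \<xi>) * exp (- (z * complex_of_real (norm \<xi>))))"
    by (rule Bochner_Integration.integrable_bound[OF integrable_poly_exp[where 'a='a, OF assms, of 0]])
      (auto simp: norm_mult)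
  show "integrable lborel (\<lambda>\<xi>. cis (x \<bullet> \<xi>) * (complex_of_real (norm \<xi>) * exp (- (z * complex_of_real (norm \<xi>)))))"
    by (rule Bochner_Integration.integrable_bound[OF integrable_poly_exp[where 'a='a, OF assms, of 1]])
      (auto simp: norm_mult intro!: mult_right_mono)
qed

lemma poisson_holomorphic:
  "(\<lambda>w. poisson w (x::'a::euclidean_space)) holomorphic_on {w. 0 < Re w}"
proof -
  have nn: "w\<^sup>2 + (complex_of_real (norm x))\<^sup>2 \<notin> \<real>\<^sub>\<le>\<^sub>0" if "0 < Re w" for w
    using poisson_base_notin[OF that, of "(norm x)\<^sup>2"] by simp
  have nz: "w\<^sup>2 + (complex_of_real (norm x))\<^sup>2 \<noteq> 0" if "0 < Re w" for w
    using nn[OF that] by auto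
  show ?thesis unfolding poisson_def
    by (intro holomorphic_intros) (use nn nz in \<open>auto simp: powr_eq_0_iff\<close>)
qed

text \<open>Both sides are holomorphic in z on the right half-plane and agree on the positive axis,
  which has limit points inside; the identity theorem extends the equality. Holomorphy of the
  integral is proved from the definition, with \<open>exp_diff_quotient\<close> as the dominating
  estimate.\<close>

theorem poisson_transform:
  fixes x :: "'a::euclidean_space"
  assumes z: "0 < Re z"
  shows "(LINT \<xi>|lborel. cis (x \<bullet> \<xi>) * exp (- (z * complex_of_real (norm \<xi>)))) = complex_of_real ((2 * pi) ^ DIM('a)) * poisson z x"
proof -
  define F where "F z = (LINT \<xi>|lborel. cis (x \<bullet> \<xi>) * exp (- (z * complex_of_real (norm \<xi>))))" for z
  define S where "S = {z. 0 < Re z}"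
  have S: "open S" "connected S"
    unfolding S_def by (auto intro: open_halfspace_Re_gt convex_connected convex_halfspace_Re_gt)
  have "F holomorphic_on S"
    unfolding holomorphic_on_def
  proof (rule ballI)
    fix z assume "z \<in> S"
    then have z: "0 < Re z" by (simp add: S_def)
    define D where "D = (LINT \<xi>|lborel. cis (x \<bullet> \<xi>) * (- (complex_of_real (norm \<xi>) * exp (- (z * complex_of_real (norm \<xi>))))))"
    define M where "M = (LINT \<xi>|(lborel :: 'a measure). (1 + norm \<xi>) ^ 2 * exp (- (Re z / 2 * norm \<xi>)))"
    have Mint: "integrable lborel (\<lambda>\<xi>::'a. (1 + norm \<xi>) ^ 2 * exp (- (Re z / 2 * norm \<xi>)))"
      using z by (intro integrable_poly_exp) auto
    have "cmod ((F (z + h) - F z) / h - D) \<le> cmod h * M" if h: "h \<noteq> 0" "cmod h \<le> Re z / 2" for h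
    proof -
      have "0 < Re (z + h)" using h z abs_Re_le_cmod[of h] by auto
      then have i: "integrable lborel (\<lambda>\<xi>. cis (x \<bullet> \<xi>) * exp (- ((z + h) * complex_of_real (norm \<xi>))))"
        "integrable lborel (\<lambda>\<xi>. cis (x \<bullet> \<xi>) * exp (- (z * complex_of_real (norm \<xi>))))"
        "integrable lborel (\<lambda>\<xi>. cis (x \<bullet> \<xi>) * (- (complex_of_real (norm \<xi>) * exp (- (z * complex_of_real (norm \<xi>))))))"
        using integrable_cis_exp[of "z + h" x] integrable_cis_exp[of z x] z by simp_all
      have "(F (z + h) - F z) / h - D = (LINT \<xi>|lborel. (cis (x \<bullet> \<xi>) * exp (- ((z + h) * complex_of_real (norm \<xi>)))
          - cis (x \<bullet> \<xi>) * exp (- (z * complex_of_real (norm \<xi>)))) / h - cis (x \<bullet> \<xi>) * (- (complex_of_real (norm \<xi>) * exp (- (z * complex_of_real (norm \<xi>))))))"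
        unfolding F_def D_def using i
        by (subst Bochner_Integration.integral_diff) (auto simp: Bochner_Integration.integral_diff)
      also have "\<dots> = (LINT \<xi>|lborel. cis (x \<bullet> \<xi>) * ((exp (- ((z + h) * norm \<xi>)) - exp (- (z * norm \<xi>))) / h
          - (- (norm \<xi> * exp (- (z * norm \<xi>))))))"
        by (intro Bochner_Integration.integral_cong) (auto simp: algebra_simps diff_divide_distrib)
      also have "cmod \<dots> \<le> (LINT \<xi>|(lborel :: 'a measure). cmod h * ((1 + norm \<xi>) ^ 2 * exp (- (Re z / 2 * norm \<xi>))))"
      proof -
        have gi: "integrable lborel (\<lambda>\<xi>::'a. cmod h * ((1 + norm \<xi>) ^ 2 * exp (- (Re z / 2 * norm \<xi>))))" using Mint by simp
        have b: "cmod (cis (x \<bullet> \<xi>) * ((exp (- ((z + h) * norm \<xi>)) - exp (- (z * norm \<xi>))) / h - (- (norm \<xi> * exp (- (z * norm \<xi>))))))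
            \<le> cmod h * ((1 + norm \<xi>) ^ 2 * exp (- (Re z / 2 * norm \<xi>)))" for \<xi> :: 'a
        proof -
          have "(norm \<xi>)\<^sup>2 * exp (- (Re z / 2 * norm \<xi>)) \<le> (1 + norm \<xi>) ^ 2 * exp (- (Re z / 2 * norm \<xi>))"
            by (intro mult_right_mono power_mono) auto
          then have "cmod h * ((norm \<xi>)\<^sup>2 * exp (- (Re z / 2 * norm \<xi>))) \<le> cmod h * ((1 + norm \<xi>) ^ 2 * exp (- (Re z / 2 * norm \<xi>)))"
            by (intro mult_left_mono) auto
          then show ?thesis using exp_diff_quotient[OF h(1) norm_ge_zero h(2), of \<xi>] by (simp only: norm_mult norm_cis mult_1)
        qed
        have fi: "integrable lborel (\<lambda>\<xi>::'a. cis (x \<bullet> \<xi>) * ((exp (- ((z + h) * norm \<xi>)) - exp (- (z * norm \<xi>))) / h - (- (norm \<xi> * exp (- (z * norm \<xi>))))))"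
        proof (rule Bochner_Integration.integrable_bound[OF gi])
          show "AE \<xi> in lborel. norm (cis (x \<bullet> \<xi>) * ((exp (- ((z + h) * norm \<xi>)) - exp (- (z * norm \<xi>))) / h - (- (norm \<xi> * exp (- (z * norm \<xi>))))))
            \<le> norm (cmod h * ((1 + norm \<xi>) ^ 2 * exp (- (Re z / 2 * norm \<xi>))))"
            by (rule AE_I2, rule order.trans[OF b]) simp
        qed measurable
        show ?thesis by (rule Bochner_Integration.integral_norm_bound_integral[OF fi gi b])
      qed
      finally show ?thesis by (simp add: M_def)
    qed
    then have "eventually (\<lambda>h. norm ((F (z + h) - F z) / h - D) \<le> cmod h * M) (at 0)"
      unfolding eventually_at using z by (intro exI[of _ "Re z / 2"]) (auto simp: dist_norm)
    moreover have "((\<lambda>h. cmod h * M) \<longlongrightarrow> 0) (at 0)"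
      by (intro tendsto_mult_left_zero tendsto_norm_zero tendsto_ident_at)
    ultimately have "((\<lambda>h. (F (z + h) - F z) / h - D) \<longlongrightarrow> 0) (at 0)"
      by (rule Lim_null_comparison)
    then have "((\<lambda>h. (F (z + h) - F z) / h) \<longlongrightarrow> D) (at 0)" by (simp add: LIM_zero_iff)
    then show "F field_differentiable at z within S"
      unfolding field_differentiable_def DERIV_def[symmetric]
      using has_field_derivative_at_within by blast
  qed
  moreover have "(\<lambda>z. complex_of_real ((2 * pi) ^ DIM('a)) * poisson z x) holomorphic_on S"
    unfolding S_def by (intro holomorphic_intros poisson_holomorphic)
  ultimately have hol: "(\<lambda>z. F z - complex_of_real ((2 * pi) ^ DIM('a)) * poisson z x) holomorphic_on S"
    by (rule holomorphic_on_diff)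
  define U where "U = complex_of_real ` {0<..}"
  have "F z - complex_of_real ((2 * pi) ^ DIM('a)) * poisson z x = 0"
  proof (rule analytic_continuation[OF hol S])
    show "U \<subseteq> S" by (auto simp: U_def S_def)
    show "(1::complex) \<in> S" by (simp add: S_def)
    show "(1::complex) islimpt U"
    proof (rule islimptI)
      fix T :: "complex set" assume "1 \<in> T" "open T"
      then obtain e where e: "0 < e" "ball 1 e \<subseteq> T" by (meson open_contains_ball)
      have "complex_of_real (1 + e / 2) \<in> ball 1 e" using e by (simp add: dist_norm)
      then show "\<exists>y\<in>U. y \<in> T \<and> y \<noteq> 1"
      proof (intro bexI conjI)
        show "complex_of_real (1 + e / 2) \<in> T" using e \<open>complex_of_real (1 + e / 2) \<in> ball 1 e\<close> by blast
        show "complex_of_real (1 + e / 2) \<noteq> 1" using e by (simp add: complex_eq_iff)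
        show "complex_of_real (1 + e / 2) \<in> U" unfolding U_def using e by (intro imageI) simp
      qed
    qed
    show "F z - complex_of_real ((2 * pi) ^ DIM('a)) * poisson z x = 0" if zU: "z \<in> U" for z
    proof -
      obtain t where t: "0 < t" "z = complex_of_real t" using zU unfolding U_def by auto
      have E: "exp (- (complex_of_real t * complex_of_real (norm \<xi>))) = complex_of_real (exp (- (t * norm \<xi>)))" for \<xi> :: 'a
        by (simp flip: exp_of_real)
      show ?thesis unfolding F_def t(2) E poisson_transform_real[OF t(1), of x] by (rule diff_self)
    qed
    show "z \<in> S" using z by (simp add: S_def)
  qed
  then show ?thesis by (simp add: F_def)
qed

section \<open>Convolution operators and mixtures of Poisson kernels\<close>

definition conv_op :: "('a::euclidean_space \<Rightarrow> complex) \<Rightarrow> 'a fun_op" where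
  "conv_op K f x = (LINT y|lborel. K (x - y) * f y)"

abbreviation nn_norm :: "('a \<Rightarrow> complex) \<Rightarrow> 'a \<Rightarrow> ennreal" where
  "nn_norm f \<equiv> \<lambda>x. ennreal (cmod (f x))"

lemma conv_op_measurable [measurable]:
  fixes K f :: "'a::euclidean_space \<Rightarrow> complex"
  assumes [measurable]: "K \<in> borel_measurable borel" "f \<in> borel_measurable borel"
  shows "conv_op K f \<in> borel_measurable borel"
proof -
  have "(\<lambda>x. LINT y|lborel. K (x - y) * f y) \<in> borel_measurable borel"
    by (rule lborel.borel_measurable_lebesgue_integral) measurable
  then show ?thesis by (simp add: conv_op_def[abs_def])
qed

text \<open>Valid at every x: where the Bochner integral does not converge its value is 0 by
  default, which satisfies the bound as well.\<close>

lemma conv_op_le_conv: "nn_norm (conv_op K f) x \<le> conv (nn_norm K) (nn_norm f) x"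
proof (cases "integrable lborel (\<lambda>y. K (x - y) * f y)")
  case True
  then show ?thesis unfolding conv_op_def conv_def
    using integral_norm_bound_ennreal[OF True] by (simp add: norm_mult ennreal_mult)
qed (simp add: conv_op_def not_integrable_integral_eq)

lemma Lp_norm_le_iff_mass:
  fixes f g :: "'a::euclidean_space \<Rightarrow> complex"
  assumes "f \<in> Lp p" "g \<in> Lp p" "0 < p" "0 \<le> B"
    and le: "(\<integral>\<^sup>+x. epow (nn_norm g x) p \<partial>lborel) \<le> epow (ennreal B) p * (\<integral>\<^sup>+x. epow (nn_norm f x) p \<partial>lborel)"
  shows "Lp_norm p g \<le> B * Lp_norm p f"
proof -
  have nn: "0 \<le> Lp_norm p f" by (simp add: Lp_norm_def)
  have "ennreal (Lp_norm p g) \<le> epow (epow (ennreal B) p * (\<integral>\<^sup>+x. epow (nn_norm f x) p \<partial>lborel)) (1 / p)"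
    unfolding ennreal_Lp_norm[OF assms(2)] using le assms(3) by (intro epow_mono) auto
  also have "\<dots> = ennreal B * ennreal (Lp_norm p f)"
    unfolding ennreal_Lp_norm[OF assms(1)] using assms(3) by (simp add: epow_mult epow_inverse)
  also have "\<dots> = ennreal (B * Lp_norm p f)" using assms(4) nn by (simp add: ennreal_mult)
  finally show ?thesis using assms(4) nn by (subst (asm) ennreal_le_iff) auto
qed

lemma conv_op_Lp:
  fixes K f :: "'a::euclidean_space \<Rightarrow> complex"
  assumes [measurable]: "K \<in> borel_measurable borel" and B: "(\<integral>\<^sup>+x. nn_norm K x \<partial>lborel) \<le> ennreal B" "0 \<le> B"
    and p: "1 < p" and f: "f \<in> Lp p"
  shows "AE x in lborel. integrable lborel (\<lambda>y. K (x - y) * f y)" "conv_op K f \<in> Lp p"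
    "Lp_norm p (conv_op K f) \<le> B * Lp_norm p f"
proof -
  have [measurable]: "f \<in> borel_measurable borel" using f by (rule Lp_D)
  have le: "(\<integral>\<^sup>+x. epow (conv (nn_norm K) (nn_norm f) x) p \<partial>lborel)
      \<le> epow (ennreal B) p * (\<integral>\<^sup>+x. epow (nn_norm f x) p \<partial>lborel)"
    using p B by (intro conv_Lp) auto
  also have fin: "\<dots> < \<top>" using Lp_D(2)[OF f] by (simp add: ennreal_mult_less_top)
  finally have "AE x in lborel. epow (conv (nn_norm K) (nn_norm f) x) p \<noteq> \<infinity>"
    by (intro nn_integral_PInf_AE) auto
  then show "AE x in lborel. integrable lborel (\<lambda>y. K (x - y) * f y)"
  proof eventually_elim
    case (elim x)
    then have "conv (nn_norm K) (nn_norm f) x < \<top>" by (simp add: less_top)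
    then show ?case by (intro integrableI_bounded) (auto simp: conv_def norm_mult ennreal_mult)
  qed
  have le': "(\<integral>\<^sup>+x. epow (nn_norm (conv_op K f) x) p \<partial>lborel)
      \<le> epow (ennreal B) p * (\<integral>\<^sup>+x. epow (nn_norm f x) p \<partial>lborel)"
    by (rule order_trans[OF _ le]) (use p in \<open>intro nn_integral_mono epow_mono conv_op_le_conv, auto\<close>)
  show L: "conv_op K f \<in> Lp p" by (rule Lp_I) (use le' fin in \<open>auto intro: le_less_trans\<close>)
  show "Lp_norm p (conv_op K f) \<le> B * Lp_norm p f"
    using p B(2) le' by (intro Lp_norm_le_iff_mass f L) auto
qed

lemma conv_op_bounded:
  fixes K :: "'a::euclidean_space \<Rightarrow> complex"
  assumes K: "K \<in> borel_measurable borel" "(\<integral>\<^sup>+x. nn_norm K x \<partial>lborel) \<le> ennreal B" "0 \<le> B" and p: "1 < p"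
  shows "conv_op K \<in> bounded_ops p"
  unfolding bounded_ops_def
proof (intro CollectI conjI ballI allI)
  fix f :: "'a \<Rightarrow> complex" assume f: "f \<in> Lp p"
  show "conv_op K f \<in> Lp p" by (rule conv_op_Lp[OF K p f])
  show "AE x in lborel. conv_op K (\<lambda>y. c * f y) x = c * conv_op K f x" for c
  proof (rule AE_I2)
    fix x
    have "(\<lambda>y. K (x - y) * (c * f y)) = (\<lambda>y. c * (K (x - y) * f y))" by (auto simp: ac_simps)
    then show "conv_op K (\<lambda>y. c * f y) x = c * conv_op K f x" by (simp add: conv_op_def)
  qed
  fix g :: "'a \<Rightarrow> complex" assume g: "g \<in> Lp p"
  show "AE x in lborel. conv_op K (\<lambda>y. f y + g y) x = conv_op K f x + conv_op K g x"
    using conv_op_Lp(1)[OF K p f] conv_op_Lp(1)[OF K p g]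
    by eventually_elim (simp add: conv_op_def distrib_left)
next
  show "\<exists>C. \<forall>f\<in>Lp p. Lp_norm p (conv_op K f) \<le> C * Lp_norm p f"
    using conv_op_Lp(3)[OF K p] by blast
qed

lemma poisson_eq_transform:
  assumes "0 < Re z"
  shows "poisson z (x::'a::euclidean_space) = complex_of_real (1 / (2 * pi) ^ DIM('a)) *
    (LINT \<xi>|lborel. cis (x \<bullet> \<xi>) * exp (- (z * complex_of_real (norm \<xi>))))"
  unfolding poisson_transform[OF assms] by (simp flip: of_real_mult of_real_power)

text \<open>The kernel is read as a Fourier integral depending on a parameter, which is measurable
  in both variables jointly; this bypasses the branch cut of the complex power in the closed
  formula.\<close>

lemma poisson_measurable2:
  assumes [measurable]: "\<zeta> \<in> borel_measurable M" and pos: "\<And>u. 0 < Re (\<zeta> u)"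
  shows "(\<lambda>z. poisson (\<zeta> (fst z)) (snd z :: 'a::euclidean_space)) \<in> borel_measurable (M \<Otimes>\<^sub>M borel)"
proof -
  have "(\<lambda>z::_ \<times> 'a. complex_of_real (1 / (2 * pi) ^ DIM('a)) *
    (LINT \<xi>|lborel. cis (snd z \<bullet> \<xi>) * exp (- (\<zeta> (fst z) * complex_of_real (norm \<xi>))))) \<in> borel_measurable (M \<Otimes>\<^sub>M borel)"
    by (intro borel_measurable_times borel_measurable_const lborel.borel_measurable_lebesgue_integral) measurable
  then show ?thesis by (simp only: poisson_eq_transform[where 'a = 'a, OF pos])
qed

lemma poisson_measurable [measurable]:
  assumes "0 < Re z"
  shows "(poisson z :: 'a::euclidean_space \<Rightarrow> complex) \<in> borel_measurable borel"
proof -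
  have "(\<lambda>x. complex_of_real (1 / (2 * pi) ^ DIM('a)) *
    (LINT \<xi>|lborel. cis (x \<bullet> \<xi>) * exp (- (z * complex_of_real (norm (\<xi>::'a)))))) \<in> borel_measurable borel"
    by (intro borel_measurable_times borel_measurable_const lborel.borel_measurable_lebesgue_integral) measurable
  moreover have "poisson z = (\<lambda>x. complex_of_real (1 / (2 * pi) ^ DIM('a)) *
    (LINT \<xi>|lborel. cis (x \<bullet> \<xi>) * exp (- (z * complex_of_real (norm (\<xi>::'a))))))"
    by (rule ext) (rule poisson_eq_transform[OF assms])
  ultimately show ?thesis by simp
qed

text \<open>The kernel is written as a Fourier integral; the double integral over y and \<xi>
  converges absolutely, because both exp (-z |\<xi>|) and f are integrable, and its other order is
  the multiplier formula.\<close>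

lemma conv_op_poisson:
  fixes f :: "'a::euclidean_space \<Rightarrow> complex"
  assumes z: "0 < Re z" and f: "integrable lborel f"
  shows "conv_op (poisson z) f x = inv_fourier (\<lambda>\<xi>. exp (- (z * complex_of_real (norm \<xi>))) * fourier f \<xi>) x"
proof -
  define c where "c = complex_of_real (1 / (2 * pi) ^ DIM('a))"
  define e where "e \<xi> = exp (- (z * complex_of_real (norm \<xi>)))" for \<xi> :: 'a
  have [measurable]: "f \<in> borel_measurable lborel" using f by auto
  have [measurable]: "e \<in> borel_measurable lborel" unfolding e_def by measurable
  have eint: "integrable lborel e" using integrable_cis_exp(1)[OF z, of "0::'a"] by (simp add: e_def[abs_def])
  define \<Psi> where "\<Psi> y \<xi> = cis ((x - y) \<bullet> \<xi>) * e \<xi> * f y" for y \<xi>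
  have [measurable]: "(\<lambda>z. \<Psi> (fst z) (snd z)) \<in> borel_measurable (lborel \<Otimes>\<^sub>M lborel)"
    unfolding \<Psi>_def by measurable
  have pint: "integrable (lborel \<Otimes>\<^sub>M lborel) (case_prod \<Psi>)"
  proof (rule integrableI_bounded)
    show "case_prod \<Psi> \<in> borel_measurable (lborel \<Otimes>\<^sub>M lborel)" by (simp add: case_prod_beta')
    have "(\<integral>\<^sup>+z. ennreal (norm (case_prod \<Psi> z)) \<partial>(lborel \<Otimes>\<^sub>M lborel))
        = (\<integral>\<^sup>+y. \<integral>\<^sup>+\<xi>. nn_norm e \<xi> * nn_norm f y \<partial>lborel \<partial>lborel)"
      by (subst lborel.nn_integral_fst[symmetric]) (auto simp: case_prod_beta' \<Psi>_def norm_mult ennreal_mult)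
    also have "\<dots> = (\<integral>\<^sup>+\<xi>. nn_norm e \<xi> \<partial>lborel) * (\<integral>\<^sup>+y. nn_norm f y \<partial>lborel)"
      by (simp add: nn_integral_multc nn_integral_cmult)
    also have "\<dots> < \<infinity>" using eint f by (auto simp: integrable_iff_bounded ennreal_mult_less_top)
    finally show "(\<integral>\<^sup>+z. ennreal (norm (case_prod \<Psi> z)) \<partial>(lborel \<Otimes>\<^sub>M lborel)) < \<infinity>" .
  qed
  have "conv_op (poisson z) f x = (LINT y|lborel. c * (LINT \<xi>|lborel. \<Psi> y \<xi>))"
  proof -
    have "poisson z (x - y) * f y = c * (LINT \<xi>|lborel. \<Psi> y \<xi>)" for y
      unfolding poisson_eq_transform[OF z] c_def \<Psi>_def e_def integral_mult_left_zero by (simp only: mult.assoc)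
    then show ?thesis by (simp add: conv_op_def)
  qed
  also have "\<dots> = c * (LINT y|lborel. LINT \<xi>|lborel. \<Psi> y \<xi>)" by simp
  also have "(LINT y|lborel. LINT \<xi>|lborel. \<Psi> y \<xi>) = (LINT \<xi>|lborel. LINT y|lborel. \<Psi> y \<xi>)"
    using lborel_pair.Fubini_integral[OF pint] by simp
  also have "\<dots> = (LINT \<xi>|lborel. cis (x \<bullet> \<xi>) * (e \<xi> * fourier f \<xi>))"
  proof (rule Bochner_Integration.integral_cong[OF refl])
    fix \<xi> :: 'a
    have "\<Psi> y \<xi> = (cis (x \<bullet> \<xi>) * e \<xi>) * (cis (- (\<xi> \<bullet> y)) * f y)" for y
      unfolding \<Psi>_def inner_diff_left using cis_mult[of "x \<bullet> \<xi>" "- (\<xi> \<bullet> y)"]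
      by (simp add: inner_commute ac_simps)
    then show "(LINT y|lborel. \<Psi> y \<xi>) = cis (x \<bullet> \<xi>) * (e \<xi> * fourier f \<xi>)"
      unfolding fourier_def by simp
  qed
  finally show ?thesis unfolding inv_fourier_def c_def e_def .
qed

definition mix_kernel :: "real measure \<Rightarrow> (real \<Rightarrow> complex) \<Rightarrow> 'a::euclidean_space \<Rightarrow> complex" where
  "mix_kernel M \<zeta> x = (LINT u|M. poisson (\<zeta> u) x)"

definition mix_majorant :: "real measure \<Rightarrow> (real \<Rightarrow> complex) \<Rightarrow> 'a::euclidean_space \<Rightarrow> ennreal" where
  "mix_majorant M \<zeta> x = (\<integral>\<^sup>+u. dilated_majorant (Re (\<zeta> u) / cmod (\<zeta> u)) (cmod (\<zeta> u)) x \<partial>M)"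

text \<open>The average of the losses \<delta>^(-\<beta>) of the single kernels. It is the only
  quantity through which M and \<zeta> enter the final estimate.\<close>

definition mix_weight :: "real measure \<Rightarrow> (real \<Rightarrow> complex) \<Rightarrow> real \<Rightarrow> ennreal" where
  "mix_weight M \<zeta> \<beta> = (\<integral>\<^sup>+u. ennreal ((Re (\<zeta> u) / cmod (\<zeta> u)) powr (- \<beta>)) \<partial>M)"

definition mix_bound :: "nat \<Rightarrow> real" where
  "mix_bound d = poisson_const d * 4 powr ((real d + 1) / 2)"

lemma mix_bound_pos: "0 < mix_bound d"
  by (simp add: mix_bound_def poisson_const_pos)

text \<open>The real part is positive at every u, not merely M-almost everywhere, so the kernel
  bounds hold for all u without an exceptional set.\<close>

locale poisson_mixture =
  fixes M :: "real measure" and \<zeta> :: "real \<Rightarrow> complex"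
  assumes prob: "prob_space M" and sets_M [measurable_cong, simp]: "sets M = sets borel"
    and zeta_measurable [measurable]: "\<zeta> \<in> borel_measurable borel" and pos: "\<And>u. 0 < Re (\<zeta> u)"
begin

sublocale prob_space M by (rule prob)

lemma zeta_nonzero: "\<zeta> u \<noteq> 0" "0 < cmod (\<zeta> u)"
  using pos[of u] by auto

lemma angle: "0 < Re (\<zeta> u) / cmod (\<zeta> u)" "Re (\<zeta> u) / cmod (\<zeta> u) \<le> 1"
  using pos[of u] zeta_nonzero[of u] complex_Re_le_cmod[of "\<zeta> u"] by auto

lemma zeta_M [measurable]: "\<zeta> \<in> borel_measurable M"
  using zeta_measurable by (simp cong: measurable_cong_sets)

lemma majorant_measurable2 [measurable]:
  "(\<lambda>z. dilated_majorant (Re (\<zeta> (fst z)) / cmod (\<zeta> (fst z))) (cmod (\<zeta> (fst z))) (snd z :: 'a::euclidean_space))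
    \<in> borel_measurable (M \<Otimes>\<^sub>M lborel)"
  "(\<lambda>z. dilated_majorant (Re (\<zeta> (snd z)) / cmod (\<zeta> (snd z))) (cmod (\<zeta> (snd z))) (fst z :: 'a::euclidean_space))
    \<in> borel_measurable (lborel \<Otimes>\<^sub>M M)"
  unfolding dilated_majorant_def majorant_def by measurable

lemma mix_majorant_measurable [measurable]:
  "(mix_majorant M \<zeta> :: 'a::euclidean_space \<Rightarrow> ennreal) \<in> borel_measurable borel"
proof -
  have "(mix_majorant M \<zeta> :: 'a \<Rightarrow> ennreal) \<in> borel_measurable lborel" unfolding mix_majorant_def[abs_def]
    by (rule borel_measurable_nn_integral) (simp add: case_prod_beta')
  then show ?thesis by simp
qed

lemma mix_majorant_minus: "mix_majorant M \<zeta> (- x) = mix_majorant M \<zeta> x"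
  by (simp add: mix_majorant_def dilated_majorant_minus)

lemma mix_kernel_measurable [measurable]:
  "(mix_kernel M \<zeta> :: 'a::euclidean_space \<Rightarrow> complex) \<in> borel_measurable borel"
proof -
  have "(\<lambda>z. (snd z, fst z)) \<in> borel \<Otimes>\<^sub>M M \<rightarrow>\<^sub>M M \<Otimes>\<^sub>M (borel :: 'a measure)" by measurable
  from measurable_compose[OF this poisson_measurable2[OF zeta_M pos]]
  have "(\<lambda>z. poisson (\<zeta> (snd z)) (fst z)) \<in> borel_measurable ((borel :: 'a measure) \<Otimes>\<^sub>M M)" by simp
  then show ?thesis unfolding mix_kernel_def[abs_def]
    by (intro borel_measurable_lebesgue_integral) (simp add: case_prod_beta')
qed

text \<open>The first bound concerns the integral of the moduli and is what Fubini needs in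
  \<open>mix_conv_op\<close>; the second dominates the operator. Where the integral defining the
  kernel does not converge, the kernel is 0 by default.\<close>

lemma mix_kernel_le:
  "(\<integral>\<^sup>+u. nn_norm (poisson (\<zeta> u)) x \<partial>M) \<le> ennreal (mix_bound DIM('a)) * mix_majorant M \<zeta> (x::'a::euclidean_space)"
  "nn_norm (mix_kernel M \<zeta>) x \<le> ennreal (mix_bound DIM('a)) * mix_majorant M \<zeta> (x::'a::euclidean_space)"
proof -
  have "(\<lambda>u. (u, x)) \<in> M \<rightarrow>\<^sub>M M \<Otimes>\<^sub>M borel" by measurable
  from measurable_compose[OF this poisson_measurable2[OF zeta_M pos]]
  have [measurable]: "(\<lambda>u. poisson (\<zeta> u) x) \<in> borel_measurable M" by simp
  have "(\<lambda>u. (u, x)) \<in> M \<rightarrow>\<^sub>M M \<Otimes>\<^sub>M lborel" by measurable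
  from measurable_compose[OF this majorant_measurable2(1)]
  have [measurable]: "(\<lambda>u. dilated_majorant (Re (\<zeta> u) / cmod (\<zeta> u)) (cmod (\<zeta> u)) x) \<in> borel_measurable M" by simp
  have "(\<integral>\<^sup>+u. nn_norm (poisson (\<zeta> u)) x \<partial>M)
      \<le> (\<integral>\<^sup>+u. ennreal (mix_bound DIM('a)) * dilated_majorant (Re (\<zeta> u) / cmod (\<zeta> u)) (cmod (\<zeta> u)) x \<partial>M)"
    unfolding mix_bound_def by (intro nn_integral_mono poisson_bound pos)
  also have "\<dots> = ennreal (mix_bound DIM('a)) * mix_majorant M \<zeta> x"
    unfolding mix_majorant_def by (rule nn_integral_cmult) measurable
  finally show le: "(\<integral>\<^sup>+u. nn_norm (poisson (\<zeta> u)) x \<partial>M) \<le> ennreal (mix_bound DIM('a)) * mix_majorant M \<zeta> x" .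
  show "nn_norm (mix_kernel M \<zeta>) x \<le> ennreal (mix_bound DIM('a)) * mix_majorant M \<zeta> x"
  proof (cases "integrable M (\<lambda>u. poisson (\<zeta> u) x)")
    case True
    show ?thesis unfolding mix_kernel_def by (rule order_trans[OF integral_norm_bound_ennreal[OF True] le])
  qed (simp add: mix_kernel_def not_integrable_integral_eq)
qed

lemma mix_majorant_mass:
  assumes C: "\<And>\<delta> \<rho>. 0 < \<delta> \<Longrightarrow> \<delta> \<le> 1 \<Longrightarrow> 0 < \<rho> \<Longrightarrow>
    (\<integral>\<^sup>+(x::'a::euclidean_space). dilated_majorant \<delta> \<rho> x \<partial>lborel) \<le> ennreal (C * \<delta> powr (- \<beta>))" and "0 \<le> C"
  shows "(\<integral>\<^sup>+x. mix_majorant M \<zeta> (x::'a) \<partial>lborel) \<le> ennreal C * mix_weight M \<zeta> \<beta>"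
proof -
  interpret P: pair_sigma_finite M "lborel :: 'a measure" ..
  have "(\<integral>\<^sup>+x. mix_majorant M \<zeta> (x::'a) \<partial>lborel)
      = (\<integral>\<^sup>+u. \<integral>\<^sup>+x. dilated_majorant (Re (\<zeta> u) / cmod (\<zeta> u)) (cmod (\<zeta> u)) (x::'a) \<partial>lborel \<partial>M)"
    unfolding mix_majorant_def by (rule P.Fubini') (simp add: case_prod_beta')
  also have "\<dots> \<le> (\<integral>\<^sup>+u. ennreal C * ennreal ((Re (\<zeta> u) / cmod (\<zeta> u)) powr (- \<beta>)) \<partial>M)"
    using C[OF angle zeta_nonzero(2)] \<open>0 \<le> C\<close> by (intro nn_integral_mono) (simp add: ennreal_mult)
  also have "\<dots> = ennreal C * mix_weight M \<zeta> \<beta>"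
    unfolding mix_weight_def by (rule nn_integral_cmult) measurable
  finally show ?thesis .
qed

text \<open>The weighted Hoelder inequality with weight \<open>\<delta>(u)\<^bsup>-\<beta>\<^esup>\<close> integrates the maximal inequality over the mixture.\<close>

lemma mix_maximal:
  fixes R :: "real set" and g :: "'a::euclidean_space \<Rightarrow> ennreal"
  assumes mx: "\<And>\<delta> s R g. 0 < \<delta> \<Longrightarrow> \<delta> \<le> 1 \<Longrightarrow> 0 < s \<Longrightarrow> finite R \<Longrightarrow> (\<forall>\<rho>\<in>R. \<exists>k::int. \<rho> = s * 2 powi k) \<Longrightarrow>
      g \<in> borel_measurable borel \<Longrightarrow>
      (\<integral>\<^sup>+(x::'a). epow (SUP \<rho>\<in>R. conv (dilated_majorant \<delta> \<rho>) g x) q \<partial>lborel)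
        \<le> epow (ennreal (C * \<delta> powr (- \<beta>))) q * (\<integral>\<^sup>+x. epow (g x) q \<partial>lborel)"
    and C: "0 \<le> C" and q: "1 < q" and R: "finite R" "\<forall>r\<in>R. \<exists>k::int. r = 2 powi k"
    and g[measurable]: "g \<in> borel_measurable borel"
  shows "(\<integral>\<^sup>+x. epow (SUP r\<in>R. conv (mix_majorant M (\<lambda>u. complex_of_real r * \<zeta> u)) g x) q \<partial>lborel)
    \<le> epow (ennreal C * mix_weight M \<zeta> \<beta>) q * (\<integral>\<^sup>+x. epow (g x) q \<partial>lborel)"
proof -
  interpret P: pair_sigma_finite M "lborel :: 'a measure" ..
  define \<delta> where "\<delta> u = Re (\<zeta> u) / cmod (\<zeta> u)" for u
  have [measurable]: "\<delta> \<in> borel_measurable borel" unfolding \<delta>_def by measurable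
  have [measurable]: "\<delta> \<in> borel_measurable M" unfolding \<delta>_def by measurable
  have \<delta>: "0 < \<delta> u" "\<delta> u \<le> 1" for u using angle[of u] by (auto simp: \<delta>_def)
  have Rpos: "0 < r" if "r \<in> R" for r using R(2) that by auto
  define Mx where "Mx u x = (SUP r\<in>R. conv (dilated_majorant (\<delta> u) (r * cmod (\<zeta> u))) g x)" for u x
  define W where "W = mix_weight M \<zeta> \<beta>"
  have cm: "(\<lambda>z. conv (dilated_majorant (\<delta> (fst z)) (r * cmod (\<zeta> (fst z)))) g (snd z)) \<in> borel_measurable (M \<Otimes>\<^sub>M lborel)" for r
    unfolding conv_def dilated_majorant_def majorant_def
    by (rule lborel.borel_measurable_nn_integral) measurable
  have [measurable]: "(\<lambda>z. Mx (fst z) (snd z)) \<in> borel_measurable (M \<Otimes>\<^sub>M lborel)"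
    unfolding Mx_def by (intro borel_measurable_SUP cm countable_finite R(1))
  \<comment> \<open>The factors \<delta>^(-\<beta>) and \<delta>^\<beta> cancel. The first becomes
    the weight in Jensen's inequality; the second compensates the loss of the maximal function, so
    that \<delta>^\<beta> Mx has an L^q bound uniform in u.\<close>
  have le: "conv (mix_majorant M (\<lambda>u. complex_of_real r * \<zeta> u)) g x
      \<le> (\<integral>\<^sup>+u. ennreal (\<delta> u powr (- \<beta>)) * (ennreal (\<delta> u powr \<beta>) * Mx u x) \<partial>M)" if r: "r \<in> R" for r x
  proof -
    have "mix_majorant M (\<lambda>u. complex_of_real r * \<zeta> u) y = (\<integral>\<^sup>+u. dilated_majorant (\<delta> u) (r * cmod (\<zeta> u)) y \<partial>M)" for y :: 'a
      using Rpos[OF r] unfolding mix_majorant_def \<delta>_def by (simp add: norm_mult)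
    then have "conv (mix_majorant M (\<lambda>u. complex_of_real r * \<zeta> u)) g x
        = (\<integral>\<^sup>+y. (\<integral>\<^sup>+u. dilated_majorant (\<delta> u) (r * cmod (\<zeta> u)) (x - y) \<partial>M) * g y \<partial>lborel)"
      by (simp add: conv_def)
    also have "\<dots> = (\<integral>\<^sup>+y. \<integral>\<^sup>+u. dilated_majorant (\<delta> u) (r * cmod (\<zeta> u)) (x - y) * g y \<partial>M \<partial>lborel)"
      unfolding dilated_majorant_def majorant_def
      by (intro nn_integral_cong nn_integral_multc[symmetric]) measurable
    also have "\<dots> = (\<integral>\<^sup>+u. conv (dilated_majorant (\<delta> u) (r * cmod (\<zeta> u))) g x \<partial>M)"
      unfolding conv_def dilated_majorant_def majorant_def by (rule P.Fubini') measurable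
    also have "\<dots> \<le> (\<integral>\<^sup>+u. Mx u x \<partial>M)"
      unfolding Mx_def using r by (intro nn_integral_mono SUP_upper)
    also have "\<dots> = (\<integral>\<^sup>+u. ennreal (\<delta> u powr (- \<beta>)) * (ennreal (\<delta> u powr \<beta>) * Mx u x) \<partial>M)"
    proof (rule nn_integral_cong)
      fix u
      have "ennreal (\<delta> u powr (- \<beta>)) * ennreal (\<delta> u powr \<beta>) = 1"
        using \<delta>[of u] by (simp flip: ennreal_mult powr_add)
      then show "Mx u x = ennreal (\<delta> u powr (- \<beta>)) * (ennreal (\<delta> u powr \<beta>) * Mx u x)"
        by (simp add: mult.assoc[symmetric])
    qed
    finally show ?thesis .
  qed
  have Mxu[measurable]: "(\<lambda>u. Mx u x) \<in> borel_measurable M" for x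
  proof -
    have "(\<lambda>u. (u, x)) \<in> M \<rightarrow>\<^sub>M M \<Otimes>\<^sub>M lborel" by measurable
    from measurable_compose[OF this \<open>(\<lambda>z. Mx (fst z) (snd z)) \<in> borel_measurable (M \<Otimes>\<^sub>M lborel)\<close>] show ?thesis by simp
  qed
  have "(\<integral>\<^sup>+x. epow (SUP r\<in>R. conv (mix_majorant M (\<lambda>u. complex_of_real r * \<zeta> u)) g x) q \<partial>lborel)
      \<le> (\<integral>\<^sup>+x. (\<integral>\<^sup>+u. ennreal (\<delta> u powr (- \<beta>)) * epow (ennreal (\<delta> u powr \<beta>) * Mx u x) q \<partial>M) * epow W (q - 1) \<partial>lborel)"
  proof (rule nn_integral_mono)
    fix x
    have "epow (SUP r\<in>R. conv (mix_majorant M (\<lambda>u. complex_of_real r * \<zeta> u)) g x) q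
        \<le> epow (\<integral>\<^sup>+u. ennreal (\<delta> u powr (- \<beta>)) * (ennreal (\<delta> u powr \<beta>) * Mx u x) \<partial>M) q"
      using q by (intro epow_mono SUP_least le) auto
    also have "\<dots> \<le> (\<integral>\<^sup>+u. ennreal (\<delta> u powr (- \<beta>)) * epow (ennreal (\<delta> u powr \<beta>) * Mx u x) q \<partial>M) * epow W (q - 1)"
      unfolding W_def mix_weight_def \<delta>_def[symmetric] using q by (intro nn_integral_product_power) auto
    finally show "epow (SUP r\<in>R. conv (mix_majorant M (\<lambda>u. complex_of_real r * \<zeta> u)) g x) q \<le> \<dots>" .
  qed
  also have "\<dots> = (\<integral>\<^sup>+x. \<integral>\<^sup>+u. ennreal (\<delta> u powr (- \<beta>)) * epow (ennreal (\<delta> u powr \<beta>) * Mx u x) q \<partial>M \<partial>lborel) * epow W (q - 1)"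
  proof (rule nn_integral_multc)
    have "(\<lambda>z. (snd z, fst z)) \<in> lborel \<Otimes>\<^sub>M M \<rightarrow>\<^sub>M M \<Otimes>\<^sub>M (lborel :: 'a measure)" by measurable
    from measurable_compose[OF this \<open>(\<lambda>z. Mx (fst z) (snd z)) \<in> borel_measurable (M \<Otimes>\<^sub>M lborel)\<close>]
    have [measurable]: "(\<lambda>z. Mx (snd z) (fst z)) \<in> borel_measurable (lborel \<Otimes>\<^sub>M M)" by simp
    have "(\<lambda>z. ennreal (\<delta> (snd z) powr (- \<beta>)) * epow (ennreal (\<delta> (snd z) powr \<beta>) * Mx (snd z) (fst z)) q) \<in> borel_measurable (lborel \<Otimes>\<^sub>M M)"
      by measurable
    then show "(\<lambda>x. \<integral>\<^sup>+u. ennreal (\<delta> u powr (- \<beta>)) * epow (ennreal (\<delta> u powr \<beta>) * Mx u x) q \<partial>M) \<in> borel_measurable lborel"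
      by (intro borel_measurable_nn_integral) (simp add: case_prod_beta')
  qed
  also have "(\<integral>\<^sup>+x. \<integral>\<^sup>+u. ennreal (\<delta> u powr (- \<beta>)) * epow (ennreal (\<delta> u powr \<beta>) * Mx u x) q \<partial>M \<partial>lborel)
      = (\<integral>\<^sup>+u. \<integral>\<^sup>+x. ennreal (\<delta> u powr (- \<beta>)) * epow (ennreal (\<delta> u powr \<beta>) * Mx u x) q \<partial>lborel \<partial>M)"
    by (rule P.Fubini') (simp add: case_prod_beta')
  also have "\<dots> * epow W (q - 1) \<le> (epow (ennreal C) q * (\<integral>\<^sup>+x. epow (g x) q \<partial>lborel) * W) * epow W (q - 1)"
  proof (rule mult_right_mono)
    have "(\<integral>\<^sup>+x. ennreal (\<delta> u powr (- \<beta>)) * epow (ennreal (\<delta> u powr \<beta>) * Mx u x) q \<partial>lborel)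
        \<le> (epow (ennreal C) q * (\<integral>\<^sup>+x. epow (g x) q \<partial>lborel)) * ennreal (\<delta> u powr (- \<beta>))" for u
    proof -
      have [measurable]: "(\<lambda>x. Mx u x) \<in> borel_measurable borel"
        unfolding Mx_def by (intro borel_measurable_SUP conv_measurable countable_finite R(1)) measurable
      have "(\<integral>\<^sup>+x. ennreal (\<delta> u powr (- \<beta>)) * epow (ennreal (\<delta> u powr \<beta>) * Mx u x) q \<partial>lborel)
          = (\<integral>\<^sup>+x. (ennreal (\<delta> u powr (- \<beta>)) * epow (ennreal (\<delta> u powr \<beta>)) q) * epow (Mx u x) q \<partial>lborel)"
        using q by (intro nn_integral_cong) (simp add: epow_mult mult.assoc)
      also have "\<dots> = (ennreal (\<delta> u powr (- \<beta>)) * epow (ennreal (\<delta> u powr \<beta>)) q) * (\<integral>\<^sup>+x. epow (Mx u x) q \<partial>lborel)"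
        by (rule nn_integral_cmult) measurable
      also have "(\<integral>\<^sup>+x. epow (Mx u x) q \<partial>lborel) \<le> epow (ennreal (C * \<delta> u powr (- \<beta>))) q * (\<integral>\<^sup>+x. epow (g x) q \<partial>lborel)"
      proof -
        \<comment> \<open>Here the scales are |\<zeta> u| 2^k. This is why the maximal inequality
          admits dyadic scales with an arbitrary base s > 0: the base varies with u.\<close>
        have "(\<integral>\<^sup>+x. epow (SUP \<rho>\<in>(\<lambda>r. r * cmod (\<zeta> u)) ` R. conv (dilated_majorant (\<delta> u) \<rho>) g x) q \<partial>lborel)
            \<le> epow (ennreal (C * \<delta> u powr (- \<beta>))) q * (\<integral>\<^sup>+x. epow (g x) q \<partial>lborel)"
          using R zeta_nonzero(2)[of u] \<delta>[of u]
          by (intro mx[of "\<delta> u" "cmod (\<zeta> u)"]) (force simp: mult.commute)+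
        then show ?thesis by (simp add: Mx_def image_image)
      qed
      finally have "(\<integral>\<^sup>+x. ennreal (\<delta> u powr (- \<beta>)) * epow (ennreal (\<delta> u powr \<beta>) * Mx u x) q \<partial>lborel)
          \<le> (ennreal (\<delta> u powr (- \<beta>)) * epow (ennreal (\<delta> u powr \<beta>)) q) *
            (epow (ennreal (C * \<delta> u powr (- \<beta>))) q * (\<integral>\<^sup>+x. epow (g x) q \<partial>lborel))"
        by (rule meta_mp) (auto intro: mult_left_mono)
      also have "\<dots> = ennreal (\<delta> u powr (- \<beta>)) * epow (ennreal (\<delta> u powr \<beta>) * ennreal (C * \<delta> u powr (- \<beta>))) q * (\<integral>\<^sup>+x. epow (g x) q \<partial>lborel)"
        using q by (simp only: epow_mult order_less_trans[OF zero_less_one] ac_simps)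
      also have "ennreal (\<delta> u powr \<beta>) * ennreal (C * \<delta> u powr (- \<beta>)) = ennreal C"
      proof -
        have "\<delta> u powr \<beta> * (C * \<delta> u powr (- \<beta>)) = C" using \<delta>[of u] by (simp add: powr_minus_divide)
        then show ?thesis using C by (simp flip: ennreal_mult)
      qed
      finally show ?thesis by (simp only: ac_simps)
    qed
    then have "(\<integral>\<^sup>+u. \<integral>\<^sup>+x. ennreal (\<delta> u powr (- \<beta>)) * epow (ennreal (\<delta> u powr \<beta>) * Mx u x) q \<partial>lborel \<partial>M)
      \<le> (\<integral>\<^sup>+u. (epow (ennreal C) q * (\<integral>\<^sup>+x. epow (g x) q \<partial>lborel)) * ennreal (\<delta> u powr (- \<beta>)) \<partial>M)"
      by (intro nn_integral_mono)
    also have "\<dots> = epow (ennreal C) q * (\<integral>\<^sup>+x. epow (g x) q \<partial>lborel) * W"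
      unfolding W_def mix_weight_def \<delta>_def[symmetric] by (rule nn_integral_cmult) measurable
    finally show "(\<integral>\<^sup>+u. \<integral>\<^sup>+x. ennreal (\<delta> u powr (- \<beta>)) * epow (ennreal (\<delta> u powr \<beta>) * Mx u x) q \<partial>lborel \<partial>M) \<le> \<dots>" .
  qed simp
  also have "\<dots> = (epow (ennreal C) q * (W * epow W (q - 1))) * (\<integral>\<^sup>+x. epow (g x) q \<partial>lborel)"
    by (simp only: ac_simps)
  also have "W * epow W (q - 1) = epow W q" using epow_add[of W 1 "q - 1"] by simp
  also have "epow (ennreal C) q * epow W q = epow (ennreal C * W) q" using q by (simp add: epow_mult)
  finally show ?thesis unfolding W_def .
qed

end

section \<open>Uniqueness of Fourier multiplier operators\<close>

text \<open>The test functions in \<open>has_symbol\<close>; the uniqueness of the operator amounts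
  to their density in Lp.\<close>

definition nice :: "real \<Rightarrow> ('a::euclidean_space \<Rightarrow> complex) \<Rightarrow> bool" where
  "nice p f \<longleftrightarrow> f \<in> Lp p \<and> integrable lborel f \<and> integrable lborel (fourier f)"

text \<open>A property of the single function f: it is a limit of \<open>nice\<close> functions.
  Distances are measured by the p-th power of the norm, so the triangle inequality takes the form
  \<open>mass_add_le\<close>, with the factor \<open>2 powr p\<close>.\<close>

definition Lp_dense :: "real \<Rightarrow> ('a::euclidean_space \<Rightarrow> complex) \<Rightarrow> bool" where
  "Lp_dense p f \<longleftrightarrow> f \<in> borel_measurable borel \<and> (\<forall>e>0. \<exists>g. nice p g \<and> (\<integral>\<^sup>+x. epow (nn_norm (\<lambda>x. f x - g x) x) p \<partial>lborel) \<le> ennreal e)"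

lemma epow_norm_add_le:
  assumes "0 < p"
  shows "epow (ennreal (cmod (a + b))) p \<le> ennreal (2 powr p) * (epow (ennreal (cmod a)) p + epow (ennreal (cmod b)) p)"
proof -
  have "ennreal (cmod (a + b)) \<le> (\<Sum>i\<in>(UNIV::bool set). if i then ennreal (cmod a) else ennreal (cmod b))"
    using norm_triangle_ineq[of a b] by (simp add: UNIV_bool add.commute ennreal_leI flip: ennreal_plus)
  then have "epow (ennreal (cmod (a + b))) p \<le> epow (\<Sum>i\<in>(UNIV::bool set). if i then ennreal (cmod a) else ennreal (cmod b)) p"
    using assms by (intro epow_mono) auto
  also have "\<dots> \<le> ennreal (real (card (UNIV::bool set)) powr p) * (\<Sum>i\<in>UNIV. epow (if i then ennreal (cmod a) else ennreal (cmod b)) p)"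
    using assms by (intro epow_sum_le) auto
  finally show ?thesis by (simp add: UNIV_bool add.commute)
qed

lemma mass_add_le:
  fixes f g :: "'a::euclidean_space \<Rightarrow> complex"
  assumes [measurable]: "f \<in> borel_measurable borel" "g \<in> borel_measurable borel" and p: "0 < p"
  shows "(\<integral>\<^sup>+x. epow (nn_norm (\<lambda>x. f x + g x) x) p \<partial>lborel)
    \<le> ennreal (2 powr p) * ((\<integral>\<^sup>+x. epow (nn_norm f x) p \<partial>lborel) + (\<integral>\<^sup>+x. epow (nn_norm g x) p \<partial>lborel))"
proof -
  have "(\<integral>\<^sup>+x. epow (nn_norm (\<lambda>x. f x + g x) x) p \<partial>lborel)
      \<le> (\<integral>\<^sup>+x. ennreal (2 powr p) * (epow (nn_norm f x) p + epow (nn_norm g x) p) \<partial>lborel)"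
    using p by (intro nn_integral_mono epow_norm_add_le)
  then show ?thesis by (simp add: nn_integral_cmult nn_integral_add)
qed

lemma Lp_add:
  assumes "f \<in> Lp p" "g \<in> Lp p" "0 < p"
  shows "(\<lambda>x. f x + g x) \<in> Lp p"
proof (rule Lp_I)
  note [measurable] = Lp_D(1)[OF assms(1)] Lp_D(1)[OF assms(2)]
  show "(\<lambda>x. f x + g x) \<in> borel_measurable borel" by measurable
  have "ennreal (2 powr p) * ((\<integral>\<^sup>+x. epow (nn_norm f x) p \<partial>lborel) + (\<integral>\<^sup>+x. epow (nn_norm g x) p \<partial>lborel)) < \<top>"
    using Lp_D(2)[OF assms(1)] Lp_D(2)[OF assms(2)] by (simp add: ennreal_mult_less_top)
  then show "(\<integral>\<^sup>+x. epow (nn_norm (\<lambda>x. f x + g x) x) p \<partial>lborel) < \<top>"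
    using mass_add_le[of f g p] assms(3) by (auto intro: le_less_trans)
qed

lemma mass_scale:
  fixes f :: "'a::euclidean_space \<Rightarrow> complex"
  assumes [measurable]: "f \<in> borel_measurable borel" and p: "0 < p"
  shows "(\<integral>\<^sup>+x. epow (nn_norm (\<lambda>x. c * f x) x) p \<partial>lborel) = epow (ennreal (cmod c)) p * (\<integral>\<^sup>+x. epow (nn_norm f x) p \<partial>lborel)"
  using p by (simp add: norm_mult ennreal_mult epow_mult nn_integral_cmult)

lemma Lp_scale:
  assumes "f \<in> Lp p" "0 < p"
  shows "(\<lambda>x. c * f x) \<in> Lp p"
proof (rule Lp_I)
  note [measurable] = Lp_D(1)[OF assms(1)]
  show "(\<lambda>x. c * f x) \<in> borel_measurable borel" by measurable
  show "(\<integral>\<^sup>+x. epow (nn_norm (\<lambda>x. c * f x) x) p \<partial>lborel) < \<top>"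
    unfolding mass_scale[OF Lp_D(1)[OF assms(1)] assms(2)] using Lp_D(2)[OF assms(1)] by (simp add: ennreal_mult_less_top)
qed

lemma integrable_cis_mult:
  fixes f :: "'a::euclidean_space \<Rightarrow> complex"
  assumes "integrable lborel f"
  shows "integrable lborel (\<lambda>x. cis (- (\<xi> \<bullet> x)) * f x)"
proof (rule Bochner_Integration.integrable_bound[OF assms])
  have [measurable]: "f \<in> borel_measurable lborel" using assms by auto
  show "(\<lambda>x. cis (- (\<xi> \<bullet> x)) * f x) \<in> borel_measurable lborel" by measurable
qed (simp add: norm_mult)

lemma nice_add:
  assumes "nice p f" "nice p g" "0 < p"
  shows "nice p (\<lambda>x. f x + g x)"
proof -
  have "fourier (\<lambda>x. f x + g x) = (\<lambda>\<xi>. fourier f \<xi> + fourier g \<xi>)"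
  proof
    fix \<xi>
    have "integrable lborel (\<lambda>x. cis (- (\<xi> \<bullet> x)) * f x)" "integrable lborel (\<lambda>x. cis (- (\<xi> \<bullet> x)) * g x)"
      using assms by (auto simp: nice_def intro!: integrable_cis_mult)
    from Bochner_Integration.integral_add[OF this]
    show "fourier (\<lambda>x. f x + g x) \<xi> = fourier f \<xi> + fourier g \<xi>"
      by (simp add: fourier_def distrib_left)
  qed
  then show ?thesis using assms Lp_add unfolding nice_def by auto
qed

lemma nice_scale:
  assumes "nice p f" "0 < p"
  shows "nice p (\<lambda>x. c * f x)"
proof -
  have "fourier (\<lambda>x. c * f x) = (\<lambda>\<xi>. c * fourier f \<xi>)"
    unfolding fourier_def by (simp add: mult.left_commute)
  then show ?thesis using assms Lp_scale unfolding nice_def by auto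
qed

lemma Lp_dense_add:
  assumes f: "Lp_dense p f" and g: "Lp_dense p g" and p: "0 < p"
  shows "Lp_dense p (\<lambda>x. f x + g x)"
  unfolding Lp_dense_def
proof (intro conjI allI impI)
  have [measurable]: "f \<in> borel_measurable borel" "g \<in> borel_measurable borel" using f g by (auto simp: Lp_dense_def)
  show "(\<lambda>x. f x + g x) \<in> borel_measurable borel" by measurable
  fix e :: real assume e: "0 < e"
  define d where "d = e / (2 powr p * 2)"
  have "0 < d" using e by (simp add: d_def)
  then obtain f' g' where f': "nice p f'" "(\<integral>\<^sup>+x. epow (nn_norm (\<lambda>x. f x - f' x) x) p \<partial>lborel) \<le> ennreal d"
    and g': "nice p g'" "(\<integral>\<^sup>+x. epow (nn_norm (\<lambda>x. g x - g' x) x) p \<partial>lborel) \<le> ennreal d"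
    using f g unfolding Lp_dense_def by meson
  have [measurable]: "f' \<in> borel_measurable borel" "g' \<in> borel_measurable borel"
    using f' g' Lp_D by (auto simp: nice_def)
  have "(\<integral>\<^sup>+x. epow (nn_norm (\<lambda>x. (f x - f' x) + (g x - g' x)) x) p \<partial>lborel)
      \<le> ennreal (2 powr p) * ((\<integral>\<^sup>+x. epow (nn_norm (\<lambda>x. f x - f' x) x) p \<partial>lborel) + (\<integral>\<^sup>+x. epow (nn_norm (\<lambda>x. g x - g' x) x) p \<partial>lborel))"
    using p by (intro mass_add_le) auto
  also have "\<dots> \<le> ennreal (2 powr p) * (ennreal d + ennreal d)"
    using f' g' by (intro mult_left_mono add_mono) auto
  also have "\<dots> = ennreal e"
    using \<open>0 < d\<close> by (simp add: d_def flip: ennreal_plus ennreal_mult)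
  finally have "(\<integral>\<^sup>+x. epow (nn_norm (\<lambda>x. (f x + g x) - (f' x + g' x)) x) p \<partial>lborel) \<le> ennreal e"
    by (simp add: algebra_simps)
  then show "\<exists>h. nice p h \<and> (\<integral>\<^sup>+x. epow (nn_norm (\<lambda>x. f x + g x - h x) x) p \<partial>lborel) \<le> ennreal e"
    using nice_add[OF f'(1) g'(1) p] by (intro exI[of _ "\<lambda>x. f' x + g' x"]) auto
qed

lemma Lp_dense_scale:
  assumes f: "Lp_dense p f" and p: "0 < p"
  shows "Lp_dense p (\<lambda>x. c * f x)"
  unfolding Lp_dense_def
proof (intro conjI allI impI)
  have [measurable]: "f \<in> borel_measurable borel" using f by (auto simp: Lp_dense_def)
  show "(\<lambda>x. c * f x) \<in> borel_measurable borel" by measurable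
  fix e :: real assume e: "0 < e"
  define d where "d = e / ((cmod c) powr p + 1)"
  have pos: "0 < (cmod c) powr p + 1" by (simp add: add_nonneg_pos)
  then have "0 < d" using e by (simp add: d_def)
  then obtain f' where f': "nice p f'" "(\<integral>\<^sup>+x. epow (nn_norm (\<lambda>x. f x - f' x) x) p \<partial>lborel) \<le> ennreal d"
    using f unfolding Lp_dense_def by meson
  have [measurable]: "f' \<in> borel_measurable borel" using f' Lp_D by (auto simp: nice_def)
  have "(\<integral>\<^sup>+x. epow (nn_norm (\<lambda>x. c * (f x - f' x)) x) p \<partial>lborel) = epow (ennreal (cmod c)) p * (\<integral>\<^sup>+x. epow (nn_norm (\<lambda>x. f x - f' x) x) p \<partial>lborel)"
    using p by (intro mass_scale) auto
  also have "\<dots> \<le> ennreal ((cmod c) powr p) * ennreal d"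
    using f' by (intro mult_mono) (auto simp: epow_ennreal)
  also have "\<dots> = ennreal ((cmod c) powr p * d)" using \<open>0 < d\<close> by (simp add: ennreal_mult)
  also have "\<dots> \<le> ennreal e"
  proof (rule ennreal_leI)
    have "(cmod c) powr p * d \<le> ((cmod c) powr p + 1) * d" using \<open>0 < d\<close> by (intro mult_right_mono) auto
    also have "\<dots> = e" using pos by (simp add: d_def)
    finally show "(cmod c) powr p * d \<le> e" .
  qed
  finally have "(\<integral>\<^sup>+x. epow (nn_norm (\<lambda>x. c * f x - c * f' x) x) p \<partial>lborel) \<le> ennreal e"
    by (simp add: right_diff_distrib)
  then show "\<exists>h. nice p h \<and> (\<integral>\<^sup>+x. epow (nn_norm (\<lambda>x. c * f x - h x) x) p \<partial>lborel) \<le> ennreal e"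
    using nice_scale[OF f'(1) p] by (intro exI[of _ "\<lambda>x. c * f' x"]) auto
qed

text \<open>The heat kernel at time \<epsilon>^2 / 4, that is, the Gaussian of total mass 1 whose
  width is proportional to \<epsilon>.\<close>

definition heat :: "real \<Rightarrow> 'a::euclidean_space \<Rightarrow> real" where
  "heat \<epsilon> x = (1 / (\<epsilon> * sqrt pi)) ^ DIM('a) * exp (- ((norm x)\<^sup>2 / \<epsilon>\<^sup>2))"

lemma heat_nonneg: "0 < \<epsilon> \<Longrightarrow> 0 \<le> heat \<epsilon> x"
  by (simp add: heat_def)

lemma heat_measurable [measurable]: "heat \<epsilon> \<in> borel_measurable borel"
  unfolding heat_def[abs_def] by measurable

lemma heat_fourier:
  fixes \<xi> :: "'a::euclidean_space"
  assumes \<epsilon>: "0 < \<epsilon>"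
  shows "integrable lborel (\<lambda>x. cis (- (\<xi> \<bullet> x)) * complex_of_real (heat \<epsilon> x))"
    "(LINT x|lborel. cis (- (\<xi> \<bullet> x)) * complex_of_real (heat \<epsilon> x)) = complex_of_real (exp (- ((norm \<xi>)\<^sup>2 * \<epsilon>\<^sup>2 / 4)))"
proof -
  define a where "a = 1 / \<epsilon>\<^sup>2"
  define c where "c = complex_of_real ((1 / (\<epsilon> * sqrt pi)) ^ DIM('a))"
  have a: "0 < a" using \<epsilon> by (simp add: a_def)
  have eq: "cis (- (\<xi> \<bullet> x)) * complex_of_real (heat \<epsilon> x) = c * (cis ((- \<xi>) \<bullet> x) * complex_of_real (exp (- (a * (norm x)\<^sup>2))))" for x :: 'a
    by (simp add: heat_def a_def c_def)
  show "integrable lborel (\<lambda>x. cis (- (\<xi> \<bullet> x)) * complex_of_real (heat \<epsilon> x))"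
    unfolding eq using gaussian_fourier(1)[OF a, of "- \<xi>"] by (rule integrable_mult_right)
  have "(LINT x|lborel. cis (- (\<xi> \<bullet> x)) * complex_of_real (heat \<epsilon> x))
      = c * complex_of_real ((pi / a) powr (real DIM('a) / 2) * exp (- ((norm (- \<xi>))\<^sup>2 / (4 * a))))"
    unfolding eq by (subst integral_mult_right_zero) (simp only: gaussian_fourier(2)[OF a, of "- \<xi>"])
  also have "(pi / a) powr (real DIM('a) / 2) = (\<epsilon> * sqrt pi) ^ DIM('a)"
  proof -
    have "pi / a = (\<epsilon> * sqrt pi)\<^sup>2" by (simp add: a_def power_mult_distrib)
    moreover have "0 < \<epsilon> * sqrt pi" using \<epsilon> by simp
    ultimately show ?thesis by (simp only: square_powr_half)
  qed
  also have "c * complex_of_real ((\<epsilon> * sqrt pi) ^ DIM('a) * exp (- ((norm (- \<xi>))\<^sup>2 / (4 * a)))) = complex_of_real (exp (- ((norm \<xi>)\<^sup>2 * \<epsilon>\<^sup>2 / 4)))"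
  proof -
    have "(1 / (\<epsilon> * sqrt pi)) ^ DIM('a) * (\<epsilon> * sqrt pi) ^ DIM('a) = 1"
      using \<epsilon> by (simp add: power_mult_distrib[symmetric])
    then have "(1 / (\<epsilon> * sqrt pi)) ^ DIM('a) * ((\<epsilon> * sqrt pi) ^ DIM('a) * exp (- ((norm (- \<xi>))\<^sup>2 / (4 * a)))) = exp (- ((norm \<xi>)\<^sup>2 * \<epsilon>\<^sup>2 / 4))"
      by (simp add: mult.assoc[symmetric] a_def)
    then show ?thesis unfolding c_def of_real_mult[symmetric] by (simp only:)
  qed
  finally show "(LINT x|lborel. cis (- (\<xi> \<bullet> x)) * complex_of_real (heat \<epsilon> x)) = complex_of_real (exp (- ((norm \<xi>)\<^sup>2 * \<epsilon>\<^sup>2 / 4)))" .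
qed

lemma heat_mass:
  assumes \<epsilon>: "0 < \<epsilon>"
  shows "(\<integral>\<^sup>+(x::'a::euclidean_space). ennreal (heat \<epsilon> x) \<partial>lborel) = 1"
proof -
  have i: "integrable lborel (\<lambda>x::'a. heat \<epsilon> x)"
    using heat_fourier(1)[OF \<epsilon>, of 0] by (simp add: complex_of_real_integrable_eq)
  have "complex_of_real (LINT x|lborel. heat \<epsilon> (x::'a)) = 1"
    using heat_fourier(2)[OF \<epsilon>, of "0::'a"] by simp
  then have "(LINT x|lborel. heat \<epsilon> (x::'a)) = 1" using of_real_eq_1_iff by blast
  then show ?thesis using i heat_nonneg[OF \<epsilon>] by (subst nn_integral_eq_integral) auto
qed

text \<open>Rescaling moves \<epsilon> from the kernel into the argument of F, so that the fixed
  function \<open>heat 1\<close> can serve as the dominating function when \<epsilon> tends to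
  0.\<close>

lemma conv_heat_eq:
  fixes F :: "'a::euclidean_space \<Rightarrow> ennreal"
  assumes [measurable]: "F \<in> borel_measurable borel" and \<epsilon>: "0 < \<epsilon>"
  shows "conv (\<lambda>x. ennreal (heat \<epsilon> x)) F x = (\<integral>\<^sup>+y. ennreal (heat 1 y) * F (x - \<epsilon> *\<^sub>R y) \<partial>lborel)"
proof -
  have "conv (\<lambda>x. ennreal (heat \<epsilon> x)) F x = (\<integral>\<^sup>+y. ennreal (heat \<epsilon> y) * F (x - y) \<partial>lborel)"
    by (subst conv_commute) (auto simp: conv_def mult.commute)
  also have "\<dots> = ennreal (\<bar>\<epsilon>\<bar> ^ DIM('a)) * (\<integral>\<^sup>+y. ennreal (heat \<epsilon> (0 + \<epsilon> *\<^sub>R y)) * F (x - (0 + \<epsilon> *\<^sub>R y)) \<partial>lborel)"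
    using \<epsilon> by (intro nn_integral_lborel_affine) auto
  also have "\<dots> = (\<integral>\<^sup>+y. ennreal (\<epsilon> ^ DIM('a)) * (ennreal (heat \<epsilon> (\<epsilon> *\<^sub>R y)) * F (x - \<epsilon> *\<^sub>R y)) \<partial>lborel)"
    using \<epsilon> by (simp add: nn_integral_cmult)
  also have "\<dots> = (\<integral>\<^sup>+y. ennreal (heat 1 y) * F (x - \<epsilon> *\<^sub>R y) \<partial>lborel)"
  proof (rule nn_integral_cong)
    fix y :: 'a
    have "\<epsilon> ^ DIM('a) * heat \<epsilon> (\<epsilon> *\<^sub>R y) = heat 1 y"
      using \<epsilon> by (simp add: heat_def power_divide power_mult_distrib)
    then show "ennreal (\<epsilon> ^ DIM('a)) * (ennreal (heat \<epsilon> (\<epsilon> *\<^sub>R y)) * F (x - \<epsilon> *\<^sub>R y)) = ennreal (heat 1 y) * F (x - \<epsilon> *\<^sub>R y)"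
      using \<epsilon> by (simp add: mult.assoc[symmetric] heat_nonneg flip: ennreal_mult)
  qed
  finally show ?thesis .
qed

text \<open>On an open set the mollified indicator converges from below pointwise and its mass does not change;
  so it converges in the mean, in the manner of Scheffe.\<close>

lemma heat_indicator_open:
  fixes U :: "'a::euclidean_space set"
  assumes U: "open U" "emeasure lborel U < \<top>" and "0 < e"
  obtains \<epsilon> where "0 < \<epsilon>"
    "(\<integral>\<^sup>+x. indicator U x - conv (\<lambda>x. ennreal (heat \<epsilon> x)) (indicator U) x \<partial>lborel) \<le> ennreal e"
proof -
  have [measurable]: "U \<in> sets borel" using U by simp
  define F where "F n = conv (\<lambda>x. ennreal (heat (1 / real (Suc n)) x)) (indicator U :: 'a \<Rightarrow> ennreal)" for n
  have Fm[measurable]: "F n \<in> borel_measurable borel" for n unfolding F_def by measurable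
  have F1: "F n x \<le> 1" for n x
  proof -
    have "F n x \<le> (\<integral>\<^sup>+y. ennreal (heat 1 (y::'a)) \<partial>lborel)"
      unfolding F_def by (subst conv_heat_eq) (auto simp: indicator_def intro!: nn_integral_mono)
    then show ?thesis by (simp add: heat_mass)
  qed
  have lim: "(\<lambda>n. F n x) \<longlonglongrightarrow> 1" if x: "x \<in> U" for x
  proof -
    have "(\<lambda>n. \<integral>\<^sup>+y. ennreal (heat 1 y) * indicator U (x - (1 / real (Suc n)) *\<^sub>R y) \<partial>lborel) \<longlonglongrightarrow> (\<integral>\<^sup>+y. ennreal (heat 1 (y::'a)) \<partial>lborel)"
    proof (rule nn_integral_dominated_convergence[where w = "\<lambda>y. ennreal (heat 1 y)"])
      show "(\<integral>\<^sup>+y. ennreal (heat 1 (y::'a)) \<partial>lborel) < \<infinity>" by (simp add: heat_mass)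
      show "AE y in lborel. (\<lambda>n. ennreal (heat 1 y) * indicator U (x - (1 / real (Suc n)) *\<^sub>R y)) \<longlonglongrightarrow> ennreal (heat 1 y)"
      proof (rule AE_I2)
        fix y :: 'a
        have "(\<lambda>n. x - (1 / real (Suc n)) *\<^sub>R y) \<longlonglongrightarrow> x - 0 *\<^sub>R y"
          by (intro tendsto_intros LIMSEQ_Suc[OF lim_1_over_n])
        then have "eventually (\<lambda>n. x - (1 / real (Suc n)) *\<^sub>R y \<in> U) sequentially"
          using x U(1) by (intro topological_tendstoD) auto
        then have "eventually (\<lambda>n. ennreal (heat 1 y) * indicator U (x - (1 / real (Suc n)) *\<^sub>R y) = ennreal (heat 1 y)) sequentially"
          by eventually_elim simp
        then show "(\<lambda>n. ennreal (heat 1 y) * indicator U (x - (1 / real (Suc n)) *\<^sub>R y)) \<longlonglongrightarrow> ennreal (heat 1 y)"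
          by (rule tendsto_eventually)
      qed
    qed (auto simp: indicator_def)
    then show ?thesis unfolding F_def by (subst conv_heat_eq) (auto simp: heat_mass)
  qed
  have "(\<lambda>n. \<integral>\<^sup>+x. indicator U x - F n x \<partial>lborel) \<longlonglongrightarrow> (\<integral>\<^sup>+(x::'a). 0 \<partial>lborel)"
  proof (rule nn_integral_dominated_convergence[where w = "indicator U"])
    show "(\<integral>\<^sup>+x. indicator U x \<partial>lborel) < \<infinity>" using U(2) by simp
    show "AE x in lborel. (\<lambda>n. indicator U x - F n x) \<longlonglongrightarrow> 0"
    proof (rule AE_I2)
      fix x
      show "(\<lambda>n. indicator U x - F n x) \<longlonglongrightarrow> 0"
      proof (cases "x \<in> U")
        case True
        have "(\<lambda>n. 1 - F n x) \<longlonglongrightarrow> 1 - (1::ennreal)"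
          by (intro tendsto_diff_ennreal tendsto_const lim True) auto
        then show ?thesis using True by simp
      qed (simp add: indicator_def)
    qed
  qed (auto simp: diff_le_self_ennreal)
  then have "eventually (\<lambda>n. (\<integral>\<^sup>+x. indicator U x - F n x \<partial>lborel) < ennreal e) sequentially"
    using \<open>0 < e\<close> by (intro order_tendstoD(2)) auto
  then obtain n where "(\<integral>\<^sup>+x. indicator U x - F n x \<partial>lborel) < ennreal e"
    unfolding eventually_sequentially by blast
  then show ?thesis using that[of "1 / real (Suc n)"] by (simp add: F_def less_imp_le)
qed

text \<open>The Fourier transform of h is a Gaussian times that of the indicator, and the latter is
  bounded by the measure of U; so it is integrable. Since h takes values in [0, 1], its p-th power
  is dominated by h, whose integral is the measure of U.\<close>

lemma nice_mollified:
  fixes U :: "'a::euclidean_space set"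
  assumes [measurable]: "U \<in> sets borel" and fin: "emeasure lborel U < \<top>" and \<epsilon>: "0 < \<epsilon>" and p: "1 \<le> p"
  defines "h \<equiv> \<lambda>x. complex_of_real (enn2real (conv (\<lambda>x. ennreal (heat \<epsilon> x)) (indicator U) x))"
  shows "nice p h"
proof -
  define F where "F = conv (\<lambda>x. ennreal (heat \<epsilon> x)) (indicator U :: 'a \<Rightarrow> ennreal)"
  have Fm[measurable]: "F \<in> borel_measurable borel" unfolding F_def by measurable
  have F1: "F x \<le> 1" for x
  proof -
    have "F x \<le> (\<integral>\<^sup>+y. ennreal (heat 1 (y::'a)) \<partial>lborel)"
      unfolding F_def by (subst conv_heat_eq) (auto simp: indicator_def \<epsilon> intro!: nn_integral_mono)
    then show ?thesis by (simp add: heat_mass)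
  qed
  then have Ftop: "F x < \<top>" for x by (meson ennreal_one_less_top le_less_trans)
  have hF: "nn_norm h x = F x" for x
    using Ftop[of x] by (simp add: h_def F_def[symmetric])
  have [measurable]: "h \<in> borel_measurable borel" unfolding h_def F_def[symmetric] by measurable
  have mass: "(\<integral>\<^sup>+x. F x \<partial>lborel) = emeasure lborel U"
    unfolding F_def by (subst conv_integral) (auto simp: heat_mass \<epsilon>)
  have L: "h \<in> Lp p"
  proof (rule Lp_I)
    have "(\<integral>\<^sup>+x. epow (nn_norm h x) p \<partial>lborel) \<le> (\<integral>\<^sup>+x. F x \<partial>lborel)"
    proof (rule nn_integral_mono)
      fix x
      have "epow (F x) (1 + (p - 1)) = F x * epow (F x) (p - 1)" by (simp only: epow_add epow_one)
      also have "\<dots> \<le> F x * epow 1 (p - 1)" using F1 p by (intro mult_left_mono epow_mono) auto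
      finally show "epow (nn_norm h x) p \<le> F x" by (simp add: hF)
    qed
    then show "(\<integral>\<^sup>+x. epow (nn_norm h x) p \<partial>lborel) < \<top>" using mass fin by (simp add: le_less_trans)
  qed measurable
  have hint: "integrable lborel h"
    by (rule integrableI_bounded) (use mass fin hF in auto)
  have hop: "h x = conv_op (\<lambda>x. complex_of_real (heat \<epsilon> x)) (indicator U) x" for x
  proof -
    have "F x = (\<integral>\<^sup>+y. ennreal (heat \<epsilon> (x - y) * indicator U y) \<partial>lborel)"
      unfolding F_def conv_def by (intro nn_integral_cong) (auto simp: indicator_def)
    then have "enn2real (F x) = (LINT y|lborel. heat \<epsilon> (x - y) * indicator U y)"
      using heat_nonneg[OF \<epsilon>] by (subst integral_eq_nn_integral) (auto simp: indicator_def)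
    then have "h x = complex_of_real (LINT y|lborel. heat \<epsilon> (x - y) * indicator U y)"
      by (simp add: h_def F_def)
    also have "\<dots> = (LINT y|lborel. complex_of_real (heat \<epsilon> (x - y) * indicator U y))"
      by (rule integral_complex_of_real[symmetric])
    also have "\<dots> = conv_op (\<lambda>x. complex_of_real (heat \<epsilon> x)) (indicator U) x"
      unfolding conv_op_def by (intro Bochner_Integration.integral_cong) (auto simp: indicator_def)
    finally show ?thesis .
  qed
  have bd: "cmod (fourier h \<xi>) \<le> measure lborel U * exp (- ((norm \<xi>)\<^sup>2 * \<epsilon>\<^sup>2 / 4))" for \<xi>
  proof -
    define \<Psi> where "\<Psi> y x = cis (- (\<xi> \<bullet> x)) * (complex_of_real (heat \<epsilon> (x - y)) * indicator U y)" for y x :: 'a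
    have [measurable]: "(\<lambda>z. \<Psi> (fst z) (snd z)) \<in> borel_measurable (lborel \<Otimes>\<^sub>M lborel)"
      unfolding \<Psi>_def by measurable
    have pint: "integrable (lborel \<Otimes>\<^sub>M lborel) (case_prod \<Psi>)"
    proof (rule integrableI_bounded)
      show "case_prod \<Psi> \<in> borel_measurable (lborel \<Otimes>\<^sub>M lborel)" by (simp add: case_prod_beta')
      have "(\<integral>\<^sup>+z. ennreal (norm (case_prod \<Psi> z)) \<partial>(lborel \<Otimes>\<^sub>M lborel))
          = (\<integral>\<^sup>+y. \<integral>\<^sup>+x. ennreal (heat \<epsilon> (x - y)) * indicator U y \<partial>lborel \<partial>lborel)"
        by (subst lborel.nn_integral_fst[symmetric])
          (auto simp: case_prod_beta' \<Psi>_def norm_mult heat_nonneg[OF \<epsilon>] indicator_def intro!: nn_integral_cong)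
      also have "\<dots> = (\<integral>\<^sup>+x. \<integral>\<^sup>+y. ennreal (heat \<epsilon> (x - y)) * indicator U y \<partial>lborel \<partial>lborel)"
        by (rule lborel_pair.Fubini') measurable
      also have "\<dots> < \<infinity>" using mass fin by (simp add: F_def conv_def)
      finally show "(\<integral>\<^sup>+z. ennreal (norm (case_prod \<Psi> z)) \<partial>(lborel \<Otimes>\<^sub>M lborel)) < \<infinity>" .
    qed
    have "fourier h \<xi> = (LINT x|lborel. LINT y|lborel. \<Psi> y x)"
      unfolding fourier_def hop conv_op_def \<Psi>_def by simp
    also have "\<dots> = (LINT y|lborel. LINT x|lborel. \<Psi> y x)"
      using lborel_pair.Fubini_integral[OF pint] by simp
    also have "\<dots> = (LINT y|lborel. complex_of_real (exp (- ((norm \<xi>)\<^sup>2 * \<epsilon>\<^sup>2 / 4))) * (cis (- (\<xi> \<bullet> y)) * indicator U y))"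
    proof (rule Bochner_Integration.integral_cong[OF refl])
      fix y :: 'a
      have "(LINT x|lborel. \<Psi> y x) = (LINT x|distr lborel borel (\<lambda>x. y + x). \<Psi> y x)"
        by (simp only: lborel_distr_plus)
      also have "\<dots> = (LINT x|lborel. \<Psi> y (y + x))"
        by (rule integral_distr) (auto simp: \<Psi>_def)
      also have "\<dots> = (LINT x|lborel. (cis (- (\<xi> \<bullet> y)) * indicator U y) * (cis (- (\<xi> \<bullet> x)) * complex_of_real (heat \<epsilon> x)))"
      proof (rule Bochner_Integration.integral_cong[OF refl])
        fix x :: 'a
        have "cis (- (\<xi> \<bullet> (y + x))) = cis (- (\<xi> \<bullet> y)) * cis (- (\<xi> \<bullet> x))"
          by (simp add: inner_add_right cis_mult)
        then show "\<Psi> y (y + x) = (cis (- (\<xi> \<bullet> y)) * indicator U y) * (cis (- (\<xi> \<bullet> x)) * complex_of_real (heat \<epsilon> x))"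
          by (simp add: \<Psi>_def)
      qed
      also have "\<dots> = (cis (- (\<xi> \<bullet> y)) * indicator U y) * complex_of_real (exp (- ((norm \<xi>)\<^sup>2 * \<epsilon>\<^sup>2 / 4)))"
        by (simp add: heat_fourier(2)[OF \<epsilon>])
      finally show "(LINT x|lborel. \<Psi> y x) = complex_of_real (exp (- ((norm \<xi>)\<^sup>2 * \<epsilon>\<^sup>2 / 4))) * (cis (- (\<xi> \<bullet> y)) * indicator U y)"
        by (simp only: mult.commute)
    qed
    also have "\<dots> = complex_of_real (exp (- ((norm \<xi>)\<^sup>2 * \<epsilon>\<^sup>2 / 4))) * (LINT y|lborel. cis (- (\<xi> \<bullet> y)) * indicator U y)" by simp
    finally have "cmod (fourier h \<xi>) = exp (- ((norm \<xi>)\<^sup>2 * \<epsilon>\<^sup>2 / 4)) * cmod (LINT y|lborel. cis (- (\<xi> \<bullet> y)) * indicator U y)"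
      by (simp add: norm_mult)
    also have "cmod (LINT y|lborel. cis (- (\<xi> \<bullet> y)) * indicator U y) \<le> measure lborel U"
    proof -
      have "integrable lborel (indicator U :: 'a \<Rightarrow> real)" using fin by (simp add: less_top)
      then have "cmod (LINT y|lborel. cis (- (\<xi> \<bullet> y)) * indicator U y) \<le> (LINT y|lborel. indicator U y)"
        by (intro Bochner_Integration.integral_norm_bound_integral Bochner_Integration.integrable_bound[OF \<open>integrable lborel (indicator U :: 'a \<Rightarrow> real)\<close>])
          (auto simp: norm_mult indicator_def)
      then show ?thesis by simp
    qed
    finally show ?thesis by (simp add: mult.commute mult_left_mono)
  qed
  have "integrable lborel (fourier h)"
  proof (rule Bochner_Integration.integrable_bound)
    have "0 < \<epsilon>\<^sup>2 / 4" using \<epsilon> by simp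
    then show "integrable lborel (\<lambda>\<xi>::'a. measure lborel U * exp (- ((norm \<xi>)\<^sup>2 * \<epsilon>\<^sup>2 / 4)))"
      using gaussian_fourier(1)[of "\<epsilon>\<^sup>2 / 4" "0::'a"] by (simp add: complex_of_real_integrable_eq mult.commute)
    have "(\<lambda>\<xi>. LINT x|lborel. cis (- (\<xi> \<bullet> x)) * h x) \<in> borel_measurable lborel"
      by (rule lborel.borel_measurable_lebesgue_integral) measurable
    then show "fourier h \<in> borel_measurable lborel" by (simp add: fourier_def[abs_def])
    show "AE \<xi> in lborel. norm (fourier h \<xi>) \<le> norm (measure lborel U * exp (- ((norm \<xi>)\<^sup>2 * \<epsilon>\<^sup>2 / 4)))"
      using bd by auto
  qed
  with L hint show ?thesis by (simp add: nice_def)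
qed

text \<open>Outer regularity replaces A by an open U. There \<open>heat_indicator_open\<close>
  controls the part of the error where the mollification lies below the indicator; the part above
  has the same integral, since mollification preserves the mass. As the error is at most 1 in
  modulus, its p-th power is no larger than itself.\<close>

lemma Lp_dense_indicator:
  fixes A :: "'a::euclidean_space set"
  assumes A[measurable]: "A \<in> sets borel" and fin: "emeasure lborel A < \<top>" and p: "1 \<le> p"
  shows "Lp_dense p (indicator A)"
  unfolding Lp_dense_def
proof (intro conjI allI impI)
  show "(indicator A :: 'a \<Rightarrow> complex) \<in> borel_measurable borel" by measurable
  fix e :: real assume e: "0 < e"
  \<comment> \<open>Three errors of size d: one for U - A and one for each sign of the mollification
    error.\<close>
  define d where "d = e / (2 powr p * 3)"
  have d: "0 < d" using e by (simp add: d_def)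
  obtain U where U: "open U" "A \<subseteq> U" "emeasure lborel (U - A) < ennreal d"
    using outer_regular_lborel[OF A, of d] d by blast
  have [measurable]: "U \<in> sets borel" using U by simp
  have "emeasure lborel U \<le> emeasure lborel A + emeasure lborel (U - A)"
    using U(2) emeasure_subadditive[of A lborel "U - A"] by (simp add: Un_absorb1)
  also have "\<dots> < \<top>" using fin U(3) by (auto simp: less_top[symmetric])
  finally have Ufin: "emeasure lborel U < \<top>" .
  obtain \<epsilon> where \<epsilon>: "0 < \<epsilon>"
    "(\<integral>\<^sup>+x. indicator U x - conv (\<lambda>x. ennreal (heat \<epsilon> x)) (indicator U) x \<partial>lborel) \<le> ennreal d"
    using heat_indicator_open[OF U(1) Ufin d] by blast
  define F where "F = conv (\<lambda>x. ennreal (heat \<epsilon> x)) (indicator U :: 'a \<Rightarrow> ennreal)"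
  define g where "g x = complex_of_real (enn2real (F x))" for x
  have nice: "nice p g" unfolding g_def F_def using Ufin \<epsilon> p by (intro nice_mollified) auto
  have [measurable]: "F \<in> borel_measurable borel" unfolding F_def by measurable
  have [measurable]: "g \<in> borel_measurable borel" unfolding g_def by measurable
  have F1: "F x \<le> 1" for x
  proof -
    have "F x \<le> (\<integral>\<^sup>+y. ennreal (heat 1 (y::'a)) \<partial>lborel)"
      unfolding F_def by (subst conv_heat_eq) (auto simp: indicator_def \<epsilon> intro!: nn_integral_mono)
    then show ?thesis by (simp add: heat_mass)
  qed
  have mass: "(\<integral>\<^sup>+x. F x \<partial>lborel) = emeasure lborel U"
    unfolding F_def by (subst conv_integral) (auto simp: heat_mass \<epsilon>)
  \<comment> \<open>Subtraction is truncated at 0, so the comparison is made additively: both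
    integrands equal the maximum of F and the indicator.\<close>
  have "(\<integral>\<^sup>+x. indicator U x + (F x - indicator U x) \<partial>lborel) = (\<integral>\<^sup>+x. F x + (indicator U x - F x) \<partial>lborel)"
  proof (rule nn_integral_cong)
    fix x
    show "indicator U x + (F x - indicator U x) = F x + (indicator U x - F x)"
    proof (cases "x \<in> U")
      case True
      then have "F x - 1 = 0" "F x + (1 - F x) = 1" using F1[of x]
        using le_less_trans[OF F1[of x] ennreal_one_less_top] by (auto simp: diff_eq_0_iff_ennreal add_diff_inverse_ennreal)
      then show ?thesis using True by simp
    qed simp
  qed
  then have "emeasure lborel U + (\<integral>\<^sup>+x. F x - indicator U x \<partial>lborel) = emeasure lborel U + (\<integral>\<^sup>+x. indicator U x - F x \<partial>lborel)"
    by (simp add: nn_integral_add mass)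
  then have sym: "(\<integral>\<^sup>+x. F x - indicator U x \<partial>lborel) = (\<integral>\<^sup>+x. indicator U x - F x \<partial>lborel)"
    using Ufin by (auto simp: ennreal_add_left_cancel)
  have "(\<integral>\<^sup>+x. epow (nn_norm (\<lambda>x. indicator U x - g x) x) p \<partial>lborel)
      \<le> (\<integral>\<^sup>+x. (indicator U x - F x) + (F x - indicator U x) \<partial>lborel)"
  proof (rule nn_integral_mono)
    fix x
    obtain r where r: "F x = ennreal r" "0 \<le> r" "r \<le> 1"
      using F1[of x] by (cases "F x") (auto simp: top_unique)
    define i where "i = (indicator U x :: real)"
    have i: "indicator U x = ennreal i" "(indicator U x :: complex) = complex_of_real i" "0 \<le> i" "i \<le> 1"
      by (auto simp: i_def indicator_def)
    have "cmod (indicator U x - g x) = \<bar>i - r\<bar>"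
      unfolding g_def r(1) i(2) using r(2) by (simp flip: of_real_diff)
    then have "epow (nn_norm (\<lambda>x. indicator U x - g x) x) p = ennreal (\<bar>i - r\<bar> powr p)"
      by (simp add: epow_ennreal)
    also have "\<dots> \<le> ennreal \<bar>i - r\<bar>"
    proof (rule ennreal_leI)
      have "\<bar>i - r\<bar> \<le> 1" using i r by auto
      then have "\<bar>i - r\<bar> powr p \<le> \<bar>i - r\<bar> powr 1" by (intro powr_mono') (use p in auto)
      then show "\<bar>i - r\<bar> powr p \<le> \<bar>i - r\<bar>" by simp
    qed
    also have "\<dots> \<le> (indicator U x - F x) + (F x - indicator U x)"
      unfolding i(1) r(1) using i r by (cases "r \<le> i") (auto simp: ennreal_minus ennreal_neg)
    finally show "epow (nn_norm (\<lambda>x. indicator U x - g x) x) p \<le> \<dots>" .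
  qed
  also have "\<dots> = (\<integral>\<^sup>+x. indicator U x - F x \<partial>lborel) + (\<integral>\<^sup>+x. indicator U x - F x \<partial>lborel)"
    by (subst nn_integral_add) (auto simp: sym)
  also have "\<dots> \<le> ennreal d + ennreal d" using \<epsilon>(2) unfolding F_def by (intro add_mono)
  finally have 1: "(\<integral>\<^sup>+x. epow (nn_norm (\<lambda>x. indicator U x - g x) x) p \<partial>lborel) \<le> ennreal d + ennreal d" .
  have 2: "(\<integral>\<^sup>+x. epow (nn_norm (\<lambda>x. indicator A x - indicator U x) x) p \<partial>lborel) \<le> ennreal d"
  proof -
    have "(\<integral>\<^sup>+x. epow (nn_norm (\<lambda>x. indicator A x - indicator U x) x) p \<partial>lborel) = (\<integral>\<^sup>+x. indicator (U - A) x \<partial>lborel)"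
      using U(2) by (intro nn_integral_cong) (auto simp: indicator_def)
    then show ?thesis using U(3) by simp
  qed
  have "(\<integral>\<^sup>+x. epow (nn_norm (\<lambda>x. (indicator A x - indicator U x) + (indicator U x - g x)) x) p \<partial>lborel)
      \<le> ennreal (2 powr p) * ((\<integral>\<^sup>+x. epow (nn_norm (\<lambda>x. indicator A x - indicator U x) x) p \<partial>lborel)
        + (\<integral>\<^sup>+x. epow (nn_norm (\<lambda>x. indicator U x - g x) x) p \<partial>lborel))"
    using p by (intro mass_add_le) auto
  also have "\<dots> \<le> ennreal (2 powr p) * (ennreal d + (ennreal d + ennreal d))"
    using 1 2 by (intro mult_left_mono add_mono) auto
  also have "\<dots> = ennreal e"
    using d by (simp add: d_def flip: ennreal_plus ennreal_mult)
  finally show "\<exists>g. nice p g \<and> (\<integral>\<^sup>+x. epow (nn_norm (\<lambda>x. indicator A x - g x) x) p \<partial>lborel) \<le> ennreal e"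
    using nice by auto
qed

lemma Lp_dense_sum:
  fixes f :: "'i \<Rightarrow> 'a::euclidean_space \<Rightarrow> complex"
  assumes "finite I" "\<And>i. i \<in> I \<Longrightarrow> Lp_dense p (f i)" "0 < p"
  shows "Lp_dense p (\<lambda>x. \<Sum>i\<in>I. f i x)"
  using assms
proof (induction I rule: finite_induct)
  case empty
  have "nice p (\<lambda>_::'a. 0)"
    unfolding nice_def using Lp_I[of "\<lambda>_::'a. 0" p] by (simp add: fourier_def[abs_def])
  then show ?case unfolding Lp_dense_def by (auto intro!: exI[of _ "\<lambda>_. 0"])
next
  case (insert i I)
  then show ?case using Lp_dense_add[of p "f i" "\<lambda>x. \<Sum>i\<in>I. f i x"] by simp
qed

text \<open>Simple functions dominated by 2 |f| converge to f in mean by dominated convergence.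
  Their nonzero level sets have finite measure by Chebyshev's inequality, so each of them is a
  finite combination of indicators already treated.\<close>

theorem Lp_dense_Lp:
  fixes f :: "'a::euclidean_space \<Rightarrow> complex"
  assumes f: "f \<in> Lp p" and p: "1 \<le> p"
  shows "Lp_dense p f"
  unfolding Lp_dense_def
proof (intro conjI allI impI)
  show fm[measurable]: "f \<in> borel_measurable borel" using f by (rule Lp_D)
  fix e :: real assume e: "0 < e"
  define d where "d = e / (2 powr p * 2)"
  have d: "0 < d" using e by (simp add: d_def)
  have "f \<in> borel_measurable lborel" by simp
  then obtain s where s: "\<And>i. simple_function lborel (s i)" "\<And>x. (\<lambda>i. s i x) \<longlonglongrightarrow> f x"
      "\<And>i x. dist (s i x) 0 \<le> 2 * dist (f x) 0"
    using borel_measurable_implies_sequence_metric[of f lborel 0] by auto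
  have sm[measurable]: "s i \<in> borel_measurable borel" for i
    using borel_measurable_simple_function[OF s(1)] by simp
  have dense: "Lp_dense p (s i)" for i
  proof -
    define R where "R = range (s i) - {0}"
    have R: "finite R" using simple_functionD(1)[OF s(1), of i] by (simp add: R_def)
    have "(\<lambda>x. \<Sum>c\<in>R. c * indicator (s i -` {c}) x) = s i"
    proof
      fix x
      have "(\<Sum>c\<in>R. c * indicator (s i -` {c}) x) = (\<Sum>c\<in>R. if c = s i x then c else 0)"
        by (intro sum.cong) (auto simp: indicator_def)
      then show "(\<Sum>c\<in>R. c * indicator (s i -` {c}) x) = s i x" using R by (auto simp: R_def)
    qed
    moreover have "Lp_dense p (\<lambda>x. \<Sum>c\<in>R. c * indicator (s i -` {c}) x)"
    proof (intro Lp_dense_sum Lp_dense_scale Lp_dense_indicator R)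
      fix c assume c: "c \<in> R"
      show [measurable]: "s i -` {c} \<in> sets borel"
        using measurable_sets[OF sm, of "{c}" i] by simp
      have "ennreal ((cmod c) powr p) * emeasure lborel (s i -` {c}) = (\<integral>\<^sup>+x. ennreal ((cmod c) powr p) * indicator (s i -` {c}) x \<partial>lborel)"
        by (subst nn_integral_cmult_indicator) auto
      also have "\<dots> \<le> (\<integral>\<^sup>+x. ennreal (2 powr p) * epow (nn_norm f x) p \<partial>lborel)"
      proof (rule nn_integral_mono)
        fix x
        have "(cmod (s i x)) powr p \<le> (2 * cmod (f x)) powr p"
          using s(3)[of i x] p by (intro powr_mono2) auto
        then show "ennreal ((cmod c) powr p) * indicator (s i -` {c}) x \<le> ennreal (2 powr p) * epow (nn_norm f x) p"
          by (auto simp: indicator_def epow_ennreal powr_mult ennreal_leI simp flip: ennreal_mult)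
      qed
      also have "\<dots> < \<top>" using Lp_D(2)[OF f] by (simp add: nn_integral_cmult ennreal_mult_less_top)
      finally show "emeasure lborel (s i -` {c}) < \<top>"
        using c by (auto simp: ennreal_mult_less_top R_def)
    qed (use p in auto)
    ultimately show ?thesis by simp
  qed
  have "(\<lambda>i. \<integral>\<^sup>+x. epow (nn_norm (\<lambda>x. f x - s i x) x) p \<partial>lborel) \<longlonglongrightarrow> (\<integral>\<^sup>+(x::'a). 0 \<partial>lborel)"
  proof (rule nn_integral_dominated_convergence[where w = "\<lambda>x. ennreal (3 powr p) * epow (nn_norm f x) p"])
    show "(\<integral>\<^sup>+x. ennreal (3 powr p) * epow (nn_norm f x) p \<partial>lborel) < \<infinity>"
      using Lp_D(2)[OF f] by (simp add: nn_integral_cmult ennreal_mult_less_top)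
    show "AE x in lborel. epow (nn_norm (\<lambda>x. f x - s i x) x) p \<le> ennreal (3 powr p) * epow (nn_norm f x) p" for i
    proof (rule AE_I2)
      fix x
      have "cmod (f x - s i x) \<le> cmod (f x) + cmod (s i x)" by (rule norm_triangle_ineq4)
      also have "\<dots> \<le> 3 * cmod (f x)" using s(3)[of i x] by simp
      finally have "cmod (f x - s i x) powr p \<le> (3 * cmod (f x)) powr p" using p by (intro powr_mono2) auto
      then show "epow (nn_norm (\<lambda>x. f x - s i x) x) p \<le> ennreal (3 powr p) * epow (nn_norm f x) p"
        by (auto simp: epow_ennreal powr_mult ennreal_leI simp flip: ennreal_mult)
    qed
    show "AE x in lborel. (\<lambda>i. epow (nn_norm (\<lambda>x. f x - s i x) x) p) \<longlonglongrightarrow> 0"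
    proof (rule AE_I2)
      fix x
      have "(\<lambda>i. cmod (f x - s i x) powr p) \<longlonglongrightarrow> cmod (f x - f x) powr p"
        using p by (intro tendsto_powr' tendsto_norm tendsto_diff tendsto_const s(2)) auto
      then have "(\<lambda>i. ennreal (cmod (f x - s i x) powr p)) \<longlonglongrightarrow> ennreal 0"
        using p by (intro tendsto_ennrealI) simp
      then show "(\<lambda>i. epow (nn_norm (\<lambda>x. f x - s i x) x) p) \<longlonglongrightarrow> 0" by (simp add: epow_ennreal)
    qed
  qed auto
  then have "eventually (\<lambda>i. (\<integral>\<^sup>+x. epow (nn_norm (\<lambda>x. f x - s i x) x) p \<partial>lborel) < ennreal d) sequentially"
    using d by (intro order_tendstoD(2)) auto
  then obtain i where i: "(\<integral>\<^sup>+x. epow (nn_norm (\<lambda>x. f x - s i x) x) p \<partial>lborel) < ennreal d"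
    unfolding eventually_sequentially by blast
  obtain g where g: "nice p g" "(\<integral>\<^sup>+x. epow (nn_norm (\<lambda>x. s i x - g x) x) p \<partial>lborel) \<le> ennreal d"
    using dense[of i] d unfolding Lp_dense_def by meson
  have [measurable]: "g \<in> borel_measurable borel" using g Lp_D by (auto simp: nice_def)
  have "(\<integral>\<^sup>+x. epow (nn_norm (\<lambda>x. (f x - s i x) + (s i x - g x)) x) p \<partial>lborel)
      \<le> ennreal (2 powr p) * ((\<integral>\<^sup>+x. epow (nn_norm (\<lambda>x. f x - s i x) x) p \<partial>lborel) + (\<integral>\<^sup>+x. epow (nn_norm (\<lambda>x. s i x - g x) x) p \<partial>lborel))"
    using p by (intro mass_add_le) auto
  also have "\<dots> \<le> ennreal (2 powr p) * (ennreal d + ennreal d)"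
    using i g by (intro mult_left_mono add_mono) auto
  also have "\<dots> = ennreal e" using d by (simp add: d_def flip: ennreal_plus ennreal_mult)
  finally show "\<exists>g. nice p g \<and> (\<integral>\<^sup>+x. epow (nn_norm (\<lambda>x. f x - g x) x) p \<partial>lborel) \<le> ennreal e"
    using g(1) by auto
qed

lemma bounded_ops_mass:
  fixes T :: "'a::euclidean_space fun_op"
  assumes T: "T \<in> bounded_ops p" and p: "0 < p"
  obtains K :: real where "0 \<le> K" "\<And>f. f \<in> Lp p \<Longrightarrow>
    (\<integral>\<^sup>+x. epow (nn_norm (T f) x) p \<partial>lborel) \<le> ennreal K * (\<integral>\<^sup>+x. epow (nn_norm f x) p \<partial>lborel)"
proof -
  obtain K where K: "\<And>f. f \<in> Lp p \<Longrightarrow> Lp_norm p (T f) \<le> K * Lp_norm p f"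
    and L: "\<And>f. f \<in> Lp p \<Longrightarrow> T f \<in> Lp p"
    using T unfolding bounded_ops_def by blast
  have "(\<integral>\<^sup>+x. epow (nn_norm (T f) x) p \<partial>lborel) \<le> ennreal (\<bar>K\<bar> powr p) * (\<integral>\<^sup>+x. epow (nn_norm f x) p \<partial>lborel)"
    if f: "f \<in> Lp p" for f
  proof -
    have nn: "0 \<le> Lp_norm p f" by (simp add: Lp_norm_def)
    have "Lp_norm p (T f) \<le> \<bar>K\<bar> * Lp_norm p f"
      using K[OF f] nn by (meson abs_ge_self mult_right_mono order_trans)
    then have "ennreal (Lp_norm p (T f)) \<le> ennreal \<bar>K\<bar> * ennreal (Lp_norm p f)"
      using nn by (simp add: ennreal_leI flip: ennreal_mult)
    then have "epow (ennreal (Lp_norm p (T f))) p \<le> epow (ennreal \<bar>K\<bar> * ennreal (Lp_norm p f)) p"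
      using p by (intro epow_mono) auto
    then show ?thesis
      unfolding ennreal_Lp_norm[OF f] ennreal_Lp_norm[OF L[OF f]] using p
      by (simp add: epow_mult epow_inverse' epow_ennreal)
  qed
  then show ?thesis by (rule that[OF powr_ge_zero])
qed

text \<open>On a \<open>nice\<close> function g both operators are given by the same formula, so T f
  - S f equals T h - S h almost everywhere, with h = f - g as small as desired. Uniqueness is what
  gives the choice operator in \<open>fourier_multiplier\<close> a definite meaning.\<close>

theorem has_symbol_unique:
  fixes f :: "'a::euclidean_space \<Rightarrow> complex"
  assumes T: "has_symbol p T m" and S: "has_symbol p S m" and p: "1 < p" and f: "f \<in> Lp p"
  shows "AE x in lborel. T f x = S f x"
proof -
  have p0: "0 < p" using p by simp
  have Tb: "T \<in> bounded_ops p" and Sb: "S \<in> bounded_ops p" using T S by (auto simp: has_symbol_def)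
  have TL: "T g \<in> Lp p" and SL: "S g \<in> Lp p" if "g \<in> Lp p" for g
    using Tb Sb that by (auto simp: bounded_ops_def)
  obtain K1 where K1: "0 \<le> K1" "\<And>f. f \<in> Lp p \<Longrightarrow>
    (\<integral>\<^sup>+x. epow (nn_norm (T f) x) p \<partial>lborel) \<le> ennreal K1 * (\<integral>\<^sup>+x. epow (nn_norm f x) p \<partial>lborel)"
    by (rule bounded_ops_mass[OF Tb p0], rule that, assumption, blast)
  obtain K2 where K2: "0 \<le> K2" "\<And>f. f \<in> Lp p \<Longrightarrow>
    (\<integral>\<^sup>+x. epow (nn_norm (S f) x) p \<partial>lborel) \<le> ennreal K2 * (\<integral>\<^sup>+x. epow (nn_norm f x) p \<partial>lborel)"
    by (rule bounded_ops_mass[OF Sb p0], rule that, assumption, blast)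
  note fm[measurable] = Lp_D(1)[OF f] Lp_D(1)[OF TL[OF f]] Lp_D(1)[OF SL[OF f]]
  define I where "I = (\<integral>\<^sup>+x. epow (nn_norm (\<lambda>x. T f x - S f x) x) p \<partial>lborel)"
  define C where "C = 2 powr p * (K1 + K2)"
  have C: "0 \<le> C" using K1 K2 by (simp add: C_def)
  have big: "I \<le> ennreal (C * e)" if e: "0 < e" for e
  proof -
    obtain g where g: "nice p g" "(\<integral>\<^sup>+x. epow (nn_norm (\<lambda>x. f x - g x) x) p \<partial>lborel) \<le> ennreal e"
      using Lp_dense_Lp[OF f] p e unfolding Lp_dense_def by (meson less_imp_le)
    then have gL: "g \<in> Lp p" by (simp add: nice_def)
    define h where "h = (\<lambda>x. f x + (- 1) * g x)"
    have h: "h \<in> Lp p" unfolding h_def using p by (intro Lp_add Lp_scale f gL) auto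
    have fgh: "f = (\<lambda>x. g x + h x)" by (simp add: h_def)
    have hm: "(\<integral>\<^sup>+x. epow (nn_norm h x) p \<partial>lborel) \<le> ennreal e" using g(2) by (simp add: h_def)
    note [measurable] = Lp_D(1)[OF TL[OF h]] Lp_D(1)[OF SL[OF h]]
    have "AE x in lborel. T g x = inv_fourier (\<lambda>\<xi>. m \<xi> * fourier g \<xi>) x"
      "AE x in lborel. S g x = inv_fourier (\<lambda>\<xi>. m \<xi> * fourier g \<xi>) x"
      using T S g(1) unfolding has_symbol_def nice_def by auto
    moreover have "AE x in lborel. T f x = T g x + T h x" "AE x in lborel. S f x = S g x + S h x"
      using Tb Sb gL h unfolding bounded_ops_def fgh by auto
    ultimately have "AE x in lborel. T f x - S f x = T h x + (- 1) * S h x" by eventually_elim simp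
    then have "I = (\<integral>\<^sup>+x. epow (nn_norm (\<lambda>x. T h x + (- 1) * S h x) x) p \<partial>lborel)"
      unfolding I_def by (intro nn_integral_cong_AE) (auto elim!: eventually_mono)
    also have "\<dots> \<le> ennreal (2 powr p) * ((\<integral>\<^sup>+x. epow (nn_norm (T h) x) p \<partial>lborel) + (\<integral>\<^sup>+x. epow (nn_norm (\<lambda>x. (- 1) * S h x) x) p \<partial>lborel))"
      using p by (intro mass_add_le) auto
    also have "\<dots> \<le> ennreal (2 powr p) * (ennreal K1 * ennreal e + ennreal K2 * ennreal e)"
    proof (intro mult_left_mono add_mono)
      show "(\<integral>\<^sup>+x. epow (nn_norm (T h) x) p \<partial>lborel) \<le> ennreal K1 * ennreal e"
        using K1(2)[OF h] hm by (meson mult_left_mono order_trans zero_le)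
      have "(\<integral>\<^sup>+x. epow (nn_norm (S h) x) p \<partial>lborel) \<le> ennreal K2 * ennreal e"
        using K2(2)[OF h] hm by (meson mult_left_mono order_trans zero_le)
      then show "(\<integral>\<^sup>+x. epow (nn_norm (\<lambda>x. (- 1) * S h x) x) p \<partial>lborel) \<le> ennreal K2 * ennreal e" by simp
    qed auto
    also have "\<dots> = ennreal (C * e)"
      using K1(1) K2(1) e by (simp add: C_def algebra_simps flip: ennreal_mult ennreal_plus)
    finally show ?thesis .
  qed
  have small: "I \<le> ennreal e" if "0 < e" for e
  proof -
    have "0 < e / (C + 1)" using that C by simp
    then have "I \<le> ennreal (C * (e / (C + 1)))" by (rule big)
    also have "\<dots> \<le> ennreal e" using that C by (intro ennreal_leI) (simp add: field_simps)
    finally show ?thesis .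
  qed
  have "I \<le> 0"
  proof (rule ennreal_le_epsilon)
    fix e :: real assume "0 < e" then show "I \<le> 0 + ennreal e" using small by simp
  qed
  then have "AE x in lborel. epow (nn_norm (\<lambda>x. T f x - S f x) x) p = 0"
    unfolding I_def by (subst (asm) le_zero_eq, subst (asm) nn_integral_0_iff_AE) auto
  then show ?thesis by eventually_elim simp
qed

section \<open>\<gamma>-boundedness of multipliers that are mixtures of Poisson semigroup operators\<close>

context poisson_mixture
begin

lemma mix_majorant_finite:
  assumes \<beta>: "(real DIM('a) - 1) / 2 < \<beta>" and W: "mix_weight M \<zeta> \<beta> < \<top>"
  shows "(\<integral>\<^sup>+x. mix_majorant M \<zeta> (x::'a::euclidean_space) \<partial>lborel) < \<top>"
proof -
  obtain C where C: "0 < C" "\<And>\<delta> \<rho>. 0 < \<delta> \<Longrightarrow> \<delta> \<le> 1 \<Longrightarrow> 0 < \<rho> \<Longrightarrow>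
    (\<integral>\<^sup>+(x::'a). dilated_majorant \<delta> \<rho> x \<partial>lborel) \<le> ennreal (C * \<delta> powr (- \<beta>))"
    using dilated_majorant_mass[OF \<beta>] by blast
  have "(\<integral>\<^sup>+x. mix_majorant M \<zeta> (x::'a) \<partial>lborel) \<le> ennreal C * mix_weight M \<zeta> \<beta>"
    using C by (intro mix_majorant_mass) auto
  also have "\<dots> < \<top>" using W by (simp add: ennreal_mult_less_top)
  finally show ?thesis .
qed

lemma mix_kernel_mass_le:
  "(\<integral>\<^sup>+x. nn_norm (mix_kernel M \<zeta>) (x::'a::euclidean_space) \<partial>lborel)
    \<le> ennreal (mix_bound DIM('a)) * (\<integral>\<^sup>+x. mix_majorant M \<zeta> (x::'a::euclidean_space) \<partial>lborel)"
proof -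
  have "(\<integral>\<^sup>+x. nn_norm (mix_kernel M \<zeta>) (x::'a) \<partial>lborel)
      \<le> (\<integral>\<^sup>+x. ennreal (mix_bound DIM('a)) * mix_majorant M \<zeta> (x::'a) \<partial>lborel)"
    by (intro nn_integral_mono mix_kernel_le)
  then show ?thesis by (simp add: nn_integral_cmult)
qed

lemma mix_kernel_mass:
  assumes \<beta>: "(real DIM('a) - 1) / 2 < \<beta>" and W: "mix_weight M \<zeta> \<beta> < \<top>"
  obtains B :: real where "0 \<le> B" "(\<integral>\<^sup>+x. nn_norm (mix_kernel M \<zeta>) (x::'a::euclidean_space) \<partial>lborel) \<le> ennreal B"
proof -
  have "ennreal (mix_bound DIM('a)) * (\<integral>\<^sup>+x. mix_majorant M \<zeta> (x::'a) \<partial>lborel) < \<top>"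
    using mix_majorant_finite[OF \<beta> W] by (simp add: ennreal_mult_less_top)
  then have "(\<integral>\<^sup>+x. nn_norm (mix_kernel M \<zeta>) (x::'a) \<partial>lborel) < \<top>"
    using mix_kernel_mass_le by (rule le_less_trans[rotated])
  then have "(\<integral>\<^sup>+x. nn_norm (mix_kernel M \<zeta>) (x::'a) \<partial>lborel)
      \<le> ennreal (enn2real (\<integral>\<^sup>+x. nn_norm (mix_kernel M \<zeta>) (x::'a) \<partial>lborel))" by simp
  then show ?thesis by (rule that[OF enn2real_nonneg])
qed

text \<open>Fubini applies at each x where the majorant convolved with |f| is finite. This
  convolution is integrable, so almost every x qualifies.\<close>

lemma mix_conv_op:
  fixes f :: "'a::euclidean_space \<Rightarrow> complex"
  assumes \<beta>: "(real DIM('a) - 1) / 2 < \<beta>" and W: "mix_weight M \<zeta> \<beta> < \<top>"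
    and f: "integrable lborel f"
  shows "AE x in lborel. conv_op (mix_kernel M \<zeta>) f x = (LINT u|M. conv_op (poisson (\<zeta> u)) f x)"
proof -
  interpret P: pair_sigma_finite "lborel :: 'a measure" M ..
  have [measurable]: "f \<in> borel_measurable borel" using f by (auto dest: borel_measurable_integrable)
  have "(\<integral>\<^sup>+x. conv (mix_majorant M \<zeta>) (nn_norm f) x \<partial>lborel) < \<top>"
    using mix_majorant_finite[OF \<beta> W] f
    by (subst conv_integral) (auto simp: ennreal_mult_less_top integrable_iff_bounded)
  then have "AE x in lborel. conv (mix_majorant M \<zeta>) (nn_norm f) x \<noteq> \<infinity>"
    by (intro nn_integral_PInf_AE) auto
  then show ?thesis
  proof eventually_elim
    case (elim x)
    define \<Psi> where "\<Psi> y u = poisson (\<zeta> u) (x - y) * f y" for y u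
    have "(\<lambda>z. (snd z, x - fst z)) \<in> lborel \<Otimes>\<^sub>M M \<rightarrow>\<^sub>M M \<Otimes>\<^sub>M (borel :: 'a measure)" by measurable
    from measurable_compose[OF this poisson_measurable2[OF zeta_M pos]]
    have [measurable]: "(\<lambda>z. poisson (\<zeta> (snd z)) (x - fst z)) \<in> borel_measurable (lborel \<Otimes>\<^sub>M M)" by simp
    have [measurable]: "(\<lambda>z. \<Psi> (fst z) (snd z)) \<in> borel_measurable (lborel \<Otimes>\<^sub>M M)"
      unfolding \<Psi>_def by measurable
    have pint: "integrable (lborel \<Otimes>\<^sub>M M) (case_prod \<Psi>)"
    proof (rule integrableI_bounded)
      show "case_prod \<Psi> \<in> borel_measurable (lborel \<Otimes>\<^sub>M M)" by (simp add: case_prod_beta')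
      have um: "(\<lambda>u. poisson (\<zeta> u) (x - y)) \<in> borel_measurable M" for y
      proof -
        have "(\<lambda>u. (u, x - y)) \<in> M \<rightarrow>\<^sub>M M \<Otimes>\<^sub>M borel" by measurable
        from measurable_compose[OF this poisson_measurable2[OF zeta_M pos]] show ?thesis by simp
      qed
      have "(\<integral>\<^sup>+z. ennreal (norm (case_prod \<Psi> z)) \<partial>(lborel \<Otimes>\<^sub>M M))
          = (\<integral>\<^sup>+y. \<integral>\<^sup>+u. nn_norm (poisson (\<zeta> u)) (x - y) * nn_norm f y \<partial>M \<partial>lborel)"
        by (subst nn_integral_fst[symmetric]) (auto simp: case_prod_beta' \<Psi>_def norm_mult ennreal_mult)
      also have "\<dots> = (\<integral>\<^sup>+y. (\<integral>\<^sup>+u. nn_norm (poisson (\<zeta> u)) (x - y) \<partial>M) * nn_norm f y \<partial>lborel)"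
        using um by (intro nn_integral_cong nn_integral_multc) auto
      also have "\<dots> \<le> (\<integral>\<^sup>+y. ennreal (mix_bound DIM('a)) * (mix_majorant M \<zeta> (x - y) * nn_norm f y) \<partial>lborel)"
        unfolding mult.assoc[symmetric] by (intro nn_integral_mono mult_right_mono mix_kernel_le) auto
      also have "\<dots> = ennreal (mix_bound DIM('a)) * conv (mix_majorant M \<zeta>) (nn_norm f) x"
        unfolding conv_def by (rule nn_integral_cmult) measurable
      also have "\<dots> < \<infinity>" using elim by (simp add: ennreal_mult_less_top less_top)
      finally show "(\<integral>\<^sup>+z. ennreal (norm (case_prod \<Psi> z)) \<partial>(lborel \<Otimes>\<^sub>M M)) < \<infinity>" .
    qed
    have "conv_op (mix_kernel M \<zeta>) f x = (LINT y|lborel. LINT u|M. \<Psi> y u)"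
      unfolding conv_op_def mix_kernel_def \<Psi>_def by simp
    also have "\<dots> = (LINT u|M. LINT y|lborel. \<Psi> y u)"
      using P.Fubini_integral[OF pint] by simp
    finally show ?case by (simp add: \<Psi>_def conv_op_def)
  qed
qed

definition mix_symbol :: "'a::euclidean_space \<Rightarrow> complex" where
  "mix_symbol \<xi> = (LINT u|M. exp (- (\<zeta> u * complex_of_real (norm \<xi>))))"

lemma norm_exp_zeta_le: "cmod (exp (- (\<zeta> u * complex_of_real (norm \<xi>)))) \<le> 1"
  using pos[of u] by (simp add: less_imp_le)

lemma mix_symbol_le: "cmod (mix_symbol \<xi>) \<le> 1"
proof -
  have "cmod (mix_symbol \<xi>) \<le> (LINT u|M. 1)"
    unfolding mix_symbol_def
    by (intro Bochner_Integration.integral_norm_bound_integral integrable_const_bound[where B = 1])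
      (use norm_exp_zeta_le in auto)
  then show ?thesis by (simp add: prob_space)
qed

text \<open>Two exchanges of integrals: of y and u in \<open>mix_conv_op\<close>, then of u and
  \<xi>. The second one converges absolutely because the exponential factor is at most 1 and
  \<open>fourier f\<close> is integrable.\<close>

theorem mix_has_symbol:
  assumes \<beta>: "(real DIM('a) - 1) / 2 < \<beta>" and W: "mix_weight M \<zeta> \<beta> < \<top>" and p: "1 < p"
  shows "has_symbol p (conv_op (mix_kernel M \<zeta>)) (mix_symbol :: 'a::euclidean_space \<Rightarrow> complex)"
  unfolding has_symbol_def
proof (intro conjI ballI impI)
  show sm: "(mix_symbol :: 'a \<Rightarrow> complex) \<in> borel_measurable lborel"
    unfolding mix_symbol_def[abs_def] by (intro borel_measurable_lebesgue_integral) measurable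
  show "bounded (range (mix_symbol :: 'a \<Rightarrow> complex))"
    using mix_symbol_le by (auto intro!: boundedI)
  show "conv_op (mix_kernel M \<zeta>) \<in> (bounded_ops p :: 'a fun_op set)"
  proof -
    obtain B where B: "0 \<le> B" "(\<integral>\<^sup>+x. nn_norm (mix_kernel M \<zeta>) (x::'a) \<partial>lborel) \<le> ennreal B"
      by (rule mix_kernel_mass[OF \<beta> W], rule that, assumption+)
    show ?thesis by (rule conv_op_bounded[OF mix_kernel_measurable B(2,1) p])
  qed
  fix f :: "'a \<Rightarrow> complex" assume f: "f \<in> Lp p" "integrable lborel f" "integrable lborel (fourier f)"
  interpret P: pair_sigma_finite M "lborel :: 'a measure" ..
  define c where "c = complex_of_real (1 / (2 * pi) ^ DIM('a))"
  have [measurable]: "fourier f \<in> borel_measurable lborel" using f(3) by auto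
  show "AE x in lborel. conv_op (mix_kernel M \<zeta>) f x = inv_fourier (\<lambda>\<xi>. mix_symbol \<xi> * fourier f \<xi>) x"
    using mix_conv_op[OF \<beta> W f(2)]
  proof eventually_elim
    case (elim x)
    define \<Psi> where "\<Psi> u \<xi> = cis (x \<bullet> \<xi>) * (exp (- (\<zeta> u * complex_of_real (norm \<xi>))) * fourier f \<xi>)" for u \<xi>
    have [measurable]: "(\<lambda>z. \<Psi> (fst z) (snd z)) \<in> borel_measurable (M \<Otimes>\<^sub>M lborel)"
      unfolding \<Psi>_def by measurable
    have pint: "integrable (M \<Otimes>\<^sub>M lborel) (case_prod \<Psi>)"
    proof (rule integrableI_bounded)
      show "case_prod \<Psi> \<in> borel_measurable (M \<Otimes>\<^sub>M lborel)" by (simp add: case_prod_beta')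
      have "(\<integral>\<^sup>+z. ennreal (norm (case_prod \<Psi> z)) \<partial>(M \<Otimes>\<^sub>M lborel)) = (\<integral>\<^sup>+u. \<integral>\<^sup>+\<xi>. nn_norm (\<Psi> u) \<xi> \<partial>lborel \<partial>M)"
        by (subst lborel.nn_integral_fst[symmetric]) (auto simp: case_prod_beta')
      also have "\<dots> \<le> (\<integral>\<^sup>+u. \<integral>\<^sup>+\<xi>. nn_norm (fourier f) \<xi> \<partial>lborel \<partial>M)"
      proof (intro nn_integral_mono ennreal_leI)
        fix u \<xi>
        show "cmod (\<Psi> u \<xi>) \<le> cmod (fourier f \<xi>)"
          unfolding \<Psi>_def norm_mult norm_cis mult_1
          using norm_exp_zeta_le[of u \<xi>] by (intro mult_left_le_one_le) auto
      qed
      also have "\<dots> < \<infinity>" using f(3) by (simp add: emeasure_space_1 integrable_iff_bounded)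
      finally show "(\<integral>\<^sup>+z. ennreal (norm (case_prod \<Psi> z)) \<partial>(M \<Otimes>\<^sub>M lborel)) < \<infinity>" .
    qed
    have "conv_op (mix_kernel M \<zeta>) f x = (LINT u|M. c * (LINT \<xi>|lborel. \<Psi> u \<xi>))"
      unfolding elim conv_op_poisson[OF pos f(2)] inv_fourier_def c_def \<Psi>_def ..
    also have "\<dots> = c * (LINT u|M. LINT \<xi>|lborel. \<Psi> u \<xi>)" by simp
    also have "(LINT u|M. LINT \<xi>|lborel. \<Psi> u \<xi>) = (LINT \<xi>|lborel. LINT u|M. \<Psi> u \<xi>)"
      using P.Fubini_integral[OF pint] by simp
    also have "\<dots> = (LINT \<xi>|lborel. cis (x \<bullet> \<xi>) * (mix_symbol \<xi> * fourier f \<xi>))"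
      unfolding \<Psi>_def mix_symbol_def by simp
    finally show ?case unfolding inv_fourier_def c_def .
  qed
qed

lemma scaled_mixture: "0 < r \<Longrightarrow> poisson_mixture M (\<lambda>u. complex_of_real r * \<zeta> u)"
  using prob pos by unfold_locales auto

text \<open>The ratio Re \<zeta> / |\<zeta>| is invariant under dilation, so all operators of the
  dyadic family share one weight.\<close>

lemma scaled_weight: "0 < r \<Longrightarrow> mix_weight M (\<lambda>u. complex_of_real r * \<zeta> u) \<beta> = mix_weight M \<zeta> \<beta>"
  by (simp add: mix_weight_def norm_mult)

end

lemma sq_mass_le_AE:
  assumes "AE x in lborel. \<forall>k<n. nn_norm (g k) x \<le> G k x" "0 < p"
  shows "sq_mass p n g \<le> (\<integral>\<^sup>+x. epow (\<Sum>k<n. G k x * G k x) (p / 2) \<partial>lborel)"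
  unfolding sq_mass_def sq_sum_def
proof (rule nn_integral_mono_AE, use assms(1) in eventually_elim)
  case (elim x)
  then show ?case using assms(2) by (intro epow_mono sum_mono mult_mono) auto
qed

text \<open>D is fixed before M, \<zeta> and T, so that the dependence on the angle and on t is
  reduced to the computation of \<open>mix_weight\<close>. The operators T k coincide with
  convolutions only almost everywhere, because \<open>function_of_A\<close> arises from a
  choice.\<close>

theorem gamma_bound_mixture:
  assumes p: "1 < p" and \<beta>: "(real DIM('a) - 1) / 2 < \<beta>"
  shows "\<exists>D>0. \<forall>M \<zeta> (T :: int \<Rightarrow> ('a::euclidean_space) fun_op). poisson_mixture M \<zeta> \<longrightarrow> mix_weight M \<zeta> \<beta> < \<top> \<longrightarrow>
    (\<forall>k. T k \<in> bounded_ops p \<and> (\<forall>f\<in>Lp p. AE x in lborel.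
      T k f x = conv_op (mix_kernel M (\<lambda>u. complex_of_real (2 powi k) * \<zeta> u)) f x)) \<longrightarrow>
    gamma_bounded p (range T) \<and> gamma_bound p (range T) \<le> D * enn2real (mix_weight M \<zeta> \<beta>)"
proof -
  obtain C1 where C1: "0 < C1" "\<And>\<delta> \<rho>. 0 < \<delta> \<Longrightarrow> \<delta> \<le> 1 \<Longrightarrow> 0 < \<rho> \<Longrightarrow>
    (\<integral>\<^sup>+(x::'a). dilated_majorant \<delta> \<rho> x \<partial>lborel) \<le> ennreal (C1 * \<delta> powr (- \<beta>))"
    using dilated_majorant_mass[OF \<beta>] by blast
  \<comment> \<open>For p = 2 this is a division by zero; the maximal inequality is then void and C2
    = 1 is taken.\<close>
  define q where "q = p / \<bar>p - 2\<bar>"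
  have q: "1 < q" if "p \<noteq> 2" using that p by (auto simp: q_def field_simps abs_if)
  obtain C2 where C2: "0 < C2" "p \<noteq> 2 \<Longrightarrow> \<forall>\<delta> s R. 0 < \<delta> \<longrightarrow> \<delta> \<le> 1 \<longrightarrow> 0 < s \<longrightarrow> finite R \<longrightarrow> (\<forall>\<rho>\<in>R. \<exists>k::int. \<rho> = s * 2 powi k) \<longrightarrow>
    (\<forall>g::'a \<Rightarrow> ennreal. g \<in> borel_measurable borel \<longrightarrow>
      (\<integral>\<^sup>+x. epow (SUP \<rho>\<in>R. conv (dilated_majorant \<delta> \<rho>) g x) q \<partial>lborel)
        \<le> epow (ennreal (C2 * \<delta> powr (- \<beta>))) q * (\<integral>\<^sup>+x. epow (g x) q \<partial>lborel))"
  proof (cases "p = 2")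
    case False
    show ?thesis by (rule exE[OF maximal_bound[OF \<beta> q[OF False]]], elim conjE, rule that, assumption, assumption)
  qed (use that[of 1] in auto)
  obtain D0 where D0: "0 < D0" "\<forall>n (f :: nat \<Rightarrow> 'a \<Rightarrow> complex) (g :: nat \<Rightarrow> 'a \<Rightarrow> complex) B. (\<forall>k<n. f k \<in> Lp p \<and> g k \<in> Lp p) \<longrightarrow>
    0 \<le> B \<longrightarrow> sq_mass p n g \<le> epow (ennreal B) p * sq_mass p n f \<longrightarrow>
    gauss_norm p n g \<le> D0 * B * gauss_norm p n f"
    by (rule exE[OF gauss_norm_le_of_sq_mass_le[where 'a = 'a, OF p]], elim conjE, rule that, assumption, assumption)
  define b where "b = mix_bound DIM('a)"
  have b: "0 < b" by (simp add: b_def mix_bound_pos)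
  define D where "D = D0 * (b * (C1 + C2))"
  have "0 < D" using D0 b C1 C2 by (simp add: D_def)
  have main: "gamma_bounded p (range T) \<and> gamma_bound p (range T) \<le> D * enn2real (mix_weight M \<zeta> \<beta>)"
    if mix: "poisson_mixture M \<zeta>" and W: "mix_weight M \<zeta> \<beta> < \<top>"
      and T: "\<forall>k. T k \<in> bounded_ops p \<and> (\<forall>f\<in>Lp p. AE x in lborel.
        T k f x = conv_op (mix_kernel M (\<lambda>u. complex_of_real (2 powi k) * \<zeta> u)) f x)"
    for M \<zeta> and T :: "int \<Rightarrow> 'a fun_op"
  proof -
    interpret poisson_mixture M \<zeta> by fact
    define w where "w = enn2real (mix_weight M \<zeta> \<beta>)"
    have w: "mix_weight M \<zeta> \<beta> = ennreal w" "0 \<le> w" using W by (auto simp: w_def less_top)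
    \<comment> \<open>C1 governs the mass of the kernels and C2 their maximal function;
      \<open>square_function_bound\<close> wants one constant for both.\<close>
    define B where "B = b * (C1 + C2) * w"
    have B: "0 \<le> B" "b * C1 * w \<le> B" "b * C2 * w \<le> B" using b C1 C2 w
      by (auto simp: B_def algebra_simps)
    have bound: "gauss_norm p n (\<lambda>k. S k (f k)) \<le> D0 * B * gauss_norm p n f"
      if Sf: "\<forall>k<n. S k \<in> range T \<and> f k \<in> Lp p" for n S and f :: "nat \<Rightarrow> 'a \<Rightarrow> complex"
    proof -
      \<comment> \<open>An operator need not determine its index, so some index is picked.
        Repetitions do no harm: the maximal function sees only the finite set of scales
        \<open>r k\<close>.\<close>
      define \<kappa> where "\<kappa> k = (SOME j. S k = T j)" for k
      have \<kappa>: "S k = T (\<kappa> k)" if "k < n" for k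
        unfolding \<kappa>_def by (rule someI_ex) (use Sf that in auto)
      define r where "r k = (2::real) powi (\<kappa> k)" for k
      have r: "0 < r k" for k by (simp add: r_def)
      define G where "G k = (mix_majorant M (\<lambda>u. complex_of_real (r k) * \<zeta> u) :: 'a \<Rightarrow> ennreal)" for k
      define K where "K k x = ennreal b * G k x" for k x
      have Gm[measurable]: "G k \<in> borel_measurable borel" for k
        unfolding G_def by (rule poisson_mixture.mix_majorant_measurable[OF scaled_mixture[OF r]])
      have [measurable]: "K k \<in> borel_measurable borel" for k unfolding K_def by measurable
      have fL: "f k \<in> Lp p" if "k < n" for k using Sf that by simp
      have gL: "S k (f k) \<in> Lp p" if "k < n" for k
      proof -
        have "T (\<kappa> k) \<in> bounded_ops p" using T by blast
        then show ?thesis using fL[OF that] \<kappa>[OF that] by (simp add: bounded_ops_def)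
      qed
      have [measurable]: "k < n \<Longrightarrow> f k \<in> borel_measurable borel" for k using fL Lp_D by blast
      have mass: "(\<integral>\<^sup>+x. K k x \<partial>lborel) \<le> ennreal B" for k
      proof -
        have "(\<integral>\<^sup>+x. G k x \<partial>lborel) \<le> ennreal C1 * mix_weight M (\<lambda>u. complex_of_real (r k) * \<zeta> u) \<beta>"
          unfolding G_def using C1 by (intro poisson_mixture.mix_majorant_mass[OF scaled_mixture[OF r]]) auto
        also have "\<dots> = ennreal (C1 * w)" using C1 w by (simp add: scaled_weight[OF r] ennreal_mult)
        finally have "ennreal b * (\<integral>\<^sup>+x. G k x \<partial>lborel) \<le> ennreal b * ennreal (C1 * w)" by (rule mult_left_mono) simp
        also have "\<dots> = ennreal (b * C1 * w)" using b C1 w by (simp add: mult.assoc flip: ennreal_mult)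
        also have "\<dots> \<le> ennreal B" using B(2) by (rule ennreal_leI)
        finally show ?thesis unfolding K_def by (simp add: nn_integral_cmult)
      qed
      have mx: "(\<integral>\<^sup>+x. epow (SUP k\<in>{..<n}. conv (K k) g x) q \<partial>lborel) \<le> epow (ennreal B) q * (\<integral>\<^sup>+x. epow (g x) q \<partial>lborel)"
        if p2: "p \<noteq> 2" and g[measurable]: "g \<in> borel_measurable borel" for g
      proof -
        have Kc: "conv (K k) g x = ennreal b * conv (G k) g x" for k x
          unfolding conv_def K_def mult.assoc by (rule nn_integral_cmult) measurable
        have Sm[measurable]: "(\<lambda>x. SUP s\<in>r ` {..<n}. conv (mix_majorant M (\<lambda>u. complex_of_real s * \<zeta> u)) g x) \<in> borel_measurable borel"
          unfolding image_image using conv_measurable[OF Gm g] unfolding G_def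
          by (intro borel_measurable_SUP) auto
        have "(\<integral>\<^sup>+x. epow (SUP k\<in>{..<n}. conv (K k) g x) q \<partial>lborel)
          \<le> (\<integral>\<^sup>+x. epow (ennreal b) q * epow (SUP s\<in>r ` {..<n}. conv (mix_majorant M (\<lambda>u. complex_of_real s * \<zeta> u)) g x) q \<partial>lborel)"
        proof (rule nn_integral_mono)
          fix x
          have "(SUP k\<in>{..<n}. conv (K k) g x) \<le> ennreal b * (SUP s\<in>r ` {..<n}. conv (mix_majorant M (\<lambda>u. complex_of_real s * \<zeta> u)) g x)"
            unfolding Kc image_image G_def by (intro SUP_least mult_left_mono SUP_upper) auto
          then have "epow (SUP k\<in>{..<n}. conv (K k) g x) q \<le> epow (ennreal b * (SUP s\<in>r ` {..<n}. conv (mix_majorant M (\<lambda>u. complex_of_real s * \<zeta> u)) g x)) q"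
            using q[OF p2] by (intro epow_mono) auto
          then show "epow (SUP k\<in>{..<n}. conv (K k) g x) q \<le> epow (ennreal b) q * epow (SUP s\<in>r ` {..<n}. conv (mix_majorant M (\<lambda>u. complex_of_real s * \<zeta> u)) g x) q"
            using q[OF p2] by (simp add: epow_mult)
        qed
        also have "\<dots> = epow (ennreal b) q * (\<integral>\<^sup>+x. epow (SUP s\<in>r ` {..<n}. conv (mix_majorant M (\<lambda>u. complex_of_real s * \<zeta> u)) g x) q \<partial>lborel)"
          by (rule nn_integral_cmult) measurable
        also have "\<dots> \<le> epow (ennreal b) q * (epow (ennreal C2 * mix_weight M \<zeta> \<beta>) q * (\<integral>\<^sup>+x. epow (g x) q \<partial>lborel))"
          by (intro mult_left_mono, rule mix_maximal, rule C2(2)[OF p2, THEN spec, THEN spec, THEN spec,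
              THEN mp, THEN mp, THEN mp, THEN mp, THEN mp, THEN spec, THEN mp], assumption+)
            (use C2(1) q[OF p2] in \<open>auto simp: r_def\<close>)
        also have "\<dots> = epow (ennreal (b * C2 * w)) q * (\<integral>\<^sup>+x. epow (g x) q \<partial>lborel)"
          using b C2(1) w q[OF p2] by (simp add: mult.assoc[symmetric] epow_mult[symmetric] ennreal_mult)
        also have "\<dots> \<le> epow (ennreal B) q * (\<integral>\<^sup>+x. epow (g x) q \<partial>lborel)"
          using B(3) q[OF p2] by (intro mult_right_mono epow_mono ennreal_leI) auto
        finally show ?thesis .
      qed
      have fin: "(\<integral>\<^sup>+x. epow (\<Sum>k<n. nn_norm (f k) x * nn_norm (f k) x) (p / 2) \<partial>lborel) < \<top>"
        using sq_mass_finite[OF fL] p unfolding sq_mass_def sq_sum_def by simp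
      \<comment> \<open>From here on the operators are represented by the positive kernels
        \<open>K k\<close> alone; all cancellation is given up.\<close>
      have "AE x in lborel. nn_norm (S k (f k)) x \<le> conv (K k) (nn_norm (f k)) x" if k: "k < n" for k
      proof -
        have "AE x in lborel. S k (f k) x = conv_op (mix_kernel M (\<lambda>u. complex_of_real (r k) * \<zeta> u)) (f k) x"
          using T fL[OF k] unfolding \<kappa>[OF k] r_def by blast
        then show ?thesis
        proof eventually_elim
          case (elim x)
          have "nn_norm (S k (f k)) x \<le> conv (nn_norm (mix_kernel M (\<lambda>u. complex_of_real (r k) * \<zeta> u))) (nn_norm (f k)) x"
            unfolding elim by (rule conv_op_le_conv)
          also have "\<dots> \<le> conv (K k) (nn_norm (f k)) x"
            unfolding conv_def K_def G_def b_def
            by (intro nn_integral_mono mult_right_mono poisson_mixture.mix_kernel_le[OF scaled_mixture[OF r]]) auto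
          finally show ?case .
        qed
      qed
      then have "AE x in lborel. \<forall>k\<in>{..<n}. nn_norm (S k (f k)) x \<le> conv (K k) (nn_norm (f k)) x"
        by (intro AE_finite_allI) auto
      then have "AE x in lborel. \<forall>k<n. nn_norm (S k (f k)) x \<le> conv (K k) (nn_norm (f k)) x"
        by (simp add: Ball_def)
      then have "sq_mass p n (\<lambda>k. S k (f k)) \<le> (\<integral>\<^sup>+x. epow (\<Sum>k<n. conv (K k) (nn_norm (f k)) x * conv (K k) (nn_norm (f k)) x) (p / 2) \<partial>lborel)"
        using p by (intro sq_mass_le_AE) auto
      also have "\<dots> \<le> epow (ennreal B) p * (\<integral>\<^sup>+x. epow (\<Sum>k<n. nn_norm (f k) x * nn_norm (f k) x) (p / 2) \<partial>lborel)"
      proof (rule square_function_bound)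
        show "K k (- x) = K k x" for k x
          unfolding K_def G_def by (simp add: poisson_mixture.mix_majorant_minus[OF scaled_mixture[OF r]])
      qed (use mass mx p fin in \<open>auto simp: q_def\<close>)
      finally have "sq_mass p n (\<lambda>k. S k (f k)) \<le> epow (ennreal B) p * sq_mass p n f"
        unfolding sq_mass_def sq_sum_def .
      then show ?thesis using fL gL B(1) by (intro D0(2)[rule_format]) auto
    qed
    have mem: "D0 * B \<in> gamma_constants p (range T)"
      unfolding gamma_constants_def using D0(1) B(1) bound by auto
    moreover have "range T \<subseteq> bounded_ops p" using T by auto
    moreover have "gamma_bound p (range T) \<le> D0 * B"
      unfolding gamma_bound_def using mem
      by (intro cInf_lower bdd_belowI[of _ 0]) (auto simp: gamma_constants_def)
    moreover have "D0 * B = D * w" by (simp add: D_def B_def)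
    ultimately show ?thesis unfolding gamma_bounded_def w_def by auto
  qed
  show ?thesis
  proof (intro exI[of _ D] conjI allI impI, goal_cases)
    case 1 show ?case by fact
  next
    case (2 M \<zeta> T) from main[OF 2] show ?case by (rule conjunct1)
  next
    case (3 M \<zeta> T) from main[OF 3] show ?case by (rule conjunct2)
  qed
qed

section \<open>Holomorphy of the Poisson semigroup\<close>

text \<open>Obtained from \<open>square_plus_square_ge_unit\<close> by homogeneity, after division
  by |w|^2.\<close>

lemma square_plus_square_ge:
  assumes w: "0 < Re w" and r: "0 \<le> r"
  shows "(\<bar>r - cmod w\<bar> + Re w) * (cmod w + r) / 4 \<le> cmod (w\<^sup>2 + complex_of_real (r\<^sup>2))"
proof -
  define \<rho> where "\<rho> = cmod w"
  have \<rho>: "0 < \<rho>" using w by (auto simp: \<rho>_def)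
  define v where "v = w / complex_of_real \<rho>"
  have v: "cmod v = 1" "Re v = Re w / \<rho>"
    using \<rho> by (auto simp: v_def norm_divide \<rho>_def[symmetric] Re_divide_of_real)
  have "w\<^sup>2 + complex_of_real (r\<^sup>2) = complex_of_real (\<rho>\<^sup>2) * (v\<^sup>2 + complex_of_real ((r / \<rho>)\<^sup>2))"
    using \<rho> by (simp add: v_def power_divide distrib_left)
  then have eq: "cmod (w\<^sup>2 + complex_of_real (r\<^sup>2)) = \<rho>\<^sup>2 * cmod (v\<^sup>2 + complex_of_real ((r / \<rho>)\<^sup>2))"
    by (simp add: norm_mult norm_power)
  have "\<rho>\<^sup>2 * ((\<bar>r / \<rho> - 1\<bar> + Re v) * (1 + r / \<rho>) / 4) \<le> cmod (w\<^sup>2 + complex_of_real (r\<^sup>2))"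
    unfolding eq using v w \<rho> r by (intro mult_left_mono square_plus_square_ge_unit) auto
  moreover have "\<rho> * \<bar>r / \<rho> - 1\<bar> = \<bar>r - \<rho>\<bar>"
  proof -
    have "\<rho> * \<bar>r / \<rho> - 1\<bar> = \<bar>\<rho> * (r / \<rho> - 1)\<bar>" using \<rho> by (simp add: abs_mult)
    then show ?thesis using \<rho> by (simp add: right_diff_distrib)
  qed
  moreover have "\<rho>\<^sup>2 * ((\<bar>r / \<rho> - 1\<bar> + Re v) * (1 + r / \<rho>) / 4) = (\<rho> * \<bar>r / \<rho> - 1\<bar> + \<rho> * Re v) * (\<rho> * 1 + \<rho> * (r / \<rho>)) / 4"
    unfolding distrib_left[symmetric] by (simp add: power2_eq_square)
  ultimately show ?thesis using v(2) \<rho> unfolding \<rho>_def by simp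
qed

text \<open>On the disc Re w is bounded below and |w| is bounded above and below, so both factors in
  \<open>square_plus_square_ge\<close> are at least a fixed multiple of 1 + |x|. The result is one
  integrable majorant for the whole disc.\<close>

lemma poisson_local_bound:
  assumes z: "0 < Re z"
  obtains A where "0 < A" "\<And>w x. w \<in> cball z (Re z / 2) \<Longrightarrow>
    cmod (poisson w (x::'a::euclidean_space)) \<le> A * (1 + norm x) powr (- (real DIM('a) + 1))"
proof -
  let ?a = "(real DIM('a) + 1) / 2"
  define h where "h = Re z / 2"
  define R where "R = cmod z + h"
  define m where "m = min h 1"
  define \<kappa> where "\<kappa> = h / (2 * R + 1) * m / 4"
  have pos: "0 < h" "0 < R" "0 < m" "m \<le> 1" "m \<le> h" using z by (auto simp: h_def R_def m_def add_nonneg_pos)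
  then have \<kappa>: "0 < \<kappa>" by (simp add: \<kappa>_def)
  define A where "A = poisson_const DIM('a) * R / \<kappa> powr ?a"
  have "0 < A" using pos \<kappa> poisson_const_pos[of "DIM('a)"] by (simp add: A_def)
  moreover have "cmod (poisson w x) \<le> A * (1 + norm x) powr (- (real DIM('a) + 1))"
    if w: "w \<in> cball z (Re z / 2)" for w and x :: 'a
  proof -
    define r where "r = norm x"
    have r: "0 \<le> r" by (simp add: r_def)
    have d: "cmod (z - w) \<le> h" using w by (simp add: dist_norm h_def)
    have "Re z - Re w \<le> h" using complex_Re_le_cmod[of "z - w"] d by simp
    then have Rw: "h \<le> Re w" by (simp add: h_def)
    then have Rw0: "0 < Re w" using pos by simp
    have cw: "cmod w \<le> R" using norm_triangle_ineq2[of w z] d unfolding R_def by (simp add: norm_minus_commute)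
    have cw2: "h \<le> cmod w" using Rw complex_Re_le_cmod[of w] by simp
    define q where "q = \<bar>r - cmod w\<bar> + Re w"
    have q1: "0 < q" "Re w \<le> q" "r - cmod w \<le> q - Re w" unfolding q_def using Rw0 by auto
    have "h * (1 + r) \<le> q * (2 * R + 1)"
    proof -
      \<comment> \<open>For large r the term r - |w| in q does the work, for small r the term Re w;
        this inequality combines them without a case distinction.\<close>
      have "Re w * r \<le> q * (cmod w + Re w)"
      proof -
        have "Re w * (r - cmod w) \<le> Re w * (q - Re w)" using q1 Rw0 by (intro mult_left_mono) auto
        then have "Re w * r - Re w * cmod w \<le> Re w * q - Re w * Re w" by (simp only: right_diff_distrib)
        moreover have "Re w * cmod w \<le> q * cmod w" using q1 by (intro mult_right_mono) auto
        moreover have "0 \<le> Re w * Re w" by simp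
        moreover have "q * (cmod w + Re w) = q * cmod w + Re w * q" by (simp add: distrib_left)
        ultimately show ?thesis by linarith
      qed
      moreover have "h * (1 + r) \<le> Re w * (1 + r)" using Rw r by (intro mult_right_mono) auto
      moreover have "Re w * (1 + r) = Re w + Re w * r" by (simp add: distrib_left)
      moreover have "q * (cmod w + Re w + 1) = q * (cmod w + Re w) + q" by (simp add: distrib_left)
      moreover have "q * (cmod w + Re w + 1) \<le> q * (2 * R + 1)"
        using q1(1) cw complex_Re_le_cmod[of w] by (intro mult_left_mono) auto
      ultimately show ?thesis using q1(2) by linarith
    qed
    then have "h * (1 + r) / (2 * R + 1) \<le> q" using pos by (subst pos_divide_le_eq) auto
    then have q2: "h / (2 * R + 1) * (1 + r) \<le> q" by simp
    have "m * r \<le> r" "m \<le> cmod w" using pos r cw2 by (auto intro: mult_left_le_one_le)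
    then have "m * (1 + r) \<le> cmod w + r" by (simp add: distrib_left)
    with q2 have "(h / (2 * R + 1) * (1 + r)) * (m * (1 + r)) \<le> q * (cmod w + r)"
      using pos r q1 by (intro mult_mono) auto
    then have "(h / (2 * R + 1) * (1 + r)) * (m * (1 + r)) / 4 \<le> q * (cmod w + r) / 4"
      by (rule divide_right_mono) simp
    moreover have "\<kappa> * (1 + r)\<^sup>2 = (h / (2 * R + 1) * (1 + r)) * (m * (1 + r)) / 4"
      by (simp add: \<kappa>_def power2_eq_square)
    ultimately have "\<kappa> * (1 + r)\<^sup>2 \<le> q * (cmod w + r) / 4" by (simp only:)
    also have "\<dots> \<le> cmod (w\<^sup>2 + complex_of_real (r\<^sup>2))" unfolding q_def by (rule square_plus_square_ge[OF Rw0 r])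
    finally have "(\<kappa> * (1 + r)\<^sup>2) powr ?a \<le> cmod (w\<^sup>2 + complex_of_real (r\<^sup>2)) powr ?a"
      using \<kappa> r by (intro powr_mono2) auto
    moreover have "0 < (\<kappa> * (1 + r)\<^sup>2) powr ?a" using \<kappa> r by simp
    ultimately have "poisson_const DIM('a) * cmod w / cmod (w\<^sup>2 + complex_of_real (r\<^sup>2)) powr ?a
        \<le> poisson_const DIM('a) * R / (\<kappa> * (1 + r)\<^sup>2) powr ?a"
      using cw poisson_const_pos[of "DIM('a)"] pos by (intro frac_le mult_left_mono mult_nonneg_nonneg) auto
    also have "(\<kappa> * (1 + r)\<^sup>2) powr ?a = \<kappa> powr ?a * (1 + r) powr (real DIM('a) + 1)"
    proof -
      have "((1 + r)\<^sup>2) powr ?a = ((1 + r) powr 2) powr ?a" using r by simp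
      also have "\<dots> = (1 + r) powr (2 * ?a)" by (rule powr_powr)
      also have "2 * ?a = real DIM('a) + 1" by simp
      finally have "((1 + r)\<^sup>2) powr ?a = (1 + r) powr (real DIM('a) + 1)" .
      moreover have "(\<kappa> * (1 + r)\<^sup>2) powr ?a = \<kappa> powr ?a * ((1 + r)\<^sup>2) powr ?a"
        using \<kappa> r by (simp add: powr_mult)
      ultimately show ?thesis by (simp only:)
    qed
    finally show ?thesis
      unfolding poisson_def norm_divide norm_mult norm_powr_of_real A_def r_def powr_minus_divide
      using poisson_const_pos[of "DIM('a)"] by simp
  qed
  ultimately show ?thesis by (rule that)
qed

text \<open>Cauchy's estimates carry the decay of \<open>poisson_local_bound\<close> over to the
  first two derivatives in z, and Taylor's formula turns the second one into the error of the
  difference quotient. As the bound is integrable in x, the difference quotients converge in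
  L^1.\<close>

lemma poisson_difference_quotient:
  assumes z: "0 < Re z"
  obtains C where "0 < C" "\<And>h x. h \<noteq> 0 \<Longrightarrow> cmod h \<le> Re z / 4 \<Longrightarrow>
    cmod ((poisson (z + h) x - poisson z x) / h - deriv (\<lambda>w. poisson w x) z)
      \<le> cmod h * C * (1 + norm (x::'a::euclidean_space)) powr (- (real DIM('a) + 1))"
    "\<And>x::'a. cmod (deriv (\<lambda>w. poisson w x) z) \<le> C * (1 + norm x) powr (- (real DIM('a) + 1))"
proof -
  obtain A where A: "0 < A" "\<And>w x. w \<in> cball z (Re z / 2) \<Longrightarrow>
    cmod (poisson w (x::'a)) \<le> A * (1 + norm x) powr (- (real DIM('a) + 1))"
    by (rule poisson_local_bound[where 'a = 'a, OF z], rule that, assumption, blast)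
  \<comment> \<open>With this radius a disc about any point of \<open>cball z r\<close> still lies
    in \<open>cball z (Re z / 2)\<close>.\<close>
  define r where "r = Re z / 4"
  have r: "0 < r" using z by (simp add: r_def)
  define C where "C = 2 * A / r\<^sup>2 + A / r"
  have C: "0 < C" "2 * A / r\<^sup>2 \<le> C" "A / r \<le> C" using A(1) r by (auto simp: C_def add_pos_pos)
  have der: "cmod ((deriv ^^ n) (\<lambda>w. poisson w x) w) \<le> fact n * (A * (1 + norm x) powr (- (real DIM('a) + 1))) / r ^ n"
    if w: "w \<in> cball z r" for w n and x :: 'a
  proof (rule Cauchy_inequality)
    have sub: "cball w r \<subseteq> cball z (Re z / 2)"
    proof
      fix v assume "v \<in> cball w r"
      then have "dist z v \<le> r + r" using w dist_triangle[of z v w] by simp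
      then show "v \<in> cball z (Re z / 2)" by (simp add: r_def)
    qed
    have pos: "cball z (Re z / 2) \<subseteq> {w. 0 < Re w}"
    proof
      fix v assume "v \<in> cball z (Re z / 2)"
      then have "cmod (z - v) \<le> Re z / 2" by (simp add: dist_norm)
      then show "v \<in> {w. 0 < Re w}" using complex_Re_le_cmod[of "z - v"] z by simp
    qed
    have hol: "(\<lambda>w. poisson w x) holomorphic_on cball w r"
      using poisson_holomorphic by (rule holomorphic_on_subset) (use sub pos in blast)
    then show "(\<lambda>w. poisson w x) holomorphic_on ball w r" by (rule holomorphic_on_subset) auto
    show "continuous_on (cball w r) (\<lambda>w. poisson w x)" using hol by (rule holomorphic_on_imp_continuous_on)
    show "norm (poisson v x) \<le> A * (1 + norm x) powr (- (real DIM('a) + 1))" if "norm (w - v) = r" for v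
      using that sub by (intro A(2)) (auto simp: dist_norm)
  qed (rule r)
  have hol: "(\<lambda>w. poisson w x) holomorphic_on ball z (2 * r)" for x :: 'a
  proof (rule holomorphic_on_subset[OF poisson_holomorphic], safe)
    fix v assume "v \<in> ball z (2 * r)"
    then have "cmod (z - v) < Re z / 2" by (simp add: dist_norm r_def)
    then show "0 < Re v" using complex_Re_le_cmod[of "z - v"] z by simp
  qed
  have quot: "cmod ((poisson (z + h) x - poisson z x) / h - deriv (\<lambda>w. poisson w x) z)
      \<le> cmod h * C * (1 + norm x) powr (- (real DIM('a) + 1))" if h: "h \<noteq> 0" "cmod h \<le> Re z / 4" for h and x :: 'a
  proof -
    define m where "m = (1 + norm x) powr (- (real DIM('a) + 1))"
    define F where "F i = (deriv ^^ i) (\<lambda>w. poisson w x)" for i :: nat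
    have "cmod (F 0 (z + h) - (\<Sum>i\<le>1. F i z * (z + h - z) ^ i / fact i)) \<le> (2 * A / r\<^sup>2 * m) * cmod (z + h - z) ^ Suc 1 / fact 1"
    proof (rule complex_Taylor)
      show "convex (cball z r)" by simp
      show "(F i has_field_derivative F (Suc i) w) (at w within cball z r)" if "w \<in> cball z r" "i \<le> 1" for i w
      proof -
        have "w \<in> ball z (2 * r)" using that r by simp
        moreover have "F i holomorphic_on ball z (2 * r)" unfolding F_def by (rule holomorphic_higher_deriv[OF hol]) simp
        ultimately have "(F i has_field_derivative deriv (F i) w) (at w)" by (intro holomorphic_derivI[of _ "ball z (2 * r)"]) auto
        then show ?thesis by (simp add: F_def has_field_derivative_at_within)
      qed
      show "cmod (F (Suc 1) w) \<le> 2 * A / r\<^sup>2 * m" if "w \<in> cball z r" for w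
        using der[OF that, of 2 x] by (simp add: F_def m_def numeral_2_eq_2)
    qed (use h r in \<open>auto simp: r_def dist_norm\<close>)
    then have *: "cmod (poisson (z + h) x - poisson z x - deriv (\<lambda>w. poisson w x) z * h) \<le> 2 * A / r\<^sup>2 * m * (cmod h)\<^sup>2"
      by (simp add: F_def power2_eq_square algebra_simps)
    have "(poisson (z + h) x - poisson z x) / h - deriv (\<lambda>w. poisson w x) z
        = (poisson (z + h) x - poisson z x - deriv (\<lambda>w. poisson w x) z * h) / h"
      using h(1) by (simp add: diff_divide_distrib)
    then have "cmod ((poisson (z + h) x - poisson z x) / h - deriv (\<lambda>w. poisson w x) z)
        = cmod (poisson (z + h) x - poisson z x - deriv (\<lambda>w. poisson w x) z * h) / cmod h"
      by (simp only: norm_divide)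
    also have "\<dots> \<le> 2 * A / r\<^sup>2 * m * (cmod h)\<^sup>2 / cmod h"
      using * by (rule divide_right_mono) simp
    also have "\<dots> = cmod h * (2 * A / r\<^sup>2) * m" using h(1) by (simp add: power2_eq_square)
    also have "\<dots> \<le> cmod h * C * m" using C by (intro mult_right_mono mult_left_mono) (auto simp: m_def)
    finally show ?thesis unfolding m_def .
  qed
  have d1: "cmod (deriv (\<lambda>w. poisson w x) z) \<le> C * (1 + norm x) powr (- (real DIM('a) + 1))" for x :: 'a
  proof -
    have "cmod (deriv (\<lambda>w. poisson w x) z) \<le> A / r * (1 + norm x) powr (- (real DIM('a) + 1))"
      using der[of z 1 x] r by simp
    also have "\<dots> \<le> C * (1 + norm x) powr (- (real DIM('a) + 1))" using C by (intro mult_right_mono) auto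
    finally show ?thesis .
  qed
  show ?thesis by (rule that[OF C(1) quot d1])
qed

text \<open>The derivative is a pointwise limit of difference quotients along the steps 1 / (n +
  1).\<close>

lemma poisson_deriv_measurable:
  assumes z: "0 < Re z"
  shows "(\<lambda>x::'a::euclidean_space. deriv (\<lambda>w. poisson w x) z) \<in> borel_measurable borel"
proof -
  define c where "c n = complex_of_real (1 / real (Suc n))" for n
  have c: "0 < Re (z + c n)" for n using z by (simp add: c_def add_pos_pos del: of_real_divide of_nat_Suc)
  note [measurable] = poisson_measurable[OF c] poisson_measurable[OF z]
  show ?thesis
  proof (rule borel_measurable_LIMSEQ_metric)
    show "(\<lambda>x::'a. (poisson (z + c n) x - poisson z x) / c n) \<in> borel_measurable borel" for n by measurable
    fix x :: 'a
    have "((\<lambda>w. poisson w x) has_field_derivative deriv (\<lambda>w. poisson w x) z) (at z)"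
      by (rule holomorphic_derivI[OF poisson_holomorphic open_halfspace_Re_gt]) (use z in simp)
    then have "((\<lambda>h. (poisson (z + h) x - poisson z x) / h) \<longlongrightarrow> deriv (\<lambda>w. poisson w x) z) (at 0)"
      by (simp add: DERIV_def)
    moreover have "filterlim c (at 0) sequentially"
    proof -
      have "(\<lambda>n. complex_of_real (1 / real (Suc n))) \<longlonglongrightarrow> complex_of_real 0"
        by (intro tendsto_of_real LIMSEQ_Suc[OF lim_1_over_n])
      then have "c \<longlonglongrightarrow> 0" by (simp only: c_def[abs_def] of_real_0)
      moreover have "c n \<noteq> 0" for n by (simp add: c_def del: of_real_divide of_nat_Suc)
      ultimately show ?thesis by (simp add: filterlim_at)
    qed
    ultimately show "(\<lambda>n. (poisson (z + c n) x - poisson z x) / c n) \<longlonglongrightarrow> deriv (\<lambda>w. poisson w x) z"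
      by (rule filterlim_compose)
  qed
qed

lemma Lp_norm_cong_AE:
  assumes "AE x in lborel. f x = g x" and [measurable]: "f \<in> borel_measurable borel" "g \<in> borel_measurable borel"
  shows "Lp_norm p f = Lp_norm p g"
proof -
  have "(LINT x|lborel. norm (f x) powr p) = (LINT x|lborel. norm (g x) powr p)"
    by (rule Bochner_Integration.integral_cong_AE, measurable, measurable)
      (use assms(1) in \<open>auto elim: eventually_mono\<close>)
  then show ?thesis by (simp add: Lp_norm_def)
qed

text \<open>The difference quotient minus the candidate derivative is again a convolution, with a
  kernel of L^1 norm at most |h| C m. The bound is linear in the norm of f, so the limit holds even
  in operator norm; the derivative is convolution with the derivative of the kernel.\<close>

theorem poisson_semigroup_holomorphic:
  fixes S :: "complex \<Rightarrow> ('a::euclidean_space) fun_op"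
  assumes p: "1 < p" and Sb: "\<And>z. 0 < Re z \<Longrightarrow> S z \<in> bounded_ops p"
    and S: "\<And>z f. 0 < Re z \<Longrightarrow> f \<in> Lp p \<Longrightarrow> AE x in lborel. S z f x = conv_op (poisson z) f x"
  shows "holomorphic_family_on p S {z. 0 < Re z}"
  unfolding holomorphic_family_on_def
proof (intro conjI ballI)
  show "S z \<in> bounded_ops p" if "z \<in> {z. 0 < Re z}" for z using Sb that by simp
  fix f :: "'a \<Rightarrow> complex" and z assume f: "f \<in> Lp p" and "z \<in> {z. 0 < Re z}"
  then have z: "0 < Re z" by simp
  obtain C where C: "0 < C" "\<And>h x. h \<noteq> 0 \<Longrightarrow> cmod h \<le> Re z / 4 \<Longrightarrow>
    cmod ((poisson (z + h) x - poisson z x) / h - deriv (\<lambda>w. poisson w x) z)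
      \<le> cmod h * C * (1 + norm (x::'a)) powr (- (real DIM('a) + 1))"
    "\<And>x::'a. cmod (deriv (\<lambda>w. poisson w x) z) \<le> C * (1 + norm x) powr (- (real DIM('a) + 1))"
    by (rule poisson_difference_quotient[where 'a = 'a, OF z], rule that, assumption, blast, blast)
  define m where "m = enn2real (\<integral>\<^sup>+(x::'a). ennreal ((1 + norm x) powr (- (real DIM('a) + 1))) \<partial>lborel)"
  have m: "0 \<le> m" "(\<integral>\<^sup>+(x::'a). ennreal ((1 + norm x) powr (- (real DIM('a) + 1))) \<partial>lborel) = ennreal m"
    using nn_integral_decay[where 'a='a, of 1] by (simp_all add: m_def)
  have kernel_mass: "(\<integral>\<^sup>+x. nn_norm K x \<partial>lborel) \<le> ennreal (c * m)"
    if K: "\<And>x. cmod (K x) \<le> c * (1 + norm x) powr (- (real DIM('a) + 1))" and c: "0 \<le> c" for c and K :: "'a \<Rightarrow> complex"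
  proof -
    have "(\<integral>\<^sup>+x. nn_norm K x \<partial>lborel) \<le> (\<integral>\<^sup>+(x::'a). ennreal c * ennreal ((1 + norm x) powr (- (real DIM('a) + 1))) \<partial>lborel)"
      using K c by (intro nn_integral_mono) (simp add: ennreal_leI flip: ennreal_mult)
    also have "\<dots> = ennreal c * (\<integral>\<^sup>+(x::'a). ennreal ((1 + norm x) powr (- (real DIM('a) + 1))) \<partial>lborel)"
      by (rule nn_integral_cmult) measurable
    also have "\<dots> = ennreal (c * m)" unfolding m(2) using c m(1) by (simp add: ennreal_mult)
    finally show ?thesis .
  qed
  have pk: "\<exists>B\<ge>0. (\<integral>\<^sup>+x. nn_norm (poisson w) (x::'a) \<partial>lborel) \<le> ennreal B" if w: "0 < Re w" for w
  proof -
    obtain A where A: "0 < A" "\<And>v x. v \<in> cball w (Re w / 2) \<Longrightarrow>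
      cmod (poisson v (x::'a)) \<le> A * (1 + norm x) powr (- (real DIM('a) + 1))"
      by (rule poisson_local_bound[where 'a = 'a, OF w], rule that, assumption, blast)
    have "(\<integral>\<^sup>+x. nn_norm (poisson w) (x::'a) \<partial>lborel) \<le> ennreal (A * m)"
      by (rule kernel_mass[OF A(2)]) (use A(1) w in auto)
    then show ?thesis using A(1) m(1) by (intro exI[of _ "A * m"]) auto
  qed
  define P' where "P' = (\<lambda>x::'a. deriv (\<lambda>w. poisson w x) z)"
  have P'm[measurable]: "P' \<in> borel_measurable borel" unfolding P'_def by (rule poisson_deriv_measurable[OF z])
  have P'mass: "(\<integral>\<^sup>+x. nn_norm P' x \<partial>lborel) \<le> ennreal (C * m)"
    unfolding P'_def by (rule kernel_mass[OF C(3)]) (use C(1) in simp)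
  define g where "g = conv_op P' f"
  have Cm: "0 \<le> C * m" using C(1) m(1) by simp
  have g: "g \<in> Lp p" unfolding g_def by (rule conv_op_Lp(2)[OF P'm P'mass Cm p f])
  have bound: "Lp_norm p (\<lambda>x. (S (z + h) f x - S z f x) / h - g x) \<le> cmod h * (C * m * Lp_norm p f)"
    if h: "h \<noteq> 0" "cmod h \<le> Re z / 4" for h
  proof -
    have zh: "0 < Re (z + h)" using h z abs_Re_le_cmod[of h] by auto
    note [measurable] = poisson_measurable[OF zh] poisson_measurable[OF z]
    define Q where "Q = (\<lambda>x::'a. (poisson (z + h) x - poisson z x) / h - P' x)"
    have Qm[measurable]: "Q \<in> borel_measurable borel" unfolding Q_def by measurable
    have Qmass: "(\<integral>\<^sup>+x. nn_norm Q x \<partial>lborel) \<le> ennreal (cmod h * C * m)"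
      unfolding Q_def P'_def by (rule kernel_mass[OF C(2)[OF h]]) (use C(1) in simp)
    have Qc: "0 \<le> cmod h * C * m" using C(1) m(1) by simp
    obtain B1 where B1: "0 \<le> B1" "(\<integral>\<^sup>+x. nn_norm (poisson (z + h)) (x::'a) \<partial>lborel) \<le> ennreal B1" using pk[OF zh] by blast
    obtain B2 where B2: "0 \<le> B2" "(\<integral>\<^sup>+x. nn_norm (poisson z) (x::'a) \<partial>lborel) \<le> ennreal B2" using pk[OF z] by blast
    have "AE x in lborel. (S (z + h) f x - S z f x) / h - g x = conv_op Q f x"
      using S[OF zh f] S[OF z f]
        conv_op_Lp(1)[OF poisson_measurable[OF zh] B1(2) B1(1) p f]
        conv_op_Lp(1)[OF poisson_measurable[OF z] B2(2) B2(1) p f]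
        conv_op_Lp(1)[OF P'm P'mass Cm p f]
    proof eventually_elim
      case (elim x)
      have "conv_op Q f x = (LINT y|lborel. (poisson (z + h) (x - y) * f y - poisson z (x - y) * f y) / h - P' (x - y) * f y)"
        unfolding conv_op_def Q_def by (intro Bochner_Integration.integral_cong) (auto simp: left_diff_distrib diff_divide_distrib)
      also have "\<dots> = (conv_op (poisson (z + h)) f x - conv_op (poisson z) f x) / h - conv_op P' f x"
        unfolding conv_op_def using elim(3-5)
        by (subst Bochner_Integration.integral_diff) (auto simp: Bochner_Integration.integral_diff)
      finally show ?case using elim(1,2) by (simp add: g_def)
    qed
    moreover have "S (z + h) f \<in> Lp p" "S z f \<in> Lp p" using Sb[OF zh] Sb[OF z] f by (auto simp: bounded_ops_def)
    then have [measurable]: "S (z + h) f \<in> borel_measurable borel" "S z f \<in> borel_measurable borel" "g \<in> borel_measurable borel"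
      "conv_op Q f \<in> borel_measurable borel"
      using g conv_op_measurable[OF Qm Lp_D(1)[OF f]] by (auto dest: Lp_D(1))
    ultimately have "Lp_norm p (\<lambda>x. (S (z + h) f x - S z f x) / h - g x) = Lp_norm p (conv_op Q f)"
      by (intro Lp_norm_cong_AE) auto
    also have "\<dots> \<le> cmod h * C * m * Lp_norm p f" by (rule conv_op_Lp(3)[OF Qm Qmass Qc p f])
    finally show ?thesis by (simp add: mult.assoc)
  qed
  have "((\<lambda>h. Lp_norm p (\<lambda>x. (S (z + h) f x - S z f x) / h - g x)) \<longlongrightarrow> 0) (at 0)"
  proof (rule Lim_null_comparison)
    show "eventually (\<lambda>h. norm (Lp_norm p (\<lambda>x. (S (z + h) f x - S z f x) / h - g x)) \<le> cmod h * (C * m * Lp_norm p f)) (at 0)"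
      unfolding eventually_at
    proof (intro exI[of _ "Re z / 4"] conjI ballI impI)
      fix h :: complex assume "h \<noteq> 0 \<and> dist h 0 < Re z / 4"
      then have "Lp_norm p (\<lambda>x. (S (z + h) f x - S z f x) / h - g x) \<le> cmod h * (C * m * Lp_norm p f)"
        by (intro bound) (auto simp: dist_norm)
      moreover have "0 \<le> Lp_norm p (\<lambda>x. (S (z + h) f x - S z f x) / h - g x)" by (simp add: Lp_norm_def)
      ultimately show "norm (Lp_norm p (\<lambda>x. (S (z + h) f x - S z f x) / h - g x)) \<le> cmod h * (C * m * Lp_norm p f)"
        by (simp only: real_norm_def abs_of_nonneg)
    qed (use z in simp)
    show "((\<lambda>h. cmod h * (C * m * Lp_norm p f)) \<longlongrightarrow> 0) (at 0)"
      by (intro tendsto_mult_left_zero tendsto_norm_zero tendsto_ident_at)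
  qed
  with g show "\<exists>g\<in>Lp p. ((\<lambda>h. Lp_norm p (\<lambda>x. (S (z + h) f x - S z f x) / h - g x)) \<longlongrightarrow> 0) (at 0)" by blast
qed

section \<open>The semigroup and the wave operators\<close>

text \<open>One operator with the given symbol is enough for the choice in
  \<open>fourier_multiplier\<close> to succeed, and uniqueness transfers its formula to the chosen
  operator.\<close>

lemma function_of_A_has_symbol:
  fixes S :: "'a::euclidean_space fun_op"
  assumes S: "has_symbol p S (symbol_of_A F)" and p: "1 < p"
  shows "has_symbol p (function_of_A p F) (symbol_of_A F :: 'a \<Rightarrow> complex)"
    "f \<in> Lp p \<Longrightarrow> AE x in lborel. function_of_A p F f x = S f x"
proof -
  show *: "has_symbol p (function_of_A p F) (symbol_of_A F :: 'a \<Rightarrow> complex)"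
    unfolding function_of_A_def fourier_multiplier_def by (rule someI[of "\<lambda>T. has_symbol p T (symbol_of_A F)", OF S])
  show "AE x in lborel. function_of_A p F f x = S f x" if "f \<in> Lp p"
    using * S p that by (rule has_symbol_unique)
qed

text \<open>The path is constant, so the location 0 of the point mass is arbitrary.\<close>

lemma exp_mixture:
  assumes "0 < Re z"
  shows "poisson_mixture (return borel 0) (\<lambda>_. z)"
proof (intro poisson_mixture.intro)
  show "prob_space (return borel (0::real))" by (rule prob_space_return) simp
  show "sets (return borel (0::real)) = sets borel" by (rule sets_return)
  show "(\<lambda>_. z) \<in> borel_measurable borel" by (rule borel_measurable_const)
  show "0 < Re z" by (rule assms)
qed

lemma mix_kernel_return: "mix_kernel (return borel 0) (\<lambda>_. z) = poisson z"
  unfolding mix_kernel_def by (intro ext integral_return) auto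

lemma mix_weight_return: "mix_weight (return borel 0) (\<lambda>_. z) \<beta> = ennreal ((Re z / cmod z) powr (- \<beta>))"
  unfolding mix_weight_def by (intro nn_integral_return) auto

lemma exp_has_symbol:
  assumes z: "0 < Re z" and p: "1 < p"
  shows "has_symbol p (conv_op (poisson z)) (symbol_of_A (exp_fun z) :: 'a::euclidean_space \<Rightarrow> complex)"
proof -
  interpret poisson_mixture "return borel 0" "\<lambda>_. z" using z by (rule exp_mixture)
  have "mix_symbol = (symbol_of_A (exp_fun z) :: 'a \<Rightarrow> complex)"
    unfolding mix_symbol_def[abs_def] symbol_of_A_def exp_fun_def
    by (intro ext integral_return) auto
  \<comment> \<open>The weight of a point mass is finite for every exponent; d is a convenient value
    above (d - 1) / 2.\<close>
  moreover have "(real DIM('a) - 1) / 2 < real DIM('a)" by (simp add: field_simps)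
  ultimately show ?thesis
    using mix_has_symbol[where 'a = 'a, of "real DIM('a)" p] p by (simp add: mix_kernel_return mix_weight_return)
qed

text \<open>A crude form of Jordan's inequality. Up to pi / 6 the mean value theorem applies with
  cos at least 1 / 2; beyond it sin is at least 1 / 2, while y / 4 \<le> pi / 8 < 1 / 2.\<close>

lemma sin_ge_quarter:
  assumes "0 \<le> y" "y \<le> pi / 2"
  shows "y / 4 \<le> sin y"
proof (cases "y \<le> pi / 6")
  case True
  show ?thesis
  proof (cases "y = 0")
    case False
    then have y: "0 < y" using assms by simp
    obtain \<xi> where \<xi>: "0 < \<xi>" "\<xi> < y" "sin y - sin 0 = (y - 0) * cos \<xi>"
      using MVT2[OF y, of sin cos] DERIV_sin by blast
    have "cos (pi / 3) \<le> cos \<xi>" using \<xi> True pi_gt_zero by (intro cos_monotone_0_pi_le) linarith+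
    then have "y * (1 / 2) \<le> y * cos \<xi>" using y by (intro mult_left_mono) (auto simp: cos_60)
    then show ?thesis using \<xi>(3) y by simp
  qed simp
next
  case False
  have "sin (pi / 6) \<le> sin y" using False assms by (intro sin_monotone_2pi_le) auto
  then show ?thesis using assms pi_less_4 by (simp add: sin_30)
qed

text \<open>cos \<theta> is the ratio Re z / |z| at z = \<open>cis \<theta> * t\<close>. Through cos
  \<theta> = sin (pi / 2 - |\<theta>|) the weight of the semigroup is expressed by the angular
  distance to the imaginary axis.\<close>

lemma cos_powr_le:
  assumes "\<bar>\<theta>\<bar> < pi / 2" "0 \<le> \<alpha>"
  shows "cos \<theta> powr (- \<alpha>) \<le> 4 powr \<alpha> * (pi / 2 - \<bar>\<theta>\<bar>) powr (- \<alpha>)"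
proof -
  define y where "y = pi / 2 - \<bar>\<theta>\<bar>"
  have y: "0 < y" "y \<le> pi / 2" using assms by (auto simp: y_def)
  have "cos \<theta> = sin y" unfolding y_def sin_diff by (simp add: cos_abs_real)
  then have "y / 4 \<le> cos \<theta>" using sin_ge_quarter[of y] y by simp
  then have "cos \<theta> powr (- \<alpha>) \<le> (y / 4) powr (- \<alpha>)" using y assms by (intro powr_mono2') auto
  also have "\<dots> = 4 powr \<alpha> * y powr (- \<alpha>)" using y by (simp add: powr_divide powr_minus_divide)
  finally show ?thesis by (simp add: y_def)
qed

section \<open>The wave operators as mixtures over the Gamma distribution\<close>

definition gamma_measure :: "real \<Rightarrow> real measure" where
  "gamma_measure \<alpha> = density lborel (\<lambda>u. ennreal (indicator {0<..} u * (u powr (\<alpha> - 1) * exp (- u)) / Gamma \<alpha>))"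

text \<open>The value of the path for \<open>u \<le> 0\<close> is irrelevant, but it keeps the real part positive.\<close>

definition wave_path :: "real \<Rightarrow> real \<Rightarrow> complex" where
  "wave_path t u = Complex (if 0 < u then u else 1) (- t)"

lemma gamma_measure_prob:
  assumes "0 < \<alpha>"
  shows "prob_space (gamma_measure \<alpha>)"
proof (rule prob_spaceI)
  have "has_bochner_integral lborel (\<lambda>u. indicator {0<..} u * (u powr (\<alpha> - 1) * exp (- (1 * u)))) (Gamma \<alpha> * 1 powr (- \<alpha>))"
    using assms by (intro has_bochner_integral_Gamma) auto
  then have i: "integrable lborel (\<lambda>u. indicator {0<..} u * (u powr (\<alpha> - 1) * exp (- u)))"
    "(LINT u|lborel. indicator {0<..} u * (u powr (\<alpha> - 1) * exp (- u))) = Gamma \<alpha>"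
    by (simp_all only: has_bochner_integral_iff mult_1 powr_one_eq_one mult_1_right)
  have b: "integrable lborel (\<lambda>u. indicator {0<..} u * (u powr (\<alpha> - 1) * exp (- u)) / Gamma \<alpha>)"
    using i(1) by (intro integrable_divide_zero)
  have b2: "(LINT u|lborel. indicator {0<..} u * (u powr (\<alpha> - 1) * exp (- u)) / Gamma \<alpha>) = 1"
    unfolding integral_divide_zero i(2) using Gamma_real_pos[OF assms] by simp
  have nn: "AE u in lborel. 0 \<le> indicator {0<..} u * (u powr (\<alpha> - 1) * exp (- u)) / Gamma \<alpha>"
    using Gamma_real_pos[OF assms] by (auto simp: indicator_def)
  have "emeasure (gamma_measure \<alpha>) (space (gamma_measure \<alpha>))
      = (\<integral>\<^sup>+u. ennreal (indicator {0<..} u * (u powr (\<alpha> - 1) * exp (- u)) / Gamma \<alpha>) \<partial>lborel)"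
    unfolding gamma_measure_def by (subst emeasure_density) auto
  also have "\<dots> = 1"
    unfolding nn_integral_eq_integral[OF b nn] b2 by simp
  finally show "emeasure (gamma_measure \<alpha>) (space (gamma_measure \<alpha>)) = 1" .
qed

lemma wave_mixture:
  assumes "0 < \<alpha>"
  shows "poisson_mixture (gamma_measure \<alpha>) (wave_path t)"
proof (intro poisson_mixture.intro gamma_measure_prob assms)
  show "sets (gamma_measure \<alpha>) = sets borel" by (simp add: gamma_measure_def)
  have "wave_path t = (\<lambda>u. complex_of_real (if 0 < u then u else 1) + \<i> * complex_of_real (- t))"
    by (auto simp: wave_path_def complex_eq_iff)
  then show "wave_path t \<in> borel_measurable borel" by simp
  show "0 < Re (wave_path t u)" for u by (simp add: wave_path_def)
qed

text \<open>The Laplace transform of the Gamma density of shape \<alpha> at s r is (1 + s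
  r)^(-\<alpha>); the imaginary part -t of the path does not depend on u and contributes only the
  phase.\<close>

lemma wave_symbol:
  assumes \<alpha>: "0 < \<alpha>" and s: "0 < s" and r: "0 \<le> r"
  shows "(LINT u|gamma_measure \<alpha>. exp (- (complex_of_real s * wave_path t u * complex_of_real r))) = wave_fun \<alpha> t s r"
proof -
  define w where "w u = indicator {0<..} u * (u powr (\<alpha> - 1) * exp (- u)) / Gamma \<alpha>" for u :: real
  have G: "0 < Gamma \<alpha>" by (rule Gamma_real_pos[OF \<alpha>])
  have b: "0 < 1 + s * r" using s r by (simp add: add_pos_nonneg)
  interpret W: poisson_mixture "gamma_measure \<alpha>" "wave_path t" using \<alpha> by (rule wave_mixture)
  have "(LINT u|gamma_measure \<alpha>. exp (- (complex_of_real s * wave_path t u * complex_of_real r)))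
      = (LINT u|lborel. w u *\<^sub>R exp (- (complex_of_real s * wave_path t u * complex_of_real r)))"
    unfolding gamma_measure_def w_def[symmetric]
  proof (rule integral_density)
    have "wave_path t \<in> borel_measurable borel" by (rule W.zeta_measurable)
    then show "(\<lambda>u. exp (- (complex_of_real s * wave_path t u * complex_of_real r))) \<in> borel_measurable lborel" by simp
    show "w \<in> borel_measurable lborel" unfolding w_def by measurable
    show "AE u in lborel. 0 \<le> w u" using G by (auto simp: w_def indicator_def)
  qed
  also have "\<dots> = (LINT u|lborel. complex_of_real (indicator {0<..} u * (u powr (\<alpha> - 1) * exp (- ((1 + s * r) * u)))) *
      (exp (\<i> * complex_of_real (t * s * r)) / complex_of_real (Gamma \<alpha>)))"
  proof (rule Bochner_Integration.integral_cong[OF refl])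
    fix u :: real
    show "w u *\<^sub>R exp (- (complex_of_real s * wave_path t u * complex_of_real r)) =
      complex_of_real (indicator {0<..} u * (u powr (\<alpha> - 1) * exp (- ((1 + s * r) * u)))) *
      (exp (\<i> * complex_of_real (t * s * r)) / complex_of_real (Gamma \<alpha>))"
    proof (cases "0 < u")
      case True
      have "- (complex_of_real s * wave_path t u * complex_of_real r) = complex_of_real (- (s * r * u)) + \<i> * complex_of_real (t * s * r)"
        using True by (simp add: wave_path_def complex_eq_iff)
      then have "exp (- (complex_of_real s * wave_path t u * complex_of_real r)) = complex_of_real (exp (- (s * r * u))) * exp (\<i> * complex_of_real (t * s * r))"
        by (simp only: exp_add exp_of_real)
      moreover have "exp (- ((1 + s * r) * u)) = exp (- u) * exp (- (s * r * u))"
        by (simp add: algebra_simps flip: exp_add)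
      ultimately show ?thesis using True by (simp add: w_def scaleR_conv_of_real)
    qed (simp add: w_def)
  qed
  also have "\<dots> = complex_of_real (Gamma \<alpha> * (1 + s * r) powr (- \<alpha>)) * (exp (\<i> * complex_of_real (t * s * r)) / complex_of_real (Gamma \<alpha>))"
  proof -
    have "(LINT u|lborel. complex_of_real (indicator {0<..} u * (u powr (\<alpha> - 1) * exp (- ((1 + s * r) * u))))) = complex_of_real (Gamma \<alpha> * (1 + s * r) powr (- \<alpha>))"
      using has_bochner_integral_Gamma[OF \<alpha> b] unfolding integral_complex_of_real by (simp add: has_bochner_integral_iff)
    then show ?thesis by (simp only: integral_mult_left_zero)
  qed
  also have "\<dots> = wave_fun \<alpha> t s r" using G by (simp add: wave_fun_def)
  finally show ?thesis .
qed

text \<open>On the path |\<zeta>| / Re \<zeta> \<le> (1 + |t|) (1 + u) / u, which separates the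
  growth in t. The power \<beta> of (1 + u) / u is at most 2^\<beta> (1 + u^(-\<beta>)); the two
  summands produce the integrals Gamma \<alpha> and Gamma (\<alpha> - \<beta>), and the second
  converges at 0 because \<beta> < \<alpha>.\<close>

lemma wave_weight_le:
  assumes \<beta>: "0 < \<beta>" "\<beta> < \<alpha>"
  shows "mix_weight (gamma_measure \<alpha>) (wave_path t) \<beta>
    \<le> ennreal ((1 + \<bar>t\<bar>) powr \<beta> * (2 powr \<beta> * (1 + Gamma (\<alpha> - \<beta>) / Gamma \<alpha>)))"
proof -
  have \<alpha>: "0 < \<alpha>" using \<beta> by simp
  have G: "0 < Gamma \<alpha>" "0 < Gamma (\<alpha> - \<beta>)" using \<beta> \<alpha> by (auto intro: Gamma_real_pos)
  interpret W: poisson_mixture "gamma_measure \<alpha>" "wave_path t" using \<alpha> by (rule wave_mixture)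
  define k where "k = (1 + \<bar>t\<bar>) powr \<beta> * 2 powr \<beta> / Gamma \<alpha>"
  have k: "0 < k" using G by (simp add: k_def add_pos_nonneg)
  define i where "i s u = indicator {0<..} u * (u powr (s - 1) * exp (- (1 * u)))" for s u :: real
  have i0: "0 \<le> i s u" for s u by (simp add: i_def)
  have [measurable]: "i s \<in> borel_measurable borel" for s unfolding i_def by measurable
  have iG: "(\<integral>\<^sup>+u. ennreal (i s u) \<partial>lborel) = ennreal (Gamma s)" if "0 < s" for s
    using has_bochner_integral_Gamma[OF that, of 1] i0 unfolding i_def[symmetric]
    by (auto simp: has_bochner_integral_iff nn_integral_eq_integral)
  have [measurable]: "wave_path t \<in> borel_measurable borel" by (rule W.zeta_measurable)
  have "mix_weight (gamma_measure \<alpha>) (wave_path t) \<beta> = (\<integral>\<^sup>+u. ennreal (indicator {0<..} u * (u powr (\<alpha> - 1) * exp (- u)) / Gamma \<alpha>) *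
      ennreal ((Re (wave_path t u) / cmod (wave_path t u)) powr (- \<beta>)) \<partial>lborel)"
    unfolding mix_weight_def gamma_measure_def by (subst nn_integral_density) auto
  also have "\<dots> \<le> (\<integral>\<^sup>+u. ennreal k * (ennreal (i \<alpha> u) + ennreal (i (\<alpha> - \<beta>) u)) \<partial>lborel)"
  proof (rule nn_integral_mono)
    fix u :: real
    show "ennreal (indicator {0<..} u * (u powr (\<alpha> - 1) * exp (- u)) / Gamma \<alpha>) *
      ennreal ((Re (wave_path t u) / cmod (wave_path t u)) powr (- \<beta>)) \<le> ennreal k * (ennreal (i \<alpha> u) + ennreal (i (\<alpha> - \<beta>) u))"
    proof (cases "0 < u")
      case True
      define n where "n = cmod (wave_path t u)"
      have wp: "wave_path t u = Complex u (- t)" using True by (simp add: wave_path_def)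
      have n: "u \<le> n" using complex_Re_le_cmod[of "Complex u (- t)"] by (simp add: n_def wp)
      have "n \<le> \<bar>u\<bar> + \<bar>t\<bar>" using cmod_le[of "Complex u (- t)"] by (simp add: n_def wp)
      also have "\<dots> \<le> (1 + \<bar>t\<bar>) * (1 + u)" using True by (simp add: algebra_simps)
      finally have "n / u \<le> (1 + \<bar>t\<bar>) * ((1 + u) / u)" using True by (simp add: field_simps)
      then have "(n / u) powr \<beta> \<le> ((1 + \<bar>t\<bar>) * ((1 + u) / u)) powr \<beta>"
        using True n \<beta> by (intro powr_mono2) auto
      also have "\<dots> = (1 + \<bar>t\<bar>) powr \<beta> * ((1 + u) / u) powr \<beta>" using True by (intro powr_mult)
      also have "((1 + u) / u) powr \<beta> \<le> 2 powr \<beta> * (1 + u powr (- \<beta>))"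
      proof (cases "u \<le> 1")
        case le: True
        have "((1 + u) / u) powr \<beta> \<le> (2 / u) powr \<beta>" using True le \<beta> by (intro powr_mono2 divide_right_mono) auto
        also have "\<dots> = 2 powr \<beta> * u powr (- \<beta>)" using True by (simp add: powr_divide powr_minus_divide)
        finally show ?thesis by (simp add: distrib_left add_increasing)
      next
        case False
        have "((1 + u) / u) powr \<beta> \<le> 2 powr \<beta>" using False \<beta> by (intro powr_mono2) (auto simp: field_simps)
        then show ?thesis by (simp add: distrib_left add_increasing2)
      qed
      finally have "(n / u) powr \<beta> \<le> (1 + \<bar>t\<bar>) powr \<beta> * (2 powr \<beta> * (1 + u powr (- \<beta>)))"
        by (rule meta_mp) (auto intro: mult_left_mono)
      moreover have "(u / n) powr (- \<beta>) = (n / u) powr \<beta>" using True n by (simp add: powr_minus_divide powr_divide)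
      ultimately have "(u powr (\<alpha> - 1) * exp (- u)) / Gamma \<alpha> * (u / n) powr (- \<beta>)
          \<le> (u powr (\<alpha> - 1) * exp (- u)) / Gamma \<alpha> * ((1 + \<bar>t\<bar>) powr \<beta> * (2 powr \<beta> * (1 + u powr (- \<beta>))))"
        using G by (intro mult_left_mono) auto
      also have "\<dots> = k * (i \<alpha> u + i (\<alpha> - \<beta>) u)"
      proof -
        have "\<alpha> - \<beta> - 1 = (\<alpha> - 1) + (- \<beta>)" by simp
        then have "u powr (\<alpha> - \<beta> - 1) = u powr (\<alpha> - 1) * u powr (- \<beta>)" by (simp only: powr_add)
        then have i: "i \<alpha> u = u powr (\<alpha> - 1) * exp (- u)" "i (\<alpha> - \<beta>) u = u powr (\<alpha> - 1) * u powr (- \<beta>) * exp (- u)"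
          using True by (simp_all add: i_def)
        have "a * e / c * (s * (b * (1 + v))) = s * b / c * (a * e + a * v * e)" for a b c e s v :: real
          by (simp add: algebra_simps add_divide_distrib)
        then show ?thesis unfolding i k_def .
      qed
      finally have "ennreal ((u powr (\<alpha> - 1) * exp (- u)) / Gamma \<alpha> * (u / n) powr (- \<beta>)) \<le> ennreal (k * (i \<alpha> u + i (\<alpha> - \<beta>) u))"
        by (rule ennreal_leI)
      also have "\<dots> = ennreal k * (ennreal (i \<alpha> u) + ennreal (i (\<alpha> - \<beta>) u))"
        using k i0 by (simp add: ennreal_mult)
      finally show ?thesis using True G by (simp add: n_def wp flip: ennreal_mult)
    qed simp
  qed
  also have "\<dots> = ennreal k * (ennreal (Gamma \<alpha>) + ennreal (Gamma (\<alpha> - \<beta>)))"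
    using \<alpha> \<beta> by (simp add: nn_integral_cmult nn_integral_add iG)
  also have "\<dots> = ennreal (k * (Gamma \<alpha> + Gamma (\<alpha> - \<beta>)))" using k G by (simp add: ennreal_mult)
  also have "k * (Gamma \<alpha> + Gamma (\<alpha> - \<beta>)) = (1 + \<bar>t\<bar>) powr \<beta> * (2 powr \<beta> * (1 + Gamma (\<alpha> - \<beta>) / Gamma \<alpha>))"
  proof -
    have "s * b / c * (c + v) = s * (b * (1 + v / c))" if "0 < c" for b c s v :: real
      using that by (simp add: field_simps)
    from this[OF G(1)] show ?thesis unfolding k_def .
  qed
  finally show ?thesis .
qed

text \<open>The weight of a single kernel is finite for every exponent, so the mixture bound is
  taken with \<beta> = \<alpha> itself and no power is lost.\<close>

lemma exp_gamma_bound: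
  assumes p: "1 < p" and \<alpha>: "(real DIM('a) - 1) / 2 < \<alpha>"
  shows "\<exists>C > 0. \<forall>t \<theta>. 0 < t \<longrightarrow> \<bar>\<theta>\<bar> < pi / 2 \<longrightarrow>
        (let \<tau> = range (\<lambda>k :: int.
               function_of_A p (exp_fun (cis \<theta> * complex_of_real (t * 2 powi k))) :: ('a::euclidean_space) fun_op)
         in gamma_bounded p \<tau> \<and>
            gamma_bound p \<tau> \<le> C * (pi / 2 - \<bar>\<theta>\<bar>) powr (- \<alpha>))"
proof -
  obtain D where D: "0 < D" "\<forall>M \<zeta> (T :: int \<Rightarrow> 'a fun_op). poisson_mixture M \<zeta> \<longrightarrow> mix_weight M \<zeta> \<alpha> < \<top> \<longrightarrow>
    (\<forall>k. T k \<in> bounded_ops p \<and> (\<forall>f\<in>Lp p. AE x in lborel.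
      T k f x = conv_op (mix_kernel M (\<lambda>u. complex_of_real (2 powi k) * \<zeta> u)) f x)) \<longrightarrow>
    gamma_bounded p (range T) \<and> gamma_bound p (range T) \<le> D * enn2real (mix_weight M \<zeta> \<alpha>)"
    by (rule exE[OF gamma_bound_mixture[OF p \<alpha>]], elim conjE, rule that, assumption, assumption)
  have "1 \<le> real DIM('a)" using DIM_positive[where 'a='a] by linarith
  then have "0 \<le> (real DIM('a) - 1) / 2" by simp
  then have \<alpha>0: "0 < \<alpha>" using \<alpha> by linarith
  have "gamma_bounded p (range T) \<and> gamma_bound p (range T) \<le> (D * 4 powr \<alpha>) * (pi / 2 - \<bar>\<theta>\<bar>) powr (- \<alpha>)"
    if t: "0 < t" and \<theta>: "\<bar>\<theta>\<bar> < pi / 2" and T: "T = (\<lambda>k :: int. function_of_A p (exp_fun (cis \<theta> * complex_of_real (t * 2 powi k))))"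
    for t \<theta> and T :: "int \<Rightarrow> 'a fun_op"
  proof -
    define z where "z = cis \<theta> * complex_of_real t"
    have cos: "0 < cos \<theta>" using \<theta> by (intro cos_gt_zero_pi) auto
    have z: "Re z = cos \<theta> * t" "cmod z = t" using t by (auto simp: z_def norm_mult)
    have W: "mix_weight (return borel 0) (\<lambda>_. z) \<alpha> = ennreal (cos \<theta> powr (- \<alpha>))"
      unfolding mix_weight_return z using t by simp
    have zk: "cis \<theta> * complex_of_real (t * 2 powi k) = complex_of_real (2 powi k) * z" for k
      by (simp add: z_def ac_simps)
    have "Re (complex_of_real c * z) = c * (cos \<theta> * t)" for c by (simp add: z)
    then have Rk: "0 < Re (complex_of_real (2 powi k) * z)" for k using cos t by (simp only:) simp
    have sym: "has_symbol p (conv_op (poisson (complex_of_real (2 powi k) * z))) (symbol_of_A (exp_fun (complex_of_real (2 powi k) * z)) :: 'a \<Rightarrow> complex)" for k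
      using Rk p by (rule exp_has_symbol)
    have Wfin: "mix_weight (return borel 0) (\<lambda>_. z) \<alpha> < \<top>" by (simp add: W)
    have mix: "poisson_mixture (return borel 0) (\<lambda>_. z)" by (rule exp_mixture) (use cos t z in simp)
    have "\<forall>k. T k \<in> bounded_ops p \<and> (\<forall>f\<in>Lp p. AE x in lborel.
      T k f x = conv_op (mix_kernel (return borel 0) (\<lambda>u. complex_of_real (2 powi k) * z)) f x)"
    proof (intro allI conjI ballI)
      fix k
      show "T k \<in> bounded_ops p"
        using function_of_A_has_symbol(1)[OF sym[of k] p] unfolding T zk has_symbol_def by blast
      show "AE x in lborel. T k f x = conv_op (mix_kernel (return borel 0) (\<lambda>u. complex_of_real (2 powi k) * z)) f x"
        if "f \<in> Lp p" for f
        unfolding mix_kernel_return T zk by (rule function_of_A_has_symbol(2)[OF sym p that])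
    qed
    then have *: "gamma_bounded p (range T) \<and> gamma_bound p (range T) \<le> D * enn2real (mix_weight (return borel 0) (\<lambda>_. z) \<alpha>)"
      by (rule D(2)[THEN spec, THEN spec, THEN spec, THEN mp, THEN mp, THEN mp, OF mix Wfin])
    have "D * enn2real (mix_weight (return borel 0) (\<lambda>_. z) \<alpha>) = D * cos \<theta> powr (- \<alpha>)" unfolding W by simp
    also have "\<dots> \<le> D * (4 powr \<alpha> * (pi / 2 - \<bar>\<theta>\<bar>) powr (- \<alpha>))"
      using cos_powr_le[OF \<theta>] \<alpha>0 D(1) by (intro mult_left_mono) auto
    finally show ?thesis using * by (simp add: mult.assoc)
  qed
  then show ?thesis unfolding Let_def using D(1) by (intro exI[of _ "D * 4 powr \<alpha>"]) auto
qed

lemma wave_has_symbol: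
  assumes p: "1 < p" and \<beta>: "(real DIM('a) - 1) / 2 < \<beta>" "0 < \<beta>" "\<beta> < \<alpha>" and s: "0 < s"
  shows "has_symbol p (conv_op (mix_kernel (gamma_measure \<alpha>) (\<lambda>u. complex_of_real s * wave_path t u)))
    (symbol_of_A (wave_fun \<alpha> t s) :: 'a::euclidean_space \<Rightarrow> complex)"
proof -
  have \<alpha>: "0 < \<alpha>" using \<beta> by simp
  interpret W: poisson_mixture "gamma_measure \<alpha>" "wave_path t" using \<alpha> by (rule wave_mixture)
  interpret S: poisson_mixture "gamma_measure \<alpha>" "\<lambda>u. complex_of_real s * wave_path t u" using s by (rule W.scaled_mixture)
  have "mix_weight (gamma_measure \<alpha>) (wave_path t) \<beta> < \<top>"
    using wave_weight_le[OF \<beta>(2,3), of t] by (rule le_less_trans) simp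
  then have "has_symbol p (conv_op (mix_kernel (gamma_measure \<alpha>) (\<lambda>u. complex_of_real s * wave_path t u))) (S.mix_symbol :: 'a \<Rightarrow> complex)"
    using \<beta>(1) p by (intro S.mix_has_symbol[of \<beta>]) (auto simp: W.scaled_weight[OF s])
  moreover have "S.mix_symbol = (symbol_of_A (wave_fun \<alpha> t s) :: 'a \<Rightarrow> complex)"
    unfolding S.mix_symbol_def[abs_def] symbol_of_A_def using wave_symbol[OF \<alpha> s norm_ge_zero] by auto
  ultimately show ?thesis by simp
qed

text \<open>\<beta> is the midpoint of (d - 1) / 2 and \<alpha>: the maximal inequality needs it
  above the former, the weight below the latter. The estimate grows like (1 + |t|)^\<beta>, which is
  at most (1 + |t|)^\<alpha>.\<close>

lemma wave_gamma_bound: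
  assumes p: "1 < p" and \<alpha>: "(real DIM('a) - 1) / 2 < \<alpha>"
  shows "\<exists>C > 0. \<forall>t :: real.
        (\<forall>k :: int. defined_on_Lp TYPE('a::euclidean_space) p (wave_fun \<alpha> t (2 powi k))) \<and>
        (let \<tau> = range (\<lambda>k :: int. function_of_A p (wave_fun \<alpha> t (2 powi k)) :: 'a fun_op)
         in gamma_bounded p \<tau> \<and>
            gamma_bound p \<tau> \<le> C * (1 + \<bar>t\<bar>) powr \<alpha>)"
proof -
  define \<beta> where "\<beta> = ((real DIM('a) - 1) / 2 + \<alpha>) / 2"
  have "1 \<le> real DIM('a)" using DIM_positive[where 'a='a] by linarith
  then have "0 \<le> (real DIM('a) - 1) / 2" by simp
  moreover have "x < (x + \<alpha>) / 2 \<and> 0 < (x + \<alpha>) / 2 \<and> (x + \<alpha>) / 2 < \<alpha>" if "0 \<le> x" "x < \<alpha>" for x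
    using that by auto
  ultimately have \<beta>: "(real DIM('a) - 1) / 2 < \<beta>" "0 < \<beta>" "\<beta> < \<alpha>"
    unfolding \<beta>_def using \<alpha> by blast+
  obtain D where D: "0 < D" "\<forall>M \<zeta> (T :: int \<Rightarrow> 'a fun_op). poisson_mixture M \<zeta> \<longrightarrow> mix_weight M \<zeta> \<beta> < \<top> \<longrightarrow>
    (\<forall>k. T k \<in> bounded_ops p \<and> (\<forall>f\<in>Lp p. AE x in lborel.
      T k f x = conv_op (mix_kernel M (\<lambda>u. complex_of_real (2 powi k) * \<zeta> u)) f x)) \<longrightarrow>
    gamma_bounded p (range T) \<and> gamma_bound p (range T) \<le> D * enn2real (mix_weight M \<zeta> \<beta>)"
    by (rule exE[OF gamma_bound_mixture[OF p \<beta>(1)]], elim conjE, rule that, assumption, assumption)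
  define g where "g = 2 powr \<beta> * (1 + Gamma (\<alpha> - \<beta>) / Gamma \<alpha>)"
  have "0 < Gamma \<alpha>" "0 < Gamma (\<alpha> - \<beta>)" using \<beta> by (auto intro: Gamma_real_pos)
  then have g: "0 < g" by (simp add: g_def add_pos_pos)
  have sym: "has_symbol p (conv_op (mix_kernel (gamma_measure \<alpha>) (\<lambda>u. complex_of_real (2 powi k) * wave_path t u)))
    (symbol_of_A (wave_fun \<alpha> t (2 powi k)) :: 'a \<Rightarrow> complex)" for k t
    using p \<beta> by (rule wave_has_symbol) simp
  have "gamma_bounded p (range T) \<and> gamma_bound p (range T) \<le> (D * g) * (1 + \<bar>t\<bar>) powr \<alpha>"
    if T: "T = (\<lambda>k :: int. function_of_A p (wave_fun \<alpha> t (2 powi k)))" for t and T :: "int \<Rightarrow> 'a fun_op"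
  proof -
    have mix: "poisson_mixture (gamma_measure \<alpha>) (wave_path t)" using \<beta> by (intro wave_mixture) simp
    have W: "mix_weight (gamma_measure \<alpha>) (wave_path t) \<beta> \<le> ennreal ((1 + \<bar>t\<bar>) powr \<beta> * g)"
      unfolding g_def by (rule wave_weight_le[OF \<beta>(2,3)])
    then have Wfin: "mix_weight (gamma_measure \<alpha>) (wave_path t) \<beta> < \<top>" by (rule le_less_trans) simp
    have "\<forall>k. T k \<in> bounded_ops p \<and> (\<forall>f\<in>Lp p. AE x in lborel.
      T k f x = conv_op (mix_kernel (gamma_measure \<alpha>) (\<lambda>u. complex_of_real (2 powi k) * wave_path t u)) f x)"
    proof (intro allI conjI ballI)
      fix k
      show "T k \<in> bounded_ops p"
        using function_of_A_has_symbol(1)[OF sym[of k t] p] unfolding T has_symbol_def by blast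
      show "AE x in lborel. T k f x = conv_op (mix_kernel (gamma_measure \<alpha>) (\<lambda>u. complex_of_real (2 powi k) * wave_path t u)) f x"
        if "f \<in> Lp p" for f
        unfolding T by (rule function_of_A_has_symbol(2)[OF sym p that])
    qed
    then have *: "gamma_bounded p (range T) \<and> gamma_bound p (range T) \<le> D * enn2real (mix_weight (gamma_measure \<alpha>) (wave_path t) \<beta>)"
      by (rule D(2)[THEN spec, THEN spec, THEN spec, THEN mp, THEN mp, THEN mp, OF mix Wfin])
    have "enn2real (mix_weight (gamma_measure \<alpha>) (wave_path t) \<beta>) \<le> (1 + \<bar>t\<bar>) powr \<beta> * g"
      using W g by (intro enn2real_leI) auto
    also have "\<dots> \<le> (1 + \<bar>t\<bar>) powr \<alpha> * g" using \<beta> g by (intro mult_right_mono powr_mono) auto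
    finally have "D * enn2real (mix_weight (gamma_measure \<alpha>) (wave_path t) \<beta>) \<le> D * ((1 + \<bar>t\<bar>) powr \<alpha> * g)"
      using D(1) by (intro mult_left_mono) auto
    then show ?thesis using * by (simp add: ac_simps)
  qed
  moreover have "defined_on_Lp TYPE('a) p (wave_fun \<alpha> t (2 powi k))" for t k
    unfolding defined_on_Lp_def using sym by blast
  ultimately show ?thesis unfolding Let_def using D(1) g by (intro exI[of _ "D * g"]) auto
qed

theorem theorem5p1:
  fixes p :: real
  assumes "1 < p"
  shows
    "(\<forall>z. 0 < Re z \<longrightarrow> defined_on_Lp TYPE('a::euclidean_space) p (exp_fun z)) \<and>
     holomorphic_family_on p (\<lambda>z. function_of_A p (exp_fun z) :: 'a fun_op) {z. 0 < Re z} \<and>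
     (\<forall>t \<theta>. 0 < t \<longrightarrow> \<bar>\<theta>\<bar> < pi / 2 \<longrightarrow>
        (\<forall>f \<in> Lp p. AE x :: 'a in lborel.
           function_of_A p (exp_fun (cis \<theta> * complex_of_real t)) f x =
           (LINT y|lborel. poisson_kernel t \<theta> (x - y) * f y))) \<and>
     (\<forall>\<alpha> > (real DIM('a) - 1) / 2. \<exists>C > 0. \<forall>t \<theta>. 0 < t \<longrightarrow> \<bar>\<theta>\<bar> < pi / 2 \<longrightarrow>
        (let \<tau> = range (\<lambda>k :: int.
               function_of_A p (exp_fun (cis \<theta> * complex_of_real (t * 2 powi k))) :: 'a fun_op)
         in gamma_bounded p \<tau> \<and>
            gamma_bound p \<tau> \<le> C * (pi / 2 - \<bar>\<theta>\<bar>) powr (- \<alpha>))) \<and>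
     (\<forall>\<alpha> > (real DIM('a) - 1) / 2. \<exists>C > 0. \<forall>t :: real.
        (\<forall>k :: int. defined_on_Lp TYPE('a) p (wave_fun \<alpha> t (2 powi k))) \<and>
        (let \<tau> = range (\<lambda>k :: int. function_of_A p (wave_fun \<alpha> t (2 powi k)) :: 'a fun_op)
         in gamma_bounded p \<tau> \<and>
            gamma_bound p \<tau> \<le> C * (1 + \<bar>t\<bar>) powr \<alpha>))"
proof (intro conjI allI impI ballI)
  have S: "has_symbol p (conv_op (poisson z)) (symbol_of_A (exp_fun z) :: 'a \<Rightarrow> complex)" if "0 < Re z" for z
    using that assms by (rule exp_has_symbol)
  show "defined_on_Lp TYPE('a) p (exp_fun z)" if "0 < Re z" for z
    unfolding defined_on_Lp_def using S[OF that] by blast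
  have eq: "AE x in lborel. function_of_A p (exp_fun z) f x = conv_op (poisson z) f x"
    if "0 < Re z" "f \<in> Lp p" for z and f :: "'a \<Rightarrow> complex"
    using function_of_A_has_symbol(2)[OF S[OF that(1)] assms that(2)] .
  show "holomorphic_family_on p (\<lambda>z. function_of_A p (exp_fun z) :: 'a fun_op) {z. 0 < Re z}"
    using assms
  proof (rule poisson_semigroup_holomorphic)
    show "function_of_A p (exp_fun z) \<in> (bounded_ops p :: 'a fun_op set)" if "0 < Re z" for z
      using function_of_A_has_symbol(1)[OF S[OF that] assms] by (simp add: has_symbol_def)
  qed (rule eq)
  show "AE x :: 'a in lborel. function_of_A p (exp_fun (cis \<theta> * complex_of_real t)) f x =
      (LINT y|lborel. poisson_kernel t \<theta> (x - y) * f y)"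
    if "0 < t" "\<bar>\<theta>\<bar> < pi / 2" "f \<in> Lp p" for t \<theta> f
  proof -
    have "0 < cos \<theta>" using that(2) by (intro cos_gt_zero_pi) auto
    then have "0 < Re (cis \<theta> * complex_of_real t)" using that(1) by simp
    from eq[OF this that(3)] show ?thesis unfolding poisson_kernel_eq conv_op_def .
  qed
qed (rule exp_gamma_bound[OF assms], assumption, rule wave_gamma_bound[OF assms], assumption)

end
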